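(* Assume the following statement (a conjecture): for all positive integers $d,f$ and every $n\geq1$, with $W_{n}^{g}:=\bigoplus_{\lambda\vdash n}\bigoplus_{M\in\operatorname{SSYT}_d(\lambda),\ f_M=g}V_M\subseteq\mathbb{Q}[\mathbf{x}_n]_d$ for $g\geq0$, (a) if $\lambda\vdash n$, $M\in\operatorname{SSYT}_d(\lambda)$, $f_M=f$, and $0\neq F\in V_M$, then every $N\in\operatorname{supp}_{n+1}F$ satisfies $f_N\in\{f,f-1\}$; (b) the map $p_n^f:W_n^f\to W_{n+1}^f$ taking $F$ to $\sum_{N\in\operatorname{supp}_{n+1}F,\ f_N=f}F_N$ is injective; (c) for $q_n^f:W_n^f\to W_{n+1}^{f-1}$, $q_n^fF:=F-p_n^fF$, the map $W_n^f\oplus W_n^{f-1}\to W_{n+1}^{f-1}$ given by $(F,G)\mapsto q_n^fF+p_n^{f-1}G$ is injective. Take $d\geq0$, and a content $\mu$ consisting of $\ell$ positive integers of sum $d$. Then: (i) The spaces $\{\mathbb{Q}[\mathbf{x}_\infty]_d^f\}_{f=-1}^{d}$ form a strictly increasing filtration of $\mathbb{Q}[\mathbf{x}_\infty]_d$ by representations of $S_\infty$ and of $S_{\mathbb{N}}$, beginning with $\{0\}$ and ending at the full representation. The quotient $\mathbb{Q}[\mathbf{x}_\infty]_d^f/\mathbb{Q}[\mathbf{x}_\infty]_d^{f-1}$ is isomorphic to $\bigoplus_{\hat{\lambda}\vdash\infty}\bigoplus_{\hat{M}\in\operatorname{SSYT}_d(\hat{\lambda}),\ f_{\hat{M}}=f}V_{\hat{M}^0}$.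 (ii) The spaces $\{\mathbb{Q}[\mathbf{x}_\infty]_\mu^f\}_{f=-1}^{\ell}$ form a strictly increasing filtration of $\mathbb{Q}[\mathbf{x}_\infty]_\mu$ by representations of $S_\infty$ and of $S_{\mathbb{N}}$, beginning with $\{0\}$ and ending at the full representation, and the quotient $\mathbb{Q}[\mathbf{x}_\infty]_\mu^f/\mathbb{Q}[\mathbf{x}_\infty]_\mu^{f-1}$ is isomorphic to $\bigoplus_{\hat{\lambda}\vdash\infty}\bigoplus_{\hat{M}\in\operatorname{SSYT}_\mu(\hat{\lambda}),\ f_{\hat{M}}=f}V_{\hat{M}^0}$.
   Context: Finite objects. $\mathbb{Q}[\mathbf{x}_n]_d$: homogeneous polynomials of degree $d$ in $x_1,\ldots,x_n$; $\mathbb{Q}[\mathbf{x}_\infty]_d$: the same in $x_1,x_2,\ldots$. A content of sum $d$ is a finite multi-set of positive integers summing to $d$; $\mathbb{Q}[\mathbf{x}_\infty]_\mu$ is the span of the monomials whose multi-set of positive exponents is $\mu$. For $\lambda\vdash n$, $\operatorname{SSYT}_d(\lambda)$ is the set of semi-standard Young tableaux of shape $\lambda$ with non-negative integer entries (rows weakly, columns strictly increasing) of entry sum $d$. For $M\in\operatorname{SSYT}_d(\lambda)$ and a bijective filling $T$ of $\lambda$ by $\{1,\ldots,n\}$, $R(T),C(T)\subseteq S_n$ are the row and column stabilizers, $p_{M,T}=\prod_{i=1}^nx_i^{h_i}$ with $h_i$ the entry of $M$ in the box of $T$ containing $i$, and $F_{M,T}=\sum_{\sigma\in C(T)}\operatorname{sgn}(\sigma)\sigma(\sum_pp)$,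 $p$ running over the $R(T)$-orbit of $p_{M,T}$. $V_M$ is the span of all $F_{M,T}$; it is an irreducible representation of $S_n$ isomorphic to the Specht module of $\lambda$, and it is known that $\mathbb{Q}[\mathbf{x}_n]_d=\bigoplus_{\lambda\vdash n}\bigoplus_{M\in\operatorname{SSYT}_d(\lambda)}V_M$. $f_M$ is the number of non-zero entries in the first row of $M$. For $F\in\mathbb{Q}[\mathbf{x}_n]_d$ write $F=\sum_MF_M$ with $F_M\in V_M$; $\operatorname{supp}_nF$ is the set of $M$ with $F_M\neq0$. A polynomial $F\in\mathbb{Q}[\mathbf{x}_n]_d$ is also an element of $\mathbb{Q}[\mathbf{x}_{n+1}]_d$, and in $\operatorname{supp}_{n+1}F$ and the components $F_N$ above, the decomposition of $\mathbb{Q}[\mathbf{x}_{n+1}]_d$ is used. Set $\mathbb{Q}[\mathbf{x}_n]_d^f=\bigoplus_{\lambda\vdash n}\bigoplus_{M\in\operatorname{SSYT}_d(\lambda),\ f_M\leq f}V_M$, and $\mathbb{Q}[\mathbf{x}_n]_d^{-1}=\{0\}$. The filtration. For $f\geq0$, $\mathbb{Q}[\mathbf{x}_\infty]_d^f$ is the set of $F\in\mathbb{Q}[\mathbf{x}_\infty]_d$ such that $F\in\mathbb{Q}[\mathbf{x}_n]_d^f$ for $n$ with $F\in\mathbb{Q}[\mathbf{x}_n]_d$ (under the assumed statement this does not depend on the choice of $n$); $\mathbb{Q}[\mathbf{x}_\infty]_d^{-1}=\{0\}$; $\mathbb{Q}[\mathbf{x}_\infty]_\mu^f=\mathbb{Q}[\mathbf{x}_\infty]_d^f\cap\mathbb{Q}[\mathbf{x}_\infty]_\mu$.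 Infinite objects. $S_{\mathbb{N}}$: all permutations of $\mathbb{N}=\{1,2,\ldots\}$, acting by permuting variables; $S_\infty$ is the union of the $S_n$ (fixing all $m>n$). $\hat{\lambda}\vdash\infty$ is a Ferrers diagram with infinite first row, the remaining rows forming a finite partition diagram (the finite part). $\operatorname{SYT}(\hat{\lambda})$: standard fillings by $\mathbb{N}$. $\hat{M}\in\operatorname{SSYT}(\hat{\lambda})$: a semi-standard filling of the finite part by positive integers, plus a multiplicity $m_h\geq0$ for each $h>0$, finitely many non-zero. Its content is the multi-set in which each $h>0$ appears $m_h$ plus its number of occurrences in the finite part; $\operatorname{SSYT}_d(\hat{\lambda})$, $\operatorname{SSYT}_\mu(\hat{\lambda})$: those with content of sum $d$, resp. content $\mu$. $f_{\hat{M}}=\sum_hm_h$; $\hat{M}^0$ is $\hat{M}$ with all multiplicities replaced by $0$. For $\hat{T}\in\operatorname{SYT}(\hat{\lambda})$, $F_{\hat{M}^0,\hat{T}}=\sum_{\sigma\in C(\hat{T})}\operatorname{sgn}(\sigma)\sigma(\sum_pp)$, where $R(\hat{T}),C(\hat{T})\subseteq S_{\mathbb{N}}$ are the row and column stabilizers of $\hat{T}$ and $p$ runs over the $R(\hat{T})$-orbit of the monomial $\prod_ix_i^{h_i}$, with $h_i$ the entry of $\hat{M}$ in the box where $\hat{T}$ has $i$ if that box is in the finite part and $h_i=0$ otherwise (a polynomial). $V_{\hat{M}^0}$ is the $\mathbb{Q}$-span of $F_{\hat{M}^0,\hat{T}}$, $\hat{T}\in\operatorname{SYT}(\hat{\lambda})$,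 a representation of $S_{\mathbb{N}}$ and $S_\infty$. *)

theory Defs
  imports Complex_Main "HOL-Library.Poly_Mapping" "HOL-Library.Multiset" "HOL-Combinatorics.Permutations"
begin

section \<open>Polynomials in the variables $x_1, x_2, \ldots$\<close>

text \<open>A monomial is its finitely supported exponent function. Variable indices are the positive
  integers; the index \<open>0\<close> of type \<^typ>\<open>nat\<close> is excluded by the definitions below.\<close>

type_synonym mono = "nat \<Rightarrow>\<^sub>0 nat"
type_synonym qpoly = "mono \<Rightarrow>\<^sub>0 rat"

definition scaleQ :: "rat \<Rightarrow> qpoly \<Rightarrow> qpoly" where
  "scaleQ c F = Poly_Mapping.map ((*) c) F"

lemma lookup_scaleQ: "Poly_Mapping.lookup (scaleQ c F) m = c * Poly_Mapping.lookup F m"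
  by (simp add: scaleQ_def Poly_Mapping.map.rep_eq when_def)

interpretation qpoly: vector_space scaleQ
  by unfold_locales (auto intro!: poly_mapping_eqI simp: lookup_scaleQ lookup_add algebra_simps)

definition mono_poly :: "mono \<Rightarrow> qpoly" where
  "mono_poly m = Poly_Mapping.single m 1"

definition mono_deg :: "mono \<Rightarrow> nat" where
  "mono_deg m = (\<Sum>i\<in>Poly_Mapping.keys m. Poly_Mapping.lookup m i)"

definition mono_content :: "mono \<Rightarrow> nat multiset" where
  "mono_content m = image_mset (Poly_Mapping.lookup m) (mset_set (Poly_Mapping.keys m))"

definition hom_in :: "nat set \<Rightarrow> nat \<Rightarrow> qpoly set" where
  "hom_in X d = {F. \<forall>m\<in>Poly_Mapping.keys F. Poly_Mapping.keys m \<subseteq> X \<and> mono_deg m = d}"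

abbreviation Qn :: "nat \<Rightarrow> nat \<Rightarrow> qpoly set" where
  "Qn n d \<equiv> hom_in {1..n} d"

abbreviation Qinf :: "nat \<Rightarrow> qpoly set" where
  "Qinf d \<equiv> hom_in {1..} d"

definition Qinf_cont :: "nat multiset \<Rightarrow> qpoly set" where
  "Qinf_cont mu = qpoly.span
     {mono_poly m | m. Poly_Mapping.keys m \<subseteq> {1..} \<and> mono_content m = mu}"

definition is_content :: "nat multiset \<Rightarrow> nat \<Rightarrow> bool" where
  "is_content mu d \<longleftrightarrow> 0 \<notin># mu \<and> sum_mset mu = d"

text \<open>The action sends $x_i$ to $x_{\sigma(i)}$.\<close>

definition mono_act :: "(nat \<Rightarrow> nat) \<Rightarrow> mono \<Rightarrow> mono" where
  "mono_act \<sigma> m = (\<Sum>i\<in>Poly_Mapping.keys m. Poly_Mapping.single (\<sigma> i) (Poly_Mapping.lookup m i))"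

definition perm_act :: "(nat \<Rightarrow> nat) \<Rightarrow> qpoly \<Rightarrow> qpoly" where
  "perm_act \<sigma> F = (\<Sum>m\<in>Poly_Mapping.keys F.
     Poly_Mapping.single (mono_act \<sigma> m) (Poly_Mapping.lookup F m))"

definition S_N :: "(nat \<Rightarrow> nat) set" where
  "S_N = {\<sigma>. \<sigma> permutes {1..}}"

definition S_infty :: "(nat \<Rightarrow> nat) set" where
  "S_infty = (\<Union>n. {\<sigma>. \<sigma> permutes {1..n}})"


section \<open>The polynomial attached to a filling\<close>

text \<open>Boxes are pairs (row, column), both counted from \<open>0\<close>. The following serves finite and
  infinite diagrams \<open>D\<close> alike: \<open>h\<close> gives the entry in each box, with only finitely many non-zero
  ones, and \<open>T\<close> is an injective filling of \<open>D\<close>. In the infinite case the diagrams used have an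
  infinite first row with zero entries and finitely many further boxes, so that the orbit and the
  column stabilizer are finite, and every element of the latter has a well-defined sign.\<close>

type_synonym box = "nat \<times> nat"

definition row_stab :: "box set \<Rightarrow> (box \<Rightarrow> nat) \<Rightarrow> (nat \<Rightarrow> nat) set" where
  "row_stab D T = {\<sigma>. \<sigma> permutes (T ` D) \<and>
     (\<forall>i. \<sigma> ` (T ` {b \<in> D. fst b = i}) = T ` {b \<in> D. fst b = i})}"

definition col_stab :: "box set \<Rightarrow> (box \<Rightarrow> nat) \<Rightarrow> (nat \<Rightarrow> nat) set" where
  "col_stab D T = {\<sigma>. \<sigma> permutes (T ` D) \<and>
     (\<forall>j. \<sigma> ` (T ` {b \<in> D. snd b = j}) = T ` {b \<in> D. snd b = j})}"

definition filling_mono :: "box set \<Rightarrow> (box \<Rightarrow> nat) \<Rightarrow> (box \<Rightarrow> nat) \<Rightarrow> qpoly" where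
  "filling_mono D h T =
     mono_poly (\<Sum>b\<in>{b \<in> D. h b \<noteq> 0}. Poly_Mapping.single (T b) (h b))"

definition filling_poly :: "box set \<Rightarrow> (box \<Rightarrow> nat) \<Rightarrow> (box \<Rightarrow> nat) \<Rightarrow> qpoly" where
  "filling_poly D h T = (\<Sum>\<sigma>\<in>col_stab D T. scaleQ (of_int (sign \<sigma>))
     (perm_act \<sigma> (\<Sum>p\<in>(\<lambda>\<tau>. perm_act \<tau> (filling_mono D h T)) ` row_stab D T. p)))"


section \<open>Finite shapes\<close>

definition is_partition :: "nat list \<Rightarrow> bool" where
  "is_partition lam \<longleftrightarrow> sorted_wrt (\<ge>) lam \<and> 0 \<notin> set lam"

definition partitions_of :: "nat \<Rightarrow> nat list set" where
  "partitions_of n = {lam. is_partition lam \<and> sum_list lam = n}"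

definition diagram :: "nat list \<Rightarrow> box set" where
  "diagram lam = {(i, j). i < length lam \<and> j < lam ! i}"

text \<open>A tableau is the list of its rows, so it determines its shape.\<close>

definition shape :: "nat list list \<Rightarrow> nat list" where
  "shape M = map length M"

definition semistandard :: "nat list list \<Rightarrow> bool" where
  "semistandard M \<longleftrightarrow> (\<forall>r\<in>set M. sorted r) \<and>
     (\<forall>i j. Suc i < length M \<and> j < length (M ! Suc i) \<longrightarrow> M ! i ! j < M ! Suc i ! j)"

definition SSYT :: "nat \<Rightarrow> nat list \<Rightarrow> nat list list set" where
  "SSYT d lam = {M. shape M = lam \<and> semistandard M \<and> sum_list (concat M) = d}"

definition all_SSYT :: "nat \<Rightarrow> nat \<Rightarrow> nat list list set" where
  "all_SSYT n d = (\<Union>lam\<in>partitions_of n. SSYT d lam)"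

text \<open>The number $f_M$; it is only used for tableaux with at least one row.\<close>

definition fnum :: "nat list list \<Rightarrow> nat" where
  "fnum M = length (filter (\<lambda>h. h \<noteq> 0) (M ! 0))"

definition F_fin :: "nat list list \<Rightarrow> (box \<Rightarrow> nat) \<Rightarrow> qpoly" where
  "F_fin M T = filling_poly (diagram (shape M)) (\<lambda>(i, j). M ! i ! j) T"

definition V_fin :: "nat list list \<Rightarrow> qpoly set" where
  "V_fin M = qpoly.span
     {F_fin M T | T. bij_betw T (diagram (shape M)) {1..sum_list (shape M)}}"

text \<open>The family $(F_M)_M$ of components of \<open>F\<close> in the decomposition of
  $\mathbb{Q}[x_1,\ldots,x_n]_d$ as the direct sum of the spaces $V_M$, extended by \<open>0\<close> to all
  other \<open>M\<close>. Since that sum is direct, \<open>THE\<close> picks the unique such family.\<close>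

definition components :: "nat \<Rightarrow> nat \<Rightarrow> qpoly \<Rightarrow> nat list list \<Rightarrow> qpoly" where
  "components n d F = (THE c. (\<forall>M\<in>all_SSYT n d. c M \<in> V_fin M) \<and>
     (\<forall>M. M \<notin> all_SSYT n d \<longrightarrow> c M = 0) \<and> F = (\<Sum>M\<in>all_SSYT n d. c M))"

definition supp :: "nat \<Rightarrow> nat \<Rightarrow> qpoly \<Rightarrow> nat list list set" where
  "supp n d F = {M \<in> all_SSYT n d. components n d F M \<noteq> 0}"

text \<open>Sums of subspaces of the polynomial space, taken as spans of unions.\<close>

definition W :: "nat \<Rightarrow> nat \<Rightarrow> nat \<Rightarrow> qpoly set" where
  "W n d g = qpoly.span (\<Union>M\<in>{M \<in> all_SSYT n d. fnum M = g}. V_fin M)"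

definition p_map :: "nat \<Rightarrow> nat \<Rightarrow> nat \<Rightarrow> qpoly \<Rightarrow> qpoly" where
  "p_map n d f F = (\<Sum>N\<in>{N \<in> supp (Suc n) d F. fnum N = f}. components (Suc n) d F N)"

definition q_map :: "nat \<Rightarrow> nat \<Rightarrow> nat \<Rightarrow> qpoly \<Rightarrow> qpoly" where
  "q_map n d f F = F - p_map n d f F"

text \<open>The filtration index is an integer, to allow for \<open>-1\<close>, where the span is that of the empty
  set and all filtration spaces are \<open>{0}\<close>.\<close>

definition Qn_filt :: "nat \<Rightarrow> nat \<Rightarrow> int \<Rightarrow> qpoly set" where
  "Qn_filt n d f = qpoly.span (\<Union>M\<in>{M \<in> all_SSYT n d. int (fnum M) \<le> f}. V_fin M)"

definition Qinf_filt :: "nat \<Rightarrow> int \<Rightarrow> qpoly set" where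
  "Qinf_filt d f = {F \<in> Qinf d. \<forall>n\<ge>1. F \<in> Qn n d \<longrightarrow> F \<in> Qn_filt n d f}"

definition Qinf_cont_filt :: "nat multiset \<Rightarrow> int \<Rightarrow> qpoly set" where
  "Qinf_cont_filt mu f = Qinf_filt (sum_mset mu) f \<inter> Qinf_cont mu"


section \<open>Infinite shapes\<close>

text \<open>An infinite shape is given by its finite part, a partition of any size; the finite part
  occupies the rows \<open>1, 2, \<dots>\<close> below the infinite row \<open>0\<close>.\<close>

definition diagram_inf :: "nat list \<Rightarrow> box set" where
  "diagram_inf lam = {0} \<times> UNIV \<union> (\<lambda>(i, j). (Suc i, j)) ` diagram lam"

definition SYT_inf :: "nat list \<Rightarrow> (box \<Rightarrow> nat) set" where
  "SYT_inf lam = {T. bij_betw T (diagram_inf lam) {1..} \<and>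
     (\<forall>i j. (i, Suc j) \<in> diagram_inf lam \<longrightarrow> T (i, j) < T (i, Suc j)) \<and>
     (\<forall>i j. (Suc i, j) \<in> diagram_inf lam \<longrightarrow> T (i, j) < T (Suc i, j))}"

text \<open>Semi-standard fillings of an infinite shape: the filling of the finite part, paired with the
  finite multiset of positive integers in which \<open>h\<close> has multiplicity $m_h$.\<close>

type_synonym tab_inf = "nat list list \<times> nat multiset"

definition SSYT_inf :: "nat list \<Rightarrow> tab_inf set" where
  "SSYT_inf lam = {(A, m). shape A = lam \<and> semistandard A \<and> 0 \<notin> set (concat A) \<and> 0 \<notin># m}"

definition content_inf :: "tab_inf \<Rightarrow> nat multiset" where
  "content_inf M = snd M + mset (concat (fst M))"

definition fnum_inf :: "tab_inf \<Rightarrow> nat" where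
  "fnum_inf M = size (snd M)"

definition zero_mult :: "tab_inf \<Rightarrow> tab_inf" where
  "zero_mult M = (fst M, {#})"

definition SSYT_inf_deg :: "nat \<Rightarrow> nat list \<Rightarrow> tab_inf set" where
  "SSYT_inf_deg d lam = {M \<in> SSYT_inf lam. sum_mset (content_inf M) = d}"

definition SSYT_inf_cont :: "nat multiset \<Rightarrow> nat list \<Rightarrow> tab_inf set" where
  "SSYT_inf_cont mu lam = {M \<in> SSYT_inf lam. content_inf M = mu}"

text \<open>The next two are only meant for \<open>M\<close> without multiplicities, so all entries of the infinite
  row are \<open>0\<close>.\<close>

definition F_inf :: "tab_inf \<Rightarrow> (box \<Rightarrow> nat) \<Rightarrow> qpoly" where
  "F_inf M T = filling_poly (diagram_inf (shape (fst M)))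
     (\<lambda>(i, j). case i of 0 \<Rightarrow> 0 | Suc k \<Rightarrow> fst M ! k ! j) T"

definition V_inf :: "tab_inf \<Rightarrow> qpoly set" where
  "V_inf M = qpoly.span {F_inf M T | T. T \<in> SYT_inf (shape (fst M))}"


section \<open>Representations\<close>

text \<open>Rational vector spaces on which permutations of the positive integers act.\<close>

record 'v rep =
  rcarrier :: "'v set"
  radd :: "'v \<Rightarrow> 'v \<Rightarrow> 'v"
  rscale :: "rat \<Rightarrow> 'v \<Rightarrow> 'v"
  ract :: "(nat \<Rightarrow> nat) \<Rightarrow> 'v \<Rightarrow> 'v"

definition quot_rep :: "qpoly set \<Rightarrow> qpoly set \<Rightarrow> qpoly set rep" where
  "quot_rep V U = \<lparr>
     rcarrier = (\<lambda>F. {F + G | G. G \<in> U}) ` V,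
     radd = (\<lambda>A B. {F + G | F G. F \<in> A \<and> G \<in> B}),
     rscale = (\<lambda>c A. {scaleQ c F + G | F G. F \<in> A \<and> G \<in> U}),
     ract = (\<lambda>\<sigma> A. perm_act \<sigma> ` A) \<rparr>"

text \<open>The external direct sum: equal summands with different indices count separately.\<close>

definition dsum_rep :: "'i set \<Rightarrow> ('i \<Rightarrow> qpoly set) \<Rightarrow> ('i \<Rightarrow> qpoly) rep" where
  "dsum_rep I V = \<lparr>
     rcarrier = {g. (\<forall>i\<in>I. g i \<in> V i) \<and> (\<forall>i. i \<notin> I \<longrightarrow> g i = 0) \<and> finite {i. g i \<noteq> 0}},
     radd = (\<lambda>g h i. g i + h i),
     rscale = (\<lambda>c g i. scaleQ c (g i)),
     ract = (\<lambda>\<sigma> g i. perm_act \<sigma> (g i)) \<rparr>"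

definition rep_iso :: "(nat \<Rightarrow> nat) set \<Rightarrow> 'v rep \<Rightarrow> 'w rep \<Rightarrow> bool" where
  "rep_iso G R S \<longleftrightarrow> (\<exists>\<phi>. bij_betw \<phi> (rcarrier R) (rcarrier S) \<and>
     (\<forall>a\<in>rcarrier R. \<forall>b\<in>rcarrier R. \<phi> (radd R a b) = radd S (\<phi> a) (\<phi> b)) \<and>
     (\<forall>c. \<forall>a\<in>rcarrier R. \<phi> (rscale R c a) = rscale S c (\<phi> a)) \<and>
     (\<forall>\<sigma>\<in>G. \<forall>a\<in>rcarrier R. \<phi> (ract R \<sigma> a) = ract S \<sigma> (\<phi> a)))"

definition subrep :: "(nat \<Rightarrow> nat) set \<Rightarrow> qpoly set \<Rightarrow> bool" where
  "subrep G V \<longleftrightarrow> qpoly.subspace V \<and> (\<forall>\<sigma>\<in>G. \<forall>F\<in>V. perm_act \<sigma> F \<in> V)"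

definition strict_filtration :: "(nat \<Rightarrow> nat) set \<Rightarrow> qpoly set \<Rightarrow> nat \<Rightarrow> (int \<Rightarrow> qpoly set) \<Rightarrow> bool"
  where
  "strict_filtration G Q l V \<longleftrightarrow> V (-1) = {0} \<and> V (int l) = Q \<and>
     (\<forall>f\<in>{0..int l}. V (f - 1) \<subset> V f) \<and> (\<forall>f\<in>{-1..int l}. subrep G (V f))"

end

theory Submission
  imports Defs
begin

text \<open>
The proof rests on one description of the filtration. For \<open>h > 0\<close> the contraction \<open>contr h\<close> sends a
monomial to the sum of all monomials obtained by deleting one variable of exponent \<open>h\<close>.
Contractions commute with each other and with all permutations of the variables, and they do not
mention the number of variables. In \<open>n\<close> variables the sum of the \<open>V_fin M\<close> with
\<open>fnum M \<le> f\<close> is exactly the space of polynomials killed by every product of \<open>f + 1\<close> contractions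
(\<open>contr_ker_characterisation\<close>, \<open>Qn_filt_eq\<close>). Hence the same description holds in infinitely many
variables, the filtration is stable under all permutations, and it is compatible with contents.

One inclusion is a count. The monomials of the row sum of \<open>M\<close> have \<open>fnum M + k\<close> variables, where \<open>k\<close>
is the number of boxes below the first row; after \<open>fnum M + 1\<close> contractions fewer than \<open>k\<close> variables
are left, some column contains two absent variables, and the column antisymmetriser gives \<open>0\<close>.
The other inclusion uses the inner product for which the monomials are orthonormal: a polynomial
killed by all \<open>(f + 1)\<close>-fold contractions is orthogonal to every \<open>V_fin M\<close> with \<open>fnum M > f\<close>
(\<open>ip_F_fin_contr_ker\<close>), so in a decomposition into the \<open>V_fin M\<close>, which exists by \<open>spanning\<close>, the
part belonging to those \<open>M\<close> is orthogonal to itself.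

For \<open>spanning\<close>, let \<open>V\<close> be the orthogonal complement of all the \<open>V_fin M\<close>; it is stable under
permutations. If \<open>V\<close> were not zero, choose a largest set of variables in which some non-zero
element of \<open>V\<close> is symmetric, then a largest set among the remaining variables such that some
non-zero element of \<open>V\<close> is symmetric in both, and so on (\<open>greedy_rows\<close>). The resulting \<open>F\<close> in \<open>V\<close> is
invariant under the row group of a tableau, and symmetrising it over a set larger than the row in
question gives \<open>0\<close>. These relations have two consequences: \<open>F\<close> has a non-zero coefficient at a
monomial which, read in the tableau, is semistandard (\<open>straightening\<close>), and pairing the column
antisymmetrisation of \<open>F\<close> with a row-invariant polynomial is the same as pairing \<open>F\<close> with it, up to
a positive factor (\<open>hook_product\<close>). So \<open>F\<close> is not orthogonal to the polynomial of that semistandard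
tableau, a contradiction.

For the quotients, an element of the \<open>f\<close>-th step is contracted by every multiset \<open>m\<close> of size \<open>f\<close>. The
results are killed by all contractions, and they all vanish exactly on the previous step. The
polynomials killed by all contractions are the direct sum of the spaces \<open>V_inf (A, {#})\<close>
(\<open>contr_ker_1_spanned\<close>, \<open>V_lower_independent\<close>), so the component at \<open>(A, m)\<close> of the isomorphism is the
\<open>A\<close>-component of the contraction by \<open>m\<close> (\<open>symbol\<close>). It is onto because \<open>g\<close> in \<open>V_inf (A, {#})\<close> can be
multiplied by a monomial with exponents \<open>m\<close> in variables that do not occur in \<open>g\<close>: a contraction of
the product by a multiset of size \<open>f\<close> acts on the second factor only, and gives a non-zero multiple
of \<open>g\<close> for \<open>m\<close> and \<open>0\<close> otherwise (\<open>contrs_attach\<close>).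

Infinite shapes reduce to finite ones, because only the columns meeting the finite part enter
the polynomial of a filling (\<open>filling_poly_core\<close>); the restriction to standard fillings is harmless
by the Garnir relations (\<open>standard_fillings_span\<close>). Directness is proved by applying row
symmetrisers: the one of a tableau of shape \<open>lam\<close> kills \<open>V_fin M\<close> for every other shape whose sum of
row indices is at least that of \<open>lam\<close>, and for shape \<open>lam\<close> it reduces the question to a
triangularity for one fixed filling (\<open>leading_monomial\<close>).
\<close>

section \<open>Linear algebra of polynomials\<close>

abbreviation "lookup \<equiv> Poly_Mapping.lookup"
abbreviation "keys \<equiv> Poly_Mapping.keys"

lemma lookup_mono_poly: "lookup (mono_poly m) m' = (if m = m' then 1 else 0)"
  by (simp add: mono_poly_def lookup_single when_def)

lemma keys_mono_poly [simp]: "keys (mono_poly m) = {m}"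
  by (simp add: mono_poly_def)

lemma keys_scaleQ: "keys (scaleQ c F) \<subseteq> keys F"
  by (auto simp: in_keys_iff lookup_scaleQ)

lemma keys_sum_subset: "keys (sum f A) \<subseteq> (\<Union>a\<in>A. keys (f a))"
proof
  fix m assume "m \<in> keys (sum f A)"
  then have "(\<Sum>a\<in>A. lookup (f a) m) \<noteq> 0" by (simp add: in_keys_iff lookup_sum)
  then obtain a where "a \<in> A" "lookup (f a) m \<noteq> 0" by (meson sum.not_neutral_contains_not_neutral)
  then show "m \<in> (\<Union>a\<in>A. keys (f a))" by (auto simp: in_keys_iff)
qed

lemma qpoly_expand: "F = (\<Sum>m\<in>keys F. scaleQ (lookup F m) (mono_poly m))"
proof (rule poly_mapping_eqI)
  fix m
  show "lookup F m = lookup (\<Sum>m\<in>keys F. scaleQ (lookup F m) (mono_poly m)) m"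
    by (simp add: lookup_sum lookup_scaleQ lookup_mono_poly sum.delta in_keys_iff if_distrib
        cong: if_cong)
qed

definition lin :: "(qpoly \<Rightarrow> qpoly) \<Rightarrow> bool" where
  "lin f \<longleftrightarrow> (\<forall>F G. f (F + G) = f F + f G) \<and> (\<forall>c F. f (scaleQ c F) = scaleQ c (f F))"

lemma lin_add: "lin f \<Longrightarrow> f (F + G) = f F + f G"
  and lin_scale: "lin f \<Longrightarrow> f (scaleQ c F) = scaleQ c (f F)"
  by (auto simp: lin_def)

lemma lin_0: "lin f \<Longrightarrow> f 0 = 0"
  by (metis lin_add add_cancel_right_right)

lemma lin_diff: "lin f \<Longrightarrow> f (F - G) = f F - f G"
  by (metis lin_add add_diff_cancel_right' diff_add_cancel)

lemma lin_sum: "lin f \<Longrightarrow> f (sum g A) = (\<Sum>a\<in>A. f (g a))"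
  by (induction A rule: infinite_finite_induct) (auto simp: lin_0 lin_add)

lemma lin_compose: "lin f \<Longrightarrow> lin g \<Longrightarrow> lin (\<lambda>F. f (g F))"
  by (simp add: lin_def)

lemma lin_eq_on_monomials:
  assumes "lin f" "lin g" "\<And>m. m \<in> keys F \<Longrightarrow> f (mono_poly m) = g (mono_poly m)"
  shows "f F = g F"
proof -
  have "f F = (\<Sum>m\<in>keys F. scaleQ (lookup F m) (f (mono_poly m)))"
    using arg_cong[OF qpoly_expand[of F], of f]
    by (simp only: lin_sum[OF assms(1)] lin_scale[OF assms(1)])
  also have "\<dots> = (\<Sum>m\<in>keys F. scaleQ (lookup F m) (g (mono_poly m)))"
    using assms(3) by simp
  also have "\<dots> = g F"
    using arg_cong[OF qpoly_expand[of F], of g]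
    by (simp only: lin_sum[OF assms(2)] lin_scale[OF assms(2)])
  finally show ?thesis .
qed

definition linear_ext :: "(mono \<Rightarrow> qpoly) \<Rightarrow> qpoly \<Rightarrow> qpoly" where
  "linear_ext t F = (\<Sum>m\<in>keys F. scaleQ (lookup F m) (t m))"

lemma linear_ext_superset:
  assumes "finite S" "keys F \<subseteq> S"
  shows "linear_ext t F = (\<Sum>m\<in>S. scaleQ (lookup F m) (t m))"
  unfolding linear_ext_def using assms
  by (intro sum.mono_neutral_left) (auto simp: in_keys_iff)

lemma lin_linear_ext: "lin (linear_ext t)"
proof -
  have "linear_ext t (F + G) = linear_ext t F + linear_ext t G" for F G
    using keys_add[of F G]
    by (simp add: linear_ext_superset[where S = "keys F \<union> keys G"] lookup_add
        qpoly.scale_left_distrib sum.distrib)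
  moreover have "linear_ext t (scaleQ c F) = scaleQ c (linear_ext t F)" for c F
    using keys_scaleQ[of c F]
    by (simp add: linear_ext_superset[where S = "keys F"] lookup_scaleQ
        qpoly.scale_sum_right)
  ultimately show ?thesis by (simp add: lin_def)
qed

lemma linear_ext_mono_poly [simp]: "linear_ext t (mono_poly m) = t m"
  by (simp add: linear_ext_def lookup_mono_poly)

lemma lin_span:
  assumes "lin f" "F \<in> qpoly.span B" "\<And>b. b \<in> B \<Longrightarrow> f b \<in> qpoly.span C"
  shows "f F \<in> qpoly.span C"
  using assms(2)
proof (induction rule: qpoly.span_induct_alt)
  case base then show ?case by (simp add: lin_0[OF assms(1)] qpoly.span_zero)
next
  case (step c x y) then show ?case
    by (simp add: lin_add[OF assms(1)] lin_scale[OF assms(1)] qpoly.span_add qpoly.span_scale assms(3))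
qed


section \<open>The action of permutations\<close>

lemma lookup_mono_act:
  assumes "bij \<sigma>" shows "lookup (mono_act \<sigma> m) i = lookup m (inv \<sigma> i)"
proof -
  have "lookup (mono_act \<sigma> m) i = (\<Sum>k\<in>keys m. if k = inv \<sigma> i then lookup m k else 0)"
    unfolding mono_act_def lookup_sum lookup_single
    using assms by (intro sum.cong) (auto simp: when_def bij_inv_eq_iff bij_is_inj)
  also have "\<dots> = lookup m (inv \<sigma> i)"
    by (simp add: sum.delta in_keys_iff)
  finally show ?thesis .
qed

lemma keys_mono_act:
  assumes "bij \<sigma>" shows "keys (mono_act \<sigma> m) = \<sigma> ` keys m"
proof (rule set_eqI)
  fix i
  have "i \<in> keys (mono_act \<sigma> m) \<longleftrightarrow> inv \<sigma> i \<in> keys m"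
    using assms by (simp add: in_keys_iff lookup_mono_act)
  also have "\<dots> \<longleftrightarrow> i \<in> \<sigma> ` keys m"
  proof -
    have "i = \<sigma> x \<longleftrightarrow> x = inv \<sigma> i" for x using bij_inv_eq_iff[OF assms, of x i] by auto
    then show ?thesis by (simp add: image_iff)
  qed
  finally show "i \<in> keys (mono_act \<sigma> m) \<longleftrightarrow> i \<in> \<sigma> ` keys m" .
qed

lemma mono_act_compose:
  assumes "bij \<sigma>" "bij \<tau>"
  shows "mono_act \<sigma> (mono_act \<tau> m) = mono_act (\<sigma> \<circ> \<tau>) m"
proof (rule poly_mapping_eqI)
  fix i
  have "inv (\<sigma> \<circ> \<tau>) i = inv \<tau> (inv \<sigma> i)"
    using assms by (metis comp_apply o_inv_distrib)
  then show "lookup (mono_act \<sigma> (mono_act \<tau> m)) i = lookup (mono_act (\<sigma> \<circ> \<tau>) m) i"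
    using assms by (simp add: lookup_mono_act bij_comp)
qed

lemma mono_act_id [simp]: "mono_act id m = m"
  by (intro poly_mapping_eqI) (simp add: lookup_mono_act)

lemma mono_act_inv [simp]:
  assumes "bij \<sigma>"
  shows "mono_act (inv \<sigma>) (mono_act \<sigma> m) = m" "mono_act \<sigma> (mono_act (inv \<sigma>) m) = m"
  using assms by (auto simp: mono_act_compose bij_imp_bij_inv bij_is_inj bij_is_surj
      inv_o_cancel surj_iff[THEN iffD1])

lemma mono_act_eq_iff: "bij \<sigma> \<Longrightarrow> mono_act \<sigma> m = m' \<longleftrightarrow> m = mono_act (inv \<sigma>) m'"
  by auto

lemma mono_content_act:
  assumes "bij \<sigma>" shows "mono_content (mono_act \<sigma> m) = mono_content m"
proof -
  have "mset_set (keys (mono_act \<sigma> m)) = image_mset \<sigma> (mset_set (keys m))"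
    using assms by (metis keys_mono_act image_mset_mset_set bij_is_inj inj_on_subset subset_UNIV)
  then show ?thesis
    using assms unfolding mono_content_def
    by (auto simp: lookup_mono_act multiset.map_comp bij_is_inj intro!: image_mset_cong)
qed

lemma perm_act_eq_linear_ext: "perm_act \<sigma> = linear_ext (\<lambda>m. mono_poly (mono_act \<sigma> m))"
  by (auto simp: fun_eq_iff perm_act_def linear_ext_def mono_poly_def scaleQ_def
      intro!: sum.cong poly_mapping_eqI)

lemma lin_perm_act: "lin (perm_act \<sigma>)"
  by (simp add: perm_act_eq_linear_ext lin_linear_ext)

lemmas perm_act_add = lin_add[OF lin_perm_act]
lemmas perm_act_scale = lin_scale[OF lin_perm_act]
lemmas perm_act_sum = lin_sum[OF lin_perm_act]
lemmas perm_act_0 [simp] = lin_0[OF lin_perm_act]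

lemma perm_act_mono_poly [simp]: "perm_act \<sigma> (mono_poly m) = mono_poly (mono_act \<sigma> m)"
  by (simp add: perm_act_eq_linear_ext)

lemma lookup_perm_act:
  assumes "bij \<sigma>" shows "lookup (perm_act \<sigma> F) m = lookup F (mono_act (inv \<sigma>) m)"
proof -
  have "lookup (perm_act \<sigma> F) m
      = (\<Sum>k\<in>keys F. if k = mono_act (inv \<sigma>) m then lookup F k else 0)"
    unfolding perm_act_def lookup_sum lookup_single
    using assms by (intro sum.cong) (auto simp: when_def mono_act_eq_iff)
  also have "\<dots> = lookup F (mono_act (inv \<sigma>) m)"
    by (simp add: sum.delta in_keys_iff)
  finally show ?thesis .
qed

lemma perm_act_compose:
  assumes "bij \<sigma>" "bij \<tau>"
  shows "perm_act \<sigma> (perm_act \<tau> F) = perm_act (\<sigma> \<circ> \<tau>) F"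
  by (rule lin_eq_on_monomials[where f = "\<lambda>F. perm_act \<sigma> (perm_act \<tau> F)"])
     (use assms in \<open>simp_all add: lin_compose lin_perm_act mono_act_compose comp_def\<close>)

lemma perm_act_id [simp]: "perm_act id F = F"
  by (intro poly_mapping_eqI) (simp add: lookup_perm_act)

lemma perm_act_inv [simp]:
  assumes "bij \<sigma>"
  shows "perm_act (inv \<sigma>) (perm_act \<sigma> F) = F" "perm_act \<sigma> (perm_act (inv \<sigma>) F) = F"
  using assms by (auto intro!: poly_mapping_eqI simp: lookup_perm_act bij_imp_bij_inv inv_inv_eq)

lemma keys_perm_act:
  assumes "bij \<sigma>" shows "keys (perm_act \<sigma> F) = mono_act \<sigma> ` keys F"
proof (rule set_eqI)
  fix m
  have "m \<in> keys (perm_act \<sigma> F) \<longleftrightarrow> mono_act (inv \<sigma>) m \<in> keys F"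
    using assms by (simp add: in_keys_iff lookup_perm_act)
  also have "\<dots> \<longleftrightarrow> m \<in> mono_act \<sigma> ` keys F"
  proof -
    have "m = mono_act \<sigma> k \<longleftrightarrow> k = mono_act (inv \<sigma>) m" for k using assms by auto
    then show ?thesis by (simp add: image_iff)
  qed
  finally show "m \<in> keys (perm_act \<sigma> F) \<longleftrightarrow> m \<in> mono_act \<sigma> ` keys F" .
qed


section \<open>The inner product with orthonormal monomials\<close>

definition ip :: "qpoly \<Rightarrow> qpoly \<Rightarrow> rat" where
  "ip F G = (\<Sum>m\<in>keys F. lookup F m * lookup G m)"

lemma ip_superset: "finite S \<Longrightarrow> keys F \<subseteq> S \<Longrightarrow> ip F G = (\<Sum>m\<in>S. lookup F m * lookup G m)"
  unfolding ip_def by (intro sum.mono_neutral_left) (auto simp: in_keys_iff)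

lemma ip_commute: "ip F G = ip G F"
  by (simp add: ip_superset[where S = "keys F \<union> keys G"] mult.commute)

lemma ip_add_left: "ip (F + F') G = ip F G + ip F' G"
  using keys_add[of F F']
  by (simp add: ip_superset[where S = "keys F \<union> keys F'"] lookup_add algebra_simps sum.distrib)

lemma ip_scale_left: "ip (scaleQ c F) G = c * ip F G"
  using keys_scaleQ[of c F]
  by (simp add: ip_superset[where S = "keys F"] lookup_scaleQ algebra_simps sum_distrib_left)

lemma ip_0_left [simp]: "ip 0 G = 0"
  by (simp add: ip_def)

lemma ip_sum_left: "ip (sum f A) G = (\<Sum>a\<in>A. ip (f a) G)"
  by (induction A rule: infinite_finite_induct) (auto simp: ip_add_left)

lemma ip_add_right: "ip G (F + F') = ip G F + ip G F'"
  and ip_scale_right: "ip G (scaleQ c F) = c * ip G F"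
  and ip_0_right [simp]: "ip G 0 = 0"
  and ip_sum_right: "ip G (sum f A) = (\<Sum>a\<in>A. ip G (f a))"
  by (simp_all add: ip_commute[of G] ip_add_left ip_scale_left ip_sum_left)

lemma ip_minus_left: "ip (F - F') G = ip F G - ip F' G"
  using ip_add_left[of "F - F'" F' G] by simp

lemma ip_mono_poly_left: "ip (mono_poly m) F = lookup F m"
  by (simp add: ip_def lookup_mono_poly)

lemma ip_self_eq_0: "ip F F = 0 \<Longrightarrow> F = 0"
proof -
  assume "ip F F = 0"
  then have "\<forall>m\<in>keys F. lookup F m * lookup F m = 0"
    unfolding ip_def by (subst (asm) sum_nonneg_eq_0_iff) auto
  then have "keys F = {}" by (metis in_keys_iff mult_eq_0_iff equals0I)
  then show "F = 0" by (simp only: keys_eq_empty)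
qed

lemma ip_perm_act:
  assumes "bij \<sigma>" shows "ip (perm_act \<sigma> F) G = ip F (perm_act (inv \<sigma>) G)"
proof -
  have "inj_on (mono_act \<sigma>) (keys F)" using assms by (metis inj_onI mono_act_inv(1))
  then show ?thesis
    using assms by (simp add: ip_def keys_perm_act sum.reindex lookup_perm_act
        bij_imp_bij_inv inv_inv_eq)
qed

lemma ip_span_right:
  assumes "G \<in> qpoly.span B" "\<And>b. b \<in> B \<Longrightarrow> ip F b = 0"
  shows "ip F G = 0"
  using assms(1)
  by (induction rule: qpoly.span_induct_alt) (auto simp: ip_add_right ip_scale_right assms(2))

text \<open>Gram-Schmidt: a new vector is first made orthogonal to the span of the others, and if
  nothing is left of it, no correction is needed.\<close>

lemma orthogonal_projection_finite:
  assumes "finite B"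
  shows "\<exists>w\<in>qpoly.span B. \<forall>b\<in>B. ip (F - w) b = 0"
  using assms
proof (induction B arbitrary: F rule: finite_induct)
  case empty then show ?case by (auto intro: qpoly.span_zero)
next
  case (insert b B)
  obtain w where w: "w \<in> qpoly.span B" "\<forall>x\<in>B. ip (F - w) x = 0" using insert.IH by blast
  obtain v where v: "v \<in> qpoly.span B" "\<forall>x\<in>B. ip (b - v) x = 0" using insert.IH by blast
  let ?b = "b - v"
  have sub: "qpoly.span B \<subseteq> qpoly.span (insert b B)" by (simp add: qpoly.span_mono subset_insertI)
  have ip_b: "ip G b = ip G ?b" if "\<forall>x\<in>B. ip G x = 0" for G
    using ip_span_right[OF v(1), of G] that ip_commute ip_minus_left by (metis diff_zero)
  show ?case
  proof (cases "?b = 0")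
    case True
    then have "ip (F - w) b = 0" using w(2) ip_b by simp
    then show ?thesis using w sub by (intro bexI[of _ w]) auto
  next
    case False
    then have nz: "ip ?b ?b \<noteq> 0" using ip_self_eq_0 by blast
    define c where "c = ip (F - w) ?b / ip ?b ?b"
    let ?w = "w + scaleQ c ?b"
    have eq: "ip (F - ?w) x = ip (F - w) x - c * ip ?b x" for x
      by (metis diff_diff_add ip_minus_left ip_scale_left)
    have 1: "\<forall>x\<in>B. ip (F - ?w) x = 0" using w(2) v(2) by (simp add: eq)
    moreover have "ip (F - ?w) ?b = 0" using nz unfolding eq by (simp add: c_def)
    ultimately have "ip (F - ?w) b = 0" using ip_b[OF 1] by simp
    moreover have "?w \<in> qpoly.span (insert b B)"
      using w v sub by (intro qpoly.span_add qpoly.span_scale qpoly.span_diff)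
        (auto simp: qpoly.span_base)
    ultimately show ?thesis using 1 by blast
  qed
qed

lemma in_span_monomials: "F \<in> qpoly.span (mono_poly ` keys F)"
proof -
  have "(\<Sum>m\<in>keys F. scaleQ (lookup F m) (mono_poly m)) \<in> qpoly.span (mono_poly ` keys F)"
    by (intro qpoly.span_sum qpoly.span_scale qpoly.span_base) auto
  then show ?thesis using qpoly_expand[of F] by metis
qed

text \<open>A set of polynomials supported on finitely many monomials may be infinite, but it
  spans a finite-dimensional space and contains a finite basis of it.\<close>

lemma orthogonal_projection:
  assumes "finite S" "\<And>b. b \<in> B \<Longrightarrow> keys b \<subseteq> S"
  shows "\<exists>w\<in>qpoly.span B. \<forall>b\<in>B. ip (F - w) b = 0"
proof -
  obtain C where C: "C \<subseteq> B" "qpoly.independent C" "B \<subseteq> qpoly.span C"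
    using qpoly.maximal_independent_subset by blast
  have "b \<in> qpoly.span (mono_poly ` S)" if "b \<in> B" for b
    using in_span_monomials[of b] qpoly.span_mono[of "mono_poly ` keys b" "mono_poly ` S"]
      assms(2)[OF that] by blast
  then have "finite C"
    using qpoly.independent_span_bound[of "mono_poly ` S" C] C assms(1) by auto
  then obtain w where w: "w \<in> qpoly.span C" "\<forall>b\<in>C. ip (F - w) b = 0"
    using orthogonal_projection_finite by blast
  then have "\<forall>b\<in>B. ip (F - w) b = 0" using C(3) ip_span_right by blast
  then show ?thesis using w(1) C(1) qpoly.span_mono by blast
qed


section \<open>Sums over stabilisers of a labelling\<close>

text \<open>Row groups, column groups and symmetric groups on subsets are all of this form: the
  label is the row, the column, or constant.\<close>

definition stab :: "nat set \<Rightarrow> (nat \<Rightarrow> nat) \<Rightarrow> (nat \<Rightarrow> nat) set" where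
  "stab X lab = {\<sigma>. \<sigma> permutes X \<and> (\<forall>x\<in>X. lab (\<sigma> x) = lab x)}"

lemma stab_permutes: "\<sigma> \<in> stab X lab \<Longrightarrow> \<sigma> permutes X"
  and stab_lab: "\<sigma> \<in> stab X lab \<Longrightarrow> x \<in> X \<Longrightarrow> lab (\<sigma> x) = lab x"
  and stab_bij: "\<sigma> \<in> stab X lab \<Longrightarrow> bij \<sigma>"
  by (auto simp: stab_def permutes_bij)

lemma finite_stab: "finite X \<Longrightarrow> finite (stab X lab)"
  by (rule finite_subset[OF _ finite_permutations[of X]]) (auto simp: stab_def)

lemma id_in_stab: "id \<in> stab X lab"
  by (simp add: stab_def permutes_id)

lemma stab_compose: "\<sigma> \<in> stab X lab \<Longrightarrow> \<tau> \<in> stab X lab \<Longrightarrow> \<sigma> \<circ> \<tau> \<in> stab X lab"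
  by (auto simp: stab_def permutes_compose permutes_in_image)

lemma stab_inv:
  assumes "\<sigma> \<in> stab X lab" shows "inv \<sigma> \<in> stab X lab"
proof -
  have p: "\<sigma> permutes X" using assms by (rule stab_permutes)
  have "lab (inv \<sigma> x) = lab x" if "x \<in> X" for x
    using stab_lab[OF assms, of "inv \<sigma> x"] that permutes_inverses(1)[OF p, of x]
      permutes_in_image[OF permutes_inv[OF p]] by simp
  then show ?thesis using permutes_inv[OF p] by (simp add: stab_def)
qed

lemma stab_mono: "X \<subseteq> Y \<Longrightarrow> \<sigma> \<in> stab X lab \<Longrightarrow> \<sigma> \<in> stab Y lab"
  by (auto simp: stab_def intro: permutes_subset) (metis permutes_not_in)

lemma transpose_in_stab:
  "x \<in> X \<Longrightarrow> y \<in> X \<Longrightarrow> lab x = lab y \<Longrightarrow> Transposition.transpose x y \<in> stab X lab"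
  by (auto simp: stab_def permutes_swap_id Transposition.transpose_def)

lemma stab_permutation: "finite X \<Longrightarrow> \<sigma> \<in> stab X lab \<Longrightarrow> permutation \<sigma>"
  using stab_permutes permutes_imp_permutation by blast

lemma stab_empty [simp]: "stab {} lab = {id}"
  by (auto simp: stab_def)

lemma bij_betw_stab_left:
  assumes "\<tau> \<in> stab X lab" shows "bij_betw (\<lambda>\<sigma>. \<tau> \<circ> \<sigma>) (stab X lab) (stab X lab)"
proof (rule bij_betw_byWitness[where f' = "\<lambda>\<sigma>. inv \<tau> \<circ> \<sigma>"])
  have "inv \<tau> \<circ> \<tau> = id" "\<tau> \<circ> inv \<tau> = id"
    using permutes_inv_o[OF stab_permutes[OF assms]] by auto
  then show "\<forall>a\<in>stab X lab. inv \<tau> \<circ> (\<tau> \<circ> a) = a" "\<forall>a\<in>stab X lab. \<tau> \<circ> (inv \<tau> \<circ> a) = a"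
    by (simp_all add: o_assoc)
qed (use assms in \<open>auto intro: stab_compose stab_inv\<close>)

lemma bij_betw_stab_right:
  assumes "\<tau> \<in> stab X lab" shows "bij_betw (\<lambda>\<sigma>. \<sigma> \<circ> \<tau>) (stab X lab) (stab X lab)"
proof (rule bij_betw_byWitness[where f' = "\<lambda>\<sigma>. \<sigma> \<circ> inv \<tau>"])
  have "inv \<tau> \<circ> \<tau> = id" "\<tau> \<circ> inv \<tau> = id"
    using permutes_inv_o[OF stab_permutes[OF assms]] by auto
  then show "\<forall>a\<in>stab X lab. (a \<circ> \<tau>) \<circ> inv \<tau> = a" "\<forall>a\<in>stab X lab. (a \<circ> inv \<tau>) \<circ> \<tau> = a"
    by (simp_all add: comp_assoc)
qed (use assms in \<open>auto intro: stab_compose stab_inv\<close>)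

lemma bij_betw_stab_inv: "bij_betw inv (stab X lab) (stab X lab)"
  by (rule bij_betw_byWitness[where f' = inv])
     (auto intro: stab_inv simp: inv_inv_eq stab_bij)

definition sym_sum :: "(nat \<Rightarrow> nat) set \<Rightarrow> qpoly \<Rightarrow> qpoly" where
  "sym_sum \<Gamma> F = (\<Sum>\<sigma>\<in>\<Gamma>. perm_act \<sigma> F)"

abbreviation sgn_rat :: "(nat \<Rightarrow> nat) \<Rightarrow> rat" where
  "sgn_rat \<sigma> \<equiv> of_int (sign \<sigma>)"

definition alt_sum :: "(nat \<Rightarrow> nat) set \<Rightarrow> qpoly \<Rightarrow> qpoly" where
  "alt_sum \<Gamma> F = (\<Sum>\<sigma>\<in>\<Gamma>. scaleQ (sgn_rat \<sigma>) (perm_act \<sigma> F))"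

lemma sgn_rat_mult_self [simp]: "sgn_rat \<sigma> * sgn_rat \<sigma> = 1"
  by (metis of_int_1 of_int_mult sign_idempotent)

lemma lin_sym_sum: "lin (sym_sum \<Gamma>)"
  by (simp add: lin_def sym_sum_def perm_act_add perm_act_scale sum.distrib qpoly.scale_sum_right)

lemma lin_alt_sum: "lin (alt_sum \<Gamma>)"
  by (simp add: lin_def alt_sum_def perm_act_add perm_act_scale sum.distrib
      qpoly.scale_sum_right qpoly.scale_right_distrib mult.commute)

lemma sym_sum_id [simp]: "sym_sum {id} F = F"
  by (simp add: sym_sum_def)

lemma alt_sum_id [simp]: "alt_sum {id} F = F"
  by (simp add: alt_sum_def)

lemma perm_act_sym_sum:
  assumes "\<tau> \<in> stab X lab"
  shows "perm_act \<tau> (sym_sum (stab X lab) F) = sym_sum (stab X lab) F"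
  unfolding sym_sum_def perm_act_sum
  by (subst sum.reindex_bij_betw[OF bij_betw_stab_left[OF assms], symmetric])
     (intro sum.cong refl perm_act_compose stab_bij[OF assms] stab_bij)

lemma sym_sum_perm_act:
  assumes "\<tau> \<in> stab X lab"
  shows "sym_sum (stab X lab) (perm_act \<tau> F) = sym_sum (stab X lab) F"
  unfolding sym_sum_def perm_act_sum
  by (subst sum.reindex_bij_betw[OF bij_betw_stab_right[OF assms], symmetric])
     (intro sum.cong refl perm_act_compose stab_bij[OF assms] stab_bij)

lemma perm_act_alt_sum:
  assumes "finite X" "\<tau> \<in> stab X lab"
  shows "perm_act \<tau> (alt_sum (stab X lab) F) = scaleQ (sgn_rat \<tau>) (alt_sum (stab X lab) F)"
proof -
  have "scaleQ (sgn_rat \<tau>) (alt_sum (stab X lab) F)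
      = (\<Sum>\<sigma>\<in>stab X lab. scaleQ (sgn_rat \<tau> * sgn_rat (\<tau> \<circ> \<sigma>)) (perm_act (\<tau> \<circ> \<sigma>) F))"
    unfolding alt_sum_def qpoly.scale_sum_right
    by (subst sum.reindex_bij_betw[OF bij_betw_stab_left[OF assms(2)], symmetric]) simp
  also have "\<dots> = (\<Sum>\<sigma>\<in>stab X lab. scaleQ (sgn_rat \<sigma>) (perm_act \<tau> (perm_act \<sigma> F)))"
  proof (rule sum.cong[OF refl])
    fix \<sigma> assume s: "\<sigma> \<in> stab X lab"
    have "sgn_rat \<tau> * sgn_rat (\<tau> \<circ> \<sigma>) = sgn_rat \<sigma>"
      using sign_compose[OF stab_permutation[OF assms] stab_permutation[OF assms(1) s]]
      by (simp flip: mult.assoc)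
    then show "scaleQ (sgn_rat \<tau> * sgn_rat (\<tau> \<circ> \<sigma>)) (perm_act (\<tau> \<circ> \<sigma>) F)
        = scaleQ (sgn_rat \<sigma>) (perm_act \<tau> (perm_act \<sigma> F))"
      using perm_act_compose[OF stab_bij[OF assms(2)] stab_bij[OF s]] by simp
  qed
  also have "\<dots> = perm_act \<tau> (alt_sum (stab X lab) F)"
    by (simp add: alt_sum_def perm_act_sum perm_act_scale)
  finally show ?thesis by simp
qed

lemma alt_sum_perm_act:
  assumes "finite X" "\<tau> \<in> stab X lab"
  shows "alt_sum (stab X lab) (perm_act \<tau> F) = scaleQ (sgn_rat \<tau>) (alt_sum (stab X lab) F)"
proof -
  have "scaleQ (sgn_rat \<tau>) (alt_sum (stab X lab) F)
      = (\<Sum>\<sigma>\<in>stab X lab. scaleQ (sgn_rat \<tau> * sgn_rat (\<sigma> \<circ> \<tau>)) (perm_act (\<sigma> \<circ> \<tau>) F))"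
    unfolding alt_sum_def qpoly.scale_sum_right
    by (subst sum.reindex_bij_betw[OF bij_betw_stab_right[OF assms(2)], symmetric]) simp
  also have "\<dots> = (\<Sum>\<sigma>\<in>stab X lab. scaleQ (sgn_rat \<sigma>) (perm_act \<sigma> (perm_act \<tau> F)))"
  proof (rule sum.cong[OF refl])
    fix \<sigma> assume s: "\<sigma> \<in> stab X lab"
    have "sgn_rat \<tau> * sgn_rat (\<sigma> \<circ> \<tau>) = sgn_rat \<sigma>"
      using sign_compose[OF stab_permutation[OF assms(1) s] stab_permutation[OF assms]]
      by (simp add: mult.left_commute)
    then show "scaleQ (sgn_rat \<tau> * sgn_rat (\<sigma> \<circ> \<tau>)) (perm_act (\<sigma> \<circ> \<tau>) F)
        = scaleQ (sgn_rat \<sigma>) (perm_act \<sigma> (perm_act \<tau> F))"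
      using perm_act_compose[OF stab_bij[OF s] stab_bij[OF assms(2)]] by simp
  qed
  finally show ?thesis by (simp add: alt_sum_def)
qed

lemma ip_alt_sum:
  assumes "finite X"
  shows "ip (alt_sum (stab X lab) F) G = ip F (alt_sum (stab X lab) G)"
proof -
  have "ip (alt_sum (stab X lab) F) G
      = (\<Sum>\<sigma>\<in>stab X lab. sgn_rat \<sigma> * ip F (perm_act (inv \<sigma>) G))"
    unfolding alt_sum_def ip_sum_left
    by (intro sum.cong refl) (simp add: ip_scale_left ip_perm_act stab_bij)
  also have "\<dots> = (\<Sum>\<sigma>\<in>stab X lab. sgn_rat (inv \<sigma>) * ip F (perm_act (inv \<sigma>) G))"
    by (intro sum.cong refl) (simp add: sign_inverse stab_permutation[OF assms])
  also have "\<dots> = (\<Sum>\<sigma>\<in>stab X lab. sgn_rat \<sigma> * ip F (perm_act \<sigma> G))"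
    by (rule sum.reindex_bij_betw[OF bij_betw_stab_inv])
  also have "\<dots> = ip F (alt_sum (stab X lab) G)"
    by (simp add: alt_sum_def ip_sum_right ip_scale_right)
  finally show ?thesis .
qed

lemma ip_sym_sum: "ip (sym_sum (stab X lab) F) G = ip F (sym_sum (stab X lab) G)"
proof -
  have "ip (sym_sum (stab X lab) F) G = (\<Sum>\<sigma>\<in>stab X lab. ip F (perm_act (inv \<sigma>) G))"
    unfolding sym_sum_def ip_sum_left
    by (intro sum.cong refl) (simp add: ip_perm_act stab_bij)
  also have "\<dots> = (\<Sum>\<sigma>\<in>stab X lab. ip F (perm_act \<sigma> G))"
    by (rule sum.reindex_bij_betw[OF bij_betw_stab_inv])
  finally show ?thesis by (simp add: sym_sum_def ip_sum_right)
qed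

lemma sym_sum_invariant:
  "(\<And>\<sigma>. \<sigma> \<in> \<Gamma> \<Longrightarrow> perm_act \<sigma> F = F) \<Longrightarrow> sym_sum \<Gamma> F = scaleQ (of_nat (card \<Gamma>)) F"
  by (rule poly_mapping_eqI)
     (simp add: sym_sum_def lookup_sum lookup_scaleQ del: sum_constant add: sum_constant[where 'a = rat])

lemma perm_act_commute:
  assumes "bij \<sigma>" "bij \<tau>" "\<sigma> \<circ> \<tau> = \<tau> \<circ> \<sigma>"
  shows "perm_act \<sigma> (perm_act \<tau> F) = perm_act \<tau> (perm_act \<sigma> F)"
  using assms by (simp add: perm_act_compose)

text \<open>The cosets of the smaller group: a permutation is determined by the image
  \<open>y\<close> of the new element \<open>t\<close> and by what remains after composing with
  the transposition of \<open>t\<close> and \<open>y\<close>.\<close>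

lemma bij_betw_stab_insert:
  assumes "t \<notin> X"
  shows "bij_betw (\<lambda>(y, \<sigma>). Transposition.transpose t y \<circ> \<sigma>)
    (insert t {y \<in> X. lab y = lab t} \<times> stab X lab) (stab (insert t X) lab)" (is "bij_betw ?f ?A ?B")
proof (rule bij_betw_byWitness[where f' = "\<lambda>\<pi>. (\<pi> t, Transposition.transpose t (\<pi> t) \<circ> \<pi>)"])
  have fix_t: "\<sigma> t = t" if "\<sigma> \<in> stab X lab" for \<sigma>
    using that assms by (metis stab_permutes permutes_not_in)
  then have "?f (y, \<sigma>) t = y" if "\<sigma> \<in> stab X lab" for y \<sigma>
    using fix_t[OF that] by simp
  then show "\<forall>a\<in>?A. (?f a t, Transposition.transpose t (?f a t) \<circ> ?f a) = a"
    by (auto simp: fun_eq_iff simp del: comp_apply) (simp_all add: comp_def)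
  show "\<forall>\<pi>\<in>?B. ?f (\<pi> t, Transposition.transpose t (\<pi> t) \<circ> \<pi>) = \<pi>"
    by (auto simp: fun_eq_iff)
  show "?f ` ?A \<subseteq> ?B"
    using assms by (auto intro!: stab_compose transpose_in_stab intro: stab_mono[of X])
  show "(\<lambda>\<pi>. (\<pi> t, Transposition.transpose t (\<pi> t) \<circ> \<pi>)) ` ?B \<subseteq> ?A"
  proof (rule image_subsetI)
    fix \<pi> assume p: "\<pi> \<in> stab (insert t X) lab"
    have img: "\<pi> t \<in> insert t X" using p by (metis insertI1 permutes_in_image stab_permutes)
    then have mem: "\<pi> t \<in> insert t {y \<in> X. lab y = lab t}"
      using stab_lab[OF p, of t] by auto
    let ?s = "Transposition.transpose t (\<pi> t) \<circ> \<pi>"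
    have s: "?s \<in> stab (insert t X) lab"
      using p img stab_lab[OF p, of t] by (intro stab_compose transpose_in_stab) auto
    have "?s permutes X"
      using stab_permutes[OF s] by (rule permutes_superset) auto
    moreover have "\<forall>x\<in>X. lab (?s x) = lab x" using s by (simp add: stab_def)
    ultimately show "(\<pi> t, ?s) \<in> ?A"
      using mem by (simp add: stab_def)
  qed
qed

lemma bij_transpose [simp]: "bij (Transposition.transpose a b)"
  by (rule involuntory_imp_bij) simp

lemma sym_sum_insert:
  assumes "finite X" "t \<notin> X"
  shows "sym_sum (stab (insert t X) lab) F = sym_sum (stab X lab) F
    + (\<Sum>y\<in>{y \<in> X. lab y = lab t}. perm_act (Transposition.transpose t y) (sym_sum (stab X lab) F))"
proof -
  have "sym_sum (stab (insert t X) lab) F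
    = (\<Sum>(y, \<sigma>)\<in>insert t {y \<in> X. lab y = lab t} \<times> stab X lab.
        perm_act (Transposition.transpose t y \<circ> \<sigma>) F)"
    unfolding sym_sum_def
    by (subst sum.reindex_bij_betw[OF bij_betw_stab_insert[OF assms(2)], symmetric])
       (simp add: case_prod_unfold)
  also have "\<dots> = (\<Sum>y\<in>insert t {y \<in> X. lab y = lab t}. \<Sum>\<sigma>\<in>stab X lab.
        perm_act (Transposition.transpose t y) (perm_act \<sigma> F))"
    by (simp add: sum.cartesian_product perm_act_compose stab_bij cong: sum.cong)
  also have "\<dots> = (\<Sum>y\<in>insert t {y \<in> X. lab y = lab t}.
        perm_act (Transposition.transpose t y) (sym_sum (stab X lab) F))"
    by (simp add: sym_sum_def perm_act_sum)
  finally show ?thesis using assms by simp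
qed

lemma alt_sum_insert:
  assumes "finite X" "t \<notin> X"
  shows "alt_sum (stab (insert t X) lab) F = alt_sum (stab X lab) F
    - (\<Sum>y\<in>{y \<in> X. lab y = lab t}. perm_act (Transposition.transpose t y) (alt_sum (stab X lab) F))"
proof -
  let ?C = "{y \<in> X. lab y = lab t}"
  have sg: "sgn_rat (Transposition.transpose t y \<circ> \<sigma>) = (if y = t then 1 else -1) * sgn_rat \<sigma>"
    if "\<sigma> \<in> stab X lab" for y \<sigma>
    using sign_compose[OF permutation_swap_id stab_permutation[OF assms(1) that], of t y]
    by (simp add: sign_swap_id)
  have "alt_sum (stab (insert t X) lab) F
    = (\<Sum>(y, \<sigma>)\<in>insert t ?C \<times> stab X lab. scaleQ (sgn_rat (Transposition.transpose t y \<circ> \<sigma>))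
        (perm_act (Transposition.transpose t y \<circ> \<sigma>) F))"
    unfolding alt_sum_def
    by (subst sum.reindex_bij_betw[OF bij_betw_stab_insert[OF assms(2)], symmetric])
       (simp add: case_prod_unfold)
  also have "\<dots> = (\<Sum>y\<in>insert t ?C. \<Sum>\<sigma>\<in>stab X lab. scaleQ (if y = t then 1 else -1)
        (perm_act (Transposition.transpose t y) (scaleQ (sgn_rat \<sigma>) (perm_act \<sigma> F))))"
    unfolding sum.cartesian_product
    by (intro sum.cong refl) (auto simp: sg perm_act_scale perm_act_compose stab_bij)
  also have "\<dots> = (\<Sum>y\<in>insert t ?C. scaleQ (if y = t then 1 else -1)
        (perm_act (Transposition.transpose t y) (alt_sum (stab X lab) F)))"
    by (simp only: alt_sum_def perm_act_sum qpoly.scale_sum_right)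
  also have "\<dots> = alt_sum (stab X lab) F
      + (\<Sum>y\<in>?C. - perm_act (Transposition.transpose t y) (alt_sum (stab X lab) F))"
    using assms by (subst sum.insert) (auto intro!: sum.cong)
  finally show ?thesis by (simp add: sum_negf)
qed

text \<open>The principle of the sign-reversing involution.\<close>

lemma alternating_sum_eq_0:
  fixes f :: "'a \<Rightarrow> qpoly"
  assumes "\<And>a. a \<in> A \<Longrightarrow> \<iota> a \<in> A" "\<And>a. a \<in> A \<Longrightarrow> \<iota> (\<iota> a) = a" "\<And>a. a \<in> A \<Longrightarrow> f (\<iota> a) = - f a"
  shows "sum f A = 0"
proof -
  have "bij_betw \<iota> A A"
    by (rule bij_betw_byWitness[where f' = \<iota>]) (use assms in auto)
  then have "sum f A = (\<Sum>a\<in>A. f (\<iota> a))" by (rule sum.reindex_bij_betw[symmetric])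
  also have "\<dots> = - sum f A" using assms(3) by (simp add: sum_negf)
  finally have "sum f A = - sum f A" .
  then show ?thesis
    by (metis (mono_tags, lifting) lookup_uminus equal_neg_zero poly_mapping_eqI lookup_zero)
qed


section \<open>The hook product\<close>

text \<open>A tableau seen from its entries: the element \<open>x\<close> of \<open>X\<close>
  stands in row \<open>r x\<close> and column \<open>c x\<close>, and the last assumption says
  that the boxes form a Young diagram. The hook and Garnir arguments then speak of the entries
  directly, and removing rows shifts no indices.\<close>

locale tableau =
  fixes X :: "nat set" and r c :: "nat \<Rightarrow> nat"
  assumes finite_X: "finite X"
    and box_inj: "\<And>x y. x \<in> X \<Longrightarrow> y \<in> X \<Longrightarrow> r x = r y \<Longrightarrow> c x = c y \<Longrightarrow> x = y"
    and young: "\<And>x i j. x \<in> X \<Longrightarrow> i \<le> r x \<Longrightarrow> j \<le> c x \<Longrightarrow> \<exists>y\<in>X. r y = i \<and> c y = j"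
begin

abbreviation row :: "nat \<Rightarrow> nat set" where "row i \<equiv> {x \<in> X. r x = i}"

lemma inj_on_c_row: "inj_on c (row i)"
  by (auto simp: inj_on_def box_inj)

lemma c_row: "c ` row i = {..<card (row i)}"
proof -
  have fin: "finite (c ` row i)" using finite_X by simp
  have down: "\<And>a b. b \<in> c ` row i \<Longrightarrow> a \<le> b \<Longrightarrow> a \<in> c ` row i"
    using young by (fastforce simp: image_iff)
  have "c ` row i = {..<card (c ` row i)}"
  proof -
    have "\<exists>m. c ` row i = {..<m}"
    proof (cases "c ` row i = {}")
      case True then show ?thesis by (intro exI[of _ 0]) simp
    next
      case False
      have "c ` row i = {..<Suc (Max (c ` row i))}"
        using Max_ge[OF fin] down[OF Max_in[OF fin False]] by (auto simp: less_Suc_eq_le)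
      then show ?thesis by blast
    qed
    then show ?thesis by (metis card_lessThan)
  qed
  then show ?thesis by (simp add: card_image inj_on_c_row)
qed

lemma box_exists:
  assumes "j < card (row i)" shows "\<exists>x\<in>X. r x = i \<and> c x = j"
proof -
  have "j \<in> c ` row i" using c_row[of i] assms by simp
  then show ?thesis by auto
qed

lemma card_row_from:
  assumes "q \<le> card (row i)" shows "card {t \<in> row i. q \<le> c t} = card (row i) - q"
proof -
  have "c ` {t \<in> row i. q \<le> c t} = {q..<card (row i)}"
  proof (rule subset_antisym)
    show "c ` {t \<in> row i. q \<le> c t} \<subseteq> {q..<card (row i)}"
      using c_row[of i] image_mono[of "{t \<in> row i. q \<le> c t}" "row i" c] by auto
    show "{q..<card (row i)} \<subseteq> c ` {t \<in> row i. q \<le> c t}"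
    proof
      fix j assume j: "j \<in> {q..<card (row i)}"
      then obtain x where "x \<in> X" "r x = i" "c x = j" using box_exists[of j i] by auto
      then show "j \<in> c ` {t \<in> row i. q \<le> c t}" using j by auto
    qed
  qed
  then have "card (c ` {t \<in> row i. q \<le> c t}) = card (row i) - q" by simp
  moreover have "inj_on c {t \<in> row i. q \<le> c t}"
    using inj_on_c_row[of i] by (rule inj_on_subset) auto
  ultimately show ?thesis by (simp add: card_image)
qed

definition below :: "nat \<Rightarrow> nat set" where
  "below i = {x \<in> X. i < r x}"

text \<open>With growing \<open>q\<close> this adds row \<open>i\<close> to the rows below it, one
  box at a time from the left.\<close>

definition lower_part :: "nat \<Rightarrow> nat \<Rightarrow> nat set" where
  "lower_part i q = below i \<union> {t \<in> row i. c t < q}"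

text \<open>For row-invariant \<open>F\<close> this says that symmetrising \<open>F\<close> over a
  row together with one element below it gives \<open>0\<close>.\<close>

definition exchange :: "qpoly \<Rightarrow> bool" where
  "exchange F \<longleftrightarrow> (\<forall>i. \<forall>y\<in>below i. F + (\<Sum>t\<in>row i. perm_act (Transposition.transpose t y) F) = 0)"

lemma finite_lower_part: "finite (lower_part i q)"
  using finite_X by (auto simp: lower_part_def below_def)

text \<open>Let \<open>u\<close> be the preimage of \<open>x\<close> under
  \<open>\<sigma>\<close>, and let \<open>y\<close> be the element in the row of \<open>u\<close>
  and the column of \<open>t\<close>; it exists because that column lies further left. Replacing
  \<open>\<sigma>\<close> by its composite with the transposition of \<open>t\<close> and
  \<open>y\<close> changes the sign, but not the polynomial, because \<open>F\<close> is invariant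
  under the transposition of \<open>u\<close> and \<open>y\<close>. So the terms cancel in
  pairs.\<close>

lemma exchange_column_sum_vanishes:
  assumes inv: "\<And>\<pi>. \<pi> \<in> stab X r \<Longrightarrow> perm_act \<pi> F = F"
    and t: "t \<in> row i" "c t < c x" and x: "x \<in> below i"
    and q: "c x = q"
  shows "(\<Sum>\<sigma>\<in>stab (lower_part i q) c. scaleQ (sgn_rat \<sigma>)
      (perm_act \<sigma> (perm_act (Transposition.transpose t (inv \<sigma> x)) F))) = 0"
proof -
  let ?\<Gamma> = "stab (lower_part i q) c"
  define partner where "partner \<sigma> = (SOME y. y \<in> X \<and> r y = r (inv \<sigma> x) \<and> c y = c t)" for \<sigma> :: "nat \<Rightarrow> nat"
  \<comment> \<open>The preimage of \<open>x\<close> stays below row \<open>i\<close>: in its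
    column \<open>q\<close> no element of row \<open>i\<close> has been added yet.\<close>
  have xq: "x \<in> lower_part i q" using x by (simp add: lower_part_def)
  have tq: "t \<in> lower_part i q" using t q by (simp add: lower_part_def)
  have u: "inv \<sigma> x \<in> below i" "c (inv \<sigma> x) = q" if "\<sigma> \<in> ?\<Gamma>" for \<sigma>
  proof -
    have "inv \<sigma> x \<in> lower_part i q"
      using xq that by (meson permutes_in_image permutes_inv stab_permutes)
    moreover show "c (inv \<sigma> x) = q" using stab_lab[OF stab_inv[OF that] xq] q by simp
    ultimately show "inv \<sigma> x \<in> below i" by (auto simp: lower_part_def)
  qed
  have partner: "partner \<sigma> \<in> below i" "r (partner \<sigma>) = r (inv \<sigma> x)" "c (partner \<sigma>) = c t"
    if "\<sigma> \<in> ?\<Gamma>" for \<sigma>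
  proof -
    have "\<exists>y. y \<in> X \<and> r y = r (inv \<sigma> x) \<and> c y = c t"
      using young[of "inv \<sigma> x" "r (inv \<sigma> x)" "c t"] u[OF that] t q by (auto simp: below_def)
    then have "partner \<sigma> \<in> X \<and> r (partner \<sigma>) = r (inv \<sigma> x) \<and> c (partner \<sigma>) = c t"
      unfolding partner_def by (rule someI_ex)
    then show "partner \<sigma> \<in> below i" "r (partner \<sigma>) = r (inv \<sigma> x)" "c (partner \<sigma>) = c t"
      using u[OF that] by (auto simp: below_def)
  qed
  define \<iota> where "\<iota> \<sigma> = \<sigma> \<circ> Transposition.transpose t (partner \<sigma>)" for \<sigma>
  have tr: "Transposition.transpose t (partner \<sigma>) \<in> ?\<Gamma>" if "\<sigma> \<in> ?\<Gamma>" for \<sigma>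
    using tq partner[OF that] by (intro transpose_in_stab) (auto simp: lower_part_def)
  have ne: "t \<noteq> partner \<sigma>" "t \<noteq> inv \<sigma> x" "inv \<sigma> x \<noteq> partner \<sigma>" if "\<sigma> \<in> ?\<Gamma>" for \<sigma>
    using partner[OF that] u[OF that] t q by (auto simp: below_def)
  have inv_\<iota>: "inv (\<iota> \<sigma>) x = inv \<sigma> x" if "\<sigma> \<in> ?\<Gamma>" for \<sigma>
  proof -
    have "\<iota> \<sigma> (inv \<sigma> x) = x"
      using ne[OF that] stab_bij[OF that] by (simp add: \<iota>_def bij_is_surj surj_f_inv_f)
    moreover have "bij (\<iota> \<sigma>)" using stab_bij[OF that] by (simp add: \<iota>_def bij_comp)
    ultimately show ?thesis by (metis bij_inv_eq_iff)
  qed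
  have partner_\<iota>: "partner (\<iota> \<sigma>) = partner \<sigma>" if "\<sigma> \<in> ?\<Gamma>" for \<sigma>
    by (simp add: partner_def inv_\<iota>[OF that])
  show ?thesis
  proof (rule alternating_sum_eq_0[where \<iota> = \<iota>])
    fix \<sigma> assume s: "\<sigma> \<in> ?\<Gamma>"
    show "\<iota> \<sigma> \<in> ?\<Gamma>" using stab_compose[OF s tr[OF s]] by (simp add: \<iota>_def)
    have "\<iota> (\<iota> \<sigma>) = (\<sigma> \<circ> Transposition.transpose t (partner \<sigma>)) \<circ> Transposition.transpose t (partner \<sigma>)"
      using partner_\<iota>[OF s] by (simp add: \<iota>_def)
    then show "\<iota> (\<iota> \<sigma>) = \<sigma>" by (simp add: comp_assoc)
    let ?u = "inv \<sigma> x" and ?y = "partner \<sigma>"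
    have row_swap: "perm_act (Transposition.transpose ?u ?y) F = F"
      using partner[OF s] u[OF s] by (intro inv transpose_in_stab) (auto simp: below_def)
    have "Transposition.transpose t ?y \<circ> Transposition.transpose t ?u
        = Transposition.transpose t ?u \<circ> Transposition.transpose ?u ?y"
      using ne[OF s] by (auto simp: fun_eq_iff Transposition.transpose_def)
    then have "perm_act (Transposition.transpose t ?y) (perm_act (Transposition.transpose t ?u) F)
        = perm_act (Transposition.transpose t ?u) F"
      using row_swap by (metis perm_act_compose bij_transpose)
    then have "perm_act (\<iota> \<sigma>) (perm_act (Transposition.transpose t ?u) F)
        = perm_act \<sigma> (perm_act (Transposition.transpose t ?u) F)"
      unfolding \<iota>_def by (metis perm_act_compose bij_transpose stab_bij[OF s])
    moreover have "sgn_rat (\<iota> \<sigma>) = - sgn_rat \<sigma>"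
      using sign_compose[OF stab_permutation[OF finite_lower_part s] permutation_swap_id, of t ?y] ne[OF s]
      by (simp add: \<iota>_def sign_swap_id)
    ultimately show "scaleQ (sgn_rat (\<iota> \<sigma>)) (perm_act (\<iota> \<sigma>)
        (perm_act (Transposition.transpose t (inv (\<iota> \<sigma>) x)) F))
      = - scaleQ (sgn_rat \<sigma>) (perm_act \<sigma> (perm_act (Transposition.transpose t ?u) F))"
      by (simp add: inv_\<iota>[OF s])
  qed
qed

text \<open>The exchange relation survives antisymmetrisation over those columns of row
  \<open>i\<close> that are already complete, if the sum is restricted to the elements of row
  \<open>i\<close> not yet used: the contribution of a used element vanishes by
  \<open>exchange_column_sum_vanishes\<close>.\<close>

lemma exchange_partial_columns:
  assumes inv: "\<And>\<pi>. \<pi> \<in> stab X r \<Longrightarrow> perm_act \<pi> F = F" and ex: "exchange F"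
    and x: "x \<in> below i" "c x = q"
  shows "(\<Sum>t\<in>{t \<in> row i. q \<le> c t}. perm_act (Transposition.transpose t x) (alt_sum (stab (lower_part i q) c) F))
    = - alt_sum (stab (lower_part i q) c) F"
proof -
  let ?\<Gamma> = "stab (lower_part i q) c"
  let ?hi = "{t \<in> row i. q \<le> c t}" and ?lo = "{t \<in> row i. c t < q}"
  have row_split: "row i = ?hi \<union> ?lo" "?hi \<inter> ?lo = {}" "finite ?hi" "finite ?lo" using finite_X by auto
  have xq: "x \<in> lower_part i q" using x by (simp add: lower_part_def)
  have u: "inv \<sigma> x \<in> below i" "c (inv \<sigma> x) = q" if "\<sigma> \<in> ?\<Gamma>" for \<sigma>
  proof -
    have "inv \<sigma> x \<in> lower_part i q"
      using xq that by (meson permutes_in_image permutes_inv stab_permutes)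
    moreover show "c (inv \<sigma> x) = q" using stab_lab[OF stab_inv[OF that] xq] x by simp
    ultimately show "inv \<sigma> x \<in> below i" by (auto simp: lower_part_def)
  qed
  have swap: "perm_act (Transposition.transpose t x) (perm_act \<sigma> F)
      = perm_act \<sigma> (perm_act (Transposition.transpose t (inv \<sigma> x)) F)" if "\<sigma> \<in> ?\<Gamma>" "t \<in> ?hi" for \<sigma> t
  proof -
    have "t \<notin> lower_part i q" using that(2) by (auto simp: lower_part_def below_def)
    then have "\<sigma> t = t" using stab_permutes[OF that(1)] by (rule permutes_not_in[rotated])
    then have "Transposition.transpose t x \<circ> \<sigma> = \<sigma> \<circ> Transposition.transpose t (inv \<sigma> x)"
      using transpose_comp_eq[OF stab_bij[OF that(1)], of t x] stab_bij[OF that(1)]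
      by (metis bij_inv_eq_iff)
    then show ?thesis by (metis perm_act_compose bij_transpose stab_bij[OF that(1)])
  qed
  have "(\<Sum>t\<in>?hi. perm_act (Transposition.transpose t x) (alt_sum ?\<Gamma> F))
      = (\<Sum>t\<in>?hi. \<Sum>\<sigma>\<in>?\<Gamma>. scaleQ (sgn_rat \<sigma>) (perm_act \<sigma> (perm_act (Transposition.transpose t (inv \<sigma> x)) F)))"
    by (intro sum.cong refl) (simp add: alt_sum_def perm_act_sum perm_act_scale swap)
  also have "\<dots> = (\<Sum>\<sigma>\<in>?\<Gamma>. scaleQ (sgn_rat \<sigma>) (perm_act \<sigma>
      (\<Sum>t\<in>?hi. perm_act (Transposition.transpose t (inv \<sigma> x)) F)))"
    by (subst sum.swap) (simp add: perm_act_sum qpoly.scale_sum_right)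
  also have "\<dots> = (\<Sum>\<sigma>\<in>?\<Gamma>. scaleQ (sgn_rat \<sigma>) (perm_act \<sigma>
      (- F - (\<Sum>t\<in>?lo. perm_act (Transposition.transpose t (inv \<sigma> x)) F))))"
  proof (intro sum.cong refl arg_cong[where f = "scaleQ _"] arg_cong[where f = "perm_act _"])
    fix \<sigma> assume s: "\<sigma> \<in> ?\<Gamma>"
    have "F + (\<Sum>t\<in>row i. perm_act (Transposition.transpose t (inv \<sigma> x)) F) = 0"
      using ex u[OF s] by (auto simp: exchange_def)
    also have "(\<Sum>t\<in>row i. perm_act (Transposition.transpose t (inv \<sigma> x)) F)
        = (\<Sum>t\<in>?hi. perm_act (Transposition.transpose t (inv \<sigma> x)) F)
        + (\<Sum>t\<in>?lo. perm_act (Transposition.transpose t (inv \<sigma> x)) F)"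
      by (subst row_split(1)) (simp only: sum.union_disjoint[OF row_split(3,4,2)])
    finally show "(\<Sum>t\<in>?hi. perm_act (Transposition.transpose t (inv \<sigma> x)) F)
      = - F - (\<Sum>t\<in>?lo. perm_act (Transposition.transpose t (inv \<sigma> x)) F)"
      by (simp add: algebra_simps eq_neg_iff_add_eq_0)
  qed
  also have "\<dots> = - alt_sum ?\<Gamma> F - (\<Sum>t\<in>?lo. \<Sum>\<sigma>\<in>?\<Gamma>. scaleQ (sgn_rat \<sigma>)
      (perm_act \<sigma> (perm_act (Transposition.transpose t (inv \<sigma> x)) F)))"
  proof -
    have "perm_act \<sigma> (- F) = - perm_act \<sigma> F" for \<sigma>
      using lin_diff[OF lin_perm_act, of \<sigma> 0 F] by simp
    then have "(\<Sum>\<sigma>\<in>?\<Gamma>. scaleQ (sgn_rat \<sigma>) (perm_act \<sigma>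
        (- F - (\<Sum>t\<in>?lo. perm_act (Transposition.transpose t (inv \<sigma> x)) F))))
      = - alt_sum ?\<Gamma> F - (\<Sum>\<sigma>\<in>?\<Gamma>. \<Sum>t\<in>?lo. scaleQ (sgn_rat \<sigma>)
      (perm_act \<sigma> (perm_act (Transposition.transpose t (inv \<sigma> x)) F)))"
      by (simp add: lin_diff[OF lin_perm_act] qpoly.scale_right_diff_distrib sum_subtractf
          alt_sum_def perm_act_sum qpoly.scale_sum_right sum_negf)
    then show ?thesis by (simp only: sum.swap[of _ ?lo ?\<Gamma>])
  qed
  also have "(\<Sum>t\<in>?lo. \<Sum>\<sigma>\<in>?\<Gamma>. scaleQ (sgn_rat \<sigma>)
      (perm_act \<sigma> (perm_act (Transposition.transpose t (inv \<sigma> x)) F))) = 0"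
    using x by (intro sum.neutral ballI exchange_column_sum_vanishes[OF inv]) auto
  finally show ?thesis by simp
qed

text \<open>Adding the box in row \<open>i\<close> and column \<open>q\<close> multiplies the
  pairing with \<open>s\<close> by \<open>(N + k) / N\<close>, where \<open>N\<close> boxes of the
  row are in column \<open>q\<close> or further right and \<open>k\<close> boxes are below the new
  one. Up to the usual shift by one, the numerator is the hook length. Since \<open>s\<close> is
  row-invariant, the new element may be replaced by any unused element of its row, and the average
  over these is known from \<open>exchange_partial_columns\<close>.\<close>

lemma hook_step:
  assumes inv: "\<And>\<pi>. \<pi> \<in> stab X r \<Longrightarrow> perm_act \<pi> F = F" and ex: "exchange F"
    and s: "\<And>\<pi>. \<pi> \<in> stab X r \<Longrightarrow> perm_act \<pi> s = s"
    and q: "q < card (row i)"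
  shows "\<exists>h>0. ip (alt_sum (stab (lower_part i (Suc q)) c) F) s = h * ip (alt_sum (stab (lower_part i q) c) F) s"
proof -
  let ?G = "alt_sum (stab (lower_part i q) c) F"
  let ?hi = "{t \<in> row i. q \<le> c t}"
  obtain t where t: "t \<in> X" "r t = i" "c t = q" using box_exists[OF q] by blast
  have "lower_part i (Suc q) = insert t (lower_part i q)"
    using t box_inj by (auto simp: lower_part_def less_Suc_eq)
  moreover have tn: "t \<notin> lower_part i q" using t by (auto simp: lower_part_def below_def)
  moreover have C: "{y \<in> lower_part i q. c y = c t} = {y \<in> below i. c y = q}"
    using t by (auto simp: lower_part_def)
  ultimately have G': "alt_sum (stab (lower_part i (Suc q)) c) F
      = ?G - (\<Sum>y\<in>{y \<in> below i. c y = q}. perm_act (Transposition.transpose t y) ?G)"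
    using alt_sum_insert[OF finite_lower_part tn, of c F] by simp
  \<comment> \<open>The number of unused elements of row \<open>i\<close>, over which the
    position of the new one is averaged.\<close>
  define N where "N = of_nat (card (row i) - q) * (1::rat)"
  have N: "N > 0" using q by (simp add: N_def)
  have swap: "ip (perm_act (Transposition.transpose t y) ?G) s
      = ip (perm_act (Transposition.transpose t' y) ?G) s"
    if t': "t' \<in> ?hi" and y: "y \<in> below i" for t' y
  proof -
    have rs: "Transposition.transpose t t' \<in> stab X r" using t t' by (intro transpose_in_stab) auto
    have out: "t' \<notin> lower_part i q" using t' by (auto simp: lower_part_def below_def)
    have "perm_act (Transposition.transpose t t') (perm_act \<sigma> F) = perm_act \<sigma> F"
      if "\<sigma> \<in> stab (lower_part i q) c" for \<sigma>
    proof -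
      have "\<sigma> t = t" "\<sigma> t' = t'" using tn out stab_permutes[OF that] by (auto simp: permutes_not_in)
      then have "Transposition.transpose t t' \<circ> \<sigma> = \<sigma> \<circ> Transposition.transpose t t'"
        using transpose_comp_eq[OF stab_bij[OF that], of t t'] stab_bij[OF that]
        by (metis bij_inv_eq_iff)
      then show ?thesis
        using perm_act_commute[OF bij_transpose stab_bij[OF that]] inv[OF rs] by metis
    qed
    then have fixG: "perm_act (Transposition.transpose t t') ?G = ?G"
      by (simp add: alt_sum_def perm_act_sum perm_act_scale)
    have "y \<noteq> t" "y \<noteq> t'" using y t t' by (auto simp: below_def)
    then have "Transposition.transpose t t' \<circ> Transposition.transpose t y
        = Transposition.transpose t' y \<circ> Transposition.transpose t t'"
      by (auto simp: fun_eq_iff Transposition.transpose_def)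
    then have "perm_act (Transposition.transpose t t') (perm_act (Transposition.transpose t y) ?G)
        = perm_act (Transposition.transpose t' y) ?G"
      using fixG by (metis perm_act_compose bij_transpose)
    moreover have "ip (perm_act (Transposition.transpose t t') Y) s = ip Y s" for Y
      using s[OF rs] by (simp add: ip_perm_act)
    ultimately show ?thesis by metis
  qed
  have one: "N * ip (perm_act (Transposition.transpose t y) ?G) s = - ip ?G s"
    if y: "y \<in> below i" "c y = q" for y
  proof -
    have "N * ip (perm_act (Transposition.transpose t y) ?G) s
        = (\<Sum>t'\<in>?hi. ip (perm_act (Transposition.transpose t y) ?G) s)"
      using card_row_from[of q i] q by (simp add: N_def)
    also have "\<dots> = (\<Sum>t'\<in>?hi. ip (perm_act (Transposition.transpose t' y) ?G) s)"
      using swap y by (intro sum.cong) auto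
    also have "\<dots> = ip (- ?G) s"
      using exchange_partial_columns[OF inv ex y] by (simp flip: ip_sum_left)
    also have "\<dots> = - ip ?G s" using ip_minus_left[of 0 ?G s] by simp
    finally show ?thesis .
  qed
  let ?k = "of_nat (card {y \<in> below i. c y = q}) :: rat"
  have "N * ip (alt_sum (stab (lower_part i (Suc q)) c) F) s
      = N * ip ?G s - (\<Sum>y\<in>{y \<in> below i. c y = q}. N * ip (perm_act (Transposition.transpose t y) ?G) s)"
    by (simp add: G' ip_minus_left ip_sum_left algebra_simps sum_distrib_left)
  also have "\<dots> = (N + ?k) * ip ?G s"
    using one by (simp add: algebra_simps)
  finally have "ip (alt_sum (stab (lower_part i (Suc q)) c) F) s = ((N + ?k) / N) * ip ?G s"
    using N by (simp add: field_simps)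
  moreover have "(N + ?k) / N > 0" using N by (simp add: add_pos_nonneg)
  ultimately show ?thesis by blast
qed

lemma hook_row:
  assumes "\<And>\<pi>. \<pi> \<in> stab X r \<Longrightarrow> perm_act \<pi> F = F" "exchange F"
    and "\<And>\<pi>. \<pi> \<in> stab X r \<Longrightarrow> perm_act \<pi> s = s"
  shows "\<exists>h>0. ip (alt_sum (stab {x \<in> X. i \<le> r x} c) F) s
    = h * ip (alt_sum (stab {x \<in> X. Suc i \<le> r x} c) F) s"
proof -
  have "\<exists>h>0. ip (alt_sum (stab (lower_part i q) c) F) s = h * ip (alt_sum (stab (lower_part i 0) c) F) s"
    if "q \<le> card (row i)" for q
    using that
  proof (induction q)
    case 0 then show ?case by (intro exI[of _ 1]) simp
  next
    case (Suc q)
    then obtain h where h: "h > 0" "ip (alt_sum (stab (lower_part i q) c) F) s = h * ip (alt_sum (stab (lower_part i 0) c) F) s"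
      by auto
    obtain h' where h': "h' > 0" "ip (alt_sum (stab (lower_part i (Suc q)) c) F) s
        = h' * ip (alt_sum (stab (lower_part i q) c) F) s"
      using hook_step[OF assms] Suc.prems by (metis Suc_le_lessD)
    show ?case using h h' by (intro exI[of _ "h' * h"]) simp
  qed
  from this[of "card (row i)"] have "\<exists>h>0. ip (alt_sum (stab (lower_part i (card (row i))) c) F) s
      = h * ip (alt_sum (stab (lower_part i 0) c) F) s" by simp
  moreover have "lower_part i 0 = {x \<in> X. Suc i \<le> r x}" by (auto simp: lower_part_def below_def)
  moreover have "lower_part i (card (row i)) = {x \<in> X. i \<le> r x}"
    using c_row[of i] by (auto simp: lower_part_def below_def)
  ultimately show ?thesis by simp
qed

text \<open>A weak form of the fact that the Young symmetriser is a quasi-idempotent: on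
  polynomials with the exchange property the column antisymmetriser followed by a pairing with
  row-invariants is multiplication by a product of quotients of hook lengths. Only the sign of the
  factor matters below.\<close>

theorem hook_product:
  assumes "\<And>\<pi>. \<pi> \<in> stab X r \<Longrightarrow> perm_act \<pi> F = F" "exchange F"
    and "\<And>\<pi>. \<pi> \<in> stab X r \<Longrightarrow> perm_act \<pi> s = s"
  shows "\<exists>h>0. ip (alt_sum (stab X c) F) s = h * ip F s"
proof -
  have "\<exists>b. \<forall>x\<in>X. r x < b"
    using finite_X by (metis finite_nat_set_iff_bounded finite_imageI imageI)
  then obtain b where b: "\<forall>x\<in>X. r x < b" by blast
  have "\<exists>h>0. ip (alt_sum (stab {x \<in> X. i \<le> r x} c) F) s = h * ip F s" if "i \<le> b" for i
    using that
  proof (induction rule: inc_induct)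
    case base
    have e: "{x \<in> X. b \<le> r x} = {}" using b by auto
    show ?case unfolding e by (intro exI[of _ 1]) simp
  next
    case (step i)
    then obtain h where h: "h > 0" "ip (alt_sum (stab {x \<in> X. Suc i \<le> r x} c) F) s = h * ip F s"
      by auto
    obtain h' where h': "h' > 0" "ip (alt_sum (stab {x \<in> X. i \<le> r x} c) F) s
        = h' * ip (alt_sum (stab {x \<in> X. Suc i \<le> r x} c) F) s"
      using hook_row[OF assms] by blast
    show ?case using h h' by (intro exI[of _ "h' * h"]) simp
  qed
  from this[of 0] show ?thesis by simp
qed

end


section \<open>Rearrangements and sorting\<close>

abbreviation Perm :: "nat set \<Rightarrow> (nat \<Rightarrow> nat) set" where
  "Perm Z \<equiv> stab Z (\<lambda>_. 0)"

lemma Perm_iff: "\<sigma> \<in> Perm Z \<longleftrightarrow> \<sigma> permutes Z"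
  by (simp add: stab_def)

text \<open>The set \<open>B\<close> consists of smallest values in \<open>A \<union> B\<close>,
  so a set of the same size with no larger sum arises from it by exchanging equal values
  only.\<close>

lemma minimal_exchange:
  fixes f :: "'a \<Rightarrow> nat"
  assumes fin: "finite A" "finite B" and D: "D \<subseteq> A \<union> B" "card D = card B"
    and hi: "\<And>a. a \<in> A \<Longrightarrow> \<beta> \<le> f a" and lo: "\<And>b. b \<in> B \<Longrightarrow> f b \<le> \<beta>"
    and le: "sum f D \<le> sum f B"
  shows "card (D - B) = card (B - D)" "\<And>x. x \<in> D - B \<Longrightarrow> f x = \<beta>" "\<And>x. x \<in> B - D \<Longrightarrow> f x = \<beta>"
proof -
  have finD: "finite D" using D(1) fin by (auto intro: finite_subset)
  have "card D = card (D \<inter> B) + card (D - B)" "card B = card (D \<inter> B) + card (B - D)"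
    using finD fin(2) by (metis card_Int_Diff Int_commute)+
  then show card: "card (D - B) = card (B - D)" using D(2) by simp
  have split: "sum f D = sum f (D \<inter> B) + sum f (D - B)" "sum f B = sum f (D \<inter> B) + sum f (B - D)"
    using finD fin(2) by (metis sum.Int_Diff Int_commute)+
  have hi': "\<beta> \<le> f x" if "x \<in> D - B" for x using that D(1) hi by auto
  have lo': "f x \<le> \<beta>" if "x \<in> B - D" for x using that lo by auto
  have 1: "(\<Sum>x\<in>D - B. \<beta>) \<le> sum f (D - B)" by (rule sum_mono) (rule hi')
  have 2: "sum f (B - D) \<le> (\<Sum>x\<in>B - D. \<beta>)" by (rule sum_mono) (rule lo')
  have 3: "sum f (D - B) \<le> sum f (B - D)" using le split by simp
  have 4: "(\<Sum>x\<in>D - B. \<beta>) = (\<Sum>x\<in>B - D. \<beta>)" using card by simp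
  have eqs: "(\<Sum>x\<in>D - B. \<beta>) = sum f (D - B)" "sum f (B - D) = (\<Sum>x\<in>B - D. \<beta>)"
    using le_antisym[OF 1 order.trans[OF 3 order.trans[OF 2 eq_refl[OF 4[symmetric]]]]]
      le_antisym[OF 2 order.trans[OF eq_refl[OF 4[symmetric]] order.trans[OF 1 3]]] by (simp_all only:)
  show "f x = \<beta>" if "x \<in> D - B" for x
    using sum_mono_inv[OF eqs(1) _ that] hi' finD by auto
  show "f x = \<beta>" if "x \<in> B - D" for x
    using sum_mono_inv[OF eqs(2) _ that] lo' fin(2) by auto
qed

text \<open>Swapping an inversion would increase the weighted sum.\<close>

lemma maximal_is_sorted:
  fixes q w :: "nat \<Rightarrow> nat"
  assumes "finite X"
    and max: "\<And>\<tau>. \<tau> \<in> stab X lab \<Longrightarrow> (\<Sum>x\<in>X. w x * q (\<tau> x)) \<le> (\<Sum>x\<in>X. w x * q x)"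
    and xy: "x \<in> X" "y \<in> X" "lab x = lab y" "w x < w y"
  shows "q x \<le> q y"
proof (rule ccontr)
  assume "\<not> q x \<le> q y"
  then have "q y < q x" by simp
  then obtain e where e: "q x = q y + e" "e > 0" by (metis less_imp_add_positive)
  obtain d where d: "w y = w x + d" "d > 0" using xy(4) by (metis less_imp_add_positive)
  let ?\<tau> = "Transposition.transpose x y"
  have ne: "x \<noteq> y" using xy by auto
  have s: "(\<Sum>z\<in>X. g z) = g x + g y + (\<Sum>z\<in>X - {x, y}. g z)" for g :: "nat \<Rightarrow> nat"
  proof -
    have "X - {x, y} = X - {x} - {y}" by auto
    then show ?thesis
      using sum.remove[OF assms(1) xy(1), of g] sum.remove[of "X - {x}" y g] assms(1) xy ne by simp
  qed
  have 1: "(\<Sum>z\<in>X - {x, y}. w z * q (?\<tau> z)) = (\<Sum>z\<in>X - {x, y}. w z * q z)"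
    by (intro sum.cong) (auto simp: Transposition.transpose_def)
  have "w x * q x + w y * q y < w x * q y + w y * q x"
    using d e by (simp add: algebra_simps)
  then have "w x * q x + w y * q y + (\<Sum>z\<in>X - {x, y}. w z * q z)
      < w x * q (?\<tau> x) + w y * q (?\<tau> y) + (\<Sum>z\<in>X - {x, y}. w z * q (?\<tau> z))"
    unfolding 1 by simp
  then have "(\<Sum>z\<in>X. w z * q z) < (\<Sum>z\<in>X. w z * q (?\<tau> z))"
    by (simp only: s[of "\<lambda>z. w z * q z"] s[of "\<lambda>z. w z * q (?\<tau> z)"])
  then show False using max[OF transpose_in_stab[OF xy(1,2,3)]] by simp
qed

lemma maximal_rearrangement:
  fixes q w :: "nat \<Rightarrow> nat"
  assumes "finite X"
  obtains \<tau> where "\<tau> \<in> stab X lab"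
    and "\<And>\<rho>. \<rho> \<in> stab X lab \<Longrightarrow> (\<Sum>x\<in>X. w x * q (\<rho> x)) \<le> (\<Sum>x\<in>X. w x * q (\<tau> x))"
proof -
  let ?g = "\<lambda>\<tau>. \<Sum>x\<in>X. w x * q (\<tau> x)"
  have fin: "finite (?g ` stab X lab)" using assms by (simp add: finite_stab)
  have ne: "?g ` stab X lab \<noteq> {}" using id_in_stab by blast
  obtain \<tau> where t: "\<tau> \<in> stab X lab" "Max (?g ` stab X lab) = ?g \<tau>"
    using Max_in[OF fin ne] by (rule imageE)
  show ?thesis
  proof (rule that[OF t(1)])
    show "?g \<rho> \<le> ?g \<tau>" if "\<rho> \<in> stab X lab" for \<rho>
      using Max_ge[OF fin imageI[OF that]] unfolding t(2) .
  qed
qed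

lemma sorted_rearrangement:
  fixes q w :: "nat \<Rightarrow> nat"
  assumes "finite X"
  obtains \<tau> where "\<tau> \<in> stab X lab"
    and "\<And>x y. x \<in> X \<Longrightarrow> y \<in> X \<Longrightarrow> lab x = lab y \<Longrightarrow> w x < w y \<Longrightarrow> q (\<tau> x) \<le> q (\<tau> y)"
proof -
  obtain \<tau> where t: "\<tau> \<in> stab X lab"
    and max: "\<And>\<rho>. \<rho> \<in> stab X lab \<Longrightarrow> (\<Sum>x\<in>X. w x * q (\<rho> x)) \<le> (\<Sum>x\<in>X. w x * q (\<tau> x))"
    using maximal_rearrangement[OF assms, of lab w q] by blast
  have "q (\<tau> x) \<le> q (\<tau> y)" if "x \<in> X" "y \<in> X" "lab x = lab y" "w x < w y" for x y
  proof (rule maximal_is_sorted[OF assms, where q = "\<lambda>x. q (\<tau> x)" and w = w and lab = lab])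
    show "(\<Sum>x\<in>X. w x * q (\<tau> (\<rho> x))) \<le> (\<Sum>x\<in>X. w x * q (\<tau> x))" if "\<rho> \<in> stab X lab" for \<rho>
      using max[OF stab_compose[OF t that]] by simp
  qed (use that in auto)
  then show ?thesis using that t by blast
qed


section \<open>Greedy choice of rows\<close>

lemma stab_split:
  assumes p: "\<pi> \<in> stab X lab" and R: "R \<subseteq> X" and stable: "\<And>x. x \<in> X \<Longrightarrow> \<pi> x \<in> R \<longleftrightarrow> x \<in> R"
  shows "restrict_id \<pi> R \<in> stab R lab" "restrict_id \<pi> (X - R) \<in> stab (X - R) lab"
    "\<pi> = restrict_id \<pi> R \<circ> restrict_id \<pi> (X - R)"
proof -
  have perm: "\<pi> permutes X" using p by (rule stab_permutes)
  have img: "\<pi> ` R = R"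
  proof -
    have "\<pi> ` R \<subseteq> R" using stable R by auto
    moreover have "R \<subseteq> \<pi> ` R"
    proof
      fix x assume x: "x \<in> R"
      then obtain z where "z \<in> X" "x = \<pi> z" using perm R by (metis imageE permutes_image subsetD)
      then show "x \<in> \<pi> ` R" using stable x by auto
    qed
    ultimately show ?thesis by blast
  qed
  have b1: "bij_betw \<pi> R R" using img permutes_inj_on[OF perm] by (simp add: bij_betw_def)
  have "\<pi> ` (X - R) = X - R"
    using img perm by (metis image_set_diff permutes_image permutes_inj)
  then have b2: "bij_betw \<pi> (X - R) (X - R)" using permutes_inj_on[OF perm] by (simp add: bij_betw_def)
  show "restrict_id \<pi> R \<in> stab R lab" "restrict_id \<pi> (X - R) \<in> stab (X - R) lab"
    using permutes_restrict_id[OF b1] permutes_restrict_id[OF b2] p R by (auto simp: stab_def restrict_id_def)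
  show "\<pi> = restrict_id \<pi> R \<circ> restrict_id \<pi> (X - R)"
    using stable R permutes_not_in[OF perm] by (auto simp: fun_eq_iff restrict_id_def)
qed

lemma subspace_sym_sum:
  assumes "qpoly.subspace V" "\<And>\<sigma>. \<sigma> \<in> \<Gamma> \<Longrightarrow> perm_act \<sigma> F \<in> V"
  shows "sym_sum \<Gamma> F \<in> V"
  unfolding sym_sum_def using assms by (intro qpoly.subspace_sum) auto

text \<open>The first row is a largest set \<open>R\<close> for which \<open>V\<close> contains a
  non-zero element symmetric in \<open>R\<close>; these elements form a space stable under the
  permutations of \<open>X - R\<close>, to which the same choice is applied. Symmetrising over a
  larger set gives an element of the same space with more symmetry, hence \<open>0\<close> by
  maximality, and the same reason makes the row lengths decrease.\<close>

lemma greedy_rows: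
  assumes "finite X" "qpoly.subspace V" "\<And>\<sigma> F. \<sigma> permutes X \<Longrightarrow> F \<in> V \<Longrightarrow> perm_act \<sigma> F \<in> V"
    and "F0 \<in> V" "F0 \<noteq> 0"
  shows "\<exists>r F. F \<in> V \<and> F \<noteq> 0 \<and> (\<forall>\<pi>\<in>stab X r. perm_act \<pi> F = F)
    \<and> (\<forall>i. card {x \<in> X. r x = Suc i} \<le> card {x \<in> X. r x = i})
    \<and> (\<forall>i Z. Z \<subseteq> {x \<in> X. i \<le> r x} \<longrightarrow> card {x \<in> X. r x = i} < card Z \<longrightarrow> sym_sum (Perm Z) F = 0)"
  using assms
proof (induction "card X" arbitrary: X V F0 rule: less_induct)
  case less
  show ?case
  proof (cases "X = {}")
    case True
    then show ?thesis using less.prems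
      by (intro exI[of _ "\<lambda>_. 0"] exI[of _ F0]) auto
  next
    case False
    define good where "good R \<longleftrightarrow> R \<subseteq> X \<and> (\<exists>F\<in>V. F \<noteq> 0 \<and> (\<forall>\<pi>\<in>Perm R. perm_act \<pi> F = F))" for R
    have fin: "finite (Collect good)"
      by (rule finite_subset[of _ "Pow X"]) (use less.prems(1) in \<open>auto simp: good_def\<close>)
    obtain x where x: "x \<in> X" using False by blast
    have "good {x}" using x less.prems(4,5) by (auto simp: good_def Perm_iff)
    then have "card ` Collect good \<noteq> {}" by blast
    from Max_in[OF finite_imageI[OF fin] this]
    obtain R where "R \<in> Collect good" and max: "Max (card ` Collect good) = card R" by (rule imageE)
    then have "good R" by simp
    moreover have "card S \<le> card R" if "good S" for S
      using Max_ge[OF finite_imageI[OF fin, of card], of "card S"] that unfolding max by auto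
    ultimately have R: "good R" "\<And>S. good S \<Longrightarrow> card S \<le> card R" by blast+
    have RX: "R \<subseteq> X" and finR: "finite R" using R(1) less.prems(1) by (auto simp: good_def intro: finite_subset)
    have "card R \<ge> 1" using R(2)[OF \<open>good {x}\<close>] by simp
    then have "R \<noteq> {}" by auto
    define V' where "V' = {F \<in> V. \<forall>\<pi>\<in>Perm R. perm_act \<pi> F = F}"
    have sub': "qpoly.subspace V'"
      using less.prems(2) by (auto simp: V'_def qpoly.subspace_def perm_act_add perm_act_scale)
    have stable': "perm_act \<sigma> F \<in> V'" if s: "\<sigma> permutes (X - R)" and F: "F \<in> V'" for \<sigma> F
    proof -
      have "perm_act \<pi> (perm_act \<sigma> F) = perm_act \<sigma> F" if p: "\<pi> permutes R" for \<pi>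
      proof -
        have "\<pi> \<circ> \<sigma> = \<sigma> \<circ> \<pi>"
        proof
          fix z
          show "(\<pi> \<circ> \<sigma>) z = (\<sigma> \<circ> \<pi>) z"
            using permutes_not_in[OF p] permutes_not_in[OF s] permutes_in_image[OF p] permutes_in_image[OF s]
            by (cases "z \<in> R"; cases "z \<in> X") (metis DiffD2 DiffI comp_apply)+
        qed
        then have "perm_act \<pi> (perm_act \<sigma> F) = perm_act \<sigma> (perm_act \<pi> F)"
          using p s by (intro perm_act_commute) (auto simp: permutes_bij)
        then show ?thesis using F p by (simp add: V'_def Perm_iff)
      qed
      moreover have "\<sigma> permutes X" using s by (rule permutes_subset) auto
      ultimately show ?thesis using F less.prems(3) by (auto simp: V'_def Perm_iff)
    qed
    obtain F1 where F1: "F1 \<in> V'" "F1 \<noteq> 0" using R(1) by (auto simp: good_def V'_def)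
    have "card (X - R) < card X" using RX \<open>R \<noteq> {}\<close> less.prems(1) by (intro psubset_card_mono) auto
    from less.hyps[OF this _ sub' stable' F1] less.prems(1)
    obtain r' F where F: "F \<in> V'" "F \<noteq> 0" and inv': "\<forall>\<pi>\<in>stab (X - R) r'. perm_act \<pi> F = F"
      and dec': "\<forall>i. card {x \<in> X - R. r' x = Suc i} \<le> card {x \<in> X - R. r' x = i}"
      and van': "\<forall>i Z. Z \<subseteq> {x \<in> X - R. i \<le> r' x} \<longrightarrow> card {x \<in> X - R. r' x = i} < card Z
        \<longrightarrow> sym_sum (Perm Z) F = 0"
      by auto
    define r where "r x = (if x \<in> R then 0 else Suc (r' x))" for x
    have row0: "{x \<in> X. r x = 0} = R" and rowS: "{x \<in> X. r x = Suc i} = {x \<in> X - R. r' x = i}"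
      and fromS: "{x \<in> X. Suc i \<le> r x} = {x \<in> X - R. i \<le> r' x}" for i
      using RX by (auto simp: r_def split: if_splits)
    have V: "F \<in> V" using F(1) by (simp add: V'_def)
    have inv: "perm_act \<pi> F = F" if p: "\<pi> \<in> stab X r" for \<pi>
    proof -
      have st: "\<pi> x \<in> R \<longleftrightarrow> x \<in> R" if "x \<in> X" for x
        using stab_lab[OF p that] by (auto simp: r_def split: if_splits)
      note sp = stab_split[OF p RX st]
      have "restrict_id \<pi> (X - R) \<in> stab (X - R) r'" using sp(2) by (fastforce simp: stab_def r_def restrict_id_def split: if_splits)
      then have "perm_act (restrict_id \<pi> (X - R)) F = F" using inv' by simp
      moreover have "perm_act (restrict_id \<pi> R) F = F"
        using F(1) sp(1) stab_permutes by (simp add: V'_def Perm_iff)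
      ultimately show ?thesis
        using perm_act_compose[OF stab_bij[OF sp(1)] stab_bij[OF sp(2)], of F] sp(3) by simp
    qed
    have van: "sym_sum (Perm Z) F = 0"
      if Z: "Z \<subseteq> {x \<in> X. i \<le> r x}" "card {x \<in> X. r x = i} < card Z" for i Z
    proof (cases i)
      case (Suc k)
      then show ?thesis using van' Z unfolding rowS fromS Suc by blast
    next
      case 0
      let ?G = "sym_sum (Perm Z) F"
      have ZX: "Z \<subseteq> X" using Z by auto
      have "?G \<in> V"
        using less.prems(3)[OF _ V] ZX
        by (intro subspace_sym_sum less.prems(2)) (auto simp: Perm_iff intro: permutes_subset)
      moreover have "\<forall>\<pi>\<in>Perm Z. perm_act \<pi> ?G = ?G" by (auto intro: perm_act_sym_sum)
      ultimately have "?G \<noteq> 0 \<Longrightarrow> good Z" using ZX by (auto simp: good_def)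
      then show ?thesis using R(2)[of Z] Z(2) row0 0 by auto
    qed
    have dec: "card {x \<in> X. r x = Suc i} \<le> card {x \<in> X. r x = i}" for i
    proof (cases i)
      case (Suc k) then show ?thesis using dec' by (simp add: rowS)
    next
      case 0
      let ?S = "{x \<in> X. r x = Suc 0}"
      have "perm_act \<pi> F = F" if "\<pi> \<in> Perm ?S" for \<pi>
      proof -
        have "\<pi> \<in> stab ?S r" using that permutes_in_image[OF stab_permutes[OF that]] by (auto simp: stab_def)
        then have "\<pi> \<in> stab X r" by (rule stab_mono[rotated]) auto
        then show ?thesis by (rule inv)
      qed
      then have "good ?S" using V F(2) by (auto simp: good_def)
      then show ?thesis using R(2) row0 0 by simp
    qed
    show ?thesis using V F(2) inv dec van by blast
  qed
qed

lemma bij_betw_rank: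
  fixes R :: "nat set"
  assumes "finite R"
  shows "bij_betw (\<lambda>x. card {y \<in> R. y < x}) R {..<card R}"
proof -
  let ?f = "\<lambda>x. card {y \<in> R. y < x}"
  have less: "?f x < ?f y" if "x \<in> R" "x < y" for x y
    using that assms by (intro psubset_card_mono) auto
  have inj: "inj_on ?f R"
  proof (rule inj_onI)
    fix x y assume xy: "x \<in> R" "y \<in> R" "?f x = ?f y"
    show "x = y"
    proof (rule ccontr)
      assume "x \<noteq> y"
      then show False using less[OF xy(1), of y] less[OF xy(2), of x] xy(3) by (cases "x < y") auto
    qed
  qed
  have "?f ` R \<subseteq> {..<card R}"
    using assms by (auto intro!: psubset_card_mono)
  then have "?f ` R = {..<card R}"
    using inj by (intro card_subset_eq) (auto simp: card_image)
  then show ?thesis using inj by (simp add: bij_betw_def)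
qed

text \<open>Rows of decreasing lengths become a tableau when each row is filled in increasing
  order.\<close>

lemma tableau_of_rows:
  assumes fin: "finite X" and dec: "\<And>i. card {x \<in> X. r x = Suc i} \<le> card {x \<in> X. r x = i}"
  defines "c \<equiv> \<lambda>x. card {y \<in> X. r y = r x \<and> y < x}"
  shows "tableau X r c"
proof
  show "finite X" by fact
  have b: "bij_betw c {x \<in> X. r x = i} {..<card {x \<in> X. r x = i}}" for i
  proof -
    have "bij_betw (\<lambda>x. card {y \<in> {x \<in> X. r x = i}. y < x}) {x \<in> X. r x = i} {..<card {x \<in> X. r x = i}}"
      using fin by (intro bij_betw_rank) auto
    moreover have "card {y \<in> {x \<in> X. r x = i}. y < x} = c x" if "x \<in> {x \<in> X. r x = i}" for x
      unfolding c_def using that by (intro arg_cong[where f = card]) auto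
    ultimately show ?thesis by (rule bij_betw_cong[THEN iffD1, rotated]) auto
  qed
  show "x = y" if "x \<in> X" "y \<in> X" "r x = r y" "c x = c y" for x y
    using b[of "r x"] that by (auto simp: bij_betw_def inj_on_def)
  have mono: "card {x \<in> X. r x = k} \<le> card {x \<in> X. r x = i}" if "i \<le> k" for i k
    using that by (rule lift_Suc_antimono_le[of "\<lambda>i. card {x \<in> X. r x = i}", rotated]) (rule dec)
  show "\<exists>y\<in>X. r y = i \<and> c y = j" if "x \<in> X" "i \<le> r x" "j \<le> c x" for x i j
  proof -
    have "c x < card {z \<in> X. r z = r x}" using b[of "r x"] that by (auto simp: bij_betw_def)
    then have "j < card {z \<in> X. r z = i}" using mono[OF that(2)] that(3) by linarith
    then have "j \<in> c ` {z \<in> X. r z = i}" using b[of i] by (simp add: bij_betw_def)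
    then show ?thesis by auto
  qed
qed


section \<open>Straightening the entries\<close>

lemma image_mset_eq_of_sym_diff:
  assumes fin: "finite A" "finite B" and card: "card (A - B) = card (B - A)"
    and A: "\<And>x. x \<in> A - B \<Longrightarrow> f x = \<beta>" and B: "\<And>x. x \<in> B - A \<Longrightarrow> f x = \<beta>"
  shows "image_mset f (mset_set A) = image_mset f (mset_set B)"
proof -
  have split: "image_mset f (mset_set A) = image_mset f (mset_set (A \<inter> B)) + replicate_mset (card (A - B)) \<beta>"
    if "finite A" "\<And>x. x \<in> A - B \<Longrightarrow> f x = \<beta>" for A B
  proof -
    have "mset_set A = mset_set (A \<inter> B) + mset_set (A - B)"
      using that(1) by (subst mset_set_Union[symmetric]) (auto simp: Int_Diff_Un)
    moreover have "image_mset f (mset_set (A - B)) = image_mset (\<lambda>_. \<beta>) (mset_set (A - B))"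
      using that by (intro image_mset_cong) auto
    ultimately show ?thesis by (simp add: image_mset_const_eq)
  qed
  have "image_mset f (mset_set A) = image_mset f (mset_set (A \<inter> B)) + replicate_mset (card (A - B)) \<beta>"
    using split[OF fin(1) A] .
  also have "\<dots> = image_mset f (mset_set B)"
    using split[OF fin(2), of A] B card by (simp add: Int_commute)
  finally show ?thesis .
qed

text \<open>Moving larger values of \<open>f\<close> from \<open>A\<close> to \<open>B\<close> is
  visible in the weighted sum through the last summand alone; this is how both straightening
  arguments terminate.\<close>

lemma sum_two_adjacent_labels:
  fixes lab f :: "nat \<Rightarrow> nat"
  assumes X: "finite X" "A \<subseteq> X" "B \<subseteq> X" "A \<inter> B = {}"
    and A: "\<And>x. x \<in> A \<Longrightarrow> lab x = a" and B: "\<And>x. x \<in> B \<Longrightarrow> lab x = Suc a"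
  shows "(\<Sum>x\<in>X. lab x * f x)
    = (\<Sum>x\<in>X - (A \<union> B). lab x * f x) + a * (\<Sum>x\<in>A \<union> B. f x) + (\<Sum>x\<in>B. f x)"
proof -
  have fin: "finite A" "finite B" using X finite_subset by blast+
  have "(\<Sum>x\<in>X. lab x * f x) = (\<Sum>x\<in>X - (A \<union> B). lab x * f x) + (\<Sum>x\<in>A \<union> B. lab x * f x)"
    using X by (intro sum.subset_diff) auto
  also have "(\<Sum>x\<in>A \<union> B. lab x * f x) = (\<Sum>x\<in>A. lab x * f x) + (\<Sum>x\<in>B. lab x * f x)"
    by (rule sum.union_disjoint[OF fin X(4)])
  also have "(\<Sum>x\<in>A. lab x * f x) = a * (\<Sum>x\<in>A. f x)"
    using A by (simp add: sum_distrib_left)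
  also have "(\<Sum>x\<in>B. lab x * f x) = Suc a * (\<Sum>x\<in>B. f x)"
    unfolding sum_distrib_left using B by (intro sum.cong) auto
  also have "a * (\<Sum>x\<in>A. f x) + Suc a * (\<Sum>x\<in>B. f x) = a * (\<Sum>x\<in>A \<union> B. f x) + (\<Sum>x\<in>B. f x)"
    unfolding sum.union_disjoint[OF fin X(4)] by (simp add: algebra_simps)
  finally show ?thesis by simp
qed

context tableau
begin

text \<open>The relations produced by the greedy choice of rows. They contain the Garnir relations
  for two adjacent rows as well as the exchange relations.\<close>

definition vanishing :: "qpoly \<Rightarrow> bool" where
  "vanishing F \<longleftrightarrow> (\<forall>i Z. Z \<subseteq> {x \<in> X. i \<le> r x} \<longrightarrow> card (row i) < card Z \<longrightarrow> sym_sum (Perm Z) F = 0)"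

definition row_invariant :: "qpoly \<Rightarrow> bool" where
  "row_invariant F \<longleftrightarrow> (\<forall>\<pi>\<in>stab X r. perm_act \<pi> F = F)"

lemma row_invariantD: "row_invariant F \<Longrightarrow> \<pi> \<in> stab X r \<Longrightarrow> perm_act \<pi> F = F"
  by (simp add: row_invariant_def)

lemma Perm_row_subset: "\<pi> \<in> Perm Z \<Longrightarrow> Z \<subseteq> row i \<Longrightarrow> \<pi> \<in> stab X r"
proof -
  assume p: "\<pi> \<in> Perm Z" and Z: "Z \<subseteq> row i"
  have "r (\<pi> x) = r x" if "x \<in> Z" for x
    using that permutes_in_image[OF stab_permutes[OF p], of x] Z by auto
  then have "\<pi> \<in> stab Z r" using stab_permutes[OF p] by (simp add: stab_def)
  then show ?thesis using Z by (auto intro: stab_mono[of Z])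
qed

lemma exchange_of_vanishing:
  assumes inv: "row_invariant F" and van: "vanishing F"
  shows "exchange F"
  unfolding exchange_def
proof (intro allI ballI)
  fix i y assume y: "y \<in> below i"
  have yX: "y \<notin> row i" using y by (auto simp: below_def)
  have fin: "finite (row i)" using finite_X by simp
  have s: "sym_sum (Perm (row i)) F = scaleQ (of_nat (card (Perm (row i)))) F"
    using Perm_row_subset row_invariantD[OF inv] by (intro sym_sum_invariant) blast
  have "0 = sym_sum (Perm (insert y (row i))) F"
  proof -
    have "insert y (row i) \<subseteq> {x \<in> X. i \<le> r x}" using y by (auto simp: below_def)
    moreover have "card (row i) < card (insert y (row i))" using yX fin by simp
    ultimately show ?thesis
      using van[unfolded vanishing_def, rule_format, of "insert y (row i)" i] by simp
  qed
  also have "\<dots> = scaleQ (of_nat (card (Perm (row i))))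
      (F + (\<Sum>t\<in>row i. perm_act (Transposition.transpose t y) F))"
    using sym_sum_insert[OF fin yX, of "\<lambda>_. 0" F]
    by (simp add: s perm_act_scale qpoly.scale_right_distrib qpoly.scale_sum_right transpose_commute)
  finally have "scaleQ (of_nat (card (Perm (row i))))
      (F + (\<Sum>t\<in>row i. perm_act (Transposition.transpose t y) F)) = 0" by simp
  moreover have "card (Perm (row i)) \<noteq> 0"
    using finite_stab[OF fin, of "\<lambda>_. 0"] id_in_stab[of "row i" "\<lambda>_. 0"] by (auto simp: card_eq_0_iff)
  ultimately show "F + (\<Sum>t\<in>row i. perm_act (Transposition.transpose t y) F) = 0"
    by simp
qed

definition weight :: "(nat \<Rightarrow> nat) \<Rightarrow> mono \<Rightarrow> nat" where
  "weight w p = (\<Sum>x\<in>X. w x * lookup p x)"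

lemma weight_stab:
  assumes "\<sigma> \<in> stab X w" shows "weight w (mono_act \<sigma> p) = weight w p"
proof -
  have "weight w (mono_act \<sigma> p) = (\<Sum>x\<in>X. w x * lookup p (inv \<sigma> x))"
    using assms by (simp add: weight_def lookup_mono_act stab_bij)
  also have "\<dots> = (\<Sum>x\<in>X. w (\<sigma> x) * lookup p (inv \<sigma> (\<sigma> x)))"
    by (rule sum.reindex_bij_betw[symmetric]) (rule permutes_imp_bij[OF stab_permutes[OF assms]])
  also have "\<dots> = weight w p"
    using assms by (simp add: weight_def stab_lab bij_is_inj stab_bij)
  finally show ?thesis .
qed

lemma c_image_initial:
  assumes "y \<in> X" shows "c ` {z \<in> row (r y). c z \<le> c y} = {..c y}"
proof -
  have "a \<in> c ` {z \<in> row (r y). c z \<le> c y}" if "a \<le> c y" for a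
    using young[OF assms order_refl that] that by force
  then show ?thesis by auto
qed

text \<open>The end of a row from column \<open>j\<close> on and the beginning of the next row up
  to column \<open>j\<close> together have one element more than the upper row.\<close>

lemma garnir_set:
  assumes x: "x \<in> X" "y \<in> X" "c x = c y" "r y = Suc (r x)"
  defines "A \<equiv> {z \<in> row (r x). c x \<le> c z}" and "B \<equiv> {z \<in> row (r y). c z \<le> c y}"
  shows "card (A \<union> B) = Suc (card (row (r x)))" "A \<inter> B = {}"
proof -
  have fin: "finite A" "finite B" using finite_X by (auto simp: A_def B_def)
  show disj: "A \<inter> B = {}" using x by (auto simp: A_def B_def)
  have "c x \<in> c ` row (r x)" by (rule imageI) (use x in simp)
  then have lt: "c x < card (row (r x))" using c_row[of "r x"] by simp
  have "card A = card (row (r x)) - c x" using card_row_from[of "c x" "r x"] lt by (simp add: A_def)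
  moreover have "inj_on c B" using inj_on_c_row[of "r y"] by (rule inj_on_subset) (auto simp: B_def)
  then have "card B = Suc (c y)"
    using c_image_initial[OF x(2)] card_image[of c B] by (simp add: B_def)
  ultimately show "card (A \<union> B) = Suc (card (row (r x)))"
    using x lt disj fin by (simp add: card_Un_disjoint)
qed

text \<open>Take a monomial of \<open>F\<close> that is extremal for the sum of row index times
  exponent; by row invariance its rows may be sorted. If some column did not increase strictly,
  the Garnir relation at that place would express the coefficient through monomials with larger
  exponents moved down, which do not occur in \<open>F\<close>, and through monomials in the same
  row orbit, which have the same coefficient. So the coefficient would be
  \<open>0\<close>.\<close>

theorem straightening:
  assumes inv: "row_invariant F" and van: "vanishing F" and F: "F \<noteq> 0"
  shows "\<exists>p\<in>keys F. (\<forall>x\<in>X. \<forall>y\<in>X. r x = r y \<longrightarrow> c x < c y \<longrightarrow> lookup p x \<le> lookup p y)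
    \<and> (\<forall>x\<in>X. \<forall>y\<in>X. c x = c y \<longrightarrow> r y = Suc (r x) \<longrightarrow> lookup p x < lookup p y)"
proof -
  have ne: "keys F \<noteq> {}" using F by (simp add: keys_eq_empty)
  then have "weight r ` keys F \<noteq> {}" by simp
  from Max_in[OF finite_imageI[OF finite_keys] this]
  obtain p0 where p0: "p0 \<in> keys F" and max0: "Max (weight r ` keys F) = weight r p0" by (rule imageE)
  obtain \<tau> where t: "\<tau> \<in> stab X r"
    and srt: "\<And>x y. x \<in> X \<Longrightarrow> y \<in> X \<Longrightarrow> r x = r y \<Longrightarrow> c x < c y \<Longrightarrow> lookup p0 (\<tau> x) \<le> lookup p0 (\<tau> y)"
    using sorted_rearrangement[OF finite_X, of r c "lookup p0"] by blast
  define p where "p = mono_act (inv \<tau>) p0"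
  have lp: "lookup p x = lookup p0 (\<tau> x)" for x
    using stab_bij[OF t] by (simp add: p_def lookup_mono_act bij_imp_bij_inv inv_inv_eq)
  have coeff_row: "lookup F (mono_act (inv \<rho>) m) = lookup F m" if "\<rho> \<in> stab X r" for \<rho> m
    using row_invariantD[OF inv that] lookup_perm_act[OF stab_bij[OF that], of F m] by simp
  have pF: "p \<in> keys F" using p0 coeff_row[OF t, of p0] by (simp add: p_def in_keys_iff)
  have "weight r p = weight r p0" using weight_stab[OF stab_inv[OF t]] by (simp add: p_def)
  then have max: "weight r m \<le> weight r p" if "m \<in> keys F" for m
    using Max_ge[OF finite_imageI[OF finite_keys, of "weight r" F], of "weight r m"] that max0 by simp
  have rows: "lookup p x \<le> lookup p y" if "x \<in> X" "y \<in> X" "r x = r y" "c x < c y" for x y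
    using srt[OF that] by (simp add: lp)
  have rows': "lookup p x \<le> lookup p y" if "x \<in> X" "y \<in> X" "r x = r y" "c x \<le> c y" for x y
    using rows[of x y] box_inj[of x y] that by (cases "c x = c y") auto
  have cols: "lookup p x < lookup p y"
    if xy: "x \<in> X" "y \<in> X" "c x = c y" "r y = Suc (r x)" for x y
  proof (rule ccontr)
    assume "\<not> lookup p x < lookup p y"
    then have ge: "lookup p y \<le> lookup p x" by simp
    define A where "A = {z \<in> row (r x). c x \<le> c z}"
    define B where "B = {z \<in> row (r y). c z \<le> c y}"
    define Z where "Z = A \<union> B"
    have fin: "finite A" "finite B" using finite_X by (auto simp: A_def B_def)
    have cardZ: "card Z = Suc (card (row (r x)))" and disj: "A \<inter> B = {}"
      using garnir_set[OF xy] by (simp_all add: A_def B_def Z_def)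
    have ZX: "Z \<subseteq> {z \<in> X. r x \<le> r z}" using xy by (auto simp: A_def B_def Z_def)
    have hi: "lookup p y \<le> lookup p a" if "a \<in> A" for a
      using rows'[of x a] that xy ge by (auto simp: A_def)
    have lo: "lookup p b \<le> lookup p y" if "b \<in> B" for b
      using rows'[of b y] that xy by (auto simp: B_def)
    have zero: "sym_sum (Perm Z) F = 0"
      using van[unfolded vanishing_def, rule_format, OF ZX] cardZ by simp
    have same: "lookup F (mono_act (inv \<pi>) p) = lookup F p"
      if p\<pi>: "\<pi> \<in> Perm Z" and nz: "lookup F (mono_act (inv \<pi>) p) \<noteq> 0" for \<pi>
    proof -
      let ?q = "mono_act (inv \<pi>) p"
      have perm: "\<pi> permutes Z" using p\<pi> by (rule stab_permutes)
      have lq: "lookup ?q z = lookup p (\<pi> z)" for z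
        using permutes_bij[OF perm] by (simp add: lookup_mono_act bij_imp_bij_inv inv_inv_eq)
      then have lqf: "lookup ?q = (\<lambda>z. lookup p (\<pi> z))" by (simp add: fun_eq_iff)
      have wsplit: "weight r m = (\<Sum>z\<in>X - Z. r z * lookup m z) + r x * (\<Sum>z\<in>Z. lookup m z) + (\<Sum>z\<in>B. lookup m z)"
        for m :: mono
        unfolding weight_def Z_def using finite_X disj xy(4)
        by (intro sum_two_adjacent_labels) (auto simp: A_def B_def)
      have "weight r ?q \<le> weight r p" using nz by (intro max) (simp add: in_keys_iff)
      moreover have "(\<Sum>z\<in>X - Z. r z * lookup ?q z) = (\<Sum>z\<in>X - Z. r z * lookup p z)"
        using permutes_not_in[OF perm] by (intro sum.cong) (auto simp: lq)
      moreover have "(\<Sum>z\<in>Z. lookup ?q z) = (\<Sum>z\<in>Z. lookup p z)"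
        unfolding lq by (rule sum.reindex_bij_betw[OF permutes_imp_bij[OF perm]])
      ultimately have "(\<Sum>z\<in>B. lookup ?q z) \<le> (\<Sum>z\<in>B. lookup p z)"
        unfolding wsplit by simp
      moreover have "(\<Sum>z\<in>B. lookup ?q z) = (\<Sum>z\<in>\<pi> ` B. lookup p z)"
        unfolding lq by (simp add: sum.reindex permutes_inj_on[OF perm])
      ultimately have le: "(\<Sum>z\<in>\<pi> ` B. lookup p z) \<le> (\<Sum>z\<in>B. lookup p z)" by simp
      have img: "\<pi> ` B \<subseteq> A \<union> B" "\<pi> ` A = A \<union> B - \<pi> ` B"
      proof -
        have "\<pi> ` (A \<union> B) = A \<union> B" using permutes_image[OF perm] by (simp add: Z_def)
        moreover have "A = (A \<union> B) - B" using disj by auto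
        ultimately show "\<pi> ` B \<subseteq> A \<union> B" "\<pi> ` A = A \<union> B - \<pi> ` B"
          using permutes_inj[OF perm] by (blast, metis image_set_diff)
      qed
      have cardB: "card (\<pi> ` B) = card B" by (simp add: card_image permutes_inj_on[OF perm])
      note ex = minimal_exchange[OF fin img(1) cardB hi lo le]
      have "image_mset (lookup ?q) (mset_set B) = image_mset (lookup p) (mset_set (\<pi> ` B))"
        by (subst image_mset_mset_set[OF permutes_inj_on[OF perm], symmetric]) (simp add: multiset.map_comp comp_def lqf)
      also have "\<dots> = image_mset (lookup p) (mset_set B)"
        using fin ex by (intro image_mset_eq_of_sym_diff[where \<beta> = "lookup p y"]) auto
      finally obtain pB where pB: "pB permutes B" "\<forall>z\<in>B. lookup ?q z = lookup p (pB z)"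
        by (rule image_mset_eq_implies_permutes[OF fin(2)])
      have "image_mset (lookup ?q) (mset_set A) = image_mset (lookup p) (mset_set (\<pi> ` A))"
        by (subst image_mset_mset_set[OF permutes_inj_on[OF perm], symmetric]) (simp add: multiset.map_comp comp_def lqf)
      also have "\<dots> = image_mset (lookup p) (mset_set A)"
      proof (rule image_mset_eq_of_sym_diff[where \<beta> = "lookup p y"])
        have eq: "\<pi> ` A - A = B - \<pi> ` B" "A - \<pi> ` A = \<pi> ` B - B" using img disj by auto
        show "card (\<pi> ` A - A) = card (A - \<pi> ` A)" unfolding eq using ex(1) by simp
        show "lookup p z = lookup p y" if "z \<in> \<pi> ` A - A" for z using ex(3) that unfolding eq by blast
        show "lookup p z = lookup p y" if "z \<in> A - \<pi> ` A" for z using ex(2) that unfolding eq by blast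
      qed (use fin in auto)
      finally obtain pA where pA: "pA permutes A" "\<forall>z\<in>A. lookup ?q z = lookup p (pA z)"
        by (rule image_mset_eq_implies_permutes[OF fin(1)])
      define \<rho> where "\<rho> = pA \<circ> pB"
      have \<rho>: "\<rho> \<in> stab X r" unfolding \<rho>_def
        using pA(1) pB(1) by (intro stab_compose) (auto intro: Perm_row_subset simp: Perm_iff A_def B_def)
      have "lookup ?q z = lookup p (\<rho> z)" for z
      proof -
        consider "z \<in> A" | "z \<in> B" | "z \<notin> Z" by (auto simp: Z_def)
        then show ?thesis
        proof cases
          case 1
          then have "pB z = z" using disj permutes_not_in[OF pB(1)] by blast
          then show ?thesis using pA 1 by (simp add: \<rho>_def)
        next
          case 2
          then have "pB z \<in> B" using permutes_in_image[OF pB(1)] by simp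
          then have "pA (pB z) = pB z" using disj permutes_not_in[OF pA(1)] by blast
          then show ?thesis using pB 2 by (simp add: \<rho>_def)
        next
          case 3
          then have "pB z = z" "pA z = z" "\<pi> z = z"
            using permutes_not_in[OF pA(1)] permutes_not_in[OF pB(1)] permutes_not_in[OF perm]
            by (auto simp: Z_def)
          then show ?thesis by (simp add: \<rho>_def lq)
        qed
      qed
      then have "?q = mono_act (inv \<rho>) p"
        using stab_bij[OF \<rho>] by (intro poly_mapping_eqI) (simp add: lookup_mono_act bij_imp_bij_inv inv_inv_eq)
      then show ?thesis using coeff_row[OF \<rho>] by simp
    qed
    \<comment> \<open>In the Garnir relation all non-zero terms are equal to the coefficient at
      \<open>p\<close>.\<close>
    let ?S = "{\<pi> \<in> Perm Z. lookup F (mono_act (inv \<pi>) p) = lookup F p}"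
    have finZ: "finite (Perm Z)" using fin by (simp add: Z_def finite_stab)
    have "0 = (\<Sum>\<pi>\<in>Perm Z. lookup F (mono_act (inv \<pi>) p))"
      using arg_cong[OF zero, of "\<lambda>G. lookup G p"]
      by (simp add: sym_sum_def lookup_sum lookup_perm_act stab_bij cong: sum.cong)
    also have "\<dots> = (\<Sum>\<pi>\<in>?S. lookup F p)"
      using finZ same by (intro sum.mono_neutral_cong_right) auto
    also have "\<dots> = of_nat (card ?S) * lookup F p" by simp
    finally have "card ?S = 0" using pF by (simp add: in_keys_iff)
    moreover have "id \<in> ?S" by (simp add: id_in_stab)
    ultimately show False using finZ by (auto simp: card_eq_0_iff)
  qed
  show ?thesis using pF rows cols by blast
qed

end


section \<open>The polynomial of a filling\<close>

definition row_of :: "box set \<Rightarrow> (box \<Rightarrow> nat) \<Rightarrow> nat \<Rightarrow> nat" where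
  "row_of D T x = fst (inv_into D T x)"

definition col_of :: "box set \<Rightarrow> (box \<Rightarrow> nat) \<Rightarrow> nat \<Rightarrow> nat" where
  "col_of D T x = snd (inv_into D T x)"

lemma row_of_T [simp]: "inj_on T D \<Longrightarrow> b \<in> D \<Longrightarrow> row_of D T (T b) = fst b"
  and col_of_T [simp]: "inj_on T D \<Longrightarrow> b \<in> D \<Longrightarrow> col_of D T (T b) = snd b"
  by (simp_all add: row_of_def col_of_def)

lemma stab_iff_image:
  "\<sigma> \<in> stab X lab \<longleftrightarrow> \<sigma> permutes X \<and> (\<forall>i. \<sigma> ` {x \<in> X. lab x = i} = {x \<in> X. lab x = i})"
proof
  assume s: "\<sigma> \<in> stab X lab"
  have p: "\<sigma> permutes X" using s by (rule stab_permutes)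
  have "\<sigma> ` {x \<in> X. lab x = i} = {x \<in> X. lab x = i}" for i
  proof
    show "\<sigma> ` {x \<in> X. lab x = i} \<subseteq> {x \<in> X. lab x = i}"
      using stab_lab[OF s] permutes_in_image[OF p] by auto
    show "{x \<in> X. lab x = i} \<subseteq> \<sigma> ` {x \<in> X. lab x = i}"
    proof
      fix y assume y: "y \<in> {x \<in> X. lab x = i}"
      have "inv \<sigma> y \<in> {x \<in> X. lab x = i}"
        using y stab_lab[OF stab_inv[OF s], of y] permutes_in_image[OF permutes_inv[OF p]] by simp
      then show "y \<in> \<sigma> ` {x \<in> X. lab x = i}"
        using permutes_inverses(1)[OF p, of y] by (metis imageI)
    qed
  qed
  then show "\<sigma> permutes X \<and> (\<forall>i. \<sigma> ` {x \<in> X. lab x = i} = {x \<in> X. lab x = i})" using p by simp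
next
  assume a: "\<sigma> permutes X \<and> (\<forall>i. \<sigma> ` {x \<in> X. lab x = i} = {x \<in> X. lab x = i})"
  have "lab (\<sigma> x) = lab x" if "x \<in> X" for x
  proof -
    have "\<sigma> x \<in> \<sigma> ` {y \<in> X. lab y = lab x}" using that by blast
    then show ?thesis using a by auto
  qed
  then show "\<sigma> \<in> stab X lab" using a by (simp add: stab_def)
qed

lemma row_stab_eq:
  assumes "inj_on T D" shows "row_stab D T = stab (T ` D) (row_of D T)"
proof -
  have "T ` {b \<in> D. fst b = i} = {x \<in> T ` D. row_of D T x = i}" for i
    using assms by auto
  then show ?thesis
    unfolding row_stab_def by (intro set_eqI) (simp only: stab_iff_image mem_Collect_eq)
qed

lemma col_stab_eq:
  assumes "inj_on T D" shows "col_stab D T = stab (T ` D) (col_of D T)"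
proof -
  have "T ` {b \<in> D. snd b = i} = {x \<in> T ` D. col_of D T x = i}" for i
    using assms by auto
  then show ?thesis
    unfolding col_stab_def by (intro set_eqI) (simp only: stab_iff_image mem_Collect_eq)
qed

definition fill_mono :: "box set \<Rightarrow> (box \<Rightarrow> nat) \<Rightarrow> (box \<Rightarrow> nat) \<Rightarrow> mono" where
  "fill_mono D h T = (\<Sum>b\<in>{b \<in> D. h b \<noteq> 0}. Poly_Mapping.single (T b) (h b))"

lemma filling_mono_eq: "filling_mono D h T = mono_poly (fill_mono D h T)"
  by (simp add: filling_mono_def fill_mono_def)

lemma lookup_fill_mono:
  assumes "finite {b \<in> D. h b \<noteq> 0}" "inj_on T D"
  shows "b \<in> D \<Longrightarrow> lookup (fill_mono D h T) (T b) = h b"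
    and "x \<notin> T ` D \<Longrightarrow> lookup (fill_mono D h T) x = 0"
proof -
  assume b: "b \<in> D"
  have "lookup (fill_mono D h T) (T b) = (\<Sum>b'\<in>{b \<in> D. h b \<noteq> 0}. if b' = b then h b' else 0)"
    unfolding fill_mono_def lookup_sum lookup_single
    using assms(2) b by (intro sum.cong) (auto simp: when_def inj_on_def)
  also have "\<dots> = h b" using assms(1) b by (simp add: sum.delta)
  finally show "lookup (fill_mono D h T) (T b) = h b" .
next
  assume "x \<notin> T ` D"
  then show "lookup (fill_mono D h T) x = 0"
    unfolding fill_mono_def lookup_sum lookup_single by (intro sum.neutral) (auto simp: when_def)
qed

lemma keys_fill_mono:
  assumes "finite {b \<in> D. h b \<noteq> 0}" "inj_on T D"
  shows "keys (fill_mono D h T) = T ` {b \<in> D. h b \<noteq> 0}"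
proof (rule set_eqI)
  fix x show "x \<in> keys (fill_mono D h T) \<longleftrightarrow> x \<in> T ` {b \<in> D. h b \<noteq> 0}"
  proof (cases "x \<in> T ` D")
    case True
    then obtain b where b: "b \<in> D" "x = T b" by auto
    then have "x \<in> T ` {b \<in> D. h b \<noteq> 0} \<longleftrightarrow> h b \<noteq> 0" using assms(2) by (auto simp: inj_on_def)
    then show ?thesis using lookup_fill_mono(1)[OF assms b(1)] b by (simp add: in_keys_iff)
  next
    case False
    then show ?thesis using lookup_fill_mono(2)[OF assms False] by (auto simp: in_keys_iff)
  qed
qed

lemma mono_content_fill_mono:
  assumes "finite {b \<in> D. h b \<noteq> 0}" "inj_on T D"
  shows "mono_content (fill_mono D h T) = image_mset h (mset_set {b \<in> D. h b \<noteq> 0})"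
proof -
  have "inj_on T {b \<in> D. h b \<noteq> 0}" using assms(2) by (rule inj_on_subset) auto
  then have "mono_content (fill_mono D h T)
      = image_mset (\<lambda>b. lookup (fill_mono D h T) (T b)) (mset_set {b \<in> D. h b \<noteq> 0})"
    by (simp add: mono_content_def keys_fill_mono[OF assms] multiset.map_comp comp_def
        flip: image_mset_mset_set)
  also have "\<dots> = image_mset h (mset_set {b \<in> D. h b \<noteq> 0})"
    using lookup_fill_mono(1)[OF assms] assms(1) by (intro image_mset_cong) auto
  finally show ?thesis .
qed

lemma fill_mono_compose:
  assumes "finite {b \<in> D. h b \<noteq> 0}" "inj_on T D" "bij \<sigma>"
  shows "fill_mono D h (\<sigma> \<circ> T) = mono_act \<sigma> (fill_mono D h T)"
proof (rule poly_mapping_eqI)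
  have inj: "inj_on (\<sigma> \<circ> T) D" using assms(2,3) by (metis bij_is_inj comp_inj_on inj_on_subset subset_UNIV)
  fix x
  show "lookup (fill_mono D h (\<sigma> \<circ> T)) x = lookup (mono_act \<sigma> (fill_mono D h T)) x"
  proof (cases "inv \<sigma> x \<in> T ` D")
    case True
    then obtain b where b: "b \<in> D" "inv \<sigma> x = T b" by auto
    then have x: "x = (\<sigma> \<circ> T) b" using assms(3) by (metis bij_inv_eq_iff comp_apply)
    show ?thesis
      using lookup_fill_mono(1)[OF assms(1) inj b(1)] lookup_fill_mono(1)[OF assms(1,2) b(1)] b
      unfolding lookup_mono_act[OF assms(3)] x[symmetric] by simp
  next
    case False
    then have "x \<notin> (\<sigma> \<circ> T) ` D" using assms(3) by (auto simp: bij_is_inj)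
    then show ?thesis
      using lookup_fill_mono(2)[OF assms(1) inj] lookup_fill_mono(2)[OF assms(1,2) False]
      by (simp add: lookup_mono_act[OF assms(3)])
  qed
qed

definition row_orbit :: "box set \<Rightarrow> (box \<Rightarrow> nat) \<Rightarrow> (box \<Rightarrow> nat) \<Rightarrow> qpoly set" where
  "row_orbit D h T = (\<lambda>\<tau>. perm_act \<tau> (filling_mono D h T)) ` row_stab D T"

definition row_sum :: "box set \<Rightarrow> (box \<Rightarrow> nat) \<Rightarrow> (box \<Rightarrow> nat) \<Rightarrow> qpoly" where
  "row_sum D h T = \<Sum> (row_orbit D h T)"

lemma filling_poly_eq: "filling_poly D h T = alt_sum (col_stab D T) (row_sum D h T)"
  by (simp add: filling_poly_def alt_sum_def row_sum_def row_orbit_def)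

lemma filling_poly_alt_sum:
  "inj_on T D \<Longrightarrow> filling_poly D h T = alt_sum (stab (T ` D) (col_of D T)) (row_sum D h T)"
  by (simp add: filling_poly_eq col_stab_eq)

lemma finite_row_orbit: "finite D \<Longrightarrow> inj_on T D \<Longrightarrow> finite (row_orbit D h T)"
  by (simp add: row_orbit_def row_stab_eq finite_stab)

lemma row_sum_invariant:
  assumes "inj_on T D" "\<pi> \<in> stab (T ` D) (row_of D T)"
  shows "perm_act \<pi> (row_sum D h T) = row_sum D h T"
proof -
  let ?R = "stab (T ` D) (row_of D T)"
  have b: "bij \<pi>" using assms(2) by (rule stab_bij)
  have inj: "inj_on (perm_act \<pi>) A" for A using b by (metis inj_onI perm_act_inv(1))
  have "perm_act \<pi> ` row_orbit D h T = (\<lambda>\<tau>. perm_act (\<pi> \<circ> \<tau>) (filling_mono D h T)) ` ?R"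
    using assms by (auto simp: row_orbit_def row_stab_eq image_image perm_act_compose stab_bij intro!: image_cong)
  also have "\<dots> = (\<lambda>\<tau>. perm_act \<tau> (filling_mono D h T)) ` ((\<lambda>\<tau>. \<pi> \<circ> \<tau>) ` ?R)"
    by (simp add: image_image)
  also have "\<dots> = row_orbit D h T"
    using bij_betw_stab_left[OF assms(2)] assms(1) by (simp add: bij_betw_def row_orbit_def row_stab_eq)
  finally have "perm_act \<pi> ` row_orbit D h T = row_orbit D h T" .
  then show ?thesis
    unfolding row_sum_def perm_act_sum using sum.reindex[OF inj, of id "row_orbit D h T"] by simp
qed

lemma ip_row_sum:
  assumes "finite D" "inj_on T D" and inv: "\<And>\<pi>. \<pi> \<in> stab (T ` D) (row_of D T) \<Longrightarrow> perm_act \<pi> F = F"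
  shows "ip F (row_sum D h T) = of_nat (card (row_orbit D h T)) * lookup F (fill_mono D h T)"
proof -
  have "ip F p = lookup F (fill_mono D h T)" if "p \<in> row_orbit D h T" for p
  proof -
    from that obtain \<tau> where t: "\<tau> \<in> stab (T ` D) (row_of D T)" "p = perm_act \<tau> (mono_poly (fill_mono D h T))"
      using assms(2) by (auto simp: row_orbit_def row_stab_eq filling_mono_eq)
    have "ip F p = ip (mono_poly (fill_mono D h T)) (perm_act (inv \<tau>) F)"
      using ip_perm_act[OF stab_bij[OF t(1)], of "mono_poly (fill_mono D h T)" F] ip_commute[of F p] t(2) by simp
    then show ?thesis using inv[OF stab_inv[OF t(1)]] by (simp add: ip_mono_poly_left)
  qed
  then show ?thesis by (simp add: row_sum_def ip_sum_right)
qed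

lemma row_orbit_nonempty: "finite D \<Longrightarrow> inj_on T D \<Longrightarrow> card (row_orbit D h T) > 0"
  using finite_row_orbit[of D T h] id_in_stab by (auto simp: card_gt_0_iff row_orbit_def row_stab_eq)

lemma row_sum_keys:
  assumes "inj_on T D" "m \<in> keys (row_sum D h T)"
  obtains \<tau> where "\<tau> \<in> stab (T ` D) (row_of D T)" "m = mono_act \<tau> (fill_mono D h T)"
proof -
  have "m \<in> (\<Union>p\<in>row_orbit D h T. keys p)"
    using keys_sum_subset[of "\<lambda>p. p" "row_orbit D h T"] assms(2) by (auto simp: row_sum_def)
  then show ?thesis
    using that assms(1) by (auto simp: row_orbit_def row_stab_eq filling_mono_eq)
qed

lemma alt_sum_keys:
  assumes "m \<in> keys (alt_sum \<Gamma> F)" "\<And>\<sigma>. \<sigma> \<in> \<Gamma> \<Longrightarrow> bij \<sigma>"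
  obtains \<sigma> m' where "\<sigma> \<in> \<Gamma>" "m' \<in> keys F" "m = mono_act \<sigma> m'"
proof -
  obtain \<sigma> where "\<sigma> \<in> \<Gamma>" "m \<in> keys (scaleQ (sgn_rat \<sigma>) (perm_act \<sigma> F))"
    using keys_sum_subset[of "\<lambda>\<sigma>. scaleQ (sgn_rat \<sigma>) (perm_act \<sigma> F)" \<Gamma>] assms(1) by (auto simp: alt_sum_def)
  then have s: "\<sigma> \<in> \<Gamma>" "m \<in> keys (perm_act \<sigma> F)" using keys_scaleQ by blast+
  then obtain m' where "m' \<in> keys F" "m = mono_act \<sigma> m'" using keys_perm_act[OF assms(2)[OF s(1)], of F] by auto
  then show ?thesis using that s(1) by blast
qed

lemma filling_poly_keys:
  assumes "inj_on T D" "m \<in> keys (filling_poly D h T)"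
  obtains \<sigma> where "\<sigma> permutes T ` D" "m = mono_act \<sigma> (fill_mono D h T)"
proof -
  obtain \<sigma> m' where s: "\<sigma> \<in> stab (T ` D) (col_of D T)" "m' \<in> keys (row_sum D h T)" "m = mono_act \<sigma> m'"
    using assms(2) unfolding filling_poly_alt_sum[OF assms(1)] by (rule alt_sum_keys) (auto intro: stab_bij)
  obtain \<tau> where t: "\<tau> \<in> stab (T ` D) (row_of D T)" "m' = mono_act \<tau> (fill_mono D h T)"
    using row_sum_keys[OF assms(1) s(2)] by blast
  have "m = mono_act (\<sigma> \<circ> \<tau>) (fill_mono D h T)"
    using s t by (simp add: mono_act_compose stab_bij)
  moreover have "\<sigma> \<circ> \<tau> permutes T ` D" using s t by (intro permutes_compose) (auto intro: stab_permutes)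
  ultimately show ?thesis using that by blast
qed

lemma stab_conj:
  assumes "bij \<sigma>"
  shows "bij_betw (\<lambda>\<tau>. \<sigma> \<circ> \<tau> \<circ> inv \<sigma>) (stab X lab) (stab (\<sigma> ` X) (lab \<circ> inv \<sigma>))"
proof -
  have sub: "\<sigma> \<circ> \<tau> \<circ> inv \<sigma> \<in> stab (\<sigma> ` X) (lab \<circ> inv \<sigma>)" if b: "bij \<sigma>" and t: "\<tau> \<in> stab X lab"
    for \<sigma> \<tau> X and lab :: "nat \<Rightarrow> nat"
  proof -
    have "\<sigma> \<circ> \<tau> \<circ> inv \<sigma> permutes \<sigma> ` X"
      unfolding permutes_def
    proof (intro conjI allI impI)
      have "bij (\<sigma> \<circ> \<tau> \<circ> inv \<sigma>)" using b stab_bij[OF t] by (simp add: bij_comp bij_imp_bij_inv)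
      then show "\<exists>!x. (\<sigma> \<circ> \<tau> \<circ> inv \<sigma>) x = y" for y by (simp only: bij_iff)
      show "(\<sigma> \<circ> \<tau> \<circ> inv \<sigma>) x = x" if "x \<notin> \<sigma> ` X" for x
      proof -
        have "inv \<sigma> x \<notin> X" using that b by (metis bij_inv_eq_iff imageI)
        then show ?thesis using permutes_not_in[OF stab_permutes[OF t]] b by (simp add: bij_is_surj surj_f_inv_f)
      qed
    qed
    then show ?thesis using t b by (auto simp: stab_def bij_is_inj)
  qed
  let ?g = "\<lambda>\<tau>. inv \<sigma> \<circ> \<tau> \<circ> \<sigma>"
  have cancel: "\<sigma> \<circ> inv \<sigma> = id" "inv \<sigma> \<circ> \<sigma> = id"
    using assms by (simp_all add: bij_is_surj bij_is_inj surj_iff[THEN iffD1] inv_o_cancel)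
  show ?thesis
  proof (rule bij_betw_byWitness[where f' = ?g])
    show "\<forall>a\<in>stab X lab. ?g (\<sigma> \<circ> a \<circ> inv \<sigma>) = a"
      using assms by (auto simp: fun_eq_iff bij_is_inj)
    show "\<forall>a\<in>stab (\<sigma> ` X) (lab \<circ> inv \<sigma>). \<sigma> \<circ> ?g a \<circ> inv \<sigma> = a"
      using assms by (auto simp: fun_eq_iff bij_is_surj surj_f_inv_f)
    show "(\<lambda>\<tau>. \<sigma> \<circ> \<tau> \<circ> inv \<sigma>) ` stab X lab \<subseteq> stab (\<sigma> ` X) (lab \<circ> inv \<sigma>)"
      using sub[OF assms] by auto
    show "?g ` stab (\<sigma> ` X) (lab \<circ> inv \<sigma>) \<subseteq> stab X lab"
    proof (rule image_subsetI)
      fix \<tau> assume "\<tau> \<in> stab (\<sigma> ` X) (lab \<circ> inv \<sigma>)"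
      from sub[OF bij_imp_bij_inv[OF assms] this] show "?g \<tau> \<in> stab X lab"
        using assms by (simp add: inv_inv_eq image_image bij_is_inj comp_assoc cancel)
    qed
  qed
qed

lemma stab_cong: "(\<And>x. x \<in> X \<Longrightarrow> lab x = lab' x) \<Longrightarrow> stab X lab = stab X lab'"
  by (auto simp: stab_def permutes_in_image)

text \<open>The permutation \<open>\<sigma>\<close> may move infinitely many points, so
  \<open>sign\<close> is not multiplicative here; conjugating the transpositions in a
  factorisation of \<open>\<tau>\<close> works all the same.\<close>

lemma sign_conj:
  assumes "finite X" "\<tau> permutes X" "bij \<sigma>"
  shows "sign (\<sigma> \<circ> \<tau> \<circ> inv \<sigma>) = sign \<tau>"
proof -
  have "permutation (\<sigma> \<circ> \<tau> \<circ> inv \<sigma>) \<and> sign (\<sigma> \<circ> \<tau> \<circ> inv \<sigma>) = sign \<tau>"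
    using assms(2,1)
  proof (induction rule: permutes_induct)
    case id
    have "\<sigma> \<circ> id \<circ> inv \<sigma> = id" using assms(3) by (auto simp: fun_eq_iff bij_is_surj surj_f_inv_f)
    then show ?case by (simp add: permutation_id)
  next
    case (swap a b p)
    have "\<sigma> a \<noteq> \<sigma> b" using swap.hyps assms(3) by (metis bij_is_inj inj_eq)
    moreover have eq: "\<sigma> \<circ> (Transposition.transpose a b \<circ> p) \<circ> inv \<sigma>
        = Transposition.transpose (\<sigma> a) (\<sigma> b) \<circ> (\<sigma> \<circ> p \<circ> inv \<sigma>)"
      using assms(3) by (auto simp: fun_eq_iff Transposition.transpose_def bij_is_inj inj_eq)
    moreover have "permutation p" using swap.hyps assms(1) permutes_imp_permutation by blast
    moreover have "permutation (\<sigma> \<circ> p \<circ> inv \<sigma>)" "sign (\<sigma> \<circ> p \<circ> inv \<sigma>) = sign p" "a \<noteq> b"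
      using swap.IH swap.hyps by blast+
    ultimately show ?case
      unfolding eq by (simp only: permutation_compose permutation_swap_id sign_compose sign_swap_id simp_thms if_False)
  qed
  then show ?thesis by simp
qed

lemma perm_act_filling_poly:
  assumes D: "finite D" and T: "inj_on T D" and b: "bij \<sigma>"
  shows "perm_act \<sigma> (filling_poly D h T) = filling_poly D h (\<sigma> \<circ> T)"
proof -
  have T': "inj_on (\<sigma> \<circ> T) D" using T b by (metis bij_is_inj comp_inj_on inj_on_subset subset_UNIV)
  have img: "(\<sigma> \<circ> T) ` D = \<sigma> ` T ` D" by (simp add: image_comp)
  have lab: "row_of D (\<sigma> \<circ> T) (\<sigma> (T b)) = fst b" "col_of D (\<sigma> \<circ> T) (\<sigma> (T b)) = snd b" if "b \<in> D" for b
    using row_of_T[OF T' that] col_of_T[OF T' that] by simp_all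
  have rows: "stab ((\<sigma> \<circ> T) ` D) (row_of D (\<sigma> \<circ> T)) = stab (\<sigma> ` T ` D) (row_of D T \<circ> inv \<sigma>)"
    unfolding img using T b lab(1)
    by (intro stab_cong) (auto simp: bij_is_inj)
  have cols: "stab ((\<sigma> \<circ> T) ` D) (col_of D (\<sigma> \<circ> T)) = stab (\<sigma> ` T ` D) (col_of D T \<circ> inv \<sigma>)"
    unfolding img using T b lab(2)
    by (intro stab_cong) (auto simp: bij_is_inj)
  have conj: "perm_act (\<sigma> \<circ> \<tau> \<circ> inv \<sigma>) (perm_act \<sigma> F) = perm_act \<sigma> (perm_act \<tau> F)" if "bij \<tau>" for \<tau> F
    using that b by (simp add: bij_comp bij_imp_bij_inv flip: perm_act_compose)
  have orbit: "row_orbit D h (\<sigma> \<circ> T) = perm_act \<sigma> ` row_orbit D h T"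
  proof -
    have "row_orbit D h (\<sigma> \<circ> T)
        = (\<lambda>\<tau>. perm_act \<tau> (perm_act \<sigma> (filling_mono D h T))) ` stab (\<sigma> ` T ` D) (row_of D T \<circ> inv \<sigma>)"
    proof -
      have "filling_mono D h (\<sigma> \<circ> T) = perm_act \<sigma> (filling_mono D h T)"
        using D fill_mono_compose[OF _ T b, of h] by (simp add: filling_mono_eq)
      then show ?thesis by (simp only: row_orbit_def row_stab_eq[OF T'] rows)
    qed
    also have "stab (\<sigma> ` T ` D) (row_of D T \<circ> inv \<sigma>) = (\<lambda>\<tau>. \<sigma> \<circ> \<tau> \<circ> inv \<sigma>) ` stab (T ` D) (row_of D T)"
      using stab_conj[OF b] by (simp add: bij_betw_def)
    also have "(\<lambda>\<tau>. perm_act \<tau> (perm_act \<sigma> (filling_mono D h T))) ` \<dots> = perm_act \<sigma> ` row_orbit D h T"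
      unfolding row_orbit_def row_stab_eq[OF T] image_image
      by (intro image_cong refl conj stab_bij)
    finally show ?thesis .
  qed
  have inj: "inj_on (perm_act \<sigma>) A" for A using b by (metis inj_onI perm_act_inv(1))
  have rs: "row_sum D h (\<sigma> \<circ> T) = perm_act \<sigma> (row_sum D h T)"
    unfolding row_sum_def orbit perm_act_sum using sum.reindex[OF inj, of id "row_orbit D h T"] by simp
  have sg: "sign (\<sigma> \<circ> \<tau> \<circ> inv \<sigma>) = sign \<tau>" if "\<tau> \<in> stab (T ` D) lab" for \<tau> lab
    using sign_conj[OF _ stab_permutes[OF that] b] D by simp
  have "filling_poly D h (\<sigma> \<circ> T)
      = alt_sum (stab (\<sigma> ` T ` D) (col_of D T \<circ> inv \<sigma>)) (perm_act \<sigma> (row_sum D h T))"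
    by (simp only: filling_poly_alt_sum[OF T'] cols rs)
  also have "\<dots> = (\<Sum>\<tau>\<in>stab (T ` D) (col_of D T). scaleQ (sgn_rat (\<sigma> \<circ> \<tau> \<circ> inv \<sigma>))
      (perm_act (\<sigma> \<circ> \<tau> \<circ> inv \<sigma>) (perm_act \<sigma> (row_sum D h T))))"
    unfolding alt_sum_def by (rule sum.reindex_bij_betw[OF stab_conj[OF b], symmetric])
  also have "\<dots> = (\<Sum>\<tau>\<in>stab (T ` D) (col_of D T). perm_act \<sigma> (scaleQ (sgn_rat \<tau>) (perm_act \<tau> (row_sum D h T))))"
    by (intro sum.cong refl) (simp add: conj stab_bij perm_act_scale sg)
  also have "\<dots> = perm_act \<sigma> (filling_poly D h T)"
    by (simp add: filling_poly_alt_sum[OF T] alt_sum_def perm_act_sum)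
  finally show ?thesis by simp
qed

definition young :: "box set \<Rightarrow> bool" where
  "young D \<longleftrightarrow> finite D \<and> (\<forall>i j i' j'. (i, j) \<in> D \<longrightarrow> i' \<le> i \<longrightarrow> j' \<le> j \<longrightarrow> (i', j') \<in> D)"

lemma youngD: "young D \<Longrightarrow> (i, j) \<in> D \<Longrightarrow> i' \<le> i \<Longrightarrow> j' \<le> j \<Longrightarrow> (i', j') \<in> D"
  by (auto simp: young_def)

lemma tableau_filling:
  assumes "young D" "inj_on T D"
  shows "tableau (T ` D) (row_of D T) (col_of D T)"
proof
  show "finite (T ` D)" using assms(1) by (simp add: young_def)
  show "x = y" if "x \<in> T ` D" "y \<in> T ` D" "row_of D T x = row_of D T y" "col_of D T x = col_of D T y" for x y
    using that assms(2) by (auto simp: prod_eq_iff)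
  show "\<exists>y\<in>T ` D. row_of D T y = i \<and> col_of D T y = j"
    if x: "x \<in> T ` D" "i \<le> row_of D T x" "j \<le> col_of D T x" for x i j
  proof -
    obtain b where b: "b \<in> D" "x = T b" using x(1) by auto
    then have le: "i \<le> fst b" "j \<le> snd b" using x assms(2) by simp_all
    have "(fst b, snd b) \<in> D" using b(1) by simp
    then have ij: "(i, j) \<in> D" using youngD[OF assms(1) _ le] by blast
    then have "row_of D T (T (i, j)) = i" "col_of D T (T (i, j)) = j" using assms(2) by simp_all
    then show ?thesis using ij by blast
  qed
qed


section \<open>Diagrams and contents\<close>

lemma finite_diagram: "finite (diagram lam)"
proof (rule finite_subset)
  show "diagram lam \<subseteq> {..<length lam} \<times> {..<Suc (Max (set lam))}"
  proof
    fix b assume "b \<in> diagram lam"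
    then obtain i j where b: "b = (i, j)" "i < length lam" "j < lam ! i" by (auto simp: diagram_def)
    have "lam ! i \<le> Max (set lam)" using b by simp
    then have "j < Suc (Max (set lam))" using b by linarith
    then show "b \<in> {..<length lam} \<times> {..<Suc (Max (set lam))}" using b by simp
  qed
qed simp

lemma is_partition_antimono:
  assumes "is_partition lam" "i \<le> k" "k < length lam" shows "lam ! k \<le> lam ! i"
  using assms by (cases "i = k") (auto simp: is_partition_def sorted_wrt_iff_nth_less)

lemma young_diagram:
  assumes "is_partition lam" shows "young (diagram lam)"
  unfolding young_def
proof (intro conjI allI impI finite_diagram)
  fix i j i' j' assume a: "(i, j) \<in> diagram lam" "i' \<le> i" "j' \<le> j"
  then have "lam ! i \<le> lam ! i'" using is_partition_antimono[OF assms a(2)] by (simp add: diagram_def)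
  then show "(i', j') \<in> diagram lam" using a by (simp add: diagram_def)
qed

definition tab_entry :: "nat list list \<Rightarrow> box \<Rightarrow> nat" where
  "tab_entry M = (\<lambda>(i, j). M ! i ! j)"

lemma tab_entry_pair [simp]: "tab_entry M (i, j) = M ! i ! j"
  by (simp add: tab_entry_def)

lemma F_fin_eq: "F_fin M T = filling_poly (diagram (shape M)) (tab_entry M) T"
  by (simp add: F_fin_def tab_entry_def)

lemma diagram_Cons: "diagram (k # lam) = (\<lambda>j. (0, j)) ` {..<k} \<union> (\<lambda>(i, j). (Suc i, j)) ` diagram lam"
proof (rule set_eqI)
  fix b :: box
  obtain i j where b: "b = (i, j)" by fastforce
  show "b \<in> diagram (k # lam) \<longleftrightarrow> b \<in> (\<lambda>j. (0, j)) ` {..<k} \<union> (\<lambda>(i, j). (Suc i, j)) ` diagram lam"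
    unfolding b by (cases i) (auto simp: diagram_def image_iff)
qed

lemma mset_diagram: "mset (concat M) = image_mset (tab_entry M) (mset_set (diagram (shape M)))"
proof (induction M)
  case Nil then show ?case by (simp add: shape_def diagram_def)
next
  case (Cons u M)
  let ?s = "\<lambda>(i, j). (Suc i, j) :: box"
  have inj: "inj_on ?s A" for A by (auto simp: inj_on_def)
  have "mset_set (diagram (shape (u # M)))
      = mset_set ((\<lambda>j. (0, j)) ` {..<length u}) + mset_set (?s ` diagram (shape M))"
    unfolding shape_def list.map diagram_Cons
    by (intro mset_set_Union finite_imageI finite_diagram) auto
  also have "mset_set ((\<lambda>j. (0::nat, j)) ` {..<length u}) = image_mset (\<lambda>j. (0, j)) (mset_set {..<length u})"
    by (rule image_mset_mset_set[symmetric]) (simp add: inj_on_def)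
  also have "mset_set (?s ` diagram (shape M)) = image_mset ?s (mset_set (diagram (shape M)))"
    by (rule image_mset_mset_set[symmetric, OF inj])
  finally have "image_mset (tab_entry (u # M)) (mset_set (diagram (shape (u # M))))
      = image_mset ((!) u) (mset_set {..<length u}) + image_mset (tab_entry (u # M) \<circ> ?s) (mset_set (diagram (shape M)))"
    by (simp add: multiset.map_comp comp_def)
  also have "tab_entry (u # M) \<circ> ?s = tab_entry M" by (auto simp: fun_eq_iff)
  also have "image_mset ((!) u) (mset_set {..<length u}) = mset u"
    by (metis atLeast_upt map_nth mset_map mset_upt lessThan_atLeast0)
  finally show ?case using Cons.IH by simp
qed

lemma card_diagram: "card (diagram lam) = sum_list lam"
proof (induction lam)
  case Nil then show ?case by (simp add: diagram_def)
next
  case (Cons k lam)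
  have "card (diagram (k # lam)) = card ((\<lambda>j. (0::nat, j)) ` {..<k}) + card ((\<lambda>(i, j). (Suc i, j)) ` diagram lam)"
    unfolding diagram_Cons by (intro card_Un_disjoint finite_imageI finite_diagram) auto
  moreover have "inj_on (\<lambda>(i, j). (Suc i, j)) (diagram lam)" by (auto simp: inj_on_def)
  ultimately show ?case using Cons.IH by (simp add: card_image[of "\<lambda>(i, j). (Suc i, j)"] card_image inj_on_def)
qed

definition tab_content :: "nat list list \<Rightarrow> nat multiset" where
  "tab_content M = filter_mset (\<lambda>h. h \<noteq> 0) (mset (concat M))"

lemma tab_content_fill_mono:
  assumes "inj_on T (diagram (shape M))"
  shows "mono_content (fill_mono (diagram (shape M)) (tab_entry M) T) = tab_content M"
proof -
  have "mset_set {b \<in> diagram (shape M). tab_entry M b \<noteq> 0}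
      = filter_mset (\<lambda>b. tab_entry M b \<noteq> 0) (mset_set (diagram (shape M)))"
    using finite_diagram by (simp add: filter_mset_mset_set)
  then show ?thesis
    using assms by (simp add: mono_content_fill_mono finite_diagram tab_content_def mset_diagram filter_mset_image_mset)
qed

lemma mono_deg_content: "mono_deg m = sum_mset (mono_content m)"
  by (simp add: mono_deg_def mono_content_def sum_unfold_sum_mset)

lemma zero_notin_mono_content: "0 \<notin># mono_content m"
  by (auto simp: mono_content_def in_keys_iff)

definition poly_with :: "nat set \<Rightarrow> nat multiset set \<Rightarrow> qpoly set" where
  "poly_with X Cs = {F. \<forall>m\<in>keys F. keys m \<subseteq> X \<and> mono_content m \<in> Cs}"

lemma subspace_poly_with: "qpoly.subspace (poly_with X Cs)"
proof (rule qpoly.subspaceI)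
  fix F G c assume "F \<in> poly_with X Cs" "G \<in> poly_with X Cs"
  then show "F + G \<in> poly_with X Cs" "scaleQ c F \<in> poly_with X Cs"
    using keys_add[of F G] keys_scaleQ[of c F] unfolding poly_with_def by blast+
qed (simp add: poly_with_def)

lemma perm_act_poly_with:
  assumes "\<sigma> permutes X" "F \<in> poly_with X Cs" shows "perm_act \<sigma> F \<in> poly_with X Cs"
proof -
  have b: "bij \<sigma>" using assms(1) by (rule permutes_bij)
  have "\<sigma> ` K \<subseteq> X" if "K \<subseteq> X" for K using that permutes_in_image[OF assms(1)] by auto
  then show ?thesis using assms(2)
    by (auto simp: poly_with_def keys_perm_act[OF b] keys_mono_act[OF b] mono_content_act[OF b])
qed

lemma poly_with_mono: "X \<subseteq> Y \<Longrightarrow> Cs \<subseteq> Ds \<Longrightarrow> poly_with X Cs \<subseteq> poly_with Y Ds"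
  by (auto simp: poly_with_def)

lemma finite_monomials_bounded:
  assumes "finite X" shows "finite {m :: mono. keys m \<subseteq> X \<and> mono_deg m \<le> d}"
proof (rule finite_subset)
  show "{m :: mono. keys m \<subseteq> X \<and> mono_deg m \<le> d}
      \<subseteq> Poly_Mapping.Abs_poly_mapping ` {f. \<forall>x. (x \<in> X \<longrightarrow> f x \<in> {..d}) \<and> (x \<notin> X \<longrightarrow> f x = 0)}"
  proof
    fix m :: mono assume m: "m \<in> {m. keys m \<subseteq> X \<and> mono_deg m \<le> d}"
    have "lookup m x \<le> d" for x
    proof (cases "x \<in> keys m")
      case True
      then have "lookup m x \<le> mono_deg m" unfolding mono_deg_def by (intro member_le_sum) auto
      then show ?thesis using m by simp
    qed (simp add: in_keys_iff)
    then have "lookup m \<in> {f. \<forall>x. (x \<in> X \<longrightarrow> f x \<in> {..d}) \<and> (x \<notin> X \<longrightarrow> f x = 0)}"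
    proof (intro CollectI allI conjI impI)
      fix x assume "x \<notin> X"
      then have "x \<notin> keys m" using m by blast
      then show "lookup m x = 0" by (simp add: in_keys_iff)
    qed (use \<open>\<And>x. lookup m x \<le> d\<close> in simp)
    then show "m \<in> Poly_Mapping.Abs_poly_mapping ` {f. \<forall>x. (x \<in> X \<longrightarrow> f x \<in> {..d}) \<and> (x \<notin> X \<longrightarrow> f x = 0)}"
      by (rule image_eqI[rotated]) (simp add: Poly_Mapping.lookup_inverse)
  qed
  show "finite (Poly_Mapping.Abs_poly_mapping ` {f. \<forall>x. (x \<in> X \<longrightarrow> f x \<in> {..d}) \<and> (x \<notin> X \<longrightarrow> f x = (0::nat))})"
    using assms by (intro finite_imageI finite_set_of_finite_funs) auto
qed


section \<open>Spanning by semistandard tableaux\<close>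

context tableau
begin

definition boxes :: "box set" where "boxes = (\<lambda>x. (r x, c x)) ` X"
definition filling :: "box \<Rightarrow> nat" where "filling = inv_into X (\<lambda>x. (r x, c x))"

lemma inj_on_box: "inj_on (\<lambda>x. (r x, c x)) X"
  by (auto simp: inj_on_def box_inj)

lemma filling_box: "x \<in> X \<Longrightarrow> filling (r x, c x) = x"
  unfolding filling_def using inv_into_f_f[OF inj_on_box] by simp

lemma bij_filling: "bij_betw filling boxes X"
  unfolding filling_def boxes_def by (intro bij_betw_inv_into bij_betw_imageI inj_on_box refl)

lemma boxes_eq: "boxes = {(i, j). j < card (row i)}"
proof (rule set_eqI)
  fix b :: box
  obtain i j where b: "b = (i, j)" by fastforce
  have "b \<in> boxes \<longleftrightarrow> j \<in> c ` row i" unfolding b boxes_def by auto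
  then show "b \<in> boxes \<longleftrightarrow> b \<in> {(i, j). j < card (row i)}" unfolding b c_row by simp
qed

text \<open>The boxes of a tableau given by labels form the diagram of the partition of row
  lengths.\<close>

lemma partition_of_boxes:
  obtains lam where "is_partition lam" "diagram lam = boxes"
proof -
  have anti: "card (row k) \<le> card (row i)" if "i \<le> k" for i k
  proof -
    have "{..<card (row k)} \<subseteq> {..<card (row i)}"
    proof (rule subsetI)
      fix j assume "j \<in> {..<card (row k)}"
      then obtain x where "x \<in> X" "r x = k" "c x = j" using box_exists by auto
      then obtain y where "y \<in> X" "r y = i" "c y = j" using young[of x i j] \<open>i \<le> k\<close> by auto
      then have "j \<in> c ` row i" by blast
      then show "j \<in> {..<card (row i)}" by (simp only: c_row)
    qed
    then show ?thesis by simp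
  qed
  have "\<exists>b. \<forall>x\<in>X. r x < b"
    using finite_X by (metis finite_nat_set_iff_bounded finite_imageI imageI)
  then obtain b where b: "\<forall>x\<in>X. r x < b" by blast
  then have "row b = {}" by auto
  then have zb: "card (row b) = 0" by (simp only: card.empty)
  define k where "k = (LEAST i. card (row i) = 0)"
  have k: "card (row k) = 0" unfolding k_def using zb by (rule LeastI)
  have pos: "card (row i) \<noteq> 0" if "i < k" for i using not_less_Least that unfolding k_def by blast
  have zero: "card (row i) = 0" if "k \<le> i" for i using anti[OF that] k by simp
  let ?lam = "map (\<lambda>i. card (row i)) [0..<k]"
  have "is_partition ?lam"
    unfolding is_partition_def by (auto simp: sorted_wrt_iff_nth_less intro: anti dest: pos)
  moreover have "diagram ?lam = boxes"
  proof (rule set_eqI)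
    fix b :: box
    obtain i j where b: "b = (i, j)" by fastforce
    show "b \<in> diagram ?lam \<longleftrightarrow> b \<in> boxes"
      using zero[of i] unfolding b boxes_eq diagram_def by (cases "i < k") simp_all
  qed
  ultimately show ?thesis using that by blast
qed

end

lemma F_fin_poly_with:
  assumes T: "bij_betw T (diagram (shape M)) X" and Cm: "tab_content M \<in> Cs"
  shows "F_fin M T \<in> poly_with X Cs"
  unfolding poly_with_def
proof (intro CollectI ballI)
  have inj: "inj_on T (diagram (shape M))" and img: "T ` diagram (shape M) = X"
    using T by (auto simp: bij_betw_def)
  let ?m = "fill_mono (diagram (shape M)) (tab_entry M) T"
  fix m assume m: "m \<in> keys (F_fin M T)"
  obtain \<sigma> where s: "\<sigma> permutes X" "m = mono_act \<sigma> ?m"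
    using filling_poly_keys[OF inj m[unfolded F_fin_eq]] unfolding img by blast
  have bij: "bij \<sigma>" using s(1) by (rule permutes_bij)
  have "keys ?m \<subseteq> X"
    using keys_fill_mono[OF _ inj, of "tab_entry M"] finite_diagram img by auto
  then have "\<sigma> ` keys ?m \<subseteq> X" using permutes_in_image[OF s(1)] by blast
  then show "keys m \<subseteq> X \<and> mono_content m \<in> Cs"
    using Cm by (simp add: s(2) keys_mono_act[OF bij] mono_content_act[OF bij] tab_content_fill_mono[OF inj])
qed

text \<open>Let \<open>V\<close> be the orthogonal complement of the polynomials
  \<open>F_fin M T\<close> among the polynomials with contents in \<open>Cs\<close>. A non-zero
  \<open>V\<close> would contain some \<open>F\<close> adapted to a tableau by
  \<open>greedy_rows\<close>; with the semistandard monomial of \<open>F\<close> found by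
  \<open>straightening\<close>, the pairing of \<open>F\<close> with the polynomial of that
  tableau is a positive multiple of a coefficient that is not zero.\<close>

theorem spanning:
  assumes n: "n \<ge> 1" and Cs: "\<And>\<mu>. \<mu> \<in> Cs \<Longrightarrow> sum_mset \<mu> = d"
    and G: "G \<in> poly_with {1..n} Cs"
  shows "G \<in> qpoly.span {F_fin M T | M T. M \<in> all_SSYT n d \<and> tab_content M \<in> Cs \<and>
    bij_betw T (diagram (shape M)) {1..n}}" (is "_ \<in> qpoly.span ?B")
proof -
  let ?X = "{1..n}"
  have B_poly: "b \<in> poly_with ?X Cs" if "b \<in> ?B" for b
    using that F_fin_poly_with by blast
  let ?S = "{m :: mono. keys m \<subseteq> ?X \<and> mono_deg m \<le> d}"
  have "keys b \<subseteq> ?S" if "b \<in> ?B" for b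
    using B_poly[OF that] Cs by (force simp: poly_with_def mono_deg_content)
  then obtain w where w: "w \<in> qpoly.span ?B" and orth: "\<forall>b\<in>?B. ip (G - w) b = 0"
    using orthogonal_projection[OF finite_monomials_bounded, of ?X ?B d G] by auto
  define V where "V = {u \<in> poly_with ?X Cs. \<forall>b\<in>?B. ip u b = 0}"
  have wP: "w \<in> poly_with ?X Cs"
    using w qpoly.span_minimal[OF _ subspace_poly_with, of ?B] B_poly by blast
  have GV: "G - w \<in> V"
    using orth qpoly.subspace_diff[OF subspace_poly_with G wP] by (simp add: V_def)
  have "G - w = 0"
  proof (rule ccontr)
    assume ne: "G - w \<noteq> 0"
    have subV: "qpoly.subspace V"
      using subspace_poly_with[of ?X Cs]
      by (auto simp: V_def qpoly.subspace_def ip_add_left ip_scale_left)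
    have stV: "perm_act \<sigma> F \<in> V" if s: "\<sigma> permutes ?X" and F: "F \<in> V" for \<sigma> F
    proof -
      have bij: "bij \<sigma>" using s by (rule permutes_bij)
      have isX: "inv \<sigma> permutes ?X" using s by (rule permutes_inv)
      have "ip (perm_act \<sigma> F) b = 0" if b: "b \<in> ?B" for b
      proof -
        from b obtain M T where bM: "b = F_fin M T" "M \<in> all_SSYT n d" "tab_content M \<in> Cs"
          and T: "bij_betw T (diagram (shape M)) ?X" by blast
        have "perm_act (inv \<sigma>) b = F_fin M (inv \<sigma> \<circ> T)"
          unfolding bM F_fin_eq using T
          by (intro perm_act_filling_poly[OF finite_diagram _ permutes_bij[OF isX]]) (auto simp: bij_betw_def)
        moreover have "bij_betw (inv \<sigma> \<circ> T) (diagram (shape M)) ?X"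
          using T permutes_imp_bij[OF isX] by (rule bij_betw_trans)
        ultimately have "perm_act (inv \<sigma>) b \<in> ?B" using bM by blast
        then show ?thesis using F by (simp add: ip_perm_act[OF bij] V_def)
      qed
      then show ?thesis using F perm_act_poly_with[OF s] by (simp add: V_def)
    qed
    obtain r F where FV: "F \<in> V" and F0: "F \<noteq> 0" and inv: "\<forall>\<pi>\<in>stab ?X r. perm_act \<pi> F = F"
      and dec: "\<And>i. card {x \<in> ?X. r x = Suc i} \<le> card {x \<in> ?X. r x = i}"
      and van: "\<forall>i Z. Z \<subseteq> {x \<in> ?X. i \<le> r x} \<longrightarrow> card {x \<in> ?X. r x = i} < card Z \<longrightarrow> sym_sum (Perm Z) F = 0"
      using greedy_rows[OF finite_atLeastAtMost subV stV GV ne] by blast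
    define c where "c = (\<lambda>x. card {y \<in> ?X. r y = r x \<and> y < x})"
    interpret tableau ?X r c
      unfolding c_def by (rule tableau_of_rows) (use dec in auto)
    have rinv: "row_invariant F" unfolding row_invariant_def by (rule inv)
    have vanF: "vanishing F" unfolding vanishing_def by (rule van)
    obtain p where p: "p \<in> keys F"
      and rows: "\<And>x y. x \<in> ?X \<Longrightarrow> y \<in> ?X \<Longrightarrow> r x = r y \<Longrightarrow> c x < c y \<Longrightarrow> lookup p x \<le> lookup p y"
      and cols: "\<And>x y. x \<in> ?X \<Longrightarrow> y \<in> ?X \<Longrightarrow> c x = c y \<Longrightarrow> r y = Suc (r x) \<Longrightarrow> lookup p x < lookup p y"
      using straightening[OF rinv vanF F0] by blast
    obtain lam where lam: "is_partition lam" "diagram lam = boxes" by (rule partition_of_boxes)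
    define T where "T = filling"
    have T: "bij_betw T (diagram lam) ?X" unfolding T_def lam(2) by (rule bij_filling)
    then have inj: "inj_on T (diagram lam)" and img: "T ` diagram lam = ?X" by (auto simp: bij_betw_def)
    have cover: "\<exists>i j. (i, j) \<in> diagram lam \<and> x = T (i, j)" if "x \<in> ?X" for x
      using that unfolding img[symmetric] by auto
    have box: "T (i, j) \<in> ?X \<and> r (T (i, j)) = i \<and> c (T (i, j)) = j" if "(i, j) \<in> diagram lam" for i j
    proof -
      obtain x where "x \<in> ?X" "(i, j) = (r x, c x)" using \<open>(i, j) \<in> diagram lam\<close> unfolding lam(2) boxes_def by blast
      then show ?thesis using filling_box[of x] by (simp add: T_def)
    qed
    define M where "M = map (\<lambda>i. map (\<lambda>j. lookup p (T (i, j))) [0..<lam ! i]) [0..<length lam]"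
    have shM: "shape M = lam" by (simp add: M_def shape_def comp_def map_nth)
    have Mij: "M ! i ! j = lookup p (T (i, j))" if "(i, j) \<in> diagram lam" for i j
      using that by (simp add: M_def diagram_def)
    have FP: "F \<in> poly_with ?X Cs" using FV by (simp add: V_def)
    then have pX: "keys p \<subseteq> ?X" and pC: "mono_content p \<in> Cs" using p by (auto simp: poly_with_def)
    have fill: "fill_mono (diagram lam) (tab_entry M) T = p"
    proof (rule poly_mapping_eqI)
      fix x
      show "lookup (fill_mono (diagram lam) (tab_entry M) T) x = lookup p x"
      proof (cases "x \<in> ?X")
        case True
        then obtain i j where b: "(i, j) \<in> diagram lam" "x = T (i, j)" using cover by blast
        then show ?thesis using lookup_fill_mono(1)[OF _ inj b(1), of "tab_entry M"] finite_diagram Mij by simp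
      next
        case False
        then have "lookup p x = 0" using pX by (auto simp: in_keys_iff)
        then show ?thesis using lookup_fill_mono(2)[OF _ inj, of "tab_entry M" x] False img finite_diagram by simp
      qed
    qed
    have contM: "tab_content M = mono_content p"
      using tab_content_fill_mono[of T M] inj shM fill by simp
    have "sum_list (concat M) = sum_mset (mset (concat M))" by (simp add: sum_mset_sum_list)
    also have "\<dots> = sum_mset (tab_content M)"
    proof -
      have "sum_mset A = sum_mset (filter_mset (\<lambda>h. h \<noteq> 0) A)" for A :: "nat multiset"
        by (induction A) auto
      then show ?thesis by (simp add: tab_content_def)
    qed
    finally have sumM: "sum_list (concat M) = d" using Cs[OF pC] contM by simp
    have "semistandard M"
      unfolding semistandard_def
    proof (intro conjI ballI allI impI)
      fix u assume "u \<in> set M"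
      then obtain i where i: "i < length lam" "u = map (\<lambda>j. lookup p (T (i, j))) [0..<lam ! i]"
        by (auto simp: M_def)
      have "lookup p (T (i, j)) \<le> lookup p (T (i, k))" if "j < k" "k < lam ! i" for j k
        using box[of i j] box[of i k] i that by (intro rows) (auto simp: diagram_def)
      then show "sorted u" unfolding i by (auto simp: sorted_wrt_iff_nth_less)
    next
      fix i j assume a: "Suc i < length M \<and> j < length (M ! Suc i)"
      then have "Suc i < length lam" by (simp add: M_def)
      then have d1: "(Suc i, j) \<in> diagram lam" using a by (simp add: M_def diagram_def)
      then have d0: "(i, j) \<in> diagram lam"
        using youngD[OF young_diagram[OF lam(1)] d1, of i j] by simp
      show "M ! i ! j < M ! Suc i ! j"
        unfolding Mij[OF d1] Mij[OF d0] using box[OF d1] box[OF d0] by (intro cols) auto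
    qed
    moreover have "sum_list lam = n" using card_diagram[of lam] bij_betw_same_card[OF T] by simp
    ultimately have MS: "M \<in> all_SSYT n d"
      using sumM shM lam(1) by (auto simp: all_SSYT_def partitions_of_def SSYT_def)
    have "tab_content M \<in> Cs" "bij_betw T (diagram (shape M)) ?X" using contM pC T shM by simp_all
    then have "F_fin M T \<in> ?B" using MS by blast
    then have zero: "ip F (F_fin M T) = 0" using FV by (simp add: V_def)
    let ?s = "row_sum (diagram lam) (tab_entry M) T"
    have labr: "row_of (diagram lam) T x = r x" and labc: "col_of (diagram lam) T x = c x" if "x \<in> ?X" for x
    proof -
      obtain i j where b: "(i, j) \<in> diagram lam" "x = T (i, j)" using cover \<open>x \<in> ?X\<close> by blast
      show "row_of (diagram lam) T x = r x" "col_of (diagram lam) T x = c x" using b inj box[OF b(1)] by simp_all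
    qed
    have Rr: "stab ?X (row_of (diagram lam) T) = stab ?X r" using labr by (rule stab_cong)
    have Rc: "stab ?X (col_of (diagram lam) T) = stab ?X c" using labc by (rule stab_cong)
    have sinv: "perm_act \<pi> ?s = ?s" if "\<pi> \<in> stab ?X r" for \<pi>
      using row_sum_invariant[OF inj, of \<pi>] that unfolding img Rr by simp
    obtain h where h: "h > 0" "ip (alt_sum (stab ?X c) F) ?s = h * ip F ?s"
      using hook_product[OF row_invariantD[OF rinv] exchange_of_vanishing[OF rinv vanF] sinv] by blast
    have "ip F (F_fin M T) = ip (alt_sum (stab ?X c) F) ?s"
      unfolding F_fin_eq shM filling_poly_alt_sum[OF inj] img Rc by (rule ip_alt_sum[OF finite_X, symmetric])
    also have "\<dots> = h * (of_nat (card (row_orbit (diagram lam) (tab_entry M) T)) * lookup F p)"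
      unfolding h(2) using ip_row_sum[OF finite_diagram inj, of F "tab_entry M"] inv
      unfolding img Rr fill by simp
    finally have "lookup F p = 0"
      using zero h(1) row_orbit_nonempty[OF finite_diagram inj, of "tab_entry M"] by simp
    then show False using p by (simp add: in_keys_iff)
  qed
  then show ?thesis using w by simp
qed


section \<open>Contractions\<close>

definition erase :: "nat \<Rightarrow> mono \<Rightarrow> mono" where
  "erase i m = m - Poly_Mapping.single i (lookup m i)"

lemma lookup_erase: "lookup (erase i m) j = (if j = i then 0 else lookup m j)"
  by (simp add: erase_def lookup_minus lookup_single when_def)

lemma keys_erase [simp]: "keys (erase i m) = keys m - {i}"
  by (auto simp: in_keys_iff lookup_erase split: if_splits)

lemma erase_commute: "erase i (erase j m) = erase j (erase i m)"
  by (rule poly_mapping_eqI) (simp add: lookup_erase)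

text \<open>The sum runs over the variables that occur in the monomial, so it is empty for
  \<open>h = 0\<close>; thus every list of natural numbers is admissible as a list of contraction
  indices.\<close>

definition contr :: "nat \<Rightarrow> qpoly \<Rightarrow> qpoly" where
  "contr h = linear_ext (\<lambda>m. \<Sum>i\<in>{i \<in> keys m. lookup m i = h}. mono_poly (erase i m))"

lemma lin_contr: "lin (contr h)"
  by (simp add: contr_def lin_linear_ext)

lemma contr_mono_poly:
  "contr h (mono_poly m) = (\<Sum>i\<in>{i \<in> keys m. lookup m i = h}. mono_poly (erase i m))"
  by (simp add: contr_def)

lemma contr_expand: "contr h F = (\<Sum>p\<in>keys F. scaleQ (lookup F p) (contr h (mono_poly p)))"
  unfolding contr_mono_poly by (simp add: contr_def linear_ext_def)

lemma contr_perm_act: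
  assumes "bij \<sigma>" shows "contr h (perm_act \<sigma> F) = perm_act \<sigma> (contr h F)"
proof (rule lin_eq_on_monomials[where f = "\<lambda>F. contr h (perm_act \<sigma> F)" and g = "\<lambda>F. perm_act \<sigma> (contr h F)"])
  fix m
  have inj: "inj_on \<sigma> A" for A using assms by (meson bij_is_inj inj_on_subset subset_UNIV)
  have "{i \<in> keys (mono_act \<sigma> m). lookup (mono_act \<sigma> m) i = h} = \<sigma> ` {i \<in> keys m. lookup m i = h}"
    using assms by (auto simp: keys_mono_act lookup_mono_act bij_is_inj)
  moreover have "erase (\<sigma> i) (mono_act \<sigma> m) = mono_act \<sigma> (erase i m)" for i
    using assms by (intro poly_mapping_eqI) (auto simp: lookup_erase lookup_mono_act bij_is_inj bij_is_surj surj_f_inv_f)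
  ultimately show "contr h (perm_act \<sigma> (mono_poly m)) = perm_act \<sigma> (contr h (mono_poly m))"
    by (simp add: contr_mono_poly perm_act_sum sum.reindex[OF inj])
qed (auto intro: lin_compose lin_contr lin_perm_act)

lemma contr_commute: "contr g (contr h F) = contr h (contr g F)"
proof (rule lin_eq_on_monomials[where f = "\<lambda>F. contr g (contr h F)" and g = "\<lambda>F. contr h (contr g F)"])
  fix m
  have two: "contr g (contr h (mono_poly m))
      = (\<Sum>i\<in>keys m. \<Sum>j\<in>keys m. if i \<noteq> j \<and> lookup m i = h \<and> lookup m j = g then mono_poly (erase j (erase i m)) else 0)"
    for g h
  proof -
    have "contr g (contr h (mono_poly m)) = (\<Sum>i\<in>{i \<in> keys m. lookup m i = h}. contr g (mono_poly (erase i m)))"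
      by (simp add: contr_mono_poly lin_sum[OF lin_contr])
    also have "\<dots> = (\<Sum>i\<in>keys m. if lookup m i = h then contr g (mono_poly (erase i m)) else 0)"
      by (rule sum.mono_neutral_cong_left) auto
    also have "\<dots> = (\<Sum>i\<in>keys m. \<Sum>j\<in>keys m. if i \<noteq> j \<and> lookup m i = h \<and> lookup m j = g then mono_poly (erase j (erase i m)) else 0)"
    proof (rule sum.cong[OF refl])
      fix i
      have "contr g (mono_poly (erase i m)) = (\<Sum>j\<in>keys m. if i \<noteq> j \<and> lookup m j = g then mono_poly (erase j (erase i m)) else 0)"
        unfolding contr_mono_poly by (rule sum.mono_neutral_cong_left) (auto simp: lookup_erase)
      then show "(if lookup m i = h then contr g (mono_poly (erase i m)) else 0)
        = (\<Sum>j\<in>keys m. if i \<noteq> j \<and> lookup m i = h \<and> lookup m j = g then mono_poly (erase j (erase i m)) else 0)"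
        by simp
    qed
    finally show ?thesis .
  qed
  have "contr g (contr h (mono_poly m)) = (\<Sum>j\<in>keys m. \<Sum>i\<in>keys m.
      if i \<noteq> j \<and> lookup m i = h \<and> lookup m j = g then mono_poly (erase j (erase i m)) else 0)"
    unfolding two by (rule sum.swap)
  also have "\<dots> = contr h (contr g (mono_poly m))"
    unfolding two by (intro sum.cong refl) (auto simp: erase_commute)
  finally show "contr g (contr h (mono_poly m)) = contr h (contr g (mono_poly m))" .
qed (auto intro: lin_compose lin_contr)

abbreviation contrs :: "nat list \<Rightarrow> qpoly \<Rightarrow> qpoly" where
  "contrs hs \<equiv> fold contr hs"

lemma lin_contrs: "lin (contrs hs)"
proof (induction hs)
  case Nil then show ?case by (simp add: lin_def)
next
  case (Cons h hs) then show ?case using lin_compose[OF Cons lin_contr[of h]] by (simp add: comp_def)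
qed

lemma contrs_perm_act: "bij \<sigma> \<Longrightarrow> contrs hs (perm_act \<sigma> F) = perm_act \<sigma> (contrs hs F)"
  by (induction hs arbitrary: F) (simp_all add: contr_perm_act)

lemma contrs_mset_cong: "mset hs = mset hs' \<Longrightarrow> contrs hs = contrs hs'"
  by (rule fold_multiset_equiv) (auto simp: fun_eq_iff contr_commute)

lemma contrs_alt_sum: "contrs hs (alt_sum (stab X lab) F) = alt_sum (stab X lab) (contrs hs F)"
  by (simp add: alt_sum_def lin_sum[OF lin_contrs] lin_scale[OF lin_contrs] contrs_perm_act stab_bij cong: sum.cong)

lemma contrs_sym_sum: "contrs hs (sym_sum (stab X lab) F) = sym_sum (stab X lab) (contrs hs F)"
  by (simp add: sym_sum_def lin_sum[OF lin_contrs] contrs_perm_act stab_bij cong: sum.cong)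

definition contr_ker :: "nat \<Rightarrow> qpoly set" where
  "contr_ker g = {F. \<forall>hs. length hs = g \<longrightarrow> contrs hs F = 0}"

lemma subspace_contr_ker: "qpoly.subspace (contr_ker g)"
  by (auto simp: qpoly.subspace_def contr_ker_def lin_add[OF lin_contrs] lin_scale[OF lin_contrs] lin_0[OF lin_contrs])

lemma perm_act_contr_ker: "bij \<sigma> \<Longrightarrow> F \<in> contr_ker g \<Longrightarrow> perm_act \<sigma> F \<in> contr_ker g"
  by (simp add: contr_ker_def contrs_perm_act)

lemma contr_in_contr_ker: "F \<in> contr_ker (Suc g) \<Longrightarrow> contr h F \<in> contr_ker g"
  by (simp add: contr_ker_def) (metis fold_simps(2) length_Cons)

lemma contrs_in_contr_ker: "F \<in> contr_ker (length hs + g) \<Longrightarrow> contrs hs F \<in> contr_ker g"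
  by (induction hs arbitrary: F) (simp_all add: contr_in_contr_ker)

lemma contr_ker_mono: "g \<le> g' \<Longrightarrow> contr_ker g \<subseteq> contr_ker g'"
proof (rule lift_Suc_mono_le[of contr_ker])
  show "contr_ker n \<subseteq> contr_ker (Suc n)" for n
  proof
    fix F assume F: "F \<in> contr_ker n"
    show "F \<in> contr_ker (Suc n)"
      unfolding contr_ker_def
    proof (intro CollectI allI impI)
      fix hs :: "nat list" assume "length hs = Suc n"
      then obtain hs' h where hs: "hs = hs' @ [h]" "length hs' = n" by (metis length_Suc_conv_rev)
      then show "contrs hs F = 0" using F lin_0[OF lin_contr] by (simp add: contr_ker_def)
    qed
  qed
qed

lemma contr_ker_0 [simp]: "contr_ker 0 = {0}"
  by (auto simp: contr_ker_def)

lemma keys_contr: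
  assumes "m \<in> keys (contr h F)"
  obtains p i where "p \<in> keys F" "i \<in> keys p" "lookup p i = h" "m = erase i p"
proof -
  have "keys (contr h F) \<subseteq> (\<Union>p\<in>keys F. keys (scaleQ (lookup F p) (contr h (mono_poly p))))"
    by (subst contr_expand) (rule keys_sum_subset)
  from subsetD[OF this assms]
  obtain p where p: "p \<in> keys F" "m \<in> keys (scaleQ (lookup F p) (contr h (mono_poly p)))"
    by (rule UN_E)
  from subsetD[OF keys_scaleQ p(2)] have "m \<in> keys (contr h (mono_poly p))" .
  then have "m \<in> (\<Union>i\<in>{i \<in> keys p. lookup p i = h}. keys (mono_poly (erase i p)))"
    unfolding contr_mono_poly by (rule subsetD[OF keys_sum_subset])
  then show ?thesis using that p(1) by auto
qed

lemma mono_content_erase: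
  assumes "i \<in> keys m" shows "mono_content m = add_mset (lookup m i) (mono_content (erase i m))"
proof -
  have "mset_set (keys m) = add_mset i (mset_set (keys m - {i}))"
    using assms by (simp add: mset_set.remove)
  moreover have "image_mset (lookup m) (mset_set (keys m - {i})) = image_mset (lookup (erase i m)) (mset_set (keys m - {i}))"
    by (intro image_mset_cong) (auto simp: lookup_erase)
  ultimately show ?thesis by (simp add: mono_content_def)
qed

lemma keys_contrs:
  assumes "m \<in> keys (contrs hs F)"
  shows "\<exists>p\<in>keys F. keys m \<subseteq> keys p \<and> mono_content p = mono_content m + mset hs"
  using assms
proof (induction hs arbitrary: F)
  case Nil then show ?case by auto
next
  case (Cons h hs)
  then obtain q where q: "q \<in> keys (contr h F)" "keys m \<subseteq> keys q" "mono_content q = mono_content m + mset hs"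
    by auto
  obtain p i where p: "p \<in> keys F" "i \<in> keys p" "lookup p i = h" "q = erase i p" using keys_contr[OF q(1)] .
  then show ?case using q mono_content_erase[OF p(2)] by (intro bexI[of _ p]) auto
qed

lemma size_mono_content: "size (mono_content m) = card (keys m)"
  by (simp add: mono_content_def)

lemma contr_poly_with:
  assumes "F \<in> poly_with X Cs" shows "contrs hs F \<in> poly_with X {\<nu>. \<nu> + mset hs \<in> Cs}"
  unfolding poly_with_def
proof (intro CollectI ballI)
  fix m assume "m \<in> keys (contrs hs F)"
  from keys_contrs[OF this] assms
  show "keys m \<subseteq> X \<and> mono_content m \<in> {\<nu>. \<nu> + mset hs \<in> Cs}"
    by (fastforce simp: poly_with_def)
qed

lemma lookup_contr:
  assumes h: "h > 0" and X: "finite X" "\<And>p. p \<in> keys F \<Longrightarrow> keys p \<subseteq> X"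
  shows "lookup (contr h F) m = (\<Sum>j\<in>X - keys m. lookup F (m + Poly_Mapping.single j h))"
proof -
  let ?a = "\<lambda>j. m + Poly_Mapping.single j h"
  have one: "lookup (contr h (mono_poly p)) m = (\<Sum>j\<in>X - keys m. if p = ?a j then 1 else 0)"
    if p: "keys p \<subseteq> X" for p
  proof -
    have eq: "i \<in> keys p \<and> lookup p i = h \<and> erase i p = m \<longleftrightarrow> i \<in> X - keys m \<and> p = ?a i" for i
    proof
      assume a: "i \<in> keys p \<and> lookup p i = h \<and> erase i p = m"
      then have "i \<notin> keys m" "i \<in> X" using p keys_erase[of i p] by auto
      moreover have "p = ?a i" using a by (intro poly_mapping_eqI) (auto simp: lookup_add lookup_single lookup_erase when_def)
      ultimately show "i \<in> X - keys m \<and> p = ?a i" by blast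
    next
      assume a: "i \<in> X - keys m \<and> p = ?a i"
      then have l: "lookup p i = h" by (simp add: lookup_add in_keys_iff)
      have "erase i p = m" using a
        by (intro poly_mapping_eqI) (auto simp: lookup_erase lookup_add lookup_single when_def in_keys_iff)
      then show "i \<in> keys p \<and> lookup p i = h \<and> erase i p = m" using l h by (simp add: in_keys_iff)
    qed
    have "lookup (contr h (mono_poly p)) m = of_nat (card {i. i \<in> keys p \<and> lookup p i = h \<and> erase i p = m})"
    proof -
      have "lookup (contr h (mono_poly p)) m = (\<Sum>i\<in>{i \<in> keys p. lookup p i = h}. if erase i p = m then 1 else 0)"
        by (simp add: contr_mono_poly lookup_sum lookup_mono_poly)
      also have "\<dots> = (\<Sum>i\<in>{i. i \<in> keys p \<and> lookup p i = h \<and> erase i p = m}. 1)"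
        by (rule sum.mono_neutral_cong_right) auto
      finally show ?thesis by simp
    qed
    also have "\<dots> = (\<Sum>i\<in>{i. i \<in> X - keys m \<and> p = ?a i}. 1)" unfolding eq by simp
    also have "\<dots> = (\<Sum>j\<in>X - keys m. if p = ?a j then 1 else 0)"
      using X(1) by (intro sum.mono_neutral_cong_left) auto
    finally show ?thesis .
  qed
  have "lookup (contr h F) m = (\<Sum>p\<in>keys F. lookup F p * lookup (contr h (mono_poly p)) m)"
    by (subst contr_expand) (simp add: lookup_sum lookup_scaleQ)
  also have "\<dots> = (\<Sum>p\<in>keys F. \<Sum>j\<in>X - keys m. if p = ?a j then lookup F p else 0)"
    using X(2) one by (intro sum.cong refl) (simp add: sum_distrib_left if_distrib cong: if_cong)
  also have "\<dots> = (\<Sum>j\<in>X - keys m. \<Sum>p\<in>keys F. if p = ?a j then lookup F p else 0)"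
    by (rule sum.swap)
  also have "\<dots> = (\<Sum>j\<in>X - keys m. lookup F (?a j))"
    by (intro sum.cong refl) (auto simp: sum.delta in_keys_iff)
  finally show ?thesis .
qed

text \<open>By induction the claim reduces to a polynomial whose single contractions vanish at the
  monomials in question. Take a monomial \<open>q\<close> of \<open>F\<close> with at least
  \<open>card (X - R) + 1\<close> variables and as many variables outside \<open>R\<close> as
  possible. It contains a variable from \<open>R\<close>. Delete it and contract: inserting it
  elsewhere in \<open>R\<close> gives back the coefficient at \<open>q\<close>, by symmetry, and
  inserting it outside \<open>R\<close> gives \<open>0\<close>, by the choice of
  \<open>q\<close>.\<close>

lemma symmetric_contr_ker_vanishes:
  assumes fin: "finite X" and R: "R \<subseteq> X"
  shows "F \<in> contr_ker g \<Longrightarrow> (\<And>p. p \<in> keys F \<Longrightarrow> keys p \<subseteq> X) \<Longrightarrow>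
    (\<And>\<pi>. \<pi> \<in> Perm R \<Longrightarrow> perm_act \<pi> F = F) \<Longrightarrow> card (X - R) + g \<le> card (keys p) \<Longrightarrow> lookup F p = 0"
proof (induction g arbitrary: F p)
  case 0 then show ?case by simp
next
  case (Suc g)
  let ?Y = "X - R"
  have contr0: "lookup (contr h F) m = 0" if "card ?Y + g \<le> card (keys m)" for h m
  proof (rule Suc.IH)
    show "contr h F \<in> contr_ker g" using Suc.prems(1) by (rule contr_in_contr_ker)
    show "keys q \<subseteq> X" if q: "q \<in> keys (contr h F)" for q
    proof -
      obtain p i where p: "p \<in> keys F" "i \<in> keys p" "lookup p i = h" "q = erase i p"
        using keys_contr[OF q] .
      then show ?thesis using Suc.prems(2)[OF p(1)] by auto
    qed
    show "perm_act \<pi> (contr h F) = contr h F" if "\<pi> \<in> Perm R" for \<pi>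
      using Suc.prems(3)[OF that] contr_perm_act[OF stab_bij[OF that], of h F] by simp
  qed (rule that)
  show ?case
  proof (rule ccontr)
    assume p: "lookup F p \<noteq> 0"
    define Q where "Q = {q \<in> keys F. card ?Y + Suc g \<le> card (keys q)}"
    have finQ: "finite Q" by (simp add: Q_def)
    have "p \<in> Q" using p Suc.prems(4) by (simp add: Q_def in_keys_iff)
    then have "(\<lambda>q. card (keys q \<inter> ?Y)) ` Q \<noteq> {}" by blast
    from Max_in[OF finite_imageI[OF finQ] this]
    obtain q where q: "q \<in> Q" and mx: "Max ((\<lambda>q. card (keys q \<inter> ?Y)) ` Q) = card (keys q \<inter> ?Y)"
      by (rule imageE)
    have max: "card (keys q' \<inter> ?Y) \<le> card (keys q \<inter> ?Y)" if "q' \<in> Q" for q'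
      using Max_ge[OF finite_imageI[OF finQ] imageI[OF that, of "\<lambda>q. card (keys q \<inter> ?Y)"]] unfolding mx .
    have qX: "keys q \<subseteq> X" and qc: "card ?Y + Suc g \<le> card (keys q)" and qF: "lookup F q \<noteq> 0"
      using q Suc.prems(2) by (auto simp: Q_def in_keys_iff)
    have "\<not> keys q \<subseteq> ?Y" using card_mono[of ?Y "keys q"] fin qc by auto
    then obtain i where i: "i \<in> keys q" "i \<in> R" using qX by auto
    define h where "h = lookup q i"
    have h: "h > 0" using i by (simp add: h_def in_keys_iff)
    let ?e = "erase i q"
    have val: "lookup F (?e + Poly_Mapping.single j h) = (if j \<in> R then lookup F q else 0)"
      if j: "j \<in> X - keys ?e" for j
    proof (cases "j \<in> R")
      case True
      let ?t = "Transposition.transpose i j"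
      have "?e + Poly_Mapping.single j h = mono_act ?t q"
        using j by (intro poly_mapping_eqI)
          (auto simp: lookup_add lookup_erase lookup_single lookup_mono_act when_def h_def in_keys_iff Transposition.transpose_def inv_swap_id)
      moreover have "?t \<in> Perm R" using i True by (intro transpose_in_stab) auto
      then have "perm_act ?t F = F" by (rule Suc.prems(3))
      ultimately have "lookup F (?e + Poly_Mapping.single j h) = lookup F q"
        using lookup_perm_act[of ?t F "mono_act ?t q"] mono_act_inv(1)[of ?t q] by simp
      then show ?thesis using True by simp
    next
      case False
      let ?q = "?e + Poly_Mapping.single j h"
      have k: "keys ?q = insert j (keys q - {i})"
        using h by (auto simp: in_keys_iff lookup_add lookup_erase lookup_single when_def split: if_splits)
      have jn: "j \<notin> keys q - {i}" "j \<noteq> i" using j False i by auto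
      have "card (keys ?q) = card (keys q)"
        unfolding k using jn(1) card_Suc_Diff1[OF finite_keys i(1)] by (simp only: card_insert_disjoint finite_Diff finite_keys not_False_eq_True)
      moreover have "keys ?q \<inter> ?Y = insert j (keys q \<inter> ?Y)" using k j False i by auto
      then have "card (keys ?q \<inter> ?Y) = Suc (card (keys q \<inter> ?Y))" using jn by simp
      ultimately have "?q \<notin> keys F" using max[of ?q] qc by (auto simp: Q_def)
      then show ?thesis using False by (simp add: in_keys_iff)
    qed
    have "card (keys ?e) = card (keys q) - 1" using i by simp
    then have "0 = lookup (contr h F) ?e" using contr0[of ?e h] qc by simp
    also have "\<dots> = (\<Sum>j\<in>X - keys ?e. lookup F (?e + Poly_Mapping.single j h))"
      by (rule lookup_contr[OF h fin]) (rule Suc.prems(2))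
    also have "\<dots> = (\<Sum>j\<in>X - keys ?e. if j \<in> R then lookup F q else 0)"
      by (intro sum.cong refl val)
    also have "\<dots> = (\<Sum>j\<in>{j \<in> X - keys ?e. j \<in> R}. lookup F q)"
      using fin by (intro sum.mono_neutral_cong_right) auto
    also have "\<dots> = of_nat (card {j \<in> X - keys ?e. j \<in> R}) * lookup F q" by simp
    finally have "card {j \<in> X - keys ?e. j \<in> R} = 0" using qF by simp
    moreover have "i \<in> {j \<in> X - keys ?e. j \<in> R}" using i R by auto
    ultimately show False using fin by (auto simp: card_eq_0_iff)
  qed
qed

text \<open>If every column contained at most one absent variable, sending each element below the
  first row to itself or, if it is absent, to the top of its column would inject these elements
  into the variables of \<open>p\<close>. So two absent variables share a column, and their
  transposition fixes \<open>p\<close>.\<close>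

lemma (in tableau) alt_sum_few_variables:
  assumes "card (keys p) < card {x \<in> X. 0 < r x}"
  shows "alt_sum (stab X c) (mono_poly p) = 0"
proof -
  have "\<exists>x\<in>X. \<exists>y\<in>X. x \<noteq> y \<and> c x = c y \<and> x \<notin> keys p \<and> y \<notin> keys p"
  proof (rule ccontr)
    assume "\<not> ?thesis"
    then have uniq: "x = y" if "x \<in> X" "y \<in> X" "c x = c y" "x \<notin> keys p" "y \<notin> keys p" for x y
      using that by blast
    \<comment> \<open>The top of the column of the element.\<close>
    define top where "top x = (SOME y. y \<in> X \<and> r y = 0 \<and> c y = c x)" for x
    have top: "top x \<in> X \<and> r (top x) = 0 \<and> c (top x) = c x" if "x \<in> X" for x
      unfolding top_def by (rule someI_ex) (use young[OF that, of 0 "c x"] in auto)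
    define f where "f x = (if x \<in> keys p then x else top x)" for x
    have "f ` {x \<in> X. 0 < r x} \<subseteq> keys p"
    proof
      fix z assume "z \<in> f ` {x \<in> X. 0 < r x}"
      then obtain x where x: "x \<in> X" "0 < r x" "z = f x" by auto
      show "z \<in> keys p"
      proof (cases "x \<in> keys p")
        case False
        then have "x \<noteq> top x" using top[OF x(1)] x(2) by auto
        then show ?thesis using uniq[of x "top x"] top[OF x(1)] x False by (auto simp: f_def)
      qed (use x in \<open>simp add: f_def\<close>)
    qed
    moreover have "inj_on f {x \<in> X. 0 < r x}"
    proof (rule inj_onI)
      fix x y assume xy: "x \<in> {x \<in> X. 0 < r x}" "y \<in> {x \<in> X. 0 < r x}" "f x = f y"
      then show "x = y"
        using top[of x] top[of y] uniq[of x y] by (auto simp: f_def split: if_splits)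
    qed
    ultimately have "card {x \<in> X. 0 < r x} \<le> card (keys p)" by (intro card_inj_on_le) auto
    then show False using assms by simp
  qed
  then obtain x y where xy: "x \<in> X" "y \<in> X" "x \<noteq> y" "c x = c y" "x \<notin> keys p" "y \<notin> keys p" by blast
  let ?t = "Transposition.transpose x y"
  have t: "?t \<in> stab X c" using xy by (intro transpose_in_stab)
  have "mono_act ?t p = p"
    using xy by (intro poly_mapping_eqI) (auto simp: lookup_mono_act inv_swap_id in_keys_iff Transposition.transpose_def)
  then have "alt_sum (stab X c) (mono_poly p) = scaleQ (sgn_rat ?t) (alt_sum (stab X c) (mono_poly p))"
    using alt_sum_perm_act[OF finite_X t, of "mono_poly p"] by simp
  then have eq: "alt_sum (stab X c) (mono_poly p) = - alt_sum (stab X c) (mono_poly p)"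
    using xy(3) by (simp add: sign_swap_id)
  show ?thesis
    by (rule poly_mapping_eqI) (metis eq lookup_uminus equal_neg_zero lookup_zero)
qed

text \<open>Entries below the first row of a semistandard tableau are positive.\<close>

lemma card_nonzero_entries:
  assumes "semistandard M" "M \<noteq> []"
  shows "card {b \<in> diagram (shape M). tab_entry M b \<noteq> 0} = fnum M + card {b \<in> diagram (shape M). 0 < fst b}"
proof -
  let ?D = "diagram (shape M)"
  have pos: "tab_entry M b \<noteq> 0" if D: "b \<in> ?D" and row: "0 < fst b" for b
  proof -
    obtain i j where b: "b = (Suc i, j)" using row by (metis gr0_conv_Suc prod.collapse)
    then have "Suc i < length M" "j < length (M ! Suc i)" using D by (auto simp: diagram_def shape_def)
    then have "M ! i ! j < M ! Suc i ! j" using assms(1) by (simp add: semistandard_def)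
    then show ?thesis by (simp add: b)
  qed
  have "{b \<in> ?D. tab_entry M b \<noteq> 0} = Pair 0 ` {j. j < length (M ! 0) \<and> M ! 0 ! j \<noteq> 0} \<union> {b \<in> ?D. 0 < fst b}"
    using pos assms(2) by (auto simp: diagram_def shape_def image_iff)
  moreover have "card (Pair (0::nat) ` {j. j < length (M ! 0) \<and> M ! 0 ! j \<noteq> 0}) = fnum M"
    by (simp add: card_image inj_on_def fnum_def length_filter_conv_card)
  moreover have "finite {b \<in> ?D. 0 < fst b}" using finite_diagram by simp
  ultimately show ?thesis by (simp add: card_Un_disjoint disjoint_iff image_iff)
qed

context
  fixes n d :: nat and M :: "nat list list" and T :: "box \<Rightarrow> nat"
  assumes n: "n \<ge> 1" and M: "M \<in> all_SSYT n d" and T: "bij_betw T (diagram (shape M)) {1..n}"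
begin

lemma all_SSYT_tableau:
  shows "M \<noteq> []" "semistandard M" "young (diagram (shape M))" "inj_on T (diagram (shape M))"
    "T ` diagram (shape M) = {1..n}"
    "tableau {1..n} (row_of (diagram (shape M)) T) (col_of (diagram (shape M)) T)"
proof -
  have p: "is_partition (shape M)" "sum_list (shape M) = n" "semistandard M"
    using M by (auto simp: all_SSYT_def partitions_of_def SSYT_def)
  then show "M \<noteq> []" "semistandard M" using n by (auto simp: shape_def)
  show y: "young (diagram (shape M))" using p by (simp add: young_diagram)
  show i: "inj_on T (diagram (shape M))" "T ` diagram (shape M) = {1..n}" using T by (auto simp: bij_betw_def)
  show "tableau {1..n} (row_of (diagram (shape M)) T) (col_of (diagram (shape M)) T)"
    using tableau_filling[OF y i(1)] unfolding i(2) .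
qed

lemma card_keys_row_sum:
  assumes "m \<in> keys (row_sum (diagram (shape M)) (tab_entry M) T)"
  shows "card (keys m) = fnum M + card {x \<in> {1..n}. 0 < row_of (diagram (shape M)) T x}"
proof -
  let ?D = "diagram (shape M)"
  note t = all_SSYT_tableau
  have im: "{x \<in> {1..n}. 0 < row_of ?D T x} = T ` {b \<in> ?D. 0 < fst b}"
    unfolding t(5)[symmetric] using t(4) by auto
  obtain \<tau> where \<tau>: "\<tau> \<in> stab (T ` ?D) (row_of ?D T)" "m = mono_act \<tau> (fill_mono ?D (tab_entry M) T)"
    using row_sum_keys[OF t(4) assms] .
  have inj: "inj_on \<tau> A" for A using stab_bij[OF \<tau>(1)] by (meson bij_is_inj inj_on_subset subset_UNIV)
  have injT: "inj_on T A" if "A \<subseteq> ?D" for A using t(4) that by (rule inj_on_subset)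
  have "card (keys m) = card (keys (fill_mono ?D (tab_entry M) T))"
    by (simp add: \<tau>(2) keys_mono_act[OF stab_bij[OF \<tau>(1)]] card_image[OF inj])
  also have "\<dots> = card {b \<in> ?D. tab_entry M b \<noteq> 0}"
    using keys_fill_mono[OF _ t(4), of "tab_entry M"] finite_diagram by (simp add: card_image[OF injT])
  also have "\<dots> = fnum M + card {x \<in> {1..n}. 0 < row_of ?D T x}"
    unfolding im card_nonzero_entries[OF t(2,1)] by (simp add: card_image[OF injT])
  finally show ?thesis .
qed

text \<open>After \<open>fnum M + 1\<close> contractions the monomials of the row sum have fewer
  variables than there are boxes below the first row.\<close>

lemma F_fin_in_contr_ker: "F_fin M T \<in> contr_ker (Suc (fnum M))"
proof -
  let ?D = "diagram (shape M)"
  note t = all_SSYT_tableau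
  interpret tableau "{1..n}" "row_of ?D T" "col_of ?D T" by (rule t(6))
  have "contrs hs (F_fin M T) = 0" if len: "length hs = Suc (fnum M)" for hs
  proof -
    let ?G = "contrs hs (row_sum ?D (tab_entry M) T)"
    have "alt_sum (stab {1..n} (col_of ?D T)) (mono_poly m) = 0" if m: "m \<in> keys ?G" for m
    proof (rule alt_sum_few_variables)
      obtain p where p: "p \<in> keys (row_sum ?D (tab_entry M) T)" "mono_content p = mono_content m + mset hs"
        using keys_contrs[OF m] by blast
      then have "card (keys p) = card (keys m) + length hs"
        by (metis size_mono_content size_union size_mset)
      then show "card (keys m) < card {x \<in> {1..n}. 0 < row_of ?D T x}"
        using card_keys_row_sum[OF p(1)] len by simp
    qed
    then have "alt_sum (stab {1..n} (col_of ?D T)) ?G = 0"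
      using lin_eq_on_monomials[OF lin_alt_sum, of "\<lambda>_. 0" ?G] by (simp add: lin_def)
    then show ?thesis
      by (simp only: F_fin_eq filling_poly_alt_sum[OF t(4)] t(5) contrs_alt_sum)
  qed
  then show ?thesis by (simp add: contr_ker_def)
qed

text \<open>The pairing does not change, up to a factor, when \<open>F\<close> is antisymmetrised
  over the columns and then symmetrised over the first row. The result is still killed by the
  contractions, so \<open>symmetric_contr_ker_vanishes\<close> applies to it.\<close>

lemma ip_F_fin_contr_ker:
  assumes F: "F \<in> contr_ker g" "\<And>p. p \<in> keys F \<Longrightarrow> keys p \<subseteq> {1..n}" and g: "g \<le> fnum M"
  shows "ip F (F_fin M T) = 0"
proof -
  let ?D = "diagram (shape M)"
  note t = all_SSYT_tableau
  interpret tableau "{1..n}" "row_of ?D T" "col_of ?D T" by (rule t(6))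
  let ?s = "row_sum ?D (tab_entry M) T"
  let ?A = "stab {1..n} (col_of ?D T)"
  define S where "S = sym_sum (Perm (row 0)) (alt_sum ?A F)"
  have S1: "S \<in> contr_ker g"
    using F(1) by (simp add: S_def contr_ker_def contrs_sym_sum contrs_alt_sum lin_0[OF lin_sym_sum] lin_0[OF lin_alt_sum])
  have S2: "keys p \<subseteq> {1..n}" if "p \<in> keys S" for p
  proof -
    have "perm_act \<sigma> G \<in> poly_with {1..n} UNIV" if "\<sigma> permutes {1..n}" "G \<in> poly_with {1..n} UNIV" for \<sigma> G
      using that by (rule perm_act_poly_with)
    moreover have "F \<in> poly_with {1..n} UNIV" using F(2) by (simp add: poly_with_def)
    moreover have "\<sigma> permutes {1..n}" if "\<sigma> \<in> Perm (row 0)" for \<sigma>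
      using stab_permutes[OF that] by (rule permutes_subset) auto
    moreover have "alt_sum ?A F \<in> poly_with {1..n} UNIV"
      unfolding alt_sum_def using calculation(1,2) stab_permutes
      by (intro qpoly.subspace_sum[OF subspace_poly_with] qpoly.subspace_scale[OF subspace_poly_with]) blast
    ultimately have "S \<in> poly_with {1..n} UNIV"
      unfolding S_def by (intro subspace_sym_sum subspace_poly_with) blast
    then show ?thesis using that by (simp add: poly_with_def)
  qed
  have S3: "perm_act \<pi> S = S" if "\<pi> \<in> Perm (row 0)" for \<pi>
    unfolding S_def by (rule perm_act_sym_sum[OF that])
  have "lookup S m = 0" if "m \<in> keys ?s" for m
  proof (rule symmetric_contr_ker_vanishes[OF finite_X _ S1 S2 S3])
    have "{1..n} - row 0 = {x \<in> {1..n}. 0 < row_of ?D T x}" by auto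
    then show "card ({1..n} - row 0) + g \<le> card (keys m)" using card_keys_row_sum[OF that] g by simp
  qed auto
  then have "0 = ip ?s S" by (simp add: ip_def)
  also have "\<dots> = ip (alt_sum ?A F) (sym_sum (Perm (row 0)) ?s)"
    unfolding S_def by (simp only: ip_commute[of ?s] ip_sym_sum)
  also have "sym_sum (Perm (row 0)) ?s = scaleQ (of_nat (card (Perm (row 0)))) ?s"
  proof (rule sym_sum_invariant)
    fix \<sigma> assume "\<sigma> \<in> Perm (row 0)"
    then have "\<sigma> \<in> stab {1..n} (row_of ?D T)" using Perm_row_subset by blast
    then show "perm_act \<sigma> ?s = ?s" using row_sum_invariant[OF t(4), of \<sigma>] unfolding t(5) by simp
  qed
  also have "ip (alt_sum ?A F) \<dots> = of_nat (card (Perm (row 0))) * ip F (F_fin M T)"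
    by (simp only: ip_scale_right ip_alt_sum[OF finite_X] F_fin_eq filling_poly_alt_sum[OF t(4)] t(5))
  finally show ?thesis
    using finite_stab[of "row 0" "\<lambda>_. 0"] id_in_stab[of "row 0" "\<lambda>_. 0"] finite_X by (auto simp: card_eq_0_iff)
qed

end

text \<open>Split \<open>G\<close> into its parts with \<open>fnum M < g\<close> and
  \<open>fnum M \<ge> g\<close>. The second part is killed by the contractions, as
  \<open>G\<close> and the first part are, hence it is orthogonal to itself.\<close>

theorem contr_ker_characterisation:
  assumes n: "n \<ge> 1" and Cs: "\<And>\<mu>. \<mu> \<in> Cs \<Longrightarrow> sum_mset \<mu> = d" and G: "G \<in> poly_with {1..n} Cs"
    and ker: "G \<in> contr_ker g"
  shows "G \<in> qpoly.span {F_fin M T | M T. M \<in> all_SSYT n d \<and> fnum M < g \<and> tab_content M \<in> Cs \<and>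
    bij_betw T (diagram (shape M)) {1..n}}" (is "_ \<in> qpoly.span ?lo")
proof -
  let ?hi = "{F_fin M T | M T. M \<in> all_SSYT n d \<and> g \<le> fnum M \<and> tab_content M \<in> Cs \<and>
    bij_betw T (diagram (shape M)) {1..n}}"
  let ?all = "{F_fin M T | M T. M \<in> all_SSYT n d \<and> tab_content M \<in> Cs \<and>
    bij_betw T (diagram (shape M)) {1..n}}"
  have "?all \<subseteq> ?lo \<union> ?hi" by (auto simp: not_le[symmetric])
  moreover have "G \<in> qpoly.span ?all" using spanning[OF n Cs G] by simp
  ultimately have "G \<in> qpoly.span (?lo \<union> ?hi)" using qpoly.span_mono by blast
  then obtain A B where AB: "G = A + B" "A \<in> qpoly.span ?lo" "B \<in> qpoly.span ?hi"
    unfolding qpoly.span_Un by blast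
  have "?lo \<subseteq> contr_ker g"
  proof
    fix b assume "b \<in> ?lo"
    then obtain M T where b: "b = F_fin M T" "M \<in> all_SSYT n d" "fnum M < g"
      "bij_betw T (diagram (shape M)) {1..n}" by blast
    then show "b \<in> contr_ker g"
      using subsetD[OF contr_ker_mono F_fin_in_contr_ker[OF n b(2,4)]] by simp
  qed
  then have A: "A \<in> contr_ker g"
    using AB(2) qpoly.span_minimal[OF _ subspace_contr_ker] by blast
  have B: "B \<in> contr_ker g"
    using qpoly.subspace_diff[OF subspace_contr_ker ker A] AB(1) by simp
  have keysB: "keys p \<subseteq> {1..n}" if "p \<in> keys B" for p
  proof -
    have "?hi \<subseteq> poly_with {1..n} UNIV" using F_fin_poly_with by blast
    then have "B \<in> poly_with {1..n} UNIV"
      using AB(3) qpoly.span_minimal[OF _ subspace_poly_with] by blast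
    then show ?thesis using that by (simp add: poly_with_def)
  qed
  have "ip B b = 0" if "b \<in> ?hi" for b
    using that ip_F_fin_contr_ker[OF n _ _ B keysB] by blast
  then have "ip B B = 0" by (rule ip_span_right[OF AB(3)])
  then have "B = 0" by (rule ip_self_eq_0)
  then show ?thesis using AB by simp
qed


section \<open>Straightening the filling\<close>

lemma (in tableau) transposed: "tableau X c r"
proof
  show "\<exists>y\<in>X. c y = i \<and> r y = j" if "x \<in> X" "i \<le> c x" "j \<le> r x" for x i j
    using young[OF that(1,3,2)] by auto
qed (use finite_X box_inj in auto)

text \<open>The set \<open>Z\<close> has more elements than the two columns have rows, so after
  any column permutation two elements of \<open>Z\<close> share a row; their transposition fixes
  the polynomial but changes the sign of the alternating sum.\<close>

lemma (in tableau) garnir_relation: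
  assumes s: "\<And>\<pi>. \<pi> \<in> stab X r \<Longrightarrow> perm_act \<pi> s = s"
    and Z: "Z \<subseteq> {x \<in> X. c x = j \<or> c x = Suc j}" "card {x \<in> X. c x = j} < card Z"
  shows "alt_sum (Perm Z) (alt_sum (stab X c) s) = 0"
proof -
  have finZ: "finite Z" using Z(1) finite_X by (auto intro: finite_subset)
  have "alt_sum (Perm Z) (perm_act \<sigma> s) = 0" if \<sigma>: "\<sigma> \<in> stab X c" for \<sigma>
  proof -
    let ?f = "\<lambda>z. r (inv \<sigma> z)"
    have iX: "inv \<sigma> z \<in> X" "c (inv \<sigma> z) = c z" if "z \<in> X" for z
      using that stab_lab[OF stab_inv[OF \<sigma>] that] permutes_in_image[OF stab_permutes[OF stab_inv[OF \<sigma>]]] by auto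
    have "?f ` Z \<subseteq> r ` {x \<in> X. c x = j}"
    proof
      fix a assume "a \<in> ?f ` Z"
      then obtain z where z: "z \<in> X" "c z = j \<or> c z = Suc j" "a = r (inv \<sigma> z)" using Z(1) by auto
      then obtain y where "y \<in> X" "r y = a" "c y = j"
        using young[OF iX(1)[OF z(1)], of a j] iX(2)[OF z(1)] by auto
      then show "a \<in> r ` {x \<in> X. c x = j}" by blast
    qed
    then have "card (?f ` Z) \<le> card (r ` {x \<in> X. c x = j})" by (rule card_mono[rotated]) (simp add: finite_X)
    also have "\<dots> \<le> card {x \<in> X. c x = j}" by (rule card_image_le) (simp add: finite_X)
    finally have "card (?f ` Z) \<le> card {x \<in> X. c x = j}" .
    then have "\<not> inj_on ?f Z" using Z(2) card_image[of ?f Z] by linarith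
    then obtain u v where uv: "u \<in> Z" "v \<in> Z" "u \<noteq> v" "?f u = ?f v" by (auto simp: inj_on_def)
    let ?t = "Transposition.transpose u v" and ?t' = "Transposition.transpose (inv \<sigma> u) (inv \<sigma> v)"
    have uX: "u \<in> X" "v \<in> X" using uv Z(1) by auto
    have b: "bij \<sigma>" using \<sigma> by (rule stab_bij)
    have comm: "?t \<circ> \<sigma> = \<sigma> \<circ> ?t'" using transpose_comp_eq[OF b, of u v] .
    have "?t' \<in> stab X r" using uv iX uX by (intro transpose_in_stab) auto
    then have "perm_act ?t' s = s" by (rule s)
    then have fixed: "perm_act ?t (perm_act \<sigma> s) = perm_act \<sigma> s"
      using perm_act_compose[OF bij_transpose b, of u v s] perm_act_compose[OF b bij_transpose, of "inv \<sigma> u" "inv \<sigma> v" s] comm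
      by simp
    have t: "?t \<in> Perm Z" using uv by (intro transpose_in_stab) auto
    have "alt_sum (Perm Z) (perm_act \<sigma> s) = - alt_sum (Perm Z) (perm_act \<sigma> s)"
      using alt_sum_perm_act[OF finZ t, of "perm_act \<sigma> s"] fixed uv(3) by (simp add: sign_swap_id)
    then show ?thesis by (metis (no_types, lifting) equal_neg_zero lookup_uminus lookup_zero poly_mapping_eqI)
  qed
  then show ?thesis
    by (simp add: alt_sum_def[of "stab X c"] lin_sum[OF lin_alt_sum] lin_scale[OF lin_alt_sum] cong: sum.cong)
qed

definition standard :: "box set \<Rightarrow> (box \<Rightarrow> nat) \<Rightarrow> bool" where
  "standard D T \<longleftrightarrow> (\<forall>i j. (i, Suc j) \<in> D \<longrightarrow> T (i, j) < T (i, Suc j))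
    \<and> (\<forall>i j. (Suc i, j) \<in> D \<longrightarrow> T (i, j) < T (Suc i, j))"

text \<open>Otherwise take a filling that violates the claim and has the largest sum of column
  index times entry. Its columns may be sorted, which costs only a sign. A descent in some row
  gives a Garnir relation, in which every term either is the same polynomial again or belongs to a
  filling with larger entries moved to the right, for which the claim holds.\<close>

theorem standard_fillings_span:
  assumes D: "young D" and T0: "bij_betw T0 D X"
  shows "filling_poly D h T0 \<in> qpoly.span {filling_poly D h T | T. bij_betw T D X \<and> standard D T}"
    (is "_ \<in> qpoly.span ?S")
proof (rule ccontr)
  assume bad0: "filling_poly D h T0 \<notin> qpoly.span ?S"
  have finD: "finite D" using D by (simp add: young_def)
  have finX: "finite X" using T0 finD bij_betw_finite by blast
  define bad where "bad T \<longleftrightarrow> bij_betw T D X \<and> filling_poly D h T \<notin> qpoly.span ?S" for T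
  \<comment> \<open>The potential grows when larger entries move to the right.\<close>
  define pot where "pot T = (\<Sum>b\<in>D. snd b * T b)" for T :: "box \<Rightarrow> nat"
  have bound: "pot T \<le> (\<Sum>b\<in>D. snd b * Max X)" if "bad T" for T
    unfolding pot_def using that finX by (intro sum_mono mult_le_mono2 Max_ge) (auto simp: bad_def bij_betw_def)
  have "bad T0" using T0 bad0 by (simp add: bad_def)
  then have "\<exists>T. bad T \<and> (\<forall>T'. bad T' \<longrightarrow> pot T' \<le> pot T)"
    by (rule Lattices_Big.ex_has_greatest_nat[where f = pot and b = "Suc (\<Sum>b\<in>D. snd b * Max X)"]) (use bound in \<open>auto simp: less_Suc_eq_le\<close>)
  then obtain T where T: "bad T" and maxT: "\<And>T'. bad T' \<Longrightarrow> pot T' \<le> pot T" by auto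
  have pot_X: "pot (\<sigma> \<circ> T) = (\<Sum>x\<in>X. col_of D T x * \<sigma> x)" if "bij_betw T D X" for T \<sigma>
  proof -
    have "inj_on T D" using that by (auto simp: bij_betw_def)
    then show ?thesis unfolding pot_def
      by (subst sum.reindex_bij_betw[OF that, symmetric]) (intro sum.cong, auto)
  qed
  have bT: "bij_betw T D X" using T by (simp add: bad_def)
  then have injT: "inj_on T D" and imgT: "T ` D = X" by (auto simp: bij_betw_def)
  obtain \<tau> where \<tau>: "\<tau> \<in> stab X (col_of D T)"
    and srt: "\<And>x y. x \<in> X \<Longrightarrow> y \<in> X \<Longrightarrow> col_of D T x = col_of D T y \<Longrightarrow> row_of D T x < row_of D T y \<Longrightarrow> \<tau> x \<le> \<tau> y"
    using sorted_rearrangement[OF finX, of "col_of D T" "row_of D T" "\<lambda>x. x"] by blast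
  \<comment> \<open>Sorting the columns changes the polynomial by a sign and does not change the
    potential.\<close>
  define T1 where "T1 = \<tau> \<circ> T"
  have b1: "bij_betw T1 D X"
    unfolding T1_def by (rule bij_betw_trans[OF bT permutes_imp_bij[OF stab_permutes[OF \<tau>]]])
  then have inj1: "inj_on T1 D" and img1: "T1 ` D = X" by (auto simp: bij_betw_def)
  have F1: "filling_poly D h T1 = scaleQ (sgn_rat \<tau>) (filling_poly D h T)"
    unfolding T1_def using perm_act_filling_poly[OF finD injT stab_bij[OF \<tau>]]
      perm_act_alt_sum[OF finX \<tau>] by (simp add: filling_poly_alt_sum[OF injT] imgT)
  have bad1: "filling_poly D h T1 \<notin> qpoly.span ?S"
  proof
    assume "filling_poly D h T1 \<in> qpoly.span ?S"
    then have "scaleQ (sgn_rat \<tau>) (filling_poly D h T1) \<in> qpoly.span ?S" by (rule qpoly.span_scale)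
    then show False using T by (simp add: F1 bad_def)
  qed
  have pot1: "pot T1 = pot T"
  proof -
    have "pot T1 = (\<Sum>x\<in>X. col_of D T (\<tau> x) * \<tau> x)"
      unfolding T1_def pot_X[OF bT] using \<tau> by (intro sum.cong) (auto simp: stab_lab)
    also have "\<dots> = (\<Sum>x\<in>X. col_of D T x * x)"
      by (rule sum.reindex_bij_betw[OF permutes_imp_bij[OF stab_permutes[OF \<tau>]]])
    finally show ?thesis using pot_X[OF bT, of id] by simp
  qed
  have col1: "T1 (i, j) < T1 (i', j)" if "(i', j) \<in> D" "i < i'" for i i' j
  proof -
    have "(i, j) \<in> D" using youngD[OF D that(1)] that(2) by simp
    then have "T1 (i, j) \<le> T1 (i', j)" unfolding T1_def
      using srt[of "T (i, j)" "T (i', j)"] that injT imgT by auto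
    moreover have "T1 (i, j) \<noteq> T1 (i', j)"
      using inj1 \<open>(i, j) \<in> D\<close> that unfolding inj_on_def by (metis less_irrefl prod.inject)
    ultimately show ?thesis by simp
  qed
  have "\<not> standard D T1"
  proof
    assume "standard D T1"
    then have "filling_poly D h T1 \<in> ?S" using b1 by blast
    then have "filling_poly D h T1 \<in> qpoly.span ?S" by (rule qpoly.span_base)
    then show False using bad1 by (rule notE[rotated])
  qed
  then obtain i j where ij: "(i, Suc j) \<in> D" "T1 (i, Suc j) \<le> T1 (i, j)"
    unfolding standard_def using col1[OF _ lessI] by (auto simp: not_less)
  have ij0: "(i, j) \<in> D" using youngD[OF D ij(1)] by simp
  interpret tableau X "row_of D T1" "col_of D T1" using tableau_filling[OF D inj1] unfolding img1 .
  interpret tr: tableau X "col_of D T1" "row_of D T1" by (rule transposed)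
  let ?r = "row_of D T1" and ?c = "col_of D T1"
  let ?x = "T1 (i, j)" and ?y = "T1 (i, Suc j)"
  have lab: "?x \<in> X" "?y \<in> X" "?r ?x = i" "?r ?y = i" "?c ?x = j" "?c ?y = Suc j"
    using inj1 img1 ij(1) ij0 by auto
  have lt: "?y < ?x"
    using ij(2) lab by (metis le_neq_implies_less n_not_Suc_n)
  define A where "A = {z \<in> X. ?c z = j \<and> i \<le> ?r z}"
  define B where "B = {z \<in> X. ?c z = Suc j \<and> ?r z \<le> i}"
  define Z where "Z = A \<union> B"
  have fin: "finite A" "finite B" using finX by (auto simp: A_def B_def)
  have cardZ: "card Z = Suc (card {z \<in> X. ?c z = j})" and disj: "A \<inter> B = {}"
    using tr.garnir_set[OF lab(1,2)] lab by (simp_all add: A_def B_def Z_def conj_ac cong: conj_cong)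
  have ZX: "Z \<subseteq> {x \<in> X. ?c x = j \<or> ?c x = Suc j}" by (auto simp: Z_def A_def B_def)
  have hi: "?x \<le> a" if a: "a \<in> A" for a
  proof -
    obtain b where b: "b \<in> D" "a = T1 b" using a img1 by (auto simp: A_def)
    then have "snd b = j" "i \<le> fst b" using a inj1 by (auto simp: A_def)
    then show ?thesis using col1[of "fst b" j i] b by (cases "i = fst b") (auto simp: less_imp_le prod.collapse)
  qed
  have lo: "b < ?x" if b: "b \<in> B" for b
  proof -
    obtain a where a: "a \<in> D" "b = T1 a" using b img1 by (auto simp: B_def)
    then have "snd a = Suc j" "fst a \<le> i" using b inj1 by (auto simp: B_def)
    moreover from this(1) have "b = T1 (fst a, Suc j)" using a by (metis prod.collapse)
    ultimately have "b \<le> ?y" using col1[of i "Suc j" "fst a"] ij(1) by (cases "i = fst a") simp_all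
    then show ?thesis using lt by simp
  qed
  let ?F = "filling_poly D h T1"
  have F_alt: "?F = alt_sum (stab X ?c) (row_sum D h T1)"
    using filling_poly_alt_sum[OF inj1] unfolding img1 .
  have zero: "alt_sum (Perm Z) ?F = 0"
    unfolding F_alt
    by (rule garnir_relation[OF _ ZX]) (use row_sum_invariant[OF inj1] img1 cardZ in auto)
  have finZ: "finite Z" using fin by (simp add: Z_def)
  have fixed: "scaleQ (sgn_rat \<pi>) (perm_act \<pi> ?F) = ?F" if p: "\<pi> \<in> Perm Z" and img: "\<pi> ` B = B" for \<pi>
  proof -
    have perm: "\<pi> permutes Z" using p by (rule stab_permutes)
    have "?c (\<pi> z) = ?c z" if "z \<in> Z" for z
    proof (cases "z \<in> B")
      case True
      then have "\<pi> z \<in> B" using img by blast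
      then show ?thesis using True by (simp add: B_def)
    next
      case False
      then have "\<pi> z \<notin> B" using img permutes_inj[OF perm] by (metis imageE inj_eq)
      moreover have "\<pi> z \<in> Z" using that permutes_in_image[OF perm] by simp
      ultimately show ?thesis using False that by (auto simp: Z_def A_def)
    qed
    then have "\<pi> \<in> stab Z ?c" using perm by (simp add: stab_def)
    then have pc: "\<pi> \<in> stab X ?c" by (rule stab_mono[rotated]) (use ZX in auto)
    show ?thesis unfolding F_alt perm_act_alt_sum[OF finX pc] by simp
  qed
  have other: "perm_act \<pi> ?F \<in> qpoly.span ?S" if p: "\<pi> \<in> Perm Z" and img: "\<pi> ` B \<noteq> B" for \<pi>
  proof (rule ccontr)
    assume "perm_act \<pi> ?F \<notin> qpoly.span ?S"
    have perm: "\<pi> permutes Z" using p by (rule stab_permutes)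
    have "Z \<subseteq> X" using ZX by auto
    then have permX: "\<pi> permutes X" using perm by (rule permutes_subset[rotated])
    have "perm_act \<pi> ?F = filling_poly D h (\<pi> \<circ> T1)"
      by (rule perm_act_filling_poly[OF finD inj1 permutes_bij[OF permX]])
    moreover have "bij_betw (\<pi> \<circ> T1) D X" by (rule bij_betw_trans[OF b1 permutes_imp_bij[OF permX]])
    ultimately have "bad (\<pi> \<circ> T1)" using \<open>perm_act \<pi> ?F \<notin> qpoly.span ?S\<close> by (simp add: bad_def)
    then have le: "pot (\<pi> \<circ> T1) \<le> pot T1" using maxT pot1 by simp
    have split: "(\<Sum>x\<in>X. ?c x * f x) = (\<Sum>x\<in>X - Z. ?c x * f x) + j * (\<Sum>x\<in>Z. f x) + (\<Sum>x\<in>B. f x)" for f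
      unfolding Z_def using finX disj by (intro sum_two_adjacent_labels) (auto simp: A_def B_def)
    have "(\<Sum>x\<in>X - Z. ?c x * \<pi> x) = (\<Sum>x\<in>X - Z. ?c x * x)"
      using permutes_not_in[OF perm] by (intro sum.cong) auto
    moreover have "(\<Sum>x\<in>Z. \<pi> x) = (\<Sum>x\<in>Z. x)"
      by (rule sum.reindex_bij_betw[OF permutes_imp_bij[OF perm], of "\<lambda>x. x"])
    moreover have "(\<Sum>x\<in>X. ?c x * \<pi> x) \<le> (\<Sum>x\<in>X. ?c x * x)"
      using le pot_X[OF b1, of \<pi>] pot_X[OF b1, of id] by simp
    ultimately have "(\<Sum>x\<in>B. \<pi> x) \<le> (\<Sum>x\<in>B. x)" unfolding split by simp
    then have le': "(\<Sum>x\<in>\<pi> ` B. x) \<le> (\<Sum>x\<in>B. x)"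
      by (simp add: sum.reindex permutes_inj_on[OF perm])
    have sub: "\<pi> ` B \<subseteq> A \<union> B" using permutes_image[OF perm] by (auto simp: Z_def)
    have cB: "card (\<pi> ` B) = card B" by (simp add: card_image permutes_inj_on[OF perm])
    note ex = minimal_exchange[OF fin sub cB, of ?x "\<lambda>x. x", OF hi less_imp_le[OF lo] le']
    have "B - \<pi> ` B = {}" using ex(3) lo by fastforce
    then have "B \<subseteq> \<pi> ` B" by blast
    then have "\<pi> ` B = B" using card_subset_eq[of "\<pi> ` B" B] cB fin by auto
    then show False using img by simp
  qed
  let ?P = "{\<pi> \<in> Perm Z. \<pi> ` B = B}"
  have finP: "finite (Perm Z)" using finZ by (rule finite_stab)
  have "0 = (\<Sum>\<pi>\<in>?P. scaleQ (sgn_rat \<pi>) (perm_act \<pi> ?F)) + (\<Sum>\<pi>\<in>Perm Z - ?P. scaleQ (sgn_rat \<pi>) (perm_act \<pi> ?F))"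
    using zero sum.subset_diff[of ?P "Perm Z" "\<lambda>\<pi>. scaleQ (sgn_rat \<pi>) (perm_act \<pi> ?F)"] finP
    by (simp add: alt_sum_def add.commute)
  also have "(\<Sum>\<pi>\<in>?P. scaleQ (sgn_rat \<pi>) (perm_act \<pi> ?F)) = (\<Sum>\<pi>\<in>?P. ?F)"
    using fixed by (intro sum.cong) auto
  also have "(\<Sum>\<pi>\<in>?P. ?F) = scaleQ (of_nat (card ?P)) ?F"
    by (rule poly_mapping_eqI) (simp add: lookup_sum lookup_scaleQ del: sum_constant add: sum_constant[where 'a = rat])
  finally have "scaleQ (of_nat (card ?P)) ?F = - (\<Sum>\<pi>\<in>Perm Z - ?P. scaleQ (sgn_rat \<pi>) (perm_act \<pi> ?F))"
    by (simp add: eq_neg_iff_add_eq_0)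
  also have "\<dots> \<in> qpoly.span ?S"
    using other by (intro qpoly.span_neg qpoly.span_sum qpoly.span_scale) auto
  finally have mult: "scaleQ (of_nat (card ?P)) ?F \<in> qpoly.span ?S" .
  have "id \<in> ?P" by (simp add: id_in_stab)
  then have "card ?P \<noteq> 0" using finP by auto
  then have "scaleQ (1 / of_nat (card ?P)) (scaleQ (of_nat (card ?P)) ?F) = ?F" by simp
  then have "?F \<in> qpoly.span ?S" using qpoly.span_scale[OF mult, of "1 / of_nat (card ?P)"] by simp
  then show False using bad1 by simp
qed

lemma filling_poly_cong:
  assumes "inj_on T D" "\<And>b. b \<in> D \<Longrightarrow> T b = T' b"
  shows "filling_poly D h T = filling_poly D h T'"
proof -
  have img: "T ` D = T' ` D" using assms(2) by (rule image_cong[OF refl])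
  have inj': "inj_on T' D" using assms(1) inj_on_cong[of D T T'] assms(2) by simp
  have inv: "inv_into D T x = inv_into D T' x" if x: "x \<in> T ` D" for x
  proof -
    obtain b where b: "b \<in> D" "x = T b" using x by auto
    then show ?thesis
      using inv_into_f_f[OF assms(1) b(1)] inv_into_f_f[OF inj' b(1)] assms(2)[OF b(1)] by simp
  qed
  have "stab (T ` D) (row_of D T) = stab (T' ` D) (row_of D T')"
    "stab (T ` D) (col_of D T) = stab (T' ` D) (col_of D T')"
    unfolding img[symmetric] using inv by (auto intro!: stab_cong simp: row_of_def col_of_def)
  moreover have "fill_mono D h T = fill_mono D h T'"
    unfolding fill_mono_def using assms(2) by (intro sum.cong) auto
  ultimately show ?thesis
    using assms(1) inj' by (simp add: filling_poly_alt_sum row_sum_def row_orbit_def row_stab_eq filling_mono_eq)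
qed

text \<open>Boxes of the first row that are alone in their column and carry the entry
  \<open>0\<close> do not contribute: column permutations fix them, and row permutations of the
  first row fix the monomial.\<close>

lemma filling_poly_restrict:
  assumes D0: "D0 \<subseteq> D" and E: "D - D0 \<subseteq> {0} \<times> UNIV"
    and cols: "\<And>b b'. b \<in> D0 \<Longrightarrow> b' \<in> D - D0 \<Longrightarrow> snd b \<noteq> snd b'"
    and h: "\<And>j. h (0, j) = 0" and inj: "inj_on T D" and fin: "finite D0"
  shows "filling_poly D h T = filling_poly D0 h T"
proof -
  have inj0: "inj_on T D0" using inj D0 by (rule inj_on_subset)
  have sub: "T ` D0 \<subseteq> T ` D" using D0 by blast
  have lab: "row_of D T (T b) = fst b" "col_of D T (T b) = snd b" "row_of D0 T (T b) = fst b" "col_of D0 T (T b) = snd b"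
    if "b \<in> D0" for b using that D0 inj inj0 by auto
  have labc: "stab (T ` D0) (col_of D0 T) = stab (T ` D0) (col_of D T)"
    and labr: "stab (T ` D0) (row_of D0 T) = stab (T ` D0) (row_of D T)"
    by (intro stab_cong; use lab in auto)+
  have "stab (T ` D) (col_of D T) = stab (T ` D0) (col_of D T)"
  proof
    show "stab (T ` D0) (col_of D T) \<subseteq> stab (T ` D) (col_of D T)" using stab_mono[OF sub] by blast
    show "stab (T ` D) (col_of D T) \<subseteq> stab (T ` D0) (col_of D T)"
    proof
      fix \<sigma> assume s: "\<sigma> \<in> stab (T ` D) (col_of D T)"
      have "\<sigma> x = x" if x: "x \<in> T ` D - T ` D0" for x
      proof -
        obtain b where b: "b \<in> D - D0" "x = T b" using x by auto
        have "\<sigma> x \<in> T ` D" using permutes_in_image[OF stab_permutes[OF s]] x by auto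
        then obtain b' where b': "b' \<in> D" "\<sigma> x = T b'" by auto
        have "snd b' = snd b" using stab_lab[OF s, of x] b b' inj by simp
        then have "b' \<in> D - D0" using cols[of b' b] b b' by auto
        then have "fst b' = 0" "fst b = 0" using E b by auto
        then have "b' = b" using \<open>snd b' = snd b\<close> by (simp add: prod_eq_iff)
        then show ?thesis using b b' by simp
      qed
      then have "\<sigma> permutes T ` D0" by (intro permutes_superset[OF stab_permutes[OF s]])
      then show "\<sigma> \<in> stab (T ` D0) (col_of D T)" using s sub by (auto simp: stab_def)
    qed
  qed
  then have colstab: "stab (T ` D) (col_of D T) = stab (T ` D0) (col_of D0 T)" using labc by simp
  have supp: "{b \<in> D. h b \<noteq> 0} = {b \<in> D0. h b \<noteq> 0}" using D0 E h by auto
  have fm: "fill_mono D h T = fill_mono D0 h T" by (simp only: fill_mono_def supp)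
  let ?m = "fill_mono D0 h T"
  define R where "R = {x \<in> T ` D. 0 < row_of D T x}"
  have RD: "R \<subseteq> T ` D" by (auto simp: R_def)
  have RD0: "R \<subseteq> T ` D0" using E inj by (auto simp: R_def)
  have keysR: "keys ?m \<subseteq> R"
  proof
    fix x assume "x \<in> keys ?m"
    then obtain b where b: "b \<in> D0" "h b \<noteq> 0" "x = T b" using keys_fill_mono[OF _ inj0, of h] fin by auto
    then have "fst b \<noteq> 0" using h by (metis prod.collapse)
    then show "x \<in> R" using b D0 inj by (auto simp: R_def)
  qed
  have "row_orbit D h T = row_orbit D0 h T"
  proof
    show "row_orbit D0 h T \<subseteq> row_orbit D h T"
      unfolding row_orbit_def row_stab_eq[OF inj] row_stab_eq[OF inj0] labr filling_mono_eq fm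
      using stab_mono[OF sub] by blast
    show "row_orbit D h T \<subseteq> row_orbit D0 h T"
    proof
      fix p assume "p \<in> row_orbit D h T"
      then obtain \<tau> where t: "\<tau> \<in> stab (T ` D) (row_of D T)" "p = mono_poly (mono_act \<tau> ?m)"
        unfolding row_orbit_def row_stab_eq[OF inj] filling_mono_eq fm by auto
      have st: "\<tau> x \<in> R \<longleftrightarrow> x \<in> R" if "x \<in> T ` D" for x
        using that stab_lab[OF t(1) that] permutes_in_image[OF stab_permutes[OF t(1)], of x] by (simp add: R_def)
      note sp = stab_split[OF t(1) RD st]
      let ?a = "restrict_id \<tau> R" and ?b = "restrict_id \<tau> (T ` D - R)"
      have "mono_act ?b ?m = ?m"
      proof (rule poly_mapping_eqI)
        fix x
        have pb: "?b permutes T ` D - R" using sp(2) by (rule stab_permutes)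
        show "lookup (mono_act ?b ?m) x = lookup ?m x"
        proof (cases "x \<in> T ` D - R")
          case True
          then have "inv ?b x \<in> T ` D - R" using permutes_in_image[OF permutes_inv[OF pb]] by simp
          then have "x \<notin> keys ?m" "inv ?b x \<notin> keys ?m" using True keysR by auto
          then show ?thesis by (simp add: lookup_mono_act[OF stab_bij[OF sp(2)]] in_keys_iff)
        next
          case False
          then have "inv ?b x = x" using permutes_not_in[OF permutes_inv[OF pb]] by simp
          then show ?thesis by (simp add: lookup_mono_act[OF stab_bij[OF sp(2)]])
        qed
      qed
      then have "mono_act \<tau> ?m = mono_act ?a ?m"
        using mono_act_compose[OF stab_bij[OF sp(1)] stab_bij[OF sp(2)], of ?m] sp(3) by simp
      moreover have "?a \<in> stab (T ` D0) (row_of D T)" using stab_mono[OF RD0 sp(1)] .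
      ultimately show "p \<in> row_orbit D0 h T"
        unfolding row_orbit_def row_stab_eq[OF inj0] labr filling_mono_eq using t(2) by auto
    qed
  qed
  then show ?thesis
    by (simp add: filling_poly_alt_sum[OF inj] filling_poly_alt_sum[OF inj0] colstab row_sum_def)
qed


section \<open>Infinite shapes as padded finite shapes\<close>

text \<open>The finite parts of semistandard fillings of infinite shapes.\<close>

definition lower_tableau :: "nat list list \<Rightarrow> bool" where
  "lower_tableau A \<longleftrightarrow> is_partition (shape A) \<and> semistandard A \<and> 0 \<notin> set (concat A)"

definition core_width :: "nat list \<Rightarrow> nat" where
  "core_width lam = (case lam of [] \<Rightarrow> 0 | k # _ \<Rightarrow> k)"

text \<open>The columns of an infinite diagram that meet the finite part \<open>lam\<close>, that
  is, \<open>lam\<close> with its longest row repeated on top.\<close>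

definition core :: "nat list \<Rightarrow> box set" where
  "core lam = diagram (core_width lam # lam)"

text \<open>The tableau on \<open>n\<close> boxes with only zeros in the first row and
  \<open>A\<close> below.\<close>

definition pad :: "nat \<Rightarrow> nat list list \<Rightarrow> nat list list" where
  "pad n A = replicate (n - sum_list (shape A)) 0 # A"

text \<open>From this size on, \<open>pad n A\<close> has a non-empty first row at least as long
  as the second; the row length must not be \<open>0\<close> because partitions have positive
  parts.\<close>

definition pad_bound :: "nat list list \<Rightarrow> nat" where
  "pad_bound A = max 1 (core_width (shape A)) + sum_list (shape A)"

definition lower_entry :: "nat list list \<Rightarrow> box \<Rightarrow> nat" where
  "lower_entry A = (\<lambda>(i, j). case i of 0 \<Rightarrow> 0 | Suc k \<Rightarrow> A ! k ! j)"

abbreviation V_lower :: "nat list list \<Rightarrow> qpoly set" where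
  "V_lower A \<equiv> V_inf (A, {#})"

lemma core_width_max: "is_partition lam \<Longrightarrow> i < length lam \<Longrightarrow> lam ! i \<le> core_width lam"
  using is_partition_antimono[of lam 0 i] by (cases lam) (auto simp: core_width_def)

lemma diagram_pad:
  "diagram (k # lam) = {(i, j). (i = 0 \<and> j < k) \<or> (\<exists>i'. i = Suc i' \<and> (i', j) \<in> diagram lam)}"
  unfolding diagram_Cons by auto

lemma diagram_inf_eq:
  "diagram_inf lam = {(i, j). i = 0 \<or> (\<exists>i'. i = Suc i' \<and> (i', j) \<in> diagram lam)}"
  unfolding diagram_inf_def by auto

lemma column_lt_core_width:
  assumes "is_partition lam" "(i, j) \<in> diagram lam" shows "j < core_width lam"
  using core_width_max[OF assms(1), of i] assms(2) by (auto simp: diagram_def)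

lemma finite_core: "finite (core lam)"
  by (simp add: core_def finite_diagram)

lemma core_column_lt:
  assumes "is_partition lam" "b \<in> core lam" shows "snd b < core_width lam"
  using assms column_lt_core_width[OF assms(1)] by (auto simp: core_def diagram_pad)

lemma filling_poly_core:
  assumes "is_partition lam" and D: "core lam \<subseteq> D" "D - core lam \<subseteq> {0} \<times> {core_width lam..}"
    and "\<And>j. h (0, j) = 0" "inj_on T D"
  shows "filling_poly D h T = filling_poly (core lam) h T"
  using assms core_column_lt[OF assms(1)]
  by (intro filling_poly_restrict finite_core) (auto, fastforce)

lemma core_subset_diagram: "core_width lam \<le> k \<Longrightarrow> core lam \<subseteq> diagram (k # lam)"
  and diagram_minus_core: "diagram (k # lam) - core lam \<subseteq> {0} \<times> {core_width lam..}"
  and core_subset_inf: "core lam \<subseteq> diagram_inf lam"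
  and inf_minus_core: "diagram_inf lam - core lam \<subseteq> {0} \<times> {core_width lam..}"
  by (auto simp: core_def diagram_pad diagram_inf_eq)

lemma F_inf_core:
  assumes "is_partition (shape A)" "inj_on T (diagram_inf (shape A))"
  shows "F_inf (A, {#}) T = filling_poly (core (shape A)) (lower_entry A) T"
  unfolding F_inf_def fst_conv lower_entry_def[symmetric]
  by (rule filling_poly_core[OF assms(1) core_subset_inf inf_minus_core _ assms(2)])
     (simp add: lower_entry_def)

lemma shape_pad: "shape (pad n A) = (n - sum_list (shape A)) # shape A"
  by (simp add: shape_def pad_def)

lemma filling_poly_entry_cong:
  assumes "\<And>b. b \<in> D \<Longrightarrow> h b = h' b" shows "filling_poly D h T = filling_poly D h' T"
proof -
  have "{b \<in> D. h b \<noteq> 0} = {b \<in> D. h' b \<noteq> 0}" using assms by auto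
  then have "fill_mono D h T = fill_mono D h' T"
    unfolding fill_mono_def using assms by (intro sum.cong) auto
  then show ?thesis by (simp add: filling_poly_eq row_sum_def row_orbit_def filling_mono_eq)
qed

lemma F_fin_pad:
  assumes A: "is_partition (shape A)" and n: "pad_bound A \<le> n" and T: "inj_on T (diagram (shape (pad n A)))"
  shows "F_fin (pad n A) T = filling_poly (core (shape A)) (lower_entry A) T"
proof -
  let ?D = "diagram (shape (pad n A))"
  have "tab_entry (pad n A) b = lower_entry A b" if "b \<in> ?D" for b
    using that[unfolded shape_pad]
    by (cases b) (auto simp: diagram_pad pad_def lower_entry_def split: nat.split)
  then have "F_fin (pad n A) T = filling_poly ?D (lower_entry A) T"
    unfolding F_fin_eq by (rule filling_poly_entry_cong)
  also have "\<dots> = filling_poly (core (shape A)) (lower_entry A) T"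
  proof (rule filling_poly_core[OF A _ _ _ T])
    have "core_width (shape A) \<le> n - sum_list (shape A)" using n by (simp add: pad_bound_def)
    then show "core (shape A) \<subseteq> ?D" unfolding shape_pad by (rule core_subset_diagram)
    show "?D - core (shape A) \<subseteq> {0} \<times> {core_width (shape A)..}"
      unfolding shape_pad by (rule diagram_minus_core)
  qed (simp add: lower_entry_def)
  finally show ?thesis .
qed

lemma pad_is_partition:
  assumes A: "is_partition (shape A)" and n: "pad_bound A \<le> n"
  shows "is_partition (shape (pad n A))" "sum_list (shape (pad n A)) = n"
proof -
  have k: "core_width (shape A) \<le> n - sum_list (shape A)" "n - sum_list (shape A) \<noteq> 0" "sum_list (shape A) \<le> n"
    using n by (auto simp: pad_bound_def)
  have "x \<le> n - sum_list (shape A)" if "x \<in> set (shape A)" for x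
    using that core_width_max[OF A] k(1) by (metis in_set_conv_nth order.trans)
  then show "is_partition (shape (pad n A))" using A k unfolding is_partition_def shape_pad by auto
  show "sum_list (shape (pad n A)) = n" using k by (simp add: shape_pad)
qed

lemma pad_semistandard:
  assumes A: "lower_tableau A" and n: "pad_bound A \<le> n" shows "semistandard (pad n A)"
  unfolding semistandard_def
proof (intro conjI ballI allI impI)
  fix u assume "u \<in> set (pad n A)"
  then show "sorted u" using A by (auto simp: pad_def lower_tableau_def semistandard_def)
next
  fix i j assume a: "Suc i < length (pad n A) \<and> j < length (pad n A ! Suc i)"
  show "pad n A ! i ! j < pad n A ! Suc i ! j"
  proof (cases i)
    case 0
    then have j: "0 < length A" "j < length (A ! 0)" using a by (auto simp: pad_def)
    then have "A ! 0 ! j \<in> set (concat A)" by (auto intro!: bexI[of _ "A ! 0"])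
    then have pos: "0 < A ! 0 ! j" using A by (metis gr0I lower_tableau_def)
    have "length (A ! 0) = core_width (shape A)" using j by (cases A) (auto simp: core_width_def shape_def)
    then have "j < n - sum_list (shape A)" using n j by (simp add: pad_bound_def)
    then show ?thesis using pos 0 by (simp add: pad_def)
  next
    case (Suc k)
    then show ?thesis using a A by (simp add: pad_def lower_tableau_def semistandard_def)
  qed
qed

lemma fnum_pad [simp]: "fnum (pad n A) = 0"
  by (simp add: fnum_def pad_def)

lemma tab_content_pad:
  assumes "lower_tableau A" shows "tab_content (pad n A) = mset (concat A)"
proof -
  have "filter_mset (\<lambda>h. h \<noteq> 0) (mset (concat A)) = mset (concat A)"
  proof -
    have "filter_mset (\<lambda>h. h \<noteq> 0) N = N" if "0 \<notin># N" for N :: "nat multiset"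
      using that by (induction N) auto
    then show ?thesis using assms by (simp add: lower_tableau_def)
  qed
  moreover have "filter_mset (\<lambda>h. h \<noteq> 0) (mset (replicate k (0::nat))) = {#}" for k
    by (rule multiset_eqI) (simp add: not_in_iff[symmetric])
  ultimately show ?thesis
    unfolding tab_content_def pad_def concat.simps mset_append filter_union_mset
    by (simp only: add_0)
qed

lemma pad_in_all_SSYT:
  assumes "lower_tableau A" "pad_bound A \<le> n"
  shows "pad n A \<in> all_SSYT n (sum_mset (mset (concat A)))"
proof -
  have "sum_list (concat (pad n A)) = sum_mset (mset (concat A))"
    by (simp add: pad_def sum_list_replicate sum_mset_sum_list)
  then show ?thesis
    using assms pad_is_partition[of A n] pad_semistandard[of A n]
    by (auto simp: all_SSYT_def partitions_of_def SSYT_def lower_tableau_def)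
qed

text \<open>Strictness of columns makes all entries below the first row positive.\<close>

lemma unpad:
  assumes n: "n \<ge> 1" and M: "M \<in> all_SSYT n d" and f: "fnum M = 0"
  obtains A where "lower_tableau A" "pad_bound A \<le> n" "M = pad n A" "tab_content M = mset (concat A)"
proof -
  have p: "is_partition (shape M)" "sum_list (shape M) = n" "semistandard M"
    using M by (auto simp: all_SSYT_def partitions_of_def SSYT_def)
  then obtain u A where MA: "M = u # A" using n by (cases M) (auto simp: shape_def)
  have "filter (\<lambda>h. h \<noteq> 0) u = []" using f by (simp add: fnum_def MA)
  then have u: "u = replicate (length u) 0" by (simp add: filter_empty_conv replicate_length_same)
  have shM: "shape M = length u # shape A" by (simp add: MA shape_def)
  have len: "length u = n - sum_list (shape A)" using p(2) by (simp add: shM)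
  then have pad: "M = pad n A" using u MA by (simp add: pad_def)
  have pA: "is_partition (shape A)" using p(1) by (auto simp: shM is_partition_def)
  have ssA: "semistandard A"
    unfolding semistandard_def
  proof (intro conjI allI impI)
    show "\<forall>v\<in>set A. sorted v" using p(3) by (simp add: MA semistandard_def)
    show "A ! i ! j < A ! Suc i ! j" if "Suc i < length A \<and> j < length (A ! Suc i)" for i j
    proof -
      have "Suc (Suc i) < length M \<and> j < length (M ! Suc (Suc i))" using that by (simp add: MA)
      then have "M ! Suc i ! j < M ! Suc (Suc i) ! j" using p(3) unfolding semistandard_def by blast
      then show ?thesis by (simp add: MA)
    qed
  qed
  have "0 < A ! i ! j" if "i < length A" "j < length (A ! i)" for i j
  proof -
    have "Suc i < length M \<and> j < length (M ! Suc i)" using that by (simp add: MA)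
    then have "M ! i ! j < M ! Suc i ! j" using p(3) unfolding semistandard_def by blast
    then show ?thesis by (simp add: MA)
  qed
  then have "0 \<notin> set (concat A)" by (auto simp: in_set_conv_nth)
  then have vA: "lower_tableau A" using pA ssA by (simp add: lower_tableau_def)
  have "core_width (shape A) \<le> length u"
    using p(1)[unfolded shM] by (cases "shape A") (auto simp: core_width_def is_partition_def)
  moreover have "length u \<noteq> 0" using p(1) by (auto simp: shM is_partition_def)
  ultimately have "pad_bound A \<le> n" using len by (simp add: pad_bound_def)
  then show ?thesis using that vA pad tab_content_pad[OF vA] by simp
qed


section \<open>The bottom layer is spanned\<close>

lemma extend_to_bijection:
  assumes "finite D" "D0 \<subseteq> D" "inj_on f D0" "f ` D0 \<subseteq> X" "finite X" "card X = card D"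
  obtains g where "bij_betw g D X" "\<And>b. b \<in> D0 \<Longrightarrow> g b = f b"
proof -
  have "card (D - D0) = card (X - f ` D0)"
    using assms by (simp add: card_Diff_subset finite_subset card_image)
  then obtain e where e: "bij_betw e (D - D0) (X - f ` D0)"
    using finite_same_card_bij[of "D - D0" "X - f ` D0"] assms by auto
  define g where "g b = (if b \<in> D0 then f b else e b)" for b
  have "bij_betw g D0 (f ` D0)" using assms(3) by (simp add: bij_betw_def g_def inj_on_def)
  moreover have "bij_betw g (D - D0) (X - f ` D0)"
    using e by (rule bij_betw_cong[THEN iffD1, rotated]) (simp add: g_def)
  ultimately have "bij_betw g (D0 \<union> (D - D0)) (f ` D0 \<union> (X - f ` D0))"
    by (rule bij_betw_combine) auto
  moreover have "D0 \<union> (D - D0) = D" "f ` D0 \<union> (X - f ` D0) = X" using assms by auto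
  ultimately have "bij_betw g D X" by simp
  then show ?thesis by (rule that) (simp add: g_def)
qed

lemma core_subset_pad:
  "pad_bound A \<le> n \<Longrightarrow> core (shape A) \<subseteq> diagram (shape (pad n A))"
  unfolding shape_pad by (rule core_subset_diagram) (simp add: pad_bound_def)

lemma core_filling_extends:
  assumes A: "is_partition (shape A)" and n: "pad_bound A \<le> n"
    and T0: "inj_on T0 (core (shape A))" "T0 ` core (shape A) \<subseteq> {1..n}"
  obtains T where "bij_betw T (diagram (shape (pad n A))) {1..n}"
    "F_fin (pad n A) T = filling_poly (core (shape A)) (lower_entry A) T0"
proof -
  have "card {1..n} = card (diagram (shape (pad n A)))"
    using pad_is_partition(2)[OF A n] by (simp add: card_diagram)
  then obtain T where T: "bij_betw T (diagram (shape (pad n A))) {1..n}" "\<And>b. b \<in> core (shape A) \<Longrightarrow> T b = T0 b"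
    using extend_to_bijection[OF finite_diagram core_subset_pad[OF n] T0 finite_atLeastAtMost] by metis
  have "F_fin (pad n A) T = filling_poly (core (shape A)) (lower_entry A) T"
    using T(1) by (intro F_fin_pad[OF A n]) (simp add: bij_betw_def)
  also have "\<dots> = filling_poly (core (shape A)) (lower_entry A) T0"
    using T(2) T0(1) by (intro filling_poly_cong[symmetric]) auto
  finally show ?thesis using that T(1) by blast
qed

lemma standard_extends_to_infinite:
  assumes lam: "is_partition lam" and k: "core_width lam \<le> k"
    and T: "bij_betw T (diagram (k # lam)) {1..k + sum_list lam}" "standard (diagram (k # lam)) T"
  obtains T' where "T' \<in> SYT_inf lam" "\<And>b. b \<in> core lam \<Longrightarrow> T' b = T b"
proof -
  let ?D = "diagram (k # lam)" and ?n = "k + sum_list lam"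
  have D: "young ?D"
  proof (cases "k = 0")
    case True
    then have "lam = []" using k lam by (cases lam) (auto simp: core_width_def is_partition_def)
    then have "diagram (k # lam) = {}" using True by (auto simp: diagram_def)
    then show ?thesis by (simp add: young_def)
  next
    case False
    have "x \<le> k" if "x \<in> set lam" for x
      using that core_width_max[OF lam] k by (metis in_set_conv_nth order.trans)
    then show ?thesis using lam False by (intro young_diagram) (auto simp: is_partition_def)
  qed
  have low: "(Suc i, j) \<in> diagram_inf lam \<longleftrightarrow> (Suc i, j) \<in> ?D" for i j
    by (simp add: diagram_pad diagram_inf_eq)
  have row0: "(0, j) \<in> ?D \<longleftrightarrow> j < k" for j by (simp add: diagram_pad)
  \<comment> \<open>The first row continues with \<open>?n + 1, ?n + 2, \<dots>\<close> from
    column \<open>k\<close> on.\<close>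
  define T' where "T' b = (if b \<in> ?D then T b else snd b + sum_list lam + 1)" for b
  have out: "diagram_inf lam - ?D = {0} \<times> {k..}"
    by (auto simp: diagram_pad diagram_inf_eq)
  have "bij_betw T' ?D {1..?n}" using T(1) by (rule bij_betw_cong[THEN iffD1, rotated]) (simp add: T'_def)
  moreover have "bij_betw T' ({0} \<times> {k..}) {?n + 1..}"
  proof (rule bij_betw_imageI)
    have val: "T' (0, j) = j + sum_list lam + 1" if "k \<le> j" for j using that row0[of j] by (simp add: T'_def)
    show "inj_on T' ({0} \<times> {k..})" by (auto simp: inj_on_def val)
    show "T' ` ({0} \<times> {k..}) = {?n + 1..}"
    proof
      show "T' ` ({0} \<times> {k..}) \<subseteq> {?n + 1..}" by (auto simp: val)
      show "{?n + 1..} \<subseteq> T' ` ({0} \<times> {k..})"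
      proof
        fix x assume x: "x \<in> {?n + 1..}"
        then have "x = T' (0, x - sum_list lam - 1)" "k \<le> x - sum_list lam - 1" by (auto simp: val)
        then show "x \<in> T' ` ({0} \<times> {k..})" by blast
      qed
    qed
  qed
  ultimately have "bij_betw T' (?D \<union> {0} \<times> {k..}) ({1..?n} \<union> {?n + 1..})"
    by (rule bij_betw_combine) auto
  moreover have "?D \<union> {0} \<times> {k..} = diagram_inf lam" by (auto simp: diagram_pad diagram_inf_eq)
  moreover have "{1..?n} \<union> {?n + 1..} = {1..}" by auto
  ultimately have bij: "bij_betw T' (diagram_inf lam) {1..}" by simp
  have Tn: "T b \<le> ?n" if "b \<in> ?D" for b using T(1) that by (auto simp: bij_betw_def)
  have rows: "T' (i, j) < T' (i, Suc j)" if "(i, Suc j) \<in> diagram_inf lam" for i j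
  proof (cases "(i, Suc j) \<in> ?D")
    case True
    then have "(i, j) \<in> ?D" using youngD[OF D, of i "Suc j" i j] by simp
    then show ?thesis using True T(2) by (simp add: T'_def standard_def)
  next
    case False
    then have i: "i = 0" "k \<le> Suc j" using that out by auto
    show ?thesis
    proof (cases "(i, j) \<in> ?D")
      case True
      then show ?thesis using False i Tn[OF True] by (simp add: T'_def)
    next
      case False': False
      then show ?thesis using False by (simp add: T'_def)
    qed
  qed
  have cols: "T' (i, j) < T' (Suc i, j)" if "(Suc i, j) \<in> diagram_inf lam" for i j
  proof -
    have "(Suc i, j) \<in> ?D" using that low by simp
    moreover from this have "(i, j) \<in> ?D" using youngD[OF D, of "Suc i" j i j] by simp
    ultimately show ?thesis using T(2) by (simp add: T'_def standard_def)
  qed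
  have "T' \<in> SYT_inf lam" using bij rows cols by (simp add: SYT_inf_def)
  then show ?thesis
    by (rule that) (use core_subset_diagram[OF k] in \<open>auto simp: T'_def\<close>)
qed

text \<open>The space \<open>V_lower A\<close> is defined by standard fillings of the infinite
  diagram, but every injective filling of the core belongs to it: extend the filling to a finite
  padded shape, straighten it there, and continue the resulting standard fillings along the first
  row.\<close>

lemma core_filling_in_V_lower:
  assumes A: "is_partition (shape A)" and T0: "inj_on T0 (core (shape A))" "T0 ` core (shape A) \<subseteq> {1..}"
  shows "filling_poly (core (shape A)) (lower_entry A) T0 \<in> V_lower A"
proof -
  define n where "n = max (pad_bound A) (Max (insert 0 (T0 ` core (shape A))))"
  have n: "pad_bound A \<le> n" by (simp add: n_def)
  have "T0 b \<le> n" if "b \<in> core (shape A)" for b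
    using that finite_core[of "shape A"] unfolding n_def by (intro max.coboundedI2 Max_ge) auto
  then have "T0 ` core (shape A) \<subseteq> {1..n}" using T0(2) by auto
  then obtain T where T: "bij_betw T (diagram (shape (pad n A))) {1..n}"
    "F_fin (pad n A) T = filling_poly (core (shape A)) (lower_entry A) T0"
    using core_filling_extends[OF A n T0(1)] by blast
  let ?D = "diagram (shape (pad n A))"
  have k: "core_width (shape A) \<le> n - sum_list (shape A)" "n = n - sum_list (shape A) + sum_list (shape A)"
    using n by (auto simp: pad_bound_def)
  have "filling_poly ?D (tab_entry (pad n A)) T
      \<in> qpoly.span {filling_poly ?D (tab_entry (pad n A)) T |T. bij_betw T ?D {1..n} \<and> standard ?D T}"
    by (rule standard_fillings_span[OF young_diagram[OF pad_is_partition(1)[OF A n]] T(1)])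
  moreover have "{filling_poly ?D (tab_entry (pad n A)) T |T. bij_betw T ?D {1..n} \<and> standard ?D T}
      \<subseteq> {F_inf (A, {#}) T | T. T \<in> SYT_inf (shape A)}"
  proof (clarify)
    fix T assume T: "bij_betw T ?D {1..n}" "standard ?D T"
    obtain T' where T': "T' \<in> SYT_inf (shape A)" "\<And>b. b \<in> core (shape A) \<Longrightarrow> T' b = T b"
      using standard_extends_to_infinite[OF A k(1), of T] T k(2) unfolding shape_pad by auto
    have inj: "inj_on T' (diagram_inf (shape A))" using T'(1) by (auto simp: SYT_inf_def bij_betw_def)
    have injT: "inj_on T ?D" using T(1) by (auto simp: bij_betw_def)
    have "F_fin (pad n A) T = filling_poly (core (shape A)) (lower_entry A) T"
      by (rule F_fin_pad[OF A n injT])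
    also have "\<dots> = filling_poly (core (shape A)) (lower_entry A) T'"
      using T'(2) inj_on_subset[OF injT core_subset_pad[OF n]] by (intro filling_poly_cong) auto
    also have "\<dots> = F_inf (A, {#}) T'" using F_inf_core[OF A inj] by simp
    finally show "\<exists>T'. filling_poly ?D (tab_entry (pad n A)) T = F_inf (A, {#}) T' \<and> T' \<in> SYT_inf (shape A)"
      using T'(1) by (auto simp: F_fin_eq)
  qed
  ultimately have "F_fin (pad n A) T \<in> qpoly.span {F_inf (A, {#}) T | T. T \<in> SYT_inf (shape A)}"
    unfolding F_fin_eq using qpoly.span_mono by blast
  then show ?thesis by (simp add: V_inf_def T(2))
qed

lemma subspace_V_fin: "qpoly.subspace (V_fin M)"
  by (simp add: V_fin_def)

lemma subspace_V_lower: "qpoly.subspace (V_lower A)"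
  by (simp add: V_inf_def)

lemma V_fin_pad_subset:
  assumes A: "is_partition (shape A)" and n: "pad_bound A \<le> n"
  shows "V_fin (pad n A) \<subseteq> V_lower A"
  unfolding V_fin_def
proof (rule qpoly.span_minimal[OF _ subspace_V_lower], clarify)
  fix T assume "bij_betw T (diagram (shape (pad n A))) {1..sum_list (shape (pad n A))}"
  then have T: "inj_on T (diagram (shape (pad n A)))" "T ` diagram (shape (pad n A)) = {1..n}"
    using pad_is_partition(2)[OF A n] by (auto simp: bij_betw_def)
  have "inj_on T (core (shape A))" using T(1) core_subset_pad[OF n] by (rule inj_on_subset)
  moreover have "T ` core (shape A) \<subseteq> {1..}" using T(2) core_subset_pad[OF n] by force
  ultimately show "F_fin (pad n A) T \<in> V_lower A"
    unfolding F_fin_pad[OF A n T(1)] by (rule core_filling_in_V_lower[OF A])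
qed

lemma V_lower_generator_core:
  assumes A: "is_partition (shape A)" and T: "T \<in> SYT_inf (shape A)"
  shows "F_inf (A, {#}) T = filling_poly (core (shape A)) (lower_entry A) T"
    "inj_on T (core (shape A))" "T ` core (shape A) \<subseteq> {1..}"
proof -
  have inj: "inj_on T (diagram_inf (shape A))" and img: "T ` diagram_inf (shape A) = {1..}"
    using T by (auto simp: SYT_inf_def bij_betw_def)
  show "F_inf (A, {#}) T = filling_poly (core (shape A)) (lower_entry A) T" by (rule F_inf_core[OF A inj])
  show "inj_on T (core (shape A))" using inj core_subset_inf by (rule inj_on_subset)
  show "T ` core (shape A) \<subseteq> {1..}" using core_subset_inf img by blast
qed

text \<open>An element of \<open>V_lower A\<close> involves finitely many fillings, and in each of
  them only the core matters; so it lives on the padded shape as soon as \<open>n\<close> exceeds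
  all entries in these cores.\<close>

lemma V_lower_eventually_V_fin:
  assumes A: "is_partition (shape A)" and g: "g \<in> V_lower A"
  shows "\<exists>n0\<ge>pad_bound A. \<forall>n\<ge>n0. g \<in> V_fin (pad n A)"
  using g unfolding V_inf_def fst_conv
proof (induction rule: qpoly.span_induct_alt)
  case base
  then show ?case by (intro exI[of _ "pad_bound A"]) (simp add: qpoly.subspace_0[OF subspace_V_fin])
next
  case (step c x y)
  then obtain T n1 where T: "T \<in> SYT_inf (shape A)" "x = F_inf (A, {#}) T"
    and n1: "n1 \<ge> pad_bound A" "\<forall>n\<ge>n1. y \<in> V_fin (pad n A)" by auto
  note core = V_lower_generator_core[OF A T(1)]
  define n0 where "n0 = max n1 (Max (insert 0 (T ` core (shape A))))"
  have "scaleQ c x + y \<in> V_fin (pad n A)" if n: "n0 \<le> n" for n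
  proof -
    have pb: "pad_bound A \<le> n" using n1(1) n by (simp add: n0_def)
    have "T b \<le> n" if "b \<in> core (shape A)" for b
      using that finite_core[of "shape A"] n unfolding n0_def
      by (intro order.trans[OF _ n[unfolded n0_def]] max.coboundedI2 Max_ge) auto
    then have "T ` core (shape A) \<subseteq> {1..n}" using core(3) by auto
    then obtain T' where T': "bij_betw T' (diagram (shape (pad n A))) {1..n}"
      "F_fin (pad n A) T' = filling_poly (core (shape A)) (lower_entry A) T"
      using core_filling_extends[OF A pb core(2)] by blast
    have "F_fin (pad n A) T' \<in> V_fin (pad n A)"
      unfolding V_fin_def using T'(1) pad_is_partition(2)[OF A pb] by (intro qpoly.span_base) auto
    then have "x \<in> V_fin (pad n A)" using T'(2) core(1) T(2) by simp
    moreover have "y \<in> V_fin (pad n A)" using n1(2) n by (simp add: n0_def)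
    ultimately show ?thesis
      by (intro qpoly.subspace_add[OF subspace_V_fin] qpoly.subspace_scale[OF subspace_V_fin])
  qed
  moreover have "pad_bound A \<le> n0" using n1(1) by (simp add: n0_def)
  ultimately show ?case by blast
qed

text \<open>The permutation may be infinite and need not preserve standardness, but it turns a
  filling of the core into another one.\<close>

lemma perm_act_V_lower:
  assumes A: "is_partition (shape A)" and s: "\<sigma> permutes {1..}" and g: "g \<in> V_lower A"
  shows "perm_act \<sigma> g \<in> V_lower A"
  unfolding V_inf_def
proof (rule lin_span[OF lin_perm_act g[unfolded V_inf_def]])
  have b: "bij \<sigma>" using s by (rule permutes_bij)
  fix x assume "x \<in> {F_inf (A, {#}) T |T. T \<in> SYT_inf (shape (fst (A, {#})))}"
  then obtain T where T: "T \<in> SYT_inf (shape A)" "x = F_inf (A, {#}) T" by auto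
  note core = V_lower_generator_core[OF A T(1)]
  have "perm_act \<sigma> x = filling_poly (core (shape A)) (lower_entry A) (\<sigma> \<circ> T)"
    unfolding T(2) core(1) by (rule perm_act_filling_poly[OF finite_core core(2) b])
  also have "\<dots> \<in> V_lower A"
  proof (rule core_filling_in_V_lower[OF A])
    show "inj_on (\<sigma> \<circ> T) (core (shape A))"
      using core(2) b by (metis bij_is_inj comp_inj_on inj_on_subset subset_UNIV)
    show "(\<sigma> \<circ> T) ` core (shape A) \<subseteq> {1..}"
      using core(3) permutes_in_image[OF s] by auto
  qed
  finally show "perm_act \<sigma> x \<in> qpoly.span {F_inf (A, {#}) T |T. T \<in> SYT_inf (shape (fst (A, {#})))}"
    by (simp add: V_inf_def)
qed

lemma V_lower_properties:
  assumes A: "lower_tableau A"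
  shows "V_lower A \<subseteq> contr_ker 1" "V_lower A \<subseteq> poly_with {1..} {mset (concat A)}"
proof -
  have pA: "is_partition (shape A)" using A by (simp add: lower_tableau_def)
  have "g \<in> contr_ker 1 \<and> g \<in> poly_with {1..} {mset (concat A)}" if g: "g \<in> V_lower A" for g
  proof -
    obtain n where n: "pad_bound A \<le> n" "g \<in> V_fin (pad n A)"
      using V_lower_eventually_V_fin[OF pA g] by blast
    have n1: "n \<ge> 1" using n(1) by (simp add: pad_bound_def)
    let ?B = "{F_fin (pad n A) T | T. bij_betw T (diagram (shape (pad n A))) {1..sum_list (shape (pad n A))}}"
    have "?B \<subseteq> contr_ker 1 \<inter> poly_with {1..} {mset (concat A)}"
    proof (clarify, intro IntI)
      fix T assume "bij_betw T (diagram (shape (pad n A))) {1..sum_list (shape (pad n A))}"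
      then have T: "bij_betw T (diagram (shape (pad n A))) {1..n}" using pad_is_partition(2)[OF pA n(1)] by simp
      show "F_fin (pad n A) T \<in> contr_ker 1"
        using F_fin_in_contr_ker[OF n1 pad_in_all_SSYT[OF A n(1)] T] by simp
      have "F_fin (pad n A) T \<in> poly_with {1..n} {mset (concat A)}"
        using F_fin_poly_with[OF T] tab_content_pad[OF A] by simp
      then show "F_fin (pad n A) T \<in> poly_with {1..} {mset (concat A)}"
        using poly_with_mono[of "{1..n}" "{1..}"] by auto
    qed
    then have "V_fin (pad n A) \<subseteq> contr_ker 1 \<inter> poly_with {1..} {mset (concat A)}"
      unfolding V_fin_def
      by (rule qpoly.span_minimal) (intro qpoly.subspace_inter subspace_contr_ker subspace_poly_with)
    then show ?thesis using n(2) by blast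
  qed
  then show "V_lower A \<subseteq> contr_ker 1" "V_lower A \<subseteq> poly_with {1..} {mset (concat A)}" by auto
qed

lemma poly_with_finite_support:
  assumes "F \<in> poly_with {1..} Cs"
  shows "\<exists>n0\<ge>1. \<forall>n\<ge>n0. F \<in> poly_with {1..n} Cs"
proof -
  let ?K = "\<Union>m\<in>keys F. keys m"
  have fin: "finite ?K" by simp
  define n0 where "n0 = Max (insert 1 ?K)"
  have "F \<in> poly_with {1..n} Cs" if "n0 \<le> n" for n
  proof -
    have "i \<le> n" if "m \<in> keys F" "i \<in> keys m" for m i
    proof -
      have "i \<in> insert 1 ?K" using that by blast
      then have "i \<le> n0" unfolding n0_def using fin by (intro Max_ge) auto
      then show ?thesis using \<open>n0 \<le> n\<close> by simp
    qed
    then have "keys m \<subseteq> {1..n}" if "m \<in> keys F" for m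
      using assms that unfolding poly_with_def by fastforce
    then show ?thesis using assms by (simp add: poly_with_def)
  qed
  moreover have "1 \<le> n0" unfolding n0_def using fin by (intro Max_ge) auto
  ultimately show ?thesis by blast
qed

theorem contr_ker_1_spanned:
  assumes Cs: "\<And>\<mu>. \<mu> \<in> Cs \<Longrightarrow> sum_mset \<mu> = d" and F: "F \<in> poly_with {1..} Cs" "F \<in> contr_ker 1"
  shows "F \<in> qpoly.span (\<Union>A\<in>{A. lower_tableau A \<and> mset (concat A) \<in> Cs}. V_lower A)"
proof -
  obtain n where n: "n \<ge> 1" "F \<in> poly_with {1..n} Cs" using poly_with_finite_support[OF F(1)] by blast
  let ?B = "{F_fin M T | M T. M \<in> all_SSYT n d \<and> fnum M < 1 \<and> tab_content M \<in> Cs \<and>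
    bij_betw T (diagram (shape M)) {1..n}}"
  have "F \<in> qpoly.span ?B" using contr_ker_characterisation[OF n(1) Cs n(2) F(2)] by simp
  moreover have "?B \<subseteq> (\<Union>A\<in>{A. lower_tableau A \<and> mset (concat A) \<in> Cs}. V_lower A)"
  proof
    fix b assume "b \<in> ?B"
    then obtain M T where b: "b = F_fin M T" and M: "M \<in> all_SSYT n d" "fnum M < 1" "tab_content M \<in> Cs"
      and T: "bij_betw T (diagram (shape M)) {1..n}" by blast
    obtain A where A: "lower_tableau A" "pad_bound A \<le> n" "M = pad n A" "tab_content M = mset (concat A)"
      using unpad[OF n(1) M(1)] M(2) by auto
    have pA: "is_partition (shape A)" using A(1) by (simp add: lower_tableau_def)
    have "F_fin M T \<in> V_fin (pad n A)"
      unfolding V_fin_def using T A(3) pad_is_partition(2)[OF pA A(2)] by (intro qpoly.span_base) auto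
    then have "F_fin M T \<in> V_lower A" using V_fin_pad_subset[OF pA A(2)] by blast
    then show "b \<in> (\<Union>A\<in>{A. lower_tableau A \<and> mset (concat A) \<in> Cs}. V_lower A)" using A M(3) b by auto
  qed
  ultimately show ?thesis using qpoly.span_mono by blast
qed


section \<open>Row symmetrisers separate tableaux\<close>

text \<open>For each bound \<open>v\<close> the positions with value at most \<open>v\<close> form
  an initial segment of their class, before and after the rearrangement, and both segments have
  the same size.\<close>

lemma sorted_unique:
  fixes q w lab :: "nat \<Rightarrow> nat"
  assumes X: "finite X" and inj: "\<And>x y. x \<in> X \<Longrightarrow> y \<in> X \<Longrightarrow> lab x = lab y \<Longrightarrow> w x = w y \<Longrightarrow> x = y"
    and t: "\<tau> \<in> stab X lab"
    and s1: "\<And>x y. x \<in> X \<Longrightarrow> y \<in> X \<Longrightarrow> lab x = lab y \<Longrightarrow> w x < w y \<Longrightarrow> q x \<le> q y"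
    and s2: "\<And>x y. x \<in> X \<Longrightarrow> y \<in> X \<Longrightarrow> lab x = lab y \<Longrightarrow> w x < w y \<Longrightarrow> q (\<tau> x) \<le> q (\<tau> y)"
    and x: "x \<in> X"
  shows "q (\<tau> x) = q x"
proof -
  let ?L = "{y \<in> X. lab y = lab x}"
  have same: "{y \<in> ?L. q y \<le> v} = {y \<in> ?L. q (\<tau> y) \<le> v}" (is "?S = ?S'") for v
  proof -
    have fin: "finite ?S" "finite ?S'" using X by auto
    have "\<tau> ` ?S' = ?S"
    proof
      show "\<tau> ` ?S' \<subseteq> ?S" using stab_lab[OF t] permutes_in_image[OF stab_permutes[OF t]] by auto
      show "?S \<subseteq> \<tau> ` ?S'"
      proof
        fix y assume y: "y \<in> ?S"
        have yi: "\<tau> (inv \<tau> y) = y" using permutes_inverses(1)[OF stab_permutes[OF t]] .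
        have "inv \<tau> y \<in> ?S'"
          using y yi stab_lab[OF stab_inv[OF t], of y] permutes_in_image[OF stab_permutes[OF stab_inv[OF t]], of y] by simp
        with yi[symmetric] show "y \<in> \<tau> ` ?S'" by (rule image_eqI)
      qed
    qed
    then have card: "card ?S = card ?S'"
      using card_image[OF permutes_inj_on[OF stab_permutes[OF t]], of ?S'] by simp
    have "?S \<subseteq> ?S' \<or> ?S' \<subseteq> ?S"
    proof (rule ccontr)
      assume "\<not> ?thesis"
      then obtain y z where y: "y \<in> ?S" "y \<notin> ?S'" and z: "z \<in> ?S'" "z \<notin> ?S" by blast
      then have "w y \<noteq> w z" using inj[of y z] by auto
      then consider "w y < w z" | "w z < w y" by linarith
      then show False
      proof cases
        case 1 then show False using s2[of y z] y z by auto
      next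
        case 2 then show False using s1[of z y] y z by auto
      qed
    qed
    then show ?thesis using card card_subset_eq[OF fin(2), of ?S] card_subset_eq[OF fin(1), of ?S'] by auto
  qed
  have "q x \<le> v \<longleftrightarrow> q (\<tau> x) \<le> v" for v
    using arg_cong[OF same[of v], of "\<lambda>S. x \<in> S"] x by simp
  then show ?thesis by (metis le_antisym order_refl)
qed

lemma alt_sum_idem:
  assumes "finite X"
  shows "alt_sum (stab X lab) (alt_sum (stab X lab) F) = scaleQ (of_nat (card (stab X lab))) (alt_sum (stab X lab) F)"
proof -
  have "alt_sum (stab X lab) (alt_sum (stab X lab) F) = (\<Sum>\<sigma>\<in>stab X lab. alt_sum (stab X lab) F)"
    unfolding alt_sum_def[of _ "alt_sum _ _"]
    by (intro sum.cong refl) (simp add: perm_act_alt_sum[OF assms])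
  then show ?thesis
    by (intro poly_mapping_eqI)
      (simp add: lookup_sum lookup_scaleQ del: sum_constant add: sum_constant[where 'a = rat])
qed

text \<open>The orbit consists of distinct monomials, so each has coefficient one.\<close>

lemma lookup_row_sum:
  assumes "finite D" "inj_on T D"
  shows "lookup (row_sum D h T) m = (if mono_poly m \<in> row_orbit D h T then 1 else 0)"
proof -
  have fin: "finite (row_orbit D h T)" using assms by (rule finite_row_orbit)
  have "lookup (row_sum D h T) m = (\<Sum>p\<in>row_orbit D h T. lookup p m)"
    by (simp add: row_sum_def lookup_sum)
  also have "\<dots> = (\<Sum>p\<in>row_orbit D h T. if p = mono_poly m then 1 else 0)"
  proof (rule sum.cong[OF refl])
    fix p assume "p \<in> row_orbit D h T"
    then obtain m' where p: "p = mono_poly m'"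
      using assms by (auto simp: row_orbit_def row_stab_eq filling_mono_eq)
    have "mono_poly m' = mono_poly m \<longleftrightarrow> m' = m"
      by (metis keys_mono_poly singleton_inject)
    then show "lookup p m = (if p = mono_poly m then 1 else 0)" by (simp add: p lookup_mono_poly)
  qed
  finally show ?thesis using fin by (simp add: sum.delta)
qed

lemma young_rows:
  assumes "young D" "inj_on T D"
  shows "D = {(i, j). j < card {x \<in> T ` D. row_of D T x = i}}"
proof -
  interpret tableau "T ` D" "row_of D T" "col_of D T" by (rule tableau_filling[OF assms])
  have "boxes = D" 
  proof -
    have "boxes = (\<lambda>b. (row_of D T (T b), col_of D T (T b))) ` D" by (simp add: boxes_def image_image)
    also have "\<dots> = (\<lambda>b. b) ` D" using assms(2) by (intro image_cong) auto
    finally show ?thesis by simp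
  qed
  then show ?thesis using boxes_eq by simp
qed

text \<open>If two elements of one column of the second tableau lay in the same row of the first,
  their transposition would show that the result is \<open>0\<close>. So the columns of the second
  tableau can be sorted by the row labels of the first, and strictly increasing labels are at
  least as large as the row index.\<close>

lemma row_symmetriser_cases:
  assumes D': "young D'" and T0: "bij_betw T0 D0 X" and T': "bij_betw T' D' X"
    and nz: "sym_sum (stab X (row_of D0 T0)) (filling_poly D' h T') \<noteq> 0"
  obtains \<sigma> where "\<sigma> \<in> stab X (col_of D' T')" "\<forall>b\<in>D'. fst b \<le> row_of D0 T0 (\<sigma> (T' b))"
proof -
  let ?rr = "row_of D0 T0" and ?c = "col_of D' T'" and ?r = "row_of D' T'"
  have inj: "inj_on T' D'" and img: "T' ` D' = X" using T' by (auto simp: bij_betw_def)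
  have finX: "finite X" using D' img by (auto simp: young_def)
  have F: "filling_poly D' h T' = alt_sum (stab X ?c) (row_sum D' h T')"
    using filling_poly_alt_sum[OF inj] unfolding img .
  have distinct: "?rr x \<noteq> ?rr y" if xy: "x \<in> X" "y \<in> X" "x \<noteq> y" "?c x = ?c y" for x y
  proof
    assume r: "?rr x = ?rr y"
    let ?t = "Transposition.transpose x y"
    have tr: "?t \<in> stab X ?rr" and tc: "?t \<in> stab X ?c" using xy r by (auto intro: transpose_in_stab)
    have "perm_act ?t (filling_poly D' h T') = - filling_poly D' h T'"
      unfolding F perm_act_alt_sum[OF finX tc] using xy(3) by (simp add: sign_swap_id)
    then have "sym_sum (stab X ?rr) (filling_poly D' h T') = - sym_sum (stab X ?rr) (filling_poly D' h T')"
      using sym_sum_perm_act[OF tr, of "filling_poly D' h T'"] lin_diff[OF lin_sym_sum, of "stab X ?rr" 0] lin_0[OF lin_sym_sum]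
      by simp
    then have "sym_sum (stab X ?rr) (filling_poly D' h T') = 0"
      by (metis (no_types, lifting) equal_neg_zero lookup_uminus lookup_zero poly_mapping_eqI)
    then show False using nz by simp
  qed
  obtain \<sigma> where s: "\<sigma> \<in> stab X ?c"
    and srt: "\<And>x y. x \<in> X \<Longrightarrow> y \<in> X \<Longrightarrow> ?c x = ?c y \<Longrightarrow> ?r x < ?r y \<Longrightarrow> ?rr (\<sigma> x) \<le> ?rr (\<sigma> y)"
    using sorted_rearrangement[OF finX, of ?c ?r ?rr] by blast
  have sX: "\<sigma> x \<in> X" if "x \<in> X" for x using that permutes_in_image[OF stab_permutes[OF s]] by simp
  have strict: "?rr (\<sigma> x) < ?rr (\<sigma> y)" if xy: "x \<in> X" "y \<in> X" "?c x = ?c y" "?r x < ?r y" for x y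
  proof -
    have "\<sigma> x \<noteq> \<sigma> y" using xy permutes_inj[OF stab_permutes[OF s]] by (auto simp: inj_eq)
    then have "?rr (\<sigma> x) \<noteq> ?rr (\<sigma> y)" using distinct[of "\<sigma> x" "\<sigma> y"] sX xy stab_lab[OF s] by simp
    then show ?thesis using srt[OF xy] by simp
  qed
  have "i \<le> ?rr (\<sigma> (T' (i, j)))" if "(i, j) \<in> D'" for i j
    using that
  proof (induction i)
    case (Suc i)
    then have d: "(i, j) \<in> D'" using youngD[OF D' Suc.prems, of i j] by simp
    have "?rr (\<sigma> (T' (i, j))) < ?rr (\<sigma> (T' (Suc i, j)))"
      using inj img d Suc.prems by (intro strict) auto
    then show ?case using Suc.IH[OF d] by simp
  qed simp
  then have "\<forall>b\<in>D'. fst b \<le> ?rr (\<sigma> (T' b))" by auto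
  then show ?thesis using that[OF s] by blast
qed

text \<open>Often written \<open>n(lam)\<close>. It plays the role of the dominance order on
  shapes.\<close>

definition row_index_sum :: "box set \<Rightarrow> nat" where
  "row_index_sum D = (\<Sum>b\<in>D. fst b)"

text \<open>Summing the inequality between row labels and row indices over all boxes leaves room
  only for equality everywhere, and then the two diagrams have the same row lengths.\<close>

lemma row_symmetriser_nonzero:
  assumes D0: "young D0" and D': "young D'" and T0: "bij_betw T0 D0 X" and T': "bij_betw T' D' X"
    and nz: "sym_sum (stab X (row_of D0 T0)) (filling_poly D' h T') \<noteq> 0"
    and le: "row_index_sum D0 \<le> row_index_sum D'"
  obtains \<sigma> where "D' = D0" "\<sigma> \<in> stab X (col_of D' T')" "\<forall>b\<in>D'. row_of D0 T0 (\<sigma> (T' b)) = fst b"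
proof -
  obtain \<sigma> where s: "\<sigma> \<in> stab X (col_of D' T')" and "\<forall>b\<in>D'. fst b \<le> row_of D0 T0 (\<sigma> (T' b))"
    by (rule row_symmetriser_cases[OF D' T0 T' nz])
  then have ge: "\<And>b. b \<in> D' \<Longrightarrow> fst b \<le> row_of D0 T0 (\<sigma> (T' b))" by simp
  have inj0: "inj_on T0 D0" and img0: "T0 ` D0 = X" and inj: "inj_on T' D'" and img: "T' ` D' = X"
    using T0 T' by (auto simp: bij_betw_def)
  have finD: "finite D'" using D' by (simp add: young_def)
  have b: "bij_betw (\<lambda>b. \<sigma> (T' b)) D' X"
    using bij_betw_trans[OF T' permutes_imp_bij[OF stab_permutes[OF s]]] by (simp add: comp_def)
  have "(\<Sum>b\<in>D'. row_of D0 T0 (\<sigma> (T' b))) = (\<Sum>x\<in>X. row_of D0 T0 x)"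
    by (rule sum.reindex_bij_betw[OF b])
  also have "\<dots> = row_index_sum D0"
    unfolding row_index_sum_def
    by (subst sum.reindex_bij_betw[OF T0, symmetric]) (simp add: inj0)
  finally have total: "(\<Sum>b\<in>D'. row_of D0 T0 (\<sigma> (T' b))) = row_index_sum D0" .
  then have sums: "(\<Sum>b\<in>D'. fst b) = (\<Sum>b\<in>D'. row_of D0 T0 (\<sigma> (T' b)))"
    using le sum_mono[of D' fst "\<lambda>b. row_of D0 T0 (\<sigma> (T' b))"] ge by (simp add: row_index_sum_def)
  have eq: "row_of D0 T0 (\<sigma> (T' b)) = fst b" if "b \<in> D'" for b
    using sum_mono_inv[OF sums _ that finD] ge by simp
  have "card {x \<in> X. row_of D' T' x = i} = card {x \<in> X. row_of D0 T0 x = i}" for i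
  proof -
    have 1: "{x \<in> X. row_of D' T' x = i} = T' ` {b \<in> D'. fst b = i}" using inj img by auto
    have 2: "{x \<in> X. row_of D0 T0 x = i} = (\<lambda>b. \<sigma> (T' b)) ` {b \<in> D'. fst b = i}"
      using b eq by (fastforce simp: bij_betw_def)
    have "inj_on T' {b \<in> D'. fst b = i}" "inj_on (\<lambda>b. \<sigma> (T' b)) {b \<in> D'. fst b = i}"
      using inj b by (auto simp: bij_betw_def intro: inj_on_subset)
    then show ?thesis unfolding 1 2 by (simp add: card_image)
  qed
  then have "D' = D0" using young_rows[OF D' inj] young_rows[OF D0 inj0] unfolding img img0 by simp
  then show ?thesis using that s eq by blast
qed

text \<open>If the result is not \<open>0\<close>, a column permutation brings the second filling
  into the row class of the first. This is the classical lemma on products of row and column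
  symmetrisers.\<close>

lemma row_symmetriser_multiple:
  assumes D: "young D" and T0: "bij_betw T0 D X" and T': "bij_betw T' D X"
  shows "\<exists>e. sym_sum (stab X (row_of D T0)) (filling_poly D h T')
    = scaleQ e (sym_sum (stab X (row_of D T0)) (filling_poly D h T0))"
proof (cases "sym_sum (stab X (row_of D T0)) (filling_poly D h T') = 0")
  case True
  then show ?thesis by (intro exI[of _ 0]) simp
next
  case False
  let ?\<rho> = "sym_sum (stab X (row_of D T0))"
  obtain \<sigma> where s: "\<sigma> \<in> stab X (col_of D T')" and "\<forall>b\<in>D. row_of D T0 (\<sigma> (T' b)) = fst b"
    by (rule row_symmetriser_nonzero[OF D D T0 T' False order_refl])
  then have eq: "\<And>b. b \<in> D \<Longrightarrow> row_of D T0 (\<sigma> (T' b)) = fst b" by simp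
  have inj0: "inj_on T0 D" and img0: "T0 ` D = X" and inj: "inj_on T' D" and img: "T' ` D = X"
    using T0 T' by (auto simp: bij_betw_def)
  have finD: "finite D" using D by (simp add: young_def)
  have finX: "finite X" using finD img by auto
  define \<pi> where "\<pi> x = (if x \<in> X then \<sigma> (T' (inv_into D T0 x)) else x)" for x
  have "bij_betw (\<lambda>x. \<sigma> (T' (inv_into D T0 x))) X X"
    using bij_betw_trans[OF bij_betw_trans[OF bij_betw_inv_into[OF T0] T'] permutes_imp_bij[OF stab_permutes[OF s]]]
    by (simp add: comp_def)
  then have "bij_betw \<pi> X X" by (rule bij_betw_cong[THEN iffD1, rotated]) (simp add: \<pi>_def)
  then have perm: "\<pi> permutes X" by (rule bij_imp_permutes) (simp add: \<pi>_def)
  have \<pi>T0: "\<pi> (T0 b) = \<sigma> (T' b)" if "b \<in> D" for b using that inj0 img0 by (auto simp: \<pi>_def)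
  have "row_of D T0 (\<pi> x) = row_of D T0 x" if "x \<in> X" for x
  proof -
    obtain b where "b \<in> D" "x = T0 b" using \<open>x \<in> X\<close> img0 by blast
    then show ?thesis using \<pi>T0 eq inj0 by simp
  qed
  then have \<pi>: "\<pi> \<in> stab X (row_of D T0)" using perm by (simp add: stab_def)
  have "perm_act \<sigma> (filling_poly D h T') = filling_poly D h (\<sigma> \<circ> T')"
    by (rule perm_act_filling_poly[OF finD inj stab_bij[OF s]])
  also have "\<dots> = filling_poly D h (\<pi> \<circ> T0)"
    using inj permutes_inj_on[OF stab_permutes[OF s]] \<pi>T0 by (intro filling_poly_cong comp_inj_on) auto
  also have "\<dots> = perm_act \<pi> (filling_poly D h T0)"
    by (rule perm_act_filling_poly[OF finD inj0 stab_bij[OF \<pi>], symmetric])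
  finally have "perm_act \<sigma> (filling_poly D h T') = perm_act \<pi> (filling_poly D h T0)" .
  moreover have "perm_act \<sigma> (filling_poly D h T') = scaleQ (sgn_rat \<sigma>) (filling_poly D h T')"
    using perm_act_alt_sum[OF finX s] by (simp add: filling_poly_alt_sum[OF inj] img)
  ultimately have "scaleQ (sgn_rat \<sigma>) (?\<rho> (filling_poly D h T')) = ?\<rho> (filling_poly D h T0)"
    using sym_sum_perm_act[OF \<pi>, of "filling_poly D h T0"] lin_scale[OF lin_sym_sum, of "stab X (row_of D T0)" "sgn_rat \<sigma>"] by metis
  then have "?\<rho> (filling_poly D h T') = scaleQ (sgn_rat \<sigma>) (?\<rho> (filling_poly D h T0))"
    by (metis qpoly.scale_scale qpoly.scale_one sgn_rat_mult_self)
  then show ?thesis by blast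
qed


section \<open>Independence for a fixed filling\<close>

context
  fixes lam :: "nat list" and T :: "box \<Rightarrow> nat" and X :: "nat set"
  assumes lam: "is_partition lam" and T: "bij_betw T (diagram lam) X"
begin

abbreviation (input) "DL \<equiv> diagram lam"
abbreviation (input) "rL \<equiv> row_of (diagram lam) T"
abbreviation (input) "cL \<equiv> col_of (diagram lam) T"
abbreviation (input) "pL A \<equiv> fill_mono (diagram lam) (tab_entry A) T"

lemma DL_facts: "inj_on T DL" "T ` DL = X" "finite DL" "finite X" "young DL" "tableau X rL cL"
  using T finite_diagram young_diagram[OF lam] tableau_filling[OF young_diagram[OF lam], of T]
  by (auto simp: bij_betw_def)

lemma lookup_pL: "(i, j) \<in> DL \<Longrightarrow> lookup (pL A) (T (i, j)) = A ! i ! j"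
  using lookup_fill_mono(1)[OF _ DL_facts(1), of "tab_entry A" "(i, j)"] DL_facts(3) by simp

lemma X_box:
  assumes "x \<in> X" obtains i j where "(i, j) \<in> DL" "x = T (i, j)" "rL x = i" "cL x = j"
proof -
  obtain b where b: "b \<in> DL" "x = T b" using assms DL_facts(2) by blast
  then show ?thesis using that[of "fst b" "snd b"] DL_facts(1) by simp
qed

lemma pL_rows:
  assumes A: "shape A = lam" "semistandard A" and xy: "x \<in> X" "y \<in> X" "rL x = rL y" "cL x < cL y"
  shows "lookup (pL A) x \<le> lookup (pL A) y"
proof -
  obtain i j where x: "(i, j) \<in> DL" "x = T (i, j)" "rL x = i" "cL x = j" using xy(1) by (rule X_box)
  obtain i' j' where y: "(i', j') \<in> DL" "y = T (i', j')" "rL y = i'" "cL y = j'" using xy(2) by (rule X_box)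
  have i: "i' = i" "j < j'" using x y xy by simp_all
  then have "i < length A" "j' < length (A ! i)" using y(1) A(1) by (auto simp: diagram_def shape_def)
  then have "sorted (A ! i)" "j' < length (A ! i)" using A(2) by (auto simp: semistandard_def)
  then have "A ! i ! j \<le> A ! i ! j'" using i(2) by (simp add: sorted_iff_nth_mono)
  then show ?thesis using lookup_pL[OF x(1)] lookup_pL[OF y(1)] x(2) y(2) i by simp
qed

lemma pL_columns:
  assumes A: "shape A = lam" "semistandard A" and xy: "x \<in> X" "y \<in> X" "cL x = cL y" "rL x < rL y"
  shows "lookup (pL A) x < lookup (pL A) y"
proof -
  obtain i j where x: "(i, j) \<in> DL" "x = T (i, j)" "rL x = i" "cL x = j" using xy(1) by (rule X_box)
  obtain i' j' where y: "(i', j') \<in> DL" "y = T (i', j')" "rL y = i'" "cL y = j'" using xy(2) by (rule X_box)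
  have i: "j' = j" "i < i'" using x y xy by simp_all
  have step: "A ! k ! j < A ! Suc k ! j" if "(Suc k, j) \<in> DL" for k
    using A that by (auto simp: semistandard_def diagram_def shape_def)
  have "A ! i ! j < A ! k ! j" if "i < k" "(k, j) \<in> DL" for k
    using that
  proof (induction k)
    case (Suc k)
    have "(k, j) \<in> DL" using youngD[OF DL_facts(5) Suc.prems(2), of k j] by simp
    then show ?case using Suc.IH Suc.prems step[OF Suc.prems(2)] by (cases "i = k") auto
  qed simp
  then show ?thesis using lookup_pL[OF x(1)] lookup_pL[OF y(1)] x(2) y(1,2) i by simp
qed

text \<open>Column permutations preserve the weight by column index, and among the row
  rearrangements of \<open>B\<close> it is largest at the sorted one only. So equality of weights
  forces the two monomials to be equal, and strictness of the columns excludes non-trivial column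
  permutations.\<close>

lemma leading_monomial:
  assumes A: "shape A = lam" "semistandard A" and B: "shape B = lam" "semistandard B"
    and s: "\<sigma> \<in> stab X cL" and t: "\<tau> \<in> stab X rL"
    and eq: "mono_act \<sigma> (pL A) = mono_act \<tau> (pL B)"
    and ge: "tableau.weight X cL (pL B) \<le> tableau.weight X cL (pL A)"
  shows "A = B" "\<sigma> = id"
proof -
  interpret tableau X rL cL by (rule DL_facts(6))
  have wA: "weight cL (pL A) = weight cL (mono_act \<tau> (pL B))"
    using weight_stab[OF s, of "pL A"] eq by simp
  let ?q = "lookup (pL B)"
  have lt: "lookup (mono_act \<tau> (pL B)) x = ?q (inv \<tau> x)" for x
    by (simp add: lookup_mono_act[OF stab_bij[OF t]])
  have rinj: "x = y" if "x \<in> X" "y \<in> X" "rL x = rL y" "cL x = cL y" for x y using box_inj that .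
  obtain \<tau>m where tm: "\<tau>m \<in> stab X rL"
    and maxm: "\<And>\<rho>. \<rho> \<in> stab X rL \<Longrightarrow> (\<Sum>x\<in>X. cL x * ?q (\<rho> x)) \<le> (\<Sum>x\<in>X. cL x * ?q (\<tau>m x))"
    using maximal_rearrangement[OF finite_X, of rL cL ?q] by blast
  have same: "?q (\<rho> x) = ?q x"
    if r: "\<rho> \<in> stab X rL" and m: "(\<Sum>x\<in>X. cL x * ?q (\<tau>m x)) \<le> (\<Sum>x\<in>X. cL x * ?q (\<rho> x))" and x: "x \<in> X" for \<rho> x
  proof (rule sorted_unique[OF finite_X rinj r _ _ x])
    show "?q x \<le> ?q y" if "x \<in> X" "y \<in> X" "rL x = rL y" "cL x < cL y" for x y
      using pL_rows[OF B that] .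
    show "?q (\<rho> x) \<le> ?q (\<rho> y)" if xy: "x \<in> X" "y \<in> X" "rL x = rL y" "cL x < cL y" for x y
    proof (rule maximal_is_sorted[OF finite_X _ xy, of "\<lambda>x. ?q (\<rho> x)"])
      fix \<kappa> assume k: "\<kappa> \<in> stab X rL"
      show "(\<Sum>x\<in>X. cL x * ?q (\<rho> (\<kappa> x))) \<le> (\<Sum>x\<in>X. cL x * ?q (\<rho> x))"
        using maxm[OF stab_compose[OF r k]] m by simp
    qed
  qed
  have "(\<Sum>x\<in>X. cL x * ?q (\<tau>m x)) = weight cL (pL B)"
    unfolding weight_def using same[OF tm order_refl] by (intro sum.cong) auto
  then have "(\<Sum>x\<in>X. cL x * ?q (\<tau>m x)) \<le> (\<Sum>x\<in>X. cL x * ?q (inv \<tau> x))"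
    using ge wA by (simp add: weight_def lt)
  then have fixB: "lookup (mono_act \<tau> (pL B)) x = ?q x" if "x \<in> X" for x
    unfolding lt using same[OF stab_inv[OF t] _ that] by simp
  have lA: "lookup (pL A) (inv \<sigma> x) = ?q x" if "x \<in> X" for x
    using fixB[OF that] arg_cong[OF eq, of "\<lambda>m. lookup m x"] by (simp add: lookup_mono_act[OF stab_bij[OF s]])
  let ?p = "lookup (pL A)"
  have istab: "inv \<sigma> \<in> stab X cL" using s by (rule stab_inv)
  have fixA: "?p (inv \<sigma> x) = ?p x" if x: "x \<in> X" for x
  proof (rule sorted_unique[OF finite_X _ istab _ _ x, of rL])
    show "x = y" if "x \<in> X" "y \<in> X" "cL x = cL y" "rL x = rL y" for x y using box_inj that by blast
    show "?p x \<le> ?p y" if "x \<in> X" "y \<in> X" "cL x = cL y" "rL x < rL y" for x y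
      using pL_columns[OF A that] by simp
    show "?p (inv \<sigma> x) \<le> ?p (inv \<sigma> y)" if xy: "x \<in> X" "y \<in> X" "cL x = cL y" "rL x < rL y" for x y
      using pL_columns[OF B xy] lA xy by simp
  qed
  have pq: "?p x = ?q x" if "x \<in> X" for x using fixA[OF that] lA[OF that] by simp
  show "A = B"
  proof (rule nth_equalityI)
    show len: "length A = length B" using A(1) B(1) by (metis length_map shape_def)
    fix i assume i: "i < length A"
    have row: "length (A ! i) = lam ! i" "length (B ! i) = lam ! i"
      using arg_cong[OF A(1), of "\<lambda>l. l ! i"] arg_cong[OF B(1), of "\<lambda>l. l ! i"] i len
      by (simp_all add: shape_def)
    show "A ! i = B ! i"
    proof (rule nth_equalityI)
      show "length (A ! i) = length (B ! i)" using row by simp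
      fix j assume "j < length (A ! i)"
      moreover have "i < length lam" using i arg_cong[OF A(1), of length] by (simp add: shape_def)
      ultimately have d: "(i, j) \<in> DL" using row(1) by (simp add: diagram_def)
      then have "T (i, j) \<in> X" using DL_facts(2) by auto
      then have "?p (T (i, j)) = ?q (T (i, j))" by (rule pq)
      then show "A ! i ! j = B ! i ! j" unfolding lookup_pL[OF d] .
    qed
  qed
  have "inv \<sigma> x = x" if x: "x \<in> X" for x
  proof (rule ccontr)
    assume ne: "inv \<sigma> x \<noteq> x"
    have iX: "inv \<sigma> x \<in> X" using permutes_in_image[OF stab_permutes[OF istab]] x by simp
    have c: "cL (inv \<sigma> x) = cL x" using stab_lab[OF istab x] .
    then have "rL (inv \<sigma> x) \<noteq> rL x" using box_inj[OF iX x] ne by blast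
    then consider "rL (inv \<sigma> x) < rL x" | "rL x < rL (inv \<sigma> x)" by linarith
    then show False using pL_columns[OF A iX x c] pL_columns[OF A x iX] c fixA[OF x] by cases auto
  qed
  then have "inv \<sigma> = id" using permutes_not_in[OF stab_permutes[OF istab]] by (auto simp: fun_eq_iff)
  then show "\<sigma> = id" using inv_inv_eq[OF stab_bij[OF s]] by simp
qed

text \<open>Triangularity: look at the coefficient of the monomial of largest weight among the
  tableaux with non-zero coefficient.\<close>

lemma independent_fixed_filling:
  assumes fin: "finite \<A>" and A: "\<And>A. A \<in> \<A> \<Longrightarrow> shape A = lam \<and> semistandard A"
    and zero: "(\<Sum>A\<in>\<A>. scaleQ (s A) (F_fin A T)) = 0" and B: "B \<in> \<A>"
  shows "s B = 0"
proof (rule ccontr)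
  assume "s B \<noteq> 0"
  interpret tableau X rL cL by (rule DL_facts(6))
  let ?S = "{A \<in> \<A>. s A \<noteq> 0}"
  have fS: "finite ?S" using fin by simp
  have "(\<lambda>A. weight cL (pL A)) ` ?S \<noteq> {}" using B \<open>s B \<noteq> 0\<close> by blast
  from Max_in[OF finite_imageI[OF fS] this]
  obtain A where AS: "A \<in> ?S" and mx: "Max ((\<lambda>A. weight cL (pL A)) ` ?S) = weight cL (pL A)"
    by (rule imageE)
  have max: "weight cL (pL A') \<le> weight cL (pL A)" if "A' \<in> ?S" for A'
    using Max_ge[OF finite_imageI[OF fS] imageI[OF that, of "\<lambda>A. weight cL (pL A)"]] unfolding mx .
  have Ap: "shape A = lam" "semistandard A" using AS A by auto
  have coef: "lookup (F_fin A' T) (pL A) = (if A' = A then 1 else 0)" if A': "A' \<in> ?S" for A'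
  proof -
    have A'p: "shape A' = lam" "semistandard A'" using A' A by auto
    let ?rs = "row_sum DL (tab_entry A') T"
    have only: "A' = A \<and> \<sigma> = id" if s: "\<sigma> \<in> stab X cL" and nz: "lookup ?rs (mono_act (inv \<sigma>) (pL A)) \<noteq> 0" for \<sigma>
    proof -
      have "mono_act (inv \<sigma>) (pL A) \<in> keys ?rs" using nz by (simp add: in_keys_iff)
      then obtain \<tau> where t: "\<tau> \<in> stab (T ` DL) rL" "mono_act (inv \<sigma>) (pL A) = mono_act \<tau> (pL A')"
        by (rule row_sum_keys[OF DL_facts(1)])
      note lm = leading_monomial[OF Ap A'p stab_inv[OF s] t(1)[unfolded DL_facts(2)] t(2) max[OF A']]
      have "\<sigma> = id" using lm(2) inv_inv_eq[OF stab_bij[OF s]] by simp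
      then show ?thesis using lm(1) by simp
    qed
    have F: "F_fin A' T = alt_sum (stab X cL) ?rs"
      unfolding F_fin_eq A'p(1) filling_poly_alt_sum[OF DL_facts(1)] DL_facts(2) ..
    have "lookup (F_fin A' T) (pL A) = (\<Sum>\<sigma>\<in>stab X cL. sgn_rat \<sigma> * lookup ?rs (mono_act (inv \<sigma>) (pL A)))"
      unfolding F alt_sum_def lookup_sum lookup_scaleQ
      by (intro sum.cong refl) (simp add: lookup_perm_act stab_bij)
    also have "\<dots> = (\<Sum>\<sigma>\<in>{id}. sgn_rat \<sigma> * lookup ?rs (mono_act (inv \<sigma>) (pL A)))"
      using only by (intro sum.mono_neutral_right finite_stab finite_X) (auto simp: id_in_stab)
    also have "\<dots> = lookup ?rs (pL A)" by simp
    finally have l: "lookup (F_fin A' T) (pL A) = lookup ?rs (pL A)" .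
    show ?thesis
    proof (cases "A' = A")
      case True
      have "mono_poly (pL A) \<in> row_orbit DL (tab_entry A) T"
        unfolding row_orbit_def row_stab_eq[OF DL_facts(1)] filling_mono_eq
        by (rule image_eqI[OF _ id_in_stab]) simp
      then show ?thesis using l True by (simp add: lookup_row_sum[OF DL_facts(3,1)])
    next
      case False
      then show ?thesis using l only[OF id_in_stab] by auto
    qed
  qed
  have "0 = lookup (\<Sum>A\<in>\<A>. scaleQ (s A) (F_fin A T)) (pL A)" using zero by simp
  also have "\<dots> = (\<Sum>A'\<in>\<A>. s A' * lookup (F_fin A' T) (pL A))" by (simp add: lookup_sum lookup_scaleQ)
  also have "\<dots> = (\<Sum>A'\<in>?S. s A' * lookup (F_fin A' T) (pL A))"
    using fin by (intro sum.mono_neutral_right) auto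
  also have "\<dots> = (\<Sum>A'\<in>?S. if A' = A then s A' else 0)" using coef by (intro sum.cong) auto
  also have "\<dots> = s A" using AS fS by (simp add: sum.delta)
  finally show False using AS by simp
qed

text \<open>For the combination \<open>y\<close> of row sums with column antisymmetrisation
  \<open>z\<close>, both \<open>ip z y\<close> and, up to a factor, \<open>ip z z\<close> are
  pairings of the row symmetrisation of \<open>z\<close> with \<open>y\<close>. So
  \<open>z\<close> vanishes if its row symmetrisation does.\<close>

lemma independent_row_symmetrised:
  assumes fin: "finite \<A>" and A: "\<And>A. A \<in> \<A> \<Longrightarrow> shape A = lam \<and> semistandard A"
    and zero: "(\<Sum>A\<in>\<A>. scaleQ (s A) (sym_sum (stab X rL) (F_fin A T))) = 0" and B: "B \<in> \<A>"
  shows "s B = 0"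
proof (rule independent_fixed_filling[OF fin A _ B])
  let ?y = "\<Sum>A\<in>\<A>. scaleQ (s A) (row_sum DL (tab_entry A) T)"
  let ?K = "alt_sum (stab X cL)"
  have F: "F_fin A T = ?K (row_sum DL (tab_entry A) T)" if "A \<in> \<A>" for A
    unfolding F_fin_eq using A[OF that] by (simp add: filling_poly_alt_sum[OF DL_facts(1)] DL_facts(2))
  have Ky: "(\<Sum>A\<in>\<A>. scaleQ (s A) (F_fin A T)) = ?K ?y"
    by (simp add: lin_sum[OF lin_alt_sum] lin_scale[OF lin_alt_sum] F cong: sum.cong)
  have ry: "perm_act \<pi> ?y = ?y" if "\<pi> \<in> stab X rL" for \<pi>
    using row_sum_invariant[OF DL_facts(1), of \<pi>] that unfolding DL_facts(2)
    by (simp add: perm_act_sum perm_act_scale)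
  have "sym_sum (stab X rL) (?K ?y) = 0"
    unfolding Ky[symmetric] using zero by (simp add: lin_sum[OF lin_sym_sum] lin_scale[OF lin_sym_sum])
  then have "0 = ip (?K ?y) (sym_sum (stab X rL) ?y)" using ip_sym_sum[of X rL "?K ?y" ?y] by simp
  also have "\<dots> = of_nat (card (stab X rL)) * ip (?K ?y) ?y"
    using sym_sum_invariant[of "stab X rL" ?y] ry by (simp add: ip_scale_right)
  finally have "ip (?K ?y) ?y = 0"
    using finite_stab[OF DL_facts(4), of rL] id_in_stab[of X rL] by (auto simp: card_eq_0_iff)
  then have "ip (?K ?y) (?K ?y) = 0"
    using ip_alt_sum[OF DL_facts(4), of cL "?K ?y" ?y] alt_sum_idem[OF DL_facts(4), of cL ?y] by (simp add: ip_scale_left)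
  then show "(\<Sum>A\<in>\<A>. scaleQ (s A) (F_fin A T)) = 0" unfolding Ky by (rule ip_self_eq_0)
qed (use A in auto)

end


section \<open>The components are independent\<close>

definition tableaux_of_size :: "nat \<Rightarrow> nat list list set" where
  "tableaux_of_size n = {M. is_partition (shape M) \<and> semistandard M \<and> sum_list (shape M) = n}"

lemma F_fin_in_V_fin:
  assumes "sum_list (shape M) = n" "bij_betw T (diagram (shape M)) {1..n}" shows "F_fin M T \<in> V_fin M"
  unfolding V_fin_def using assms by (intro qpoly.span_base) auto

lemma perm_act_V_fin:
  assumes "sum_list (shape M) = n" "\<sigma> permutes {1..n}" "g \<in> V_fin M" shows "perm_act \<sigma> g \<in> V_fin M"
  unfolding V_fin_def
proof (rule lin_span[OF lin_perm_act assms(3)[unfolded V_fin_def]])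
  fix b assume "b \<in> {F_fin M T |T. bij_betw T (diagram (shape M)) {1..sum_list (shape M)}}"
  then obtain T where T: "b = F_fin M T" "bij_betw T (diagram (shape M)) {1..n}" using assms(1) by auto
  have "perm_act \<sigma> b = F_fin M (\<sigma> \<circ> T)"
    unfolding T(1) F_fin_eq using T(2)
    by (intro perm_act_filling_poly finite_diagram permutes_bij[OF assms(2)]) (simp add: bij_betw_def)
  moreover have "bij_betw (\<sigma> \<circ> T) (diagram (shape M)) {1..n}"
    using T(2) permutes_imp_bij[OF assms(2)] by (rule bij_betw_trans)
  ultimately show "perm_act \<sigma> b \<in> qpoly.span {F_fin M T |T. bij_betw T (diagram (shape M)) {1..sum_list (shape M)}}"
    using F_fin_in_V_fin[OF assms(1)] by (simp add: V_fin_def)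
qed

lemma diagram_inj:
  assumes "is_partition lam" "is_partition mu" "diagram lam = diagram mu" shows "lam = mu"
proof -
  have rows: "{j. (i, j) \<in> diagram lam} = {..<if i < length lam then lam ! i else 0}" for lam i
    by (auto simp: diagram_def)
  have eq: "(if i < length lam then lam ! i else 0) = (if i < length mu then mu ! i else 0)" for i
    using rows[of i lam] rows[of i mu] assms(3) by (metis card_lessThan)
  have pos: "nu ! i \<noteq> 0" if "is_partition nu" "i < length nu" for nu i
    using that nth_mem[OF that(2)] unfolding is_partition_def by metis
  have "length lam = length mu"
  proof (rule ccontr)
    assume "length lam \<noteq> length mu"
    then consider "length lam < length mu" | "length mu < length lam" by linarith
    then show False
      using eq[of "length lam"] eq[of "length mu"] pos[OF assms(1), of "length mu"] pos[OF assms(2), of "length lam"]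
      by cases auto
  qed
  then show ?thesis using eq by (intro nth_equalityI) (auto split: if_splits, metis)
qed

text \<open>The row symmetriser of a tableau of shape \<open>lam\<close> kills the components of
  the other shapes, by minimality of \<open>lam\<close>. It maps each component of shape
  \<open>lam\<close> to a multiple of one polynomial, and these polynomials are
  independent.\<close>

lemma row_symmetrised_components:
  assumes fin: "finite \<M>" and M: "\<M> \<subseteq> tableaux_of_size n"
    and w: "\<And>M. M \<in> \<M> \<Longrightarrow> w M \<in> V_fin M" and zero: "(\<Sum>M\<in>\<M>. w M) = 0"
    and lam: "is_partition lam" and min: "\<And>M. M \<in> \<M> \<Longrightarrow> w M \<noteq> 0 \<Longrightarrow>
        row_index_sum (diagram lam) \<le> row_index_sum (diagram (shape M))"
    and T0: "bij_betw T0 (diagram lam) {1..n}" and N: "N \<in> \<M>" "shape N = lam"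
  shows "sym_sum (stab {1..n} (row_of (diagram lam) T0)) (w N) = 0"
proof -
  let ?X = "{1..n}" and ?\<rho> = "sym_sum (stab {1..n} (row_of (diagram lam) T0))"
  have part: "is_partition (shape M)" "semistandard M" "sum_list (shape M) = n" if "M \<in> \<M>" for M
    using M that by (auto simp: tableaux_of_size_def)
  have other: "?\<rho> (w M) = 0" if MM: "M \<in> \<M>" and ne: "shape M \<noteq> lam" for M
  proof (cases "w M = 0")
    case True then show ?thesis by (simp add: lin_0[OF lin_sym_sum])
  next
    case False
    have "?\<rho> (F_fin M T) = 0" if T: "bij_betw T (diagram (shape M)) ?X" for T
    proof (rule ccontr)
      assume nz: "?\<rho> (F_fin M T) \<noteq> 0"
      obtain \<sigma> where "diagram (shape M) = diagram lam"
        by (rule row_symmetriser_nonzero[OF young_diagram[OF lam] young_diagram[OF part(1)[OF MM]] T0 T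
            nz[unfolded F_fin_eq] min[OF MM False]])
      then show False using diagram_inj[OF part(1)[OF MM] lam] ne by simp
    qed
    then have "?\<rho> (w M) \<in> qpoly.span {}"
      using part(3)[OF MM] by (intro lin_span[OF lin_sym_sum w[OF MM, unfolded V_fin_def]]) (auto simp: qpoly.span_zero)
    then show ?thesis by simp
  qed
  have mult: "\<exists>e. ?\<rho> (w M) = scaleQ e (?\<rho> (F_fin M T0))" if MM: "M \<in> \<M>" and sh: "shape M = lam" for M
  proof -
    have "?\<rho> (w M) \<in> qpoly.span {?\<rho> (F_fin M T0)}"
    proof (rule lin_span[OF lin_sym_sum w[OF MM, unfolded V_fin_def]])
      fix b assume "b \<in> {F_fin M T |T. bij_betw T (diagram (shape M)) {1..sum_list (shape M)}}"
      then obtain T where T: "b = F_fin M T" "bij_betw T (diagram lam) ?X" using part(3)[OF MM] sh by auto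
      obtain e where "?\<rho> b = scaleQ e (?\<rho> (F_fin M T0))"
        using row_symmetriser_multiple[OF young_diagram[OF lam] T0 T(2), of "tab_entry M"]
        unfolding T(1) F_fin_eq sh by blast
      then show "?\<rho> b \<in> qpoly.span {?\<rho> (F_fin M T0)}"
        by (simp add: qpoly.span_scale qpoly.span_base)
    qed
    then show ?thesis unfolding qpoly.span_singleton by auto
  qed
  let ?L = "{M \<in> \<M>. shape M = lam}"
  have "\<forall>M\<in>?L. \<exists>e. ?\<rho> (w M) = scaleQ e (?\<rho> (F_fin M T0))" using mult by blast
  then obtain e where e: "\<And>M. M \<in> ?L \<Longrightarrow> ?\<rho> (w M) = scaleQ (e M) (?\<rho> (F_fin M T0))" by metis
  have "(\<Sum>M\<in>?L. scaleQ (e M) (?\<rho> (F_fin M T0))) = (\<Sum>M\<in>?L. ?\<rho> (w M))"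
    using e by (intro sum.cong) auto
  also have "\<dots> = (\<Sum>M\<in>\<M>. ?\<rho> (w M))"
    using fin other by (intro sum.mono_neutral_left) auto
  also have "\<dots> = 0" using zero lin_sum[OF lin_sym_sum, of _ w \<M>] by (simp add: lin_0[OF lin_sym_sum] flip: lin_sum[OF lin_sym_sum])
  finally have "e N = 0"
    using fin N part by (intro independent_row_symmetrised[OF lam T0, of ?L e]) auto
  then show ?thesis using e[of N] N by simp
qed

text \<open>A component of minimal row index sum is killed by all row symmetrisers of its shape,
  and so are its images under permutations, because these also are components of a vanishing sum.
  Hence it is orthogonal to all generators of its own space.\<close>

theorem V_fin_independent:
  assumes fin: "finite \<M>" and M: "\<M> \<subseteq> tableaux_of_size n"
    and w: "\<And>M. M \<in> \<M> \<Longrightarrow> w M \<in> V_fin M" and zero: "(\<Sum>M\<in>\<M>. w M) = 0" and N0: "N0 \<in> \<M>"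
  shows "w N0 = 0"
proof (rule ccontr)
  assume "w N0 \<noteq> 0"
  let ?X = "{1..n}" and ?S = "{M \<in> \<M>. w M \<noteq> 0}"
  define N where "N = arg_min_on (\<lambda>M. row_index_sum (diagram (shape M))) ?S"
  have fS: "finite ?S" "?S \<noteq> {}" using fin N0 \<open>w N0 \<noteq> 0\<close> by auto
  have NS: "N \<in> ?S" unfolding N_def by (rule arg_min_if_finite(1)[OF fS])
  have min: "row_index_sum (diagram (shape N)) \<le> row_index_sum (diagram (shape M))" if "M \<in> ?S" for M
    unfolding N_def by (rule arg_min_least[OF fS that])
  have part: "is_partition (shape N)" "sum_list (shape N) = n" using NS M by (auto simp: tableaux_of_size_def)
  let ?D = "diagram (shape N)"
  have "ip (w N) (F_fin N T) = 0" if T: "bij_betw T ?D ?X" for T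
  proof -
    have inj: "inj_on T ?D" and img: "T ` ?D = ?X" using T by (auto simp: bij_betw_def)
    let ?R = "stab ?X (row_of ?D T)" and ?C = "stab ?X (col_of ?D T)" and ?s = "row_sum ?D (tab_entry N) T"
    have "sym_sum ?R (perm_act \<sigma> (w N)) = 0" if s: "\<sigma> permutes ?X" for \<sigma>
    proof (rule row_symmetrised_components[OF fin M _ _ part(1) _ T, where w = "\<lambda>M. perm_act \<sigma> (w M)"])
      show "perm_act \<sigma> (w M) \<in> V_fin M" if "M \<in> \<M>" for M
        using w[OF that] M that s by (intro perm_act_V_fin) (auto simp: tableaux_of_size_def)
      show "(\<Sum>M\<in>\<M>. perm_act \<sigma> (w M)) = 0" using zero by (simp flip: perm_act_sum)
      show "row_index_sum ?D \<le> row_index_sum (diagram (shape M))" if "M \<in> \<M>" "perm_act \<sigma> (w M) \<noteq> 0" for M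
        using that by (intro min) auto
    qed (use NS in auto)
    then have z: "sym_sum ?R (alt_sum ?C (w N)) = 0"
      by (simp add: alt_sum_def lin_sum[OF lin_sym_sum] lin_scale[OF lin_sym_sum] stab_permutes)
    have "sym_sum ?R ?s = scaleQ (of_nat (card ?R)) ?s"
      using row_sum_invariant[OF inj, of _ "tab_entry N"] unfolding img by (intro sym_sum_invariant) simp
    then have "of_nat (card ?R) * ip (alt_sum ?C (w N)) ?s = ip (sym_sum ?R (alt_sum ?C (w N))) ?s"
      using ip_sym_sum[of ?X "row_of ?D T" "alt_sum ?C (w N)" ?s] by (simp add: ip_scale_right)
    then have "of_nat (card ?R) * ip (alt_sum ?C (w N)) ?s = 0" using z by simp
    moreover have "card ?R \<noteq> 0"
      using finite_stab[of ?X "row_of ?D T"] id_in_stab[of ?X "row_of ?D T"] by (auto simp: card_eq_0_iff)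
    ultimately have "ip (alt_sum ?C (w N)) ?s = 0" by simp
    then show ?thesis
      unfolding F_fin_eq filling_poly_alt_sum[OF inj] img
      using ip_alt_sum[of ?X "col_of ?D T" "w N" ?s] by simp
  qed
  then have "ip (w N) (w N) = 0"
    using part(2) by (intro ip_span_right[OF w[of N, unfolded V_fin_def]]) (use NS in auto)
  then show False using NS ip_self_eq_0 by blast
qed

text \<open>Finitely many elements can be moved to padded shapes of one common size.\<close>

theorem V_lower_independent:
  assumes fin: "finite \<A>" and A: "\<And>A. A \<in> \<A> \<Longrightarrow> lower_tableau A"
    and g: "\<And>A. A \<in> \<A> \<Longrightarrow> g A \<in> V_lower A" and zero: "(\<Sum>A\<in>\<A>. g A) = 0" and B: "B \<in> \<A>"
  shows "g B = 0"
proof -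
  have pA: "is_partition (shape A)" if "A \<in> \<A>" for A using A[OF that] by (simp add: lower_tableau_def)
  have "\<forall>A\<in>\<A>. \<exists>n0. pad_bound A \<le> n0 \<and> (\<forall>n\<ge>n0. g A \<in> V_fin (pad n A))"
    using V_lower_eventually_V_fin[OF pA g] by blast
  then obtain n0 where n0: "\<And>A. A \<in> \<A> \<Longrightarrow> pad_bound A \<le> n0 A \<and> (\<forall>n\<ge>n0 A. g A \<in> V_fin (pad n A))"
    by metis
  define n where "n = Max (n0 ` \<A>)"
  have n: "n0 A \<le> n" if "A \<in> \<A>" for A unfolding n_def using fin that by simp
  have pb: "pad_bound A \<le> n" if "A \<in> \<A>" for A using n0[OF that] n[OF that] by simp
  have inj: "inj_on (pad n) \<A>" by (auto simp: inj_on_def pad_def)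
  have tl: "tl (pad n A) = A" for A by (simp add: pad_def)
  have "g (tl (pad n B)) = 0"
  proof (rule V_fin_independent[where \<M> = "pad n ` \<A>" and n = n and w = "\<lambda>M. g (tl M)"])
    show "pad n ` \<A> \<subseteq> tableaux_of_size n"
      using pad_is_partition[OF pA pb] pad_semistandard[OF A pb] by (auto simp: tableaux_of_size_def)
    show "g (tl M) \<in> V_fin M" if "M \<in> pad n ` \<A>" for M
      using that n0 n by (auto simp: tl)
    show "(\<Sum>M\<in>pad n ` \<A>. g (tl M)) = 0" using zero by (simp add: sum.reindex[OF inj] tl)
  qed (use fin B in auto)
  then show ?thesis by (simp add: tl)
qed


section \<open>The filtration as a contraction filtration\<close>

definition contents_of :: "nat \<Rightarrow> nat multiset set" where
  "contents_of d = {\<mu>. is_content \<mu> d}"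

lemma contents_of_sum: "\<mu> \<in> contents_of d \<Longrightarrow> sum_mset \<mu> = d"
  by (simp add: contents_of_def is_content_def)

lemma hom_in_eq: "hom_in X d = poly_with X (contents_of d)"
  by (auto simp: hom_in_def poly_with_def contents_of_def is_content_def mono_deg_content
      zero_notin_mono_content)

lemma Qinf_cont_eq: "Qinf_cont mu = poly_with {1..} {mu}"
proof
  show "Qinf_cont mu \<subseteq> poly_with {1..} {mu}"
    unfolding Qinf_cont_def by (rule qpoly.span_minimal[OF _ subspace_poly_with]) (auto simp: poly_with_def)
  show "poly_with {1..} {mu} \<subseteq> Qinf_cont mu"
  proof
    fix F assume "F \<in> poly_with {1..} {mu}"
    then have "mono_poly ` keys F \<subseteq> {mono_poly m | m. keys m \<subseteq> {1..} \<and> mono_content m = mu}"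
      by (auto simp: poly_with_def)
    then show "F \<in> Qinf_cont mu"
      unfolding Qinf_cont_def using in_span_monomials[of F] qpoly.span_mono by blast
  qed
qed

lemma tab_content_in:
  assumes "M \<in> all_SSYT n d" shows "tab_content M \<in> contents_of d"
proof -
  have "sum_mset A = sum_mset (filter_mset (\<lambda>h. h \<noteq> 0) A)" for A :: "nat multiset"
    by (induction A) auto
  then have "sum_mset (tab_content M) = sum_list (concat M)"
    by (metis tab_content_def sum_mset_sum_list)
  then show ?thesis
    using assms by (auto simp: contents_of_def is_content_def tab_content_def all_SSYT_def SSYT_def)
qed

lemma all_SSYT_size: "M \<in> all_SSYT n d \<Longrightarrow> sum_list (shape M) = n"
  by (auto simp: all_SSYT_def partitions_of_def SSYT_def)

lemma Qn_filt_eq: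
  assumes n: "n \<ge> 1" shows "Qn_filt n d f = Qn n d \<inter> contr_ker (nat (f + 1))"
proof
  have iff: "int (fnum M) \<le> f \<longleftrightarrow> fnum M < nat (f + 1)" for M by linarith
  show "Qn_filt n d f \<subseteq> Qn n d \<inter> contr_ker (nat (f + 1))"
    unfolding Qn_filt_def hom_in_eq
  proof (rule qpoly.span_minimal)
    show "qpoly.subspace (poly_with {1..n} (contents_of d) \<inter> contr_ker (nat (f + 1)))"
      by (intro qpoly.subspace_inter subspace_poly_with subspace_contr_ker)
    show "(\<Union>M\<in>{M \<in> all_SSYT n d. int (fnum M) \<le> f}. V_fin M) \<subseteq> poly_with {1..n} (contents_of d) \<inter> contr_ker (nat (f + 1))"
    proof (rule UN_least)
      fix M assume "M \<in> {M \<in> all_SSYT n d. int (fnum M) \<le> f}"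
      then have M: "M \<in> all_SSYT n d" "fnum M < nat (f + 1)" using iff by auto
      show "V_fin M \<subseteq> poly_with {1..n} (contents_of d) \<inter> contr_ker (nat (f + 1))"
        unfolding V_fin_def
      proof (rule qpoly.span_minimal)
        show "qpoly.subspace (poly_with {1..n} (contents_of d) \<inter> contr_ker (nat (f + 1)))"
          by (intro qpoly.subspace_inter subspace_poly_with subspace_contr_ker)
        show "{F_fin M T |T. bij_betw T (diagram (shape M)) {1..sum_list (shape M)}}
          \<subseteq> poly_with {1..n} (contents_of d) \<inter> contr_ker (nat (f + 1))"
        proof
          fix b assume "b \<in> {F_fin M T |T. bij_betw T (diagram (shape M)) {1..sum_list (shape M)}}"
          then obtain T where T: "b = F_fin M T" "bij_betw T (diagram (shape M)) {1..n}"
            using all_SSYT_size[OF M(1)] by auto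
          have "b \<in> contr_ker (nat (f + 1))"
            using subsetD[OF contr_ker_mono F_fin_in_contr_ker[OF n M(1) T(2)]] M(2) T(1) by simp
          then show "b \<in> poly_with {1..n} (contents_of d) \<inter> contr_ker (nat (f + 1))"
            using F_fin_poly_with[OF T(2) tab_content_in[OF M(1)]] T(1) by simp
        qed
      qed
    qed
  qed
  show "Qn n d \<inter> contr_ker (nat (f + 1)) \<subseteq> Qn_filt n d f"
  proof
    fix F assume F: "F \<in> Qn n d \<inter> contr_ker (nat (f + 1))"
    then have "F \<in> qpoly.span {F_fin M T | M T. M \<in> all_SSYT n d \<and> fnum M < nat (f + 1) \<and>
        tab_content M \<in> contents_of d \<and> bij_betw T (diagram (shape M)) {1..n}}" (is "_ \<in> qpoly.span ?B")
      unfolding hom_in_eq by (intro contr_ker_characterisation[OF n contents_of_sum]) auto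
    moreover have "?B \<subseteq> (\<Union>M\<in>{M \<in> all_SSYT n d. int (fnum M) \<le> f}. V_fin M)"
      using F_fin_in_V_fin[OF all_SSYT_size] iff by blast
    ultimately show "F \<in> Qn_filt n d f" unfolding Qn_filt_def using qpoly.span_mono by blast
  qed
qed

text \<open>The common form of the two filtrations: \<open>Cs\<close> is the set of all contents
  of sum \<open>d\<close> or a single content. The index is shifted by one, so that
  \<open>filt Cs 0\<close> is the zero space.\<close>

definition filt :: "nat multiset set \<Rightarrow> nat \<Rightarrow> qpoly set" where
  "filt Cs g = poly_with {1..} Cs \<inter> contr_ker g"

text \<open>Both conditions defining \<open>filt\<close> are independent of
  \<open>n\<close>.\<close>

lemma Qinf_filt_eq: "Qinf_filt d f = filt (contents_of d) (nat (f + 1))"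
proof
  show "Qinf_filt d f \<subseteq> filt (contents_of d) (nat (f + 1))"
  proof
    fix F assume F: "F \<in> Qinf_filt d f"
    then have Q: "F \<in> poly_with {1..} (contents_of d)" by (simp add: Qinf_filt_def hom_in_eq)
    then obtain n where n: "n \<ge> 1" "F \<in> poly_with {1..n} (contents_of d)" using poly_with_finite_support by blast
    then have "F \<in> Qn_filt n d f" using F by (simp add: Qinf_filt_def hom_in_eq)
    then show "F \<in> filt (contents_of d) (nat (f + 1))" using Q by (simp add: filt_def Qn_filt_eq[OF n(1)])
  qed
  show "filt (contents_of d) (nat (f + 1)) \<subseteq> Qinf_filt d f"
    by (auto simp: filt_def Qinf_filt_def Qn_filt_eq hom_in_eq)
qed

lemma Qinf_cont_filt_eq:
  assumes "is_content mu d" shows "Qinf_cont_filt mu f = filt {mu} (nat (f + 1))"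
proof -
  have "{mu} \<subseteq> contents_of (sum_mset mu)" using assms by (simp add: contents_of_def is_content_def)
  then have "poly_with {1..} {mu} \<subseteq> poly_with {1..} (contents_of (sum_mset mu))" by (intro poly_with_mono) auto
  then show ?thesis by (auto simp: Qinf_cont_filt_def Qinf_filt_eq filt_def Qinf_cont_eq)
qed

lemma subspace_filt: "qpoly.subspace (filt Cs g)"
  unfolding filt_def by (intro qpoly.subspace_inter subspace_poly_with subspace_contr_ker)

lemma perm_act_filt: "\<sigma> \<in> S_N \<Longrightarrow> F \<in> filt Cs g \<Longrightarrow> perm_act \<sigma> F \<in> filt Cs g"
  by (auto simp: filt_def S_N_def perm_act_poly_with perm_act_contr_ker permutes_bij)

lemma filt_mono: "g \<le> g' \<Longrightarrow> filt Cs g \<subseteq> filt Cs g'"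
  using contr_ker_mono by (auto simp: filt_def)

lemma filt_0 [simp]: "filt Cs 0 = {0}"
  by (auto simp: filt_def poly_with_def)

text \<open>A contraction makes the content smaller by one element.\<close>

lemma filt_full:
  assumes "\<And>\<mu>. \<mu> \<in> Cs \<Longrightarrow> size \<mu> \<le> l" shows "filt Cs (Suc l) = poly_with {1..} Cs"
proof -
  have "F \<in> contr_ker (Suc l)" if F: "F \<in> poly_with {1..} Cs" for F
    unfolding contr_ker_def
  proof (intro CollectI allI impI)
    fix hs :: "nat list" assume len: "length hs = Suc l"
    have "keys (contrs hs F) = {}"
    proof (rule equals0I)
      fix m assume "m \<in> keys (contrs hs F)"
      then obtain p where p: "p \<in> keys F" "mono_content p = mono_content m + mset hs" using keys_contrs by blast
      then have "mono_content p \<in> Cs" using F p(1) unfolding poly_with_def by blast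
      then have "size (mono_content p) \<le> l" by (rule assms)
      then show False using p(2) len by simp
    qed
    then show "contrs hs F = 0" by (simp add: keys_eq_empty)
  qed
  then show ?thesis by (auto simp: filt_def)
qed


section \<open>Products with monomials in fresh variables\<close>

definition attach :: "mono \<Rightarrow> qpoly \<Rightarrow> qpoly" where
  "attach p = linear_ext (\<lambda>m. mono_poly (m + p))"

lemma lin_attach: "lin (attach p)"
  by (simp add: attach_def lin_linear_ext)

lemma attach_mono_poly [simp]: "attach p (mono_poly m) = mono_poly (m + p)"
  by (simp add: attach_def)

lemma attach_0 [simp]: "attach 0 F = F"
  by (rule lin_eq_on_monomials[where g = "\<lambda>F. F"]) (simp_all add: lin_attach, simp add: lin_def)

lemma keys_attach: "m \<in> keys (attach p F) \<Longrightarrow> \<exists>q\<in>keys F. m = q + p"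
proof -
  assume m: "m \<in> keys (attach p F)"
  have "keys (attach p F) \<subseteq> (\<Union>q\<in>keys F. keys (scaleQ (lookup F q) (mono_poly (q + p))))"
    unfolding attach_def linear_ext_def by (rule keys_sum_subset)
  from subsetD[OF this m]
  obtain q where q: "q \<in> keys F" "m \<in> keys (scaleQ (lookup F q) (mono_poly (q + p)))" by (rule UN_E)
  from subsetD[OF keys_scaleQ q(2)] show ?thesis using q(1) by auto
qed

lemma keys_plus_mono: "keys (m + p) = keys m \<union> keys (p :: mono)"
  by (auto simp: in_keys_iff lookup_add)

lemma mono_content_plus:
  assumes "keys m \<inter> keys p = {}" shows "mono_content (m + p) = mono_content m + mono_content p"
proof -
  have "mset_set (keys m \<union> keys p) = mset_set (keys m) + mset_set (keys p)"
    using assms by (intro mset_set_Union) auto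
  moreover have "image_mset (lookup (m + p)) (mset_set (keys m)) = image_mset (lookup m) (mset_set (keys m))"
    "image_mset (lookup (m + p)) (mset_set (keys p)) = image_mset (lookup p) (mset_set (keys p))"
    using assms by (auto intro!: image_mset_cong simp: lookup_add in_keys_iff disjoint_iff)
  ultimately show ?thesis by (simp add: mono_content_def keys_plus_mono)
qed

lemma contr_attach:
  assumes "\<And>m. m \<in> keys G \<Longrightarrow> keys m \<inter> keys p = {}"
  shows "contr h (attach p G)
    = attach p (contr h G) + (\<Sum>i\<in>{i \<in> keys p. lookup p i = h}. attach (erase i p) G)"
proof (rule lin_eq_on_monomials[where f = "\<lambda>G. contr h (attach p G)" and
    g = "\<lambda>G. attach p (contr h G) + (\<Sum>i\<in>{i \<in> keys p. lookup p i = h}. attach (erase i p) G)"])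
  show "lin (\<lambda>G. contr h (attach p G))" by (rule lin_compose[OF lin_contr lin_attach])
  show "lin (\<lambda>G. attach p (contr h G) + (\<Sum>i\<in>{i \<in> keys p. lookup p i = h}. attach (erase i p) G))"
    by (simp add: lin_def lin_add[OF lin_attach] lin_scale[OF lin_attach] lin_add[OF lin_contr] lin_scale[OF lin_contr]
        sum.distrib qpoly.scale_sum_right qpoly.scale_right_distrib algebra_simps)
  fix m assume "m \<in> keys G"
  then have disj: "keys m \<inter> keys p = {}" by (rule assms)
  have split: "{i \<in> keys (m + p). lookup (m + p) i = h}
      = {i \<in> keys m. lookup m i = h} \<union> {i \<in> keys p. lookup p i = h}"
    using disj by (auto simp: keys_plus_mono lookup_add in_keys_iff disjoint_iff)
  have e1: "erase i (m + p) = erase i m + p" if "i \<in> keys m" for i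
    using disj that by (intro poly_mapping_eqI) (auto simp: lookup_erase lookup_add in_keys_iff disjoint_iff)
  have e2: "erase i (m + p) = m + erase i p" if "i \<in> keys p" for i
    using disj that by (intro poly_mapping_eqI) (auto simp: lookup_erase lookup_add in_keys_iff disjoint_iff)
  have "contr h (attach p (mono_poly m)) = (\<Sum>i\<in>{i \<in> keys m. lookup m i = h}. mono_poly (erase i (m + p)))
      + (\<Sum>i\<in>{i \<in> keys p. lookup p i = h}. mono_poly (erase i (m + p)))"
    unfolding attach_mono_poly contr_mono_poly split using disj by (intro sum.union_disjoint) auto
  also have "\<dots> = (\<Sum>i\<in>{i \<in> keys m. lookup m i = h}. mono_poly (erase i m + p))
      + (\<Sum>i\<in>{i \<in> keys p. lookup p i = h}. mono_poly (m + erase i p))"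
    using e1 e2 by (intro arg_cong2[where f = "(+)"] sum.cong) auto
  finally show "contr h (attach p (mono_poly m)) = attach p (contr h (mono_poly m))
      + (\<Sum>i\<in>{i \<in> keys p. lookup p i = h}. attach (erase i p) (mono_poly m))"
    by (simp add: contr_mono_poly lin_sum[OF lin_attach])
qed

text \<open>A contraction of the product either acts on \<open>G\<close>, which gives
  \<open>0\<close>, or removes a variable of \<open>p\<close>. As many contractions as
  \<open>p\<close> has variables leave only multiples of \<open>G\<close>, and \<open>c\<close>
  counts the orders in which the variables of \<open>p\<close> can be removed.\<close>

lemma contrs_attach:
  assumes G: "G \<in> contr_ker 1"
  shows "length hs = card (keys p) \<Longrightarrow> (\<And>m. m \<in> keys G \<Longrightarrow> keys m \<inter> keys p = {}) \<Longrightarrow>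
    \<exists>c. contrs hs (attach p G) = scaleQ c G \<and> (if mset hs = mono_content p then c > 0 else c = 0)"
proof (induction hs arbitrary: p)
  case Nil
  then have "keys p = {}" by simp
  then have "p = 0" by (simp add: keys_eq_empty)
  then show ?case by (intro exI[of _ 1]) (simp add: mono_content_def)
next
  case (Cons h hs)
  let ?I = "{i \<in> keys p. lookup p i = h}"
  have "contr h G = 0" using G by (simp add: contr_ker_def) (metis fold_simps length_Cons list.size(3) One_nat_def)
  then have step: "contr h (attach p G) = (\<Sum>i\<in>?I. attach (erase i p) G)"
    using contr_attach[of G p h] Cons.prems(2) by (simp add: lin_0[OF lin_attach])
  have ex: "\<exists>c. contrs hs (attach (erase i p) G) = scaleQ c G
      \<and> (if mset (h # hs) = mono_content p then c > 0 else c = 0)" if i: "i \<in> ?I" for i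
  proof -
    have "mono_content p = add_mset h (mono_content (erase i p))" using mono_content_erase[of i p] i by simp
    then have eq: "mset (h # hs) = mono_content p \<longleftrightarrow> mset hs = mono_content (erase i p)" by auto
    have "length hs = card (keys (erase i p))" using Cons.prems(1) i by simp
    moreover have "keys m \<inter> keys (erase i p) = {}" if "m \<in> keys G" for m using Cons.prems(2)[OF that] by auto
    ultimately show ?thesis unfolding eq by (rule Cons.IH)
  qed
  then have "\<forall>i\<in>?I. \<exists>c. contrs hs (attach (erase i p) G) = scaleQ c G
      \<and> (if mset (h # hs) = mono_content p then c > 0 else c = 0)" by blast
  from bchoice[OF this] obtain c where "\<forall>i\<in>?I. contrs hs (attach (erase i p) G) = scaleQ (c i) G
      \<and> (if mset (h # hs) = mono_content p then c i > 0 else c i = 0)" ..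
  then have c: "\<And>i. i \<in> ?I \<Longrightarrow> contrs hs (attach (erase i p) G) = scaleQ (c i) G"
      "\<And>i. i \<in> ?I \<Longrightarrow> if mset (h # hs) = mono_content p then c i > 0 else c i = 0"
    by simp_all
  have "contrs (h # hs) (attach p G) = scaleQ (\<Sum>i\<in>?I. c i) G"
    using c(1) by (simp add: step lin_sum[OF lin_contrs] qpoly.scale_sum_left)
  moreover have "if mset (h # hs) = mono_content p then (\<Sum>i\<in>?I. c i) > 0 else (\<Sum>i\<in>?I. c i) = 0"
  proof (cases "mset (h # hs) = mono_content p")
    case True
    then have "h \<in># mono_content p" by (metis list.set_intros(1) set_mset_mset)
    then have "?I \<noteq> {}" by (auto simp: mono_content_def)
    then show ?thesis using True c(2) by (auto intro!: sum_pos)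
  next
    case False
    then show ?thesis using c(2) by (auto intro!: sum.neutral)
  qed
  ultimately show ?case by blast
qed

lemma fresh_monomial:
  assumes "0 \<notin># m"
  obtains p where "mono_content p = m" "keys p \<subseteq> {N<..}"
proof -
  obtain xs where xs: "mset xs = m" using ex_mset by blast
  have inj: "inj_on (\<lambda>k. N + 1 + k) A" for A by (simp add: inj_on_def)
  define p where "p = fill_mono ({0} \<times> {..<length xs}) (\<lambda>b. xs ! snd b) (\<lambda>b. N + 1 + snd b)"
  have fin: "finite {b \<in> {0::nat} \<times> {..<length xs}. xs ! snd b \<noteq> 0}" by simp
  have injT: "inj_on (\<lambda>b. N + 1 + snd b) ({0::nat} \<times> {..<length xs})" by (auto simp: inj_on_def)
  have nz: "xs ! k \<noteq> 0" if "k < length xs" for k using assms xs that by (metis nth_mem set_mset_mset)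
  have all: "{b \<in> {0::nat} \<times> {..<length xs}. xs ! snd b \<noteq> 0} = Pair 0 ` {..<length xs}" using nz by auto
  have "mono_content p = image_mset (\<lambda>b. xs ! snd b) (mset_set (Pair (0::nat) ` {..<length xs}))"
    unfolding p_def mono_content_fill_mono[OF fin injT] all ..
  also have "\<dots> = image_mset (\<lambda>k. xs ! k) (mset_set {..<length xs})"
    by (subst image_mset_mset_set[symmetric]) (simp_all add: inj_on_def multiset.map_comp comp_def)
  also have "\<dots> = mset xs" by (metis atLeast_upt map_nth mset_map mset_upt lessThan_atLeast0)
  finally have "mono_content p = m" using xs by simp
  moreover have "keys p \<subseteq> {N<..}" unfolding p_def keys_fill_mono[OF fin injT] by auto
  ultimately show ?thesis using that by blast
qed

text \<open>The product of \<open>g\<close> with a monomial of content \<open>m\<close> in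
  variables beyond those of \<open>g\<close>, suitably scaled.\<close>

lemma lift_from_layer:
  assumes A: "lower_tableau A" and g: "g \<in> V_lower A" and m: "0 \<notin># m" "m + mset (concat A) \<in> Cs"
  shows "\<exists>F\<in>filt Cs (Suc (size m)). \<forall>hs. length hs = size m \<longrightarrow> contrs hs F = (if mset hs = m then g else 0)"
proof -
  have gk: "g \<in> contr_ker 1" and gp: "g \<in> poly_with {1..} {mset (concat A)}"
    using V_lower_properties[OF A] g by auto
  obtain N where N: "g \<in> poly_with {1..N} {mset (concat A)}" using poly_with_finite_support[OF gp] by blast
  obtain p where p: "mono_content p = m" "keys p \<subseteq> {N<..}" using fresh_monomial[OF m(1)] .
  have disj: "keys q \<inter> keys p = {}" if "q \<in> keys g" for q
    using N that p(2) by (fastforce simp: poly_with_def)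
  have card: "card (keys p) = size m" using p(1) size_mono_content by metis
  obtain xs where xs: "mset xs = m" using ex_mset by blast
  then have len: "length xs = card (keys p)" using card by (metis size_mset)
  obtain c where c: "contrs xs (attach p g) = scaleQ c g" "c > 0"
    using contrs_attach[OF gk len disj] xs p(1) by auto
  define F where "F = scaleQ (1 / c) (attach p g)"
  have val: "contrs hs F = (if mset hs = m then g else 0)" if l: "length hs = size m" for hs
  proof (cases "mset hs = m")
    case True
    then have "contrs hs = contrs xs" using xs by (intro contrs_mset_cong) simp
    then show ?thesis using True c by (simp add: F_def lin_scale[OF lin_contrs])
  next
    case False
    obtain c' where "contrs hs (attach p g) = scaleQ c' g" "if mset hs = mono_content p then c' > 0 else c' = 0"
      using contrs_attach[OF gk _ disj, of hs] l card by auto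
    then show ?thesis using False p(1) by (simp add: F_def lin_scale[OF lin_contrs])
  qed
  have "F \<in> contr_ker (Suc (size m))"
    unfolding contr_ker_def
  proof (intro CollectI allI impI)
    fix hs :: "nat list" assume "length hs = Suc (size m)"
    then obtain hs' h where hs: "hs = hs' @ [h]" "length hs' = size m" by (metis length_Suc_conv_rev)
    have "contr h g = 0" using gk by (simp add: contr_ker_def) (metis fold_simps length_Cons list.size(3) One_nat_def)
    then show "contrs hs F = 0" using val[OF hs(2)] by (simp add: hs(1) lin_0[OF lin_contr])
  qed
  moreover have "attach p g \<in> poly_with {1..} Cs"
    unfolding poly_with_def
  proof (intro CollectI ballI)
    fix q assume "q \<in> keys (attach p g)"
    then obtain q' where q': "q' \<in> keys g" "q = q' + p" using keys_attach by blast
    have "keys q' \<subseteq> {1..}" "mono_content q' = mset (concat A)" using gp q'(1) by (auto simp: poly_with_def)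
    moreover have "keys p \<subseteq> {1..}" using p(2) by force
    ultimately show "keys q \<subseteq> {1..} \<and> mono_content q \<in> Cs"
      using m(2) mono_content_plus[OF disj[OF q'(1)]] by (simp add: q'(2) keys_plus_mono p(1) add.commute)
  qed
  then have "F \<in> poly_with {1..} Cs" unfolding F_def by (rule qpoly.subspace_scale[OF subspace_poly_with])
  ultimately have "F \<in> filt Cs (Suc (size m))" by (simp add: filt_def)
  then show ?thesis using val by blast
qed

lemma V_lower_nonzero:
  assumes "lower_tableau A" shows "\<exists>g\<in>V_lower A. g \<noteq> 0"
proof -
  have pA: "is_partition (shape A)" using assms by (simp add: lower_tableau_def)
  let ?n = "pad_bound A" and ?M = "pad (pad_bound A) A"
  have p: "is_partition (shape ?M)" "sum_list (shape ?M) = ?n" "semistandard ?M"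
    using pad_is_partition[OF pA order_refl] pad_semistandard[OF assms order_refl] by auto
  have "card (diagram (shape ?M)) = card {1..?n}" using p(2) by (simp add: card_diagram)
  then obtain T where T: "bij_betw T (diagram (shape ?M)) {1..?n}"
    using finite_same_card_bij[OF finite_diagram finite_atLeastAtMost] by blast
  have "F_fin ?M T \<noteq> 0"
  proof
    assume "F_fin ?M T = 0"
    then have "(1::rat) = 0"
      using p by (intro independent_fixed_filling[OF p(1) T, of "{?M}" "\<lambda>_. 1" ?M]) auto
    then show False by simp
  qed
  moreover have "F_fin ?M T \<in> V_lower A"
    using F_fin_in_V_fin[OF p(2) T] V_fin_pad_subset[OF pA order_refl] by blast
  ultimately show ?thesis by blast
qed

text \<open>Distribute the elements of \<open>mu\<close>: \<open>f\<close> of them form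
  \<open>m\<close>, and the others form a single row \<open>A\<close>.\<close>

lemma filt_strict:
  assumes mu: "mu \<in> Cs" "0 \<notin># mu" and f: "f \<le> size mu"
  shows "filt Cs f \<subset> filt Cs (Suc f)"
proof -
  define xs where "xs = sorted_list_of_multiset mu"
  define m where "m = mset (take f xs)"
  define A where "A = (if drop f xs = [] then [] else [drop f xs])"
  have set: "0 \<notin> set xs" using mu(2) by (simp add: xs_def)
  have "length xs = size mu" unfolding xs_def by (metis mset_sorted_list_of_multiset size_mset)
  then have size: "size m = f" using f by (simp add: m_def)
  have A: "lower_tableau A"
    using set in_set_dropD[of 0 f xs] sorted_wrt_drop[of "(\<le>)" xs f]
    by (auto simp: A_def lower_tableau_def shape_def is_partition_def semistandard_def xs_def)
  have "m + mset (concat A) = mset (take f xs @ drop f xs)" by (simp add: m_def A_def del: append_take_drop_id)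
  then have mem: "m + mset (concat A) \<in> Cs" using mu(1) by (simp add: xs_def)
  have m0: "0 \<notin># m" using set in_set_takeD[of 0 f xs] by (auto simp: m_def)
  obtain g where g: "g \<in> V_lower A" "g \<noteq> 0" using V_lower_nonzero[OF A] by blast
  from lift_from_layer[OF A g(1) m0 mem, unfolded size] obtain F where F: "F \<in> filt Cs (Suc f)" "\<forall>hs. length hs = f \<longrightarrow> contrs hs F = (if mset hs = m then g else 0)"
    by (rule bexE)
  have "contrs (take f xs) F = g" using F(2) size by (simp add: m_def)
  moreover have "length (take f xs) = f" using size by (simp add: m_def)
  ultimately have "F \<notin> contr_ker f" using g(2) unfolding contr_ker_def by blast
  then show ?thesis using F(1) filt_mono[of f "Suc f" Cs] by (auto simp: filt_def)
qed

theorem strict_filtration_filt: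
  assumes le: "\<And>\<mu>. \<mu> \<in> Cs \<Longrightarrow> size \<mu> \<le> l" and mu: "mu \<in> Cs" "0 \<notin># mu" "size mu = l"
    and G: "G \<subseteq> S_N" and V: "\<And>f. V f = filt Cs (nat (f + 1))"
  shows "strict_filtration G (poly_with {1..} Cs) l V"
  unfolding strict_filtration_def
proof (intro conjI ballI)
  show "V (- 1) = {0}" by (simp add: V)
  show "V (int l) = poly_with {1..} Cs" using filt_full[OF le] by (simp add: V nat_add_distrib)
  show "V (f - 1) \<subset> V f" if "f \<in> {0..int l}" for f
  proof -
    have "nat f \<le> size mu" using that mu(3) by (simp add: nat_le_iff)
    then have "filt Cs (nat f) \<subset> filt Cs (Suc (nat f))" by (rule filt_strict[OF mu(1,2)])
    then show ?thesis using that by (simp add: V nat_add_distrib)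
  qed
  show "subrep G (V f)" for f
    using subspace_filt perm_act_filt G by (auto simp: subrep_def V)
qed


section \<open>Decomposing the bottom layer\<close>

text \<open>A decomposition of \<open>G\<close> along the spaces \<open>V_lower A\<close>, of all
  shapes and contents at once.\<close>

definition decomposes :: "(nat list list \<Rightarrow> qpoly) \<Rightarrow> qpoly \<Rightarrow> bool" where
  "decomposes g G \<longleftrightarrow> finite {A. g A \<noteq> 0} \<and> (\<forall>A. g A \<noteq> 0 \<longrightarrow> lower_tableau A \<and> g A \<in> V_lower A)
    \<and> G = (\<Sum>A\<in>{A. g A \<noteq> 0}. g A)"

lemma decomposesI:
  assumes "finite S" "\<And>A. A \<in> S \<Longrightarrow> lower_tableau A \<and> g A \<in> V_lower A" "\<And>A. A \<notin> S \<Longrightarrow> g A = 0"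
    and "G = (\<Sum>A\<in>S. g A)"
  shows "decomposes g G"
proof -
  have sub: "{A. g A \<noteq> 0} \<subseteq> S" using assms(3) by blast
  then have "(\<Sum>A\<in>S. g A) = (\<Sum>A\<in>{A. g A \<noteq> 0}. g A)"
    using assms(1) by (intro sum.mono_neutral_right) auto
  then show ?thesis
    using assms sub finite_subset[OF sub] unfolding decomposes_def by blast
qed

lemma decomposes_sum:
  assumes "decomposes g G" "finite S" "{A. g A \<noteq> 0} \<subseteq> S" shows "G = (\<Sum>A\<in>S. g A)"
proof -
  have "(\<Sum>A\<in>{A. g A \<noteq> 0}. g A) = (\<Sum>A\<in>S. g A)"
    using assms by (intro sum.mono_neutral_left) auto
  then show ?thesis using assms(1) by (simp add: decomposes_def)
qed

lemma decomposes_member: "decomposes g G \<Longrightarrow> g A \<in> V_lower A"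
  by (cases "g A = 0") (auto simp: decomposes_def qpoly.subspace_0[OF subspace_V_lower])

lemma decomposes_combine:
  assumes g: "decomposes g G" and h: "decomposes h H"
  shows "decomposes (\<lambda>A. scaleQ c (g A) + h A) (scaleQ c G + H)"
proof (rule decomposesI[where S = "{A. g A \<noteq> 0} \<union> {A. h A \<noteq> 0}"])
  let ?S = "{A. g A \<noteq> 0} \<union> {A. h A \<noteq> 0}"
  show fin: "finite ?S" using g h by (simp add: decomposes_def)
  show "lower_tableau A \<and> scaleQ c (g A) + h A \<in> V_lower A" if "A \<in> ?S" for A
    using that g h decomposes_member[OF g, of A] decomposes_member[OF h, of A]
      qpoly.subspace_add[OF subspace_V_lower] qpoly.subspace_scale[OF subspace_V_lower]
    unfolding decomposes_def by blast
  have "G = (\<Sum>A\<in>?S. g A)" "H = (\<Sum>A\<in>?S. h A)"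
    using decomposes_sum[OF g fin] decomposes_sum[OF h fin] by auto
  then show "scaleQ c G + H = (\<Sum>A\<in>?S. scaleQ c (g A) + h A)"
    by (simp add: sum.distrib qpoly.scale_sum_right)
qed auto

lemma decomposes_perm_act:
  assumes g: "decomposes g G" and s: "\<sigma> \<in> S_N"
  shows "decomposes (\<lambda>A. perm_act \<sigma> (g A)) (perm_act \<sigma> G)"
proof (rule decomposesI[where S = "{A. g A \<noteq> 0}"])
  show "lower_tableau A \<and> perm_act \<sigma> (g A) \<in> V_lower A" if "A \<in> {A. g A \<noteq> 0}" for A
    using that g s by (auto simp: decomposes_def lower_tableau_def S_N_def intro: perm_act_V_lower)
  show "perm_act \<sigma> G = (\<Sum>A\<in>{A. g A \<noteq> 0}. perm_act \<sigma> (g A))"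
    using g by (simp add: decomposes_def perm_act_sum)
qed (use g in \<open>auto simp: decomposes_def\<close>)

lemma decomposes_unique:
  assumes g: "decomposes g G" and h: "decomposes h G" shows "g = h"
proof
  fix A
  let ?d = "\<lambda>A. scaleQ (-1) (g A) + h A"
  have d: "decomposes ?d 0" using decomposes_combine[OF g h, of "-1"] by simp
  have "?d A = 0"
  proof (cases "A \<in> {A. ?d A \<noteq> 0}")
    case True
    show ?thesis
      by (rule V_lower_independent[where \<A> = "{A. ?d A \<noteq> 0}", OF _ _ _ _ True])
        (use d in \<open>auto simp: decomposes_def\<close>)
  qed simp
  then show "g A = h A" by simp
qed

lemma decomposes_0: "decomposes (\<lambda>_. 0) 0"
  by (simp add: decomposes_def)

lemma decomposition_of_span:
  assumes "G \<in> qpoly.span (\<Union>A\<in>\<A>. V_lower A)" "\<And>A. A \<in> \<A> \<Longrightarrow> lower_tableau A"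
  shows "\<exists>g. decomposes g G \<and> (\<forall>A. g A \<noteq> 0 \<longrightarrow> A \<in> \<A>)"
  using assms(1)
proof (induction rule: qpoly.span_induct_alt)
  case base
  show ?case using decomposes_0 by blast
next
  case (step c x y)
  then obtain A h where A: "A \<in> \<A>" "x \<in> V_lower A" and h: "decomposes h y" "\<forall>A. h A \<noteq> 0 \<longrightarrow> A \<in> \<A>" by blast
  let ?x = "\<lambda>B. if B = A then x else 0"
  have "decomposes ?x x"
    by (rule decomposesI[where S = "{A}"]) (use A assms(2) in auto)
  then have "decomposes (\<lambda>B. scaleQ c (?x B) + h B) (scaleQ c x + y)" using h(1) by (rule decomposes_combine)
  moreover have "B \<in> \<A>" if "scaleQ c (?x B) + h B \<noteq> 0" for B
    using that A(1) h(2) by (cases "B = A") auto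
  ultimately show ?case by blast
qed


section \<open>The quotients\<close>

lemma finite_submultisets: "finite {m. m \<subseteq># (M :: nat multiset)}"
proof (rule finite_subset)
  show "{m. m \<subseteq># M} \<subseteq> mset ` {xs. set xs \<subseteq> set_mset M \<and> length xs \<le> size M}"
  proof
    fix m assume m: "m \<in> {m. m \<subseteq># M}"
    obtain xs where xs: "mset xs = m" using ex_mset by blast
    have "set xs \<subseteq> set_mset M" using m xs set_mset_mono by fastforce
    moreover have "length xs \<le> size M" using m xs size_mset_mono by fastforce
    ultimately show "m \<in> mset ` {xs. set xs \<subseteq> set_mset M \<and> length xs \<le> size M}" using xs by blast
  qed
  show "finite (mset ` {xs. set xs \<subseteq> set_mset M \<and> length xs \<le> size M})"
    by (intro finite_imageI finite_lists_length_le) simp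
qed

text \<open>The first isomorphism theorem, for the encoding of quotients by cosets. A coset is
  mapped to the value of \<open>\<psi>\<close> at an arbitrary element of it.\<close>

lemma quotient_iso:
  assumes U: "qpoly.subspace U" and V: "qpoly.subspace V" and UV: "U \<subseteq> V"
    and stable: "\<And>\<sigma> F. \<sigma> \<in> S \<Longrightarrow> F \<in> U \<Longrightarrow> perm_act \<sigma> F \<in> U" "\<And>\<sigma> F. \<sigma> \<in> S \<Longrightarrow> F \<in> V \<Longrightarrow> perm_act \<sigma> F \<in> V"
    and add: "\<And>F G. F \<in> V \<Longrightarrow> G \<in> V \<Longrightarrow> \<psi> (F + G) = (\<lambda>i. \<psi> F i + \<psi> G i)"
    and scale: "\<And>c F. F \<in> V \<Longrightarrow> \<psi> (scaleQ c F) = (\<lambda>i. scaleQ c (\<psi> F i))"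
    and act: "\<And>\<sigma> F. \<sigma> \<in> S \<Longrightarrow> F \<in> V \<Longrightarrow> \<psi> (perm_act \<sigma> F) = (\<lambda>i. perm_act \<sigma> (\<psi> F i))"
    and onto: "\<psi> ` V = rcarrier (dsum_rep I Y)"
    and ker: "\<And>F. F \<in> V \<Longrightarrow> \<psi> F = (\<lambda>_. 0) \<longleftrightarrow> F \<in> U"
  shows "rep_iso S (quot_rep V U) (dsum_rep I Y)"
proof -
  let ?coset = "\<lambda>F. {F + G | G. G \<in> U}"
  define \<phi> where "\<phi> A = \<psi> (SOME F. F \<in> A)" for A
  have U0: "0 \<in> U" using U by (rule qpoly.subspace_0)
  have \<phi>: "\<phi> A = v" if "F \<in> A" "\<And>F. F \<in> A \<Longrightarrow> \<psi> F = v" for A F v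
    unfolding \<phi>_def using that by (metis someI)
  have shift: "\<psi> (F + G) = \<psi> F" if "F \<in> V" "G \<in> U" for F G
  proof -
    have "\<psi> G = (\<lambda>_. 0)" using ker[of G] that UV by blast
    then show ?thesis using add[of F G] that UV by auto
  qed
  have self: "F \<in> ?coset F" for F using U0 by force
  have \<phi>_coset: "\<phi> (?coset F) = \<psi> F" if "F \<in> V" for F
    by (rule \<phi>[OF self]) (use shift that in auto)
  have carrier: "rcarrier (quot_rep V U) = ?coset ` V" by (simp add: quot_rep_def)
  have "bij_betw \<phi> (?coset ` V) (rcarrier (dsum_rep I Y))"
  proof (rule bij_betw_imageI)
    show "inj_on \<phi> (?coset ` V)"
    proof (rule inj_onI)
      fix A B assume "A \<in> ?coset ` V" "B \<in> ?coset ` V" and eq: "\<phi> A = \<phi> B"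
      then obtain F G where F: "F \<in> V" "A = ?coset F" and G: "G \<in> V" "B = ?coset G" by blast
      have "\<psi> F = \<psi> G" using eq \<phi>_coset F G by simp
      moreover have "\<psi> (F - G) = (\<lambda>i. \<psi> F i + \<psi> (scaleQ (-1) G) i)"
        using add[OF F(1) qpoly.subspace_scale[OF V G(1), of "-1"]] by simp
      ultimately have "\<psi> (F - G) = (\<lambda>_. 0)" using scale[OF G(1), of "-1"] by simp
      then have d: "F - G \<in> U" using ker[of "F - G"] qpoly.subspace_diff[OF V F(1) G(1)] by simp
      show "A = B"
      proof
        show "A \<subseteq> B"
        proof
          fix x assume "x \<in> A"
          then obtain u where u: "u \<in> U" "x = F + u" using F(2) by blast
          have "x = G + ((F - G) + u)" using u by simp
          then show "x \<in> B" using qpoly.subspace_add[OF U d u(1)] G(2) by blast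
        qed
        show "B \<subseteq> A"
        proof
          fix x assume "x \<in> B"
          then obtain u where u: "u \<in> U" "x = G + u" using G(2) by blast
          have "x = F + (u - (F - G))" using u by simp
          then show "x \<in> A" using qpoly.subspace_diff[OF U u(1) d] F(2) by blast
        qed
      qed
    qed
    have "\<phi> ` ?coset ` V = \<psi> ` V" unfolding image_image using \<phi>_coset by (rule image_cong[OF refl])
    then show "\<phi> ` ?coset ` V = rcarrier (dsum_rep I Y)" using onto by simp
  qed
  moreover have "\<phi> (radd (quot_rep V U) A B) = radd (dsum_rep I Y) (\<phi> A) (\<phi> B)"
    if AB: "A \<in> ?coset ` V" "B \<in> ?coset ` V" for A B
  proof -
    obtain F G where F: "F \<in> V" "A = ?coset F" and G: "G \<in> V" "B = ?coset G"
      using AB by blast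
    have "\<phi> {F + G | F G. F \<in> A \<and> G \<in> B} = \<psi> (F + G)"
    proof (rule \<phi>)
      have "F \<in> A" "G \<in> B" unfolding F(2) G(2) by (rule self)+
      then show "F + G \<in> {F + G | F G. F \<in> A \<and> G \<in> B}" by blast
      fix x assume "x \<in> {F + G | F G. F \<in> A \<and> G \<in> B}"
      then obtain u v where "u \<in> U" "v \<in> U" "x = (F + u) + (G + v)" using F G by blast
      then have "x = (F + G) + (u + v)" "u + v \<in> U" using qpoly.subspace_add[OF U] by (auto simp: algebra_simps)
      then show "\<psi> x = \<psi> (F + G)" using shift qpoly.subspace_add[OF V F(1) G(1)] by simp
    qed
    then show ?thesis using add[OF F(1) G(1)] F G \<phi>_coset by (simp add: quot_rep_def dsum_rep_def)
  qed
  moreover have "\<phi> (rscale (quot_rep V U) c A) = rscale (dsum_rep I Y) c (\<phi> A)" if A: "A \<in> ?coset ` V" for c A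
  proof -
    obtain F where F: "F \<in> V" "A = ?coset F" using A by blast
    have "\<phi> {scaleQ c F + G | F G. F \<in> A \<and> G \<in> U} = \<psi> (scaleQ c F)"
    proof (rule \<phi>)
      have "F \<in> A" unfolding F(2) by (rule self)
      then have "scaleQ c F + 0 \<in> {scaleQ c F + G | F G. F \<in> A \<and> G \<in> U}" using U0 by blast
      then show "scaleQ c F \<in> {scaleQ c F + G | F G. F \<in> A \<and> G \<in> U}" by simp
      fix x assume "x \<in> {scaleQ c F + G | F G. F \<in> A \<and> G \<in> U}"
      then obtain u v where "u \<in> U" "v \<in> U" "x = scaleQ c (F + u) + v" using F by blast
      then have "x = scaleQ c F + (scaleQ c u + v)" "scaleQ c u + v \<in> U"
        using qpoly.subspace_add[OF U] qpoly.subspace_scale[OF U] by (auto simp: qpoly.scale_right_distrib algebra_simps)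
      then show "\<psi> x = \<psi> (scaleQ c F)" using shift qpoly.subspace_scale[OF V F(1)] by simp
    qed
    then show ?thesis using scale[OF F(1)] F \<phi>_coset by (simp add: quot_rep_def dsum_rep_def)
  qed
  moreover have "\<phi> (ract (quot_rep V U) \<sigma> A) = ract (dsum_rep I Y) \<sigma> (\<phi> A)" if s: "\<sigma> \<in> S" and A: "A \<in> ?coset ` V" for \<sigma> A
  proof -
    obtain F where F: "F \<in> V" "A = ?coset F" using A by blast
    have "\<phi> (perm_act \<sigma> ` A) = \<psi> (perm_act \<sigma> F)"
    proof (rule \<phi>)
      have "F \<in> A" unfolding F(2) by (rule self)
      then show "perm_act \<sigma> F \<in> perm_act \<sigma> ` A" by blast
      fix x assume "x \<in> perm_act \<sigma> ` A"
      then obtain u where "u \<in> U" "x = perm_act \<sigma> (F + u)" using F by blast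
      then show "\<psi> x = \<psi> (perm_act \<sigma> F)"
        using shift[OF stable(2)[OF s F(1)] stable(1)[OF s]] by (simp add: perm_act_add)
    qed
    then show ?thesis using act[OF s F(1)] F \<phi>_coset by (simp add: quot_rep_def dsum_rep_def)
  qed
  ultimately show ?thesis unfolding rep_iso_def carrier by blast
qed

definition layer_index :: "nat multiset set \<Rightarrow> nat \<Rightarrow> tab_inf set" where
  "layer_index Cs f = {(A, m). lower_tableau A \<and> 0 \<notin># m \<and> m + mset (concat A) \<in> Cs \<and> size m = f}"

text \<open>The component at \<open>(A, m)\<close> is the \<open>A\<close>-component of the
  contraction by \<open>m\<close>. By \<open>contrs_mset_cong\<close> the order in which the
  elements of \<open>m\<close> are listed is irrelevant.\<close>

definition symbol :: "nat multiset set \<Rightarrow> nat \<Rightarrow> qpoly \<Rightarrow> tab_inf \<Rightarrow> qpoly" where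
  "symbol Cs f F = (\<lambda>(A, m). if (A, m) \<in> layer_index Cs f
    then (SOME g. decomposes g (contrs (sorted_list_of_multiset m) F)) A else 0)"

lemma symbol_eqI:
  assumes "\<And>i. i \<notin> layer_index Cs f \<Longrightarrow> u i = 0"
    and dec: "\<And>m. 0 \<notin># m \<Longrightarrow> size m = f \<Longrightarrow> decomposes (\<lambda>A. u (A, m)) (contrs (sorted_list_of_multiset m) F)"
  shows "symbol Cs f F = u"
proof
  fix i :: tab_inf
  obtain A m where i: "i = (A, m)" by fastforce
  show "symbol Cs f F i = u i"
  proof (cases "i \<in> layer_index Cs f")
    case True
    then have m: "0 \<notin># m" "size m = f" by (auto simp: i layer_index_def)
    have "(SOME g. decomposes g (contrs (sorted_list_of_multiset m) F)) = (\<lambda>A. u (A, m))"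
      using dec[OF m] decomposes_unique by (intro some_equality) auto
    then show ?thesis using True by (simp add: symbol_def i)
  next
    case False
    then show ?thesis using assms(1) by (simp add: symbol_def i)
  qed
qed

context
  fixes Cs :: "nat multiset set" and d f :: nat
  assumes Cs: "\<And>\<mu>. \<mu> \<in> Cs \<Longrightarrow> sum_mset \<mu> = d"
begin

lemma symbol_decomposes:
  assumes F: "F \<in> filt Cs (Suc f)" and m: "0 \<notin># m" "size m = f"
  shows "decomposes (\<lambda>A. symbol Cs f F (A, m)) (contrs (sorted_list_of_multiset m) F)"
proof -
  let ?G = "contrs (sorted_list_of_multiset m) F"
  let ?Cs = "{\<nu>. \<nu> + m \<in> Cs}"
  have len: "length (sorted_list_of_multiset m) = f" using m(2) by (metis mset_sorted_list_of_multiset size_mset)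
  have "?G \<in> contr_ker 1" using F contrs_in_contr_ker[of F "sorted_list_of_multiset m" 1] len by (simp add: filt_def)
  moreover have "?G \<in> poly_with {1..} ?Cs"
    using F contr_poly_with[of F "{1..}" Cs "sorted_list_of_multiset m"] by (simp add: filt_def)
  moreover have "sum_mset \<nu> = d - sum_mset m" if "\<nu> \<in> ?Cs" for \<nu> using Cs[of "\<nu> + m"] that by auto
  ultimately have "?G \<in> qpoly.span (\<Union>A\<in>{A. lower_tableau A \<and> mset (concat A) \<in> ?Cs}. V_lower A)"
    by (intro contr_ker_1_spanned) auto
  then have "\<exists>g. decomposes g ?G \<and> (\<forall>A. g A \<noteq> 0 \<longrightarrow> A \<in> {A. lower_tableau A \<and> mset (concat A) \<in> ?Cs})"
    by (rule decomposition_of_span) simp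
  then obtain g where g: "decomposes g ?G" "\<forall>A. g A \<noteq> 0 \<longrightarrow> A \<in> {A. lower_tableau A \<and> mset (concat A) \<in> ?Cs}"
    by (elim exE conjE)
  have some: "(SOME g. decomposes g ?G) = g"
    using g(1) decomposes_unique by (intro some_equality) auto
  have "(\<lambda>A. symbol Cs f F (A, m)) = g"
  proof
    fix A
    have "(A, m) \<in> layer_index Cs f" if "g A \<noteq> 0"
      using g(2) that m by (simp add: layer_index_def add.commute)
    then show "symbol Cs f F (A, m) = g A" unfolding symbol_def by (cases "g A = 0") (auto simp: some)
  qed
  then show ?thesis using g(1) by simp
qed

lemma symbol_outside: "i \<notin> layer_index Cs f \<Longrightarrow> symbol Cs f F i = 0"
  by (cases i) (simp add: symbol_def)

lemma symbol_linear:
  assumes F: "F \<in> filt Cs (Suc f)" and G: "G \<in> filt Cs (Suc f)"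
  shows "symbol Cs f (scaleQ c F + G) = (\<lambda>i. scaleQ c (symbol Cs f F i) + symbol Cs f G i)"
proof (rule symbol_eqI)
  fix m :: "nat multiset" assume m: "0 \<notin># m" "size m = f"
  show "decomposes (\<lambda>A. scaleQ c (symbol Cs f F (A, m)) + symbol Cs f G (A, m)) (contrs (sorted_list_of_multiset m) (scaleQ c F + G))"
    using decomposes_combine[OF symbol_decomposes[OF F m] symbol_decomposes[OF G m]]
    by (simp add: lin_add[OF lin_contrs] lin_scale[OF lin_contrs])
qed (simp add: symbol_outside)

lemma symbol_zero: "symbol Cs f 0 = (\<lambda>_. 0)"
  by (rule symbol_eqI) (simp_all add: lin_0[OF lin_contrs] decomposes_0)

lemma symbol_perm_act:
  assumes F: "F \<in> filt Cs (Suc f)" and s: "\<sigma> \<in> S_N"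
  shows "symbol Cs f (perm_act \<sigma> F) = (\<lambda>i. perm_act \<sigma> (symbol Cs f F i))"
proof (rule symbol_eqI)
  fix m :: "nat multiset" assume m: "0 \<notin># m" "size m = f"
  have "bij \<sigma>" using s by (simp add: S_N_def permutes_bij)
  then show "decomposes (\<lambda>A. perm_act \<sigma> (symbol Cs f F (A, m))) (contrs (sorted_list_of_multiset m) (perm_act \<sigma> F))"
    using decomposes_perm_act[OF symbol_decomposes[OF F m] s] by (simp add: contrs_perm_act)
qed (simp add: symbol_outside)

lemma contrs_with_zero: "0 \<in> set hs \<Longrightarrow> contrs hs F = 0"
proof (induction hs arbitrary: F)
  case (Cons h hs)
  have "contr 0 G = 0" for G
  proof -
    have "contr 0 (mono_poly p) = 0" for p
      unfolding contr_mono_poly by (rule sum.neutral) (auto simp: in_keys_iff)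
    then show ?thesis by (subst contr_expand) simp
  qed
  then show ?case using Cons by (cases "h = 0") (auto simp: lin_0[OF lin_contrs])
qed simp

text \<open>If the components vanish, so do all contractions by lists of \<open>f\<close> positive
  numbers; those by lists containing \<open>0\<close> vanish anyway.\<close>

lemma symbol_kernel:
  assumes F: "F \<in> filt Cs (Suc f)"
  shows "symbol Cs f F = (\<lambda>_. 0) \<longleftrightarrow> F \<in> filt Cs f"
proof
  assume z: "symbol Cs f F = (\<lambda>_. 0)"
  have "contrs hs F = 0" if len: "length hs = f" for hs
  proof (cases "0 \<in> set hs")
    case True then show ?thesis by (rule contrs_with_zero)
  next
    case False
    have "contrs (sorted_list_of_multiset (mset hs)) F = 0"
      using symbol_decomposes[OF F, of "mset hs"] False len unfolding z by (simp add: decomposes_def)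
    then show ?thesis using contrs_mset_cong[of hs "sorted_list_of_multiset (mset hs)"] by simp
  qed
  then show "F \<in> filt Cs f" using F by (simp add: filt_def contr_ker_def)
next
  assume "F \<in> filt Cs f"
  then have z: "contrs hs F = 0" if "length hs = f" for hs using that by (simp add: filt_def contr_ker_def)
  show "symbol Cs f F = (\<lambda>_. 0)"
  proof (rule symbol_eqI)
    fix m :: "nat multiset" assume "size m = f"
    then have "length (sorted_list_of_multiset m) = f" by (metis mset_sorted_list_of_multiset size_mset)
    then show "decomposes (\<lambda>A. 0) (contrs (sorted_list_of_multiset m) F)" using z decomposes_0 by simp
  qed simp
qed

text \<open>A contraction by \<open>m\<close> can be non-zero only if \<open>m\<close> is
  contained in the content of a monomial of \<open>F\<close>.\<close>

lemma symbol_finite_support: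
  assumes F: "F \<in> filt Cs (Suc f)" shows "finite {i. symbol Cs f F i \<noteq> 0}"
proof -
  let ?M = "\<Union>p\<in>keys F. {m. m \<subseteq># mono_content p}"
  let ?M' = "{m \<in> ?M. 0 \<notin># m \<and> size m = f}"
  have "{i. symbol Cs f F i \<noteq> 0} \<subseteq> (\<Union>m\<in>?M'. (\<lambda>A. (A, m)) ` {A. symbol Cs f F (A, m) \<noteq> 0})"
  proof
    fix i assume i: "i \<in> {i. symbol Cs f F i \<noteq> 0}"
    obtain A m where Am: "i = (A, m)" by fastforce
    have "i \<in> layer_index Cs f" using i symbol_outside by blast
    then have m: "0 \<notin># m" "size m = f" by (auto simp: Am layer_index_def)
    have dec: "decomposes (\<lambda>A. symbol Cs f F (A, m)) (contrs (sorted_list_of_multiset m) F)"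
      by (rule symbol_decomposes[OF F m])
    have "contrs (sorted_list_of_multiset m) F \<noteq> 0"
    proof
      assume "contrs (sorted_list_of_multiset m) F = 0"
      then have "decomposes (\<lambda>A. symbol Cs f F (A, m)) 0" using dec by simp
      then have "(\<lambda>A. symbol Cs f F (A, m)) = (\<lambda>_. 0)" using decomposes_0 by (rule decomposes_unique)
      then show False using i Am by (simp add: fun_eq_iff)
    qed
    then obtain q where "q \<in> keys (contrs (sorted_list_of_multiset m) F)" by (metis keys_eq_empty equals0I)
    then obtain p where "p \<in> keys F" "mono_content p = mono_content q + m" using keys_contrs by fastforce
    then have "m \<subseteq># mono_content p" "p \<in> keys F" by simp_all
    then have "m \<in> ?M'" using m by blast
    then show "i \<in> (\<Union>m\<in>?M'. (\<lambda>A. (A, m)) ` {A. symbol Cs f F (A, m) \<noteq> 0})" using i Am by blast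
  qed
  moreover have "finite ?M" by (simp add: finite_submultisets)
  then have "finite ?M'" by simp
  moreover have "finite {A. symbol Cs f F (A, m) \<noteq> 0}" if "m \<in> ?M'" for m
    using symbol_decomposes[OF F, of m] that by (simp add: decomposes_def)
  ultimately show ?thesis by (meson finite_UN_I finite_imageI finite_subset)
qed

text \<open>Each component is lifted separately by \<open>lift_from_layer\<close>; the lifts do
  not interfere.\<close>

lemma symbol_onto:
  "symbol Cs f ` filt Cs (Suc f) = rcarrier (dsum_rep (layer_index Cs f) (\<lambda>M. V_inf (zero_mult M)))"
proof
  show "symbol Cs f ` filt Cs (Suc f) \<subseteq> rcarrier (dsum_rep (layer_index Cs f) (\<lambda>M. V_inf (zero_mult M)))"
  proof (rule image_subsetI)
    fix F assume F: "F \<in> filt Cs (Suc f)"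
    have "symbol Cs f F i \<in> V_inf (zero_mult i)" if i: "i \<in> layer_index Cs f" for i
    proof -
      obtain A m where Am: "i = (A, m)" by fastforce
      then have "0 \<notin># m" "size m = f" using i by (auto simp: layer_index_def)
      from decomposes_member[OF symbol_decomposes[OF F this], of A] show ?thesis by (simp add: Am zero_mult_def)
    qed
    then show "symbol Cs f F \<in> rcarrier (dsum_rep (layer_index Cs f) (\<lambda>M. V_inf (zero_mult M)))"
      using symbol_outside symbol_finite_support[OF F] by (simp add: dsum_rep_def)
  qed
  show "rcarrier (dsum_rep (layer_index Cs f) (\<lambda>M. V_inf (zero_mult M))) \<subseteq> symbol Cs f ` filt Cs (Suc f)"
  proof
    fix g assume "g \<in> rcarrier (dsum_rep (layer_index Cs f) (\<lambda>M. V_inf (zero_mult M)))"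
    then have gV: "\<And>i. i \<in> layer_index Cs f \<Longrightarrow> g i \<in> V_inf (zero_mult i)"
      and g0: "\<And>i. i \<notin> layer_index Cs f \<Longrightarrow> g i = 0" and fin: "finite {i. g i \<noteq> 0}"
      by (auto simp: dsum_rep_def)
    let ?I = "{i. g i \<noteq> 0}"
    have idx: "i \<in> layer_index Cs f" if "i \<in> ?I" for i using that g0 by blast
    have "\<exists>F\<in>filt Cs (Suc f). \<forall>hs. length hs = f \<longrightarrow> contrs hs F = (if mset hs = snd i then g i else 0)"
      if i: "i \<in> ?I" for i
    proof -
      obtain A m where Am: "i = (A, m)" by fastforce
      have p: "lower_tableau A" "0 \<notin># m" "m + mset (concat A) \<in> Cs" "size m = f"
        using idx[OF i] by (auto simp: Am layer_index_def)
      have "g i \<in> V_lower A" using gV[OF idx[OF i]] by (simp add: Am zero_mult_def)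
      from lift_from_layer[OF p(1) this p(2,3)] show ?thesis unfolding p(4) Am by simp
    qed
    then have "\<forall>i\<in>?I. \<exists>F. F \<in> filt Cs (Suc f) \<and> (\<forall>hs. length hs = f \<longrightarrow> contrs hs F = (if mset hs = snd i then g i else 0))"
      by blast
    from bchoice[OF this] obtain F where F: "\<forall>i\<in>?I. F i \<in> filt Cs (Suc f) \<and>
        (\<forall>hs. length hs = f \<longrightarrow> contrs hs (F i) = (if mset hs = snd i then g i else 0))" ..
    define H where "H = (\<Sum>i\<in>?I. F i)"
    have H: "H \<in> filt Cs (Suc f)"
      unfolding H_def using F by (intro qpoly.subspace_sum[OF subspace_filt]) auto
    have "symbol Cs f H = g"
    proof (rule symbol_eqI)
      fix m :: "nat multiset" assume m: "0 \<notin># m" "size m = f"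
      have len: "length (sorted_list_of_multiset m) = f" using m(2) by (metis mset_sorted_list_of_multiset size_mset)
      let ?S = "fst ` {i \<in> ?I. snd i = m}"
      show "decomposes (\<lambda>A. g (A, m)) (contrs (sorted_list_of_multiset m) H)"
      proof (rule decomposesI[where S = ?S])
        show "finite ?S" using fin by simp
        show "lower_tableau A \<and> g (A, m) \<in> V_lower A" if "A \<in> ?S" for A
        proof -
          have "(A, m) \<in> layer_index Cs f" using that idx by fastforce
          then show ?thesis using gV[of "(A, m)"] by (simp add: layer_index_def zero_mult_def)
        qed
        show "g (A, m) = 0" if "A \<notin> ?S" for A using that by (force simp: image_iff)
        have inj: "inj_on fst {i \<in> ?I. snd i = m}" by (auto simp: inj_on_def)
        have "contrs (sorted_list_of_multiset m) H = (\<Sum>i\<in>?I. if m = snd i then g i else 0)"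
          unfolding H_def lin_sum[OF lin_contrs] using F len by (intro sum.cong) auto
        also have "\<dots> = (\<Sum>i\<in>{i \<in> ?I. snd i = m}. g i)"
          using fin by (intro sum.mono_neutral_cong_right) auto
        also have "\<dots> = (\<Sum>i\<in>{i \<in> ?I. snd i = m}. g (fst i, m))" by (intro sum.cong) auto
        also have "\<dots> = (\<Sum>A\<in>?S. g (A, m))" by (subst sum.reindex[OF inj]) simp
        finally show "contrs (sorted_list_of_multiset m) H = (\<Sum>A\<in>?S. g (A, m))" .
      qed
    qed (rule g0)
    then show "g \<in> symbol Cs f ` filt Cs (Suc f)" using H by blast
  qed
qed

theorem layer_iso:
  assumes G: "G \<subseteq> S_N"
  shows "rep_iso G (quot_rep (filt Cs (Suc f)) (filt Cs f))
    (dsum_rep (layer_index Cs f) (\<lambda>M. V_inf (zero_mult M)))"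
proof (rule quotient_iso[where \<psi> = "symbol Cs f"])
  show "filt Cs f \<subseteq> filt Cs (Suc f)" by (rule filt_mono) simp
  show "symbol Cs f (F + H) = (\<lambda>i. symbol Cs f F i + symbol Cs f H i)"
    if "F \<in> filt Cs (Suc f)" "H \<in> filt Cs (Suc f)" for F H
    using symbol_linear[OF that, of 1] by simp
  show "symbol Cs f (scaleQ c F) = (\<lambda>i. scaleQ c (symbol Cs f F i))" if "F \<in> filt Cs (Suc f)" for c F
    using symbol_linear[OF that qpoly.subspace_0[OF subspace_filt], of c] by (simp add: symbol_zero)
qed (use G in \<open>auto intro: subspace_filt perm_act_filt symbol_perm_act simp: symbol_kernel symbol_onto\<close>)

end

lemma layer_index_degree:
  "layer_index (contents_of d) f
    = (\<Union>lam\<in>{lam. is_partition lam}. {M \<in> SSYT_inf_deg d lam. fnum_inf M = f})"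
  by (auto simp: layer_index_def contents_of_def is_content_def lower_tableau_def SSYT_inf_deg_def SSYT_inf_def
      content_inf_def fnum_inf_def)

lemma layer_index_content:
  "layer_index {mu} f
    = (\<Union>lam\<in>{lam. is_partition lam}. {M \<in> SSYT_inf_cont mu lam. fnum_inf M = f})"
  by (auto simp: layer_index_def lower_tableau_def SSYT_inf_cont_def SSYT_inf_def content_inf_def fnum_inf_def)

lemma S_infty_subset: "S_infty \<subseteq> S_N"
  by (auto simp: S_infty_def S_N_def intro: permutes_subset)

lemma size_le_sum_mset: "0 \<notin># (\<mu> :: nat multiset) \<Longrightarrow> size \<mu> \<le> sum_mset \<mu>"
  by (induction \<mu>) (auto simp: Suc_le_eq add_strict_increasing)

theorem proposition4p15:
  fixes d l :: nat and mu :: "nat multiset"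
  assumes conj_a: "\<And>e f n lam M F N. \<lbrakk>e > 0; f > 0; n \<ge> 1; lam \<in> partitions_of n;
      M \<in> SSYT e lam; fnum M = f; F \<in> V_fin M; F \<noteq> 0; N \<in> supp (Suc n) e F\<rbrakk>
      \<Longrightarrow> fnum N \<in> {f, f - 1}"
    and conj_b: "\<And>e f n. \<lbrakk>e > 0; f > 0; n \<ge> 1\<rbrakk> \<Longrightarrow> inj_on (p_map n e f) (W n e f)"
    and conj_c: "\<And>e f n. \<lbrakk>e > 0; f > 0; n \<ge> 1\<rbrakk> \<Longrightarrow>
      inj_on (\<lambda>(F, G). q_map n e f F + p_map n e (f - 1) G) (W n e f \<times> W n e (f - 1))"
    and mu: "is_content mu d" "size mu = l"
  shows
    "(\<forall>S\<in>{S_infty, S_N}.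
        strict_filtration S (Qinf d) d (Qinf_filt d) \<and>
        (\<forall>f\<le>d. rep_iso S
           (quot_rep (Qinf_filt d (int f)) (Qinf_filt d (int f - 1)))
           (dsum_rep (\<Union>lam\<in>{lam. is_partition lam}. {M \<in> SSYT_inf_deg d lam. fnum_inf M = f})
              (\<lambda>M. V_inf (zero_mult M))))) \<and>
     (\<forall>S\<in>{S_infty, S_N}.
        strict_filtration S (Qinf_cont mu) l (Qinf_cont_filt mu) \<and>
        (\<forall>f\<le>l. rep_iso S
           (quot_rep (Qinf_cont_filt mu (int f)) (Qinf_cont_filt mu (int f - 1)))
           (dsum_rep (\<Union>lam\<in>{lam. is_partition lam}. {M \<in> SSYT_inf_cont mu lam. fnum_inf M = f})
              (\<lambda>M. V_inf (zero_mult M)))))"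
proof -
  have index: "nat (int f + 1) = Suc f" "nat (int f - 1 + 1) = f" for f by simp_all
  have degree: "strict_filtration S (Qinf d) d (Qinf_filt d) \<and>
      (\<forall>f\<le>d. rep_iso S (quot_rep (Qinf_filt d (int f)) (Qinf_filt d (int f - 1)))
         (dsum_rep (\<Union>lam\<in>{lam. is_partition lam}. {M \<in> SSYT_inf_deg d lam. fnum_inf M = f})
            (\<lambda>M. V_inf (zero_mult M))))" if S: "S \<subseteq> S_N" for S
  proof (intro conjI allI impI)
    show "strict_filtration S (Qinf d) d (Qinf_filt d)"
      unfolding hom_in_eq
    proof (rule strict_filtration_filt[OF _ _ _ _ S Qinf_filt_eq])
      show "size \<mu> \<le> d" if "\<mu> \<in> contents_of d" for \<mu>
        using that size_le_sum_mset[of \<mu>] by (auto simp: contents_of_def is_content_def)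
      \<comment> \<open>The content of \<open>d\<close> ones has the largest possible
        size.\<close>
      show "replicate_mset d 1 \<in> contents_of d" by (simp add: contents_of_def is_content_def)
    qed simp_all
    show "rep_iso S (quot_rep (Qinf_filt d (int f)) (Qinf_filt d (int f - 1)))
         (dsum_rep (\<Union>lam\<in>{lam. is_partition lam}. {M \<in> SSYT_inf_deg d lam. fnum_inf M = f})
            (\<lambda>M. V_inf (zero_mult M)))" for f
      unfolding layer_index_degree[symmetric] Qinf_filt_eq index
      by (rule layer_iso[OF contents_of_sum S])
  qed
  have content: "strict_filtration S (Qinf_cont mu) l (Qinf_cont_filt mu) \<and>
      (\<forall>f\<le>l. rep_iso S (quot_rep (Qinf_cont_filt mu (int f)) (Qinf_cont_filt mu (int f - 1)))
         (dsum_rep (\<Union>lam\<in>{lam. is_partition lam}. {M \<in> SSYT_inf_cont mu lam. fnum_inf M = f})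
            (\<lambda>M. V_inf (zero_mult M))))" if S: "S \<subseteq> S_N" for S
  proof (intro conjI allI impI)
    show "strict_filtration S (Qinf_cont mu) l (Qinf_cont_filt mu)"
      unfolding Qinf_cont_eq
      by (rule strict_filtration_filt[OF _ _ _ mu(2) S Qinf_cont_filt_eq[OF mu(1)]])
        (use mu in \<open>auto simp: is_content_def\<close>)
    show "rep_iso S (quot_rep (Qinf_cont_filt mu (int f)) (Qinf_cont_filt mu (int f - 1)))
         (dsum_rep (\<Union>lam\<in>{lam. is_partition lam}. {M \<in> SSYT_inf_cont mu lam. fnum_inf M = f})
            (\<lambda>M. V_inf (zero_mult M)))" for f
      unfolding layer_index_content[symmetric] Qinf_cont_filt_eq[OF mu(1)] index
      by (rule layer_iso[OF _ S]) simp
  qed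
  show ?thesis using degree content S_infty_subset by blast
qed

end
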